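(* Let $K$ be a commutative ring with unit that is both a $\mathbb{Q}$-ring (contains $\mathbb{Q}$ as a subring) and an integral domain, let $\chi=(\chi_d\colon W_d\to U(K))_{d\ge1}$ be an $\omega$-invariant sequence of characters, and let $E$ be a $K$-module with finite basis. (i) The $K$-linear map $c_E\colon[\chi](E)\to[\chi](E)\otimes[\chi](E)$, $$c_E(x_1\chi\ldots\chi x_n)=\sum_{p+h=n}\ \sum_{\rho\in M(\chi;n;p,h)}\chi(\rho)\,(x_{\rho(1)}\chi\ldots\chi x_{\rho(p)})\otimes(x_{\rho(p+1)}\chi\ldots\chi x_{\rho(n)})$$ (sum over non-negative integers $p,h$), defines a structure of graded coassociative $K$-coalgebra on the graded $K$-module $[\chi](E)$, which is, moreover, counital, with counit the linear form $\epsilon_E\colon[\chi](E)\to K$ given by $\epsilon_E(z)=z$ if $z\in[\chi]^0(E)=K$ and $\epsilon_E(z)=0$ if $z\in([\chi](E))_+=\coprod_{d\ge1}[\chi]^d(E)$. (ii) The structure $([\chi](E),c_E,\epsilon_E)$ of graded coassociative $K$-coalgebra with counit defines by functoriality (transposing $c_E$ and $\epsilon_E$) a structure of graded associative algebra with unit on the graded dual $([\chi](E))^{*gr}=[\chi](E^* )$, and the latter coincides with the canonical structure $([\chi](E^* ),m_{E^*},\varepsilon_{E^*})$ of graded associative algebra with unit on the graded $K$-module $[\chi](E^* )$.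
   Context: $S_\infty$ is the group of permutations of the positive integers fixing all but finitely many elements, $S_d\le S_\infty$ the subgroup fixing all $t>d$, and $\omega\colon S_\infty\to S_\infty$ the injective endomorphism $(\omega(\sigma))(1)=1$, $(\omega(\sigma))(t)=\sigma(t-1)+1$ for $t\ge2$. A sequence of group homomorphisms $\chi=(\chi_d\colon W_d\to U(K))_{d\ge1}$ ($U(K)$ the group of units of $K$) is $\omega$-invariant if $W_d\le S_d$, $W_d\le W_{d+1}$, $\omega(W_d)\le W_{d+1}$, and $\chi_{d+1}|_{W_d}=\chi_d=\chi_{d+1}\circ\omega|_{W_d}$ for all $d\ge1$. We write $\chi(\sigma)=\chi_d(\sigma)$ for $\sigma\in W_d$, and $W_0$ is trivial. It is known that then $\chi_d=\chi_d^{-1}$ for all $d$. $S_d$ acts on $T^d(E)$ by $\sigma(x_1\otimes\cdots\otimes x_d)=x_{\sigma^{-1}(1)}\otimes\cdots\otimes x_{\sigma^{-1}(d)}$. $[\chi]^d(E)$ is the quotient of $T^d(E)$ by the submodule generated by all $\chi_d(\sigma)^{-1}z-\sigma z$, $\sigma\in W_d$, $z\in T^d(E)$; $[\chi]^0(E)=K$; the image of $x_1\otimes\cdots\otimes x_d$ is $x_1\chi\ldots\chi x_d$. $[\chi](E)=\coprod_{d\ge0}[\chi]^d(E)$ is an associative graded $K$-algebra with multiplication $m_E\colon(x_1\chi\ldots\chi x_d)\otimes(y_1\chi\ldots\chi y_e)\mapsto x_1\chi\ldots\chi x_d\chi y_1\chi\ldots\chi y_e$ and unit $\varepsilon_E\colon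 K\to[\chi](E)$, $\varepsilon_E(a)=a1$. $M(\chi;n;p,h)$, $p+h=n$, is the set of lexicographically minimal representatives (comparing the words $(\rho(1),\ldots,\rho(n))$) of the left classes $\rho X$ of $W_n$ modulo its subgroup $X=W_p\times\omega^p(W_h)$. The map $c_E$ is well defined. Graded dual: $([\chi](E))^{*gr}=\coprod_{d\ge0}([\chi]^d(E))^*$. It is identified with $[\chi](E^* )$ by means of the bilinear form $\langle\ ,\ \rangle\colon[\chi](E)\times[\chi](E^* )\to K$ for which components of different degrees are orthogonal, $\langle x_1\chi\ldots\chi x_d,x_1^*\chi\ldots\chi x_d^*\rangle=\sum_{\sigma\in W_d}\chi(\sigma)\prod_{t=1}^d x_t^*(x_{\sigma^{-1}(t)})$ for $d\ge1$, and $\langle k,k^*\rangle=kk^*$ in degree $0$; this form induces isomorphisms $[\chi]^d(E^* )\cong([\chi]^d(E))^*$ for all $d$. The algebra structure defined by functoriality on the graded dual has product $f\cdot g=(f\otimes g)\circ c_E$ (with $K\otimes K=K$) and unit map $K\to([\chi](E))^{*gr}$, $k\mapsto k\,\epsilon_E$. *)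

theory Defs
  imports "HOL-Algebra.Algebra" "HOL-Algebra.Algebraic_Closure_Type"
begin

section \<open>Modules over a commutative ring\<close>

text \<open>
  Modules are records of type \<open>module\<close> from \<open>HOL-Algebra\<close>. That record type extends
  \<open>ring\<close>, so it has multiplication and unit fields. They play no role for a mere module,
  and below they are \<open>undefined\<close> whenever a module is constructed.
\<close>

definition module_hom ::
  "('k,'r) ring_scheme \<Rightarrow> ('k,'a,'s) module_scheme \<Rightarrow> ('k,'b,'t) module_scheme \<Rightarrow> ('a \<Rightarrow> 'b) set"
  where "module_hom K M N = {f \<in> carrier M \<rightarrow> carrier N.
     (\<forall>x\<in>carrier M. \<forall>y\<in>carrier M. f (x \<oplus>\<^bsub>M\<^esub> y) = f x \<oplus>\<^bsub>N\<^esub> f y) \<and>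
     (\<forall>a\<in>carrier K. \<forall>x\<in>carrier M. f (a \<odot>\<^bsub>M\<^esub> x) = a \<odot>\<^bsub>N\<^esub> f x)}"

definition is_finite_basis :: "('k,'r) ring_scheme \<Rightarrow> ('k,'a,'s) module_scheme \<Rightarrow> 'a set \<Rightarrow> bool"
  where "is_finite_basis K M B \<longleftrightarrow> finite B \<and> B \<subseteq> carrier M \<and>
     (\<forall>x\<in>carrier M. \<exists>!a. a \<in> B \<rightarrow>\<^sub>E carrier K \<and> x = (\<Oplus>\<^bsub>M\<^esub>b\<in>B. a b \<odot>\<^bsub>M\<^esub> b))"

definition regular_module :: "('k,'r) ring_scheme \<Rightarrow> ('k,'k) module"
  where "regular_module K = \<lparr>carrier = carrier K, monoid.mult = monoid.mult K, one = \<one>\<^bsub>K\<^esub>, ring.zero = \<zero>\<^bsub>K\<^esub>,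
     add = add K, module.smult = monoid.mult K\<rparr>"

definition dual_module ::
  "('k,'r) ring_scheme \<Rightarrow> ('k,'a,'s) module_scheme \<Rightarrow> ('k,'a \<Rightarrow> 'k) module"
  where "dual_module K M = \<lparr>
     carrier = module_hom K M (regular_module K) \<inter> extensional (carrier M),
     monoid.mult = undefined, one = undefined,
     ring.zero = (\<lambda>x\<in>carrier M. \<zero>\<^bsub>K\<^esub>),
     add = (\<lambda>f g. \<lambda>x\<in>carrier M. f x \<oplus>\<^bsub>K\<^esub> g x),
     module.smult = (\<lambda>a f. \<lambda>x\<in>carrier M. a \<otimes>\<^bsub>K\<^esub> f x)\<rparr>"

definition submodule_generated ::
  "('k,'r) ring_scheme \<Rightarrow> ('k,'a,'s) module_scheme \<Rightarrow> 'a set \<Rightarrow> 'a set"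
  where "submodule_generated K M S = \<Inter>{N. submodule N K M \<and> S \<subseteq> N}"

definition quotient_module :: "('k,'a,'s) module_scheme \<Rightarrow> 'a set \<Rightarrow> ('k,'a set) module"
  where "quotient_module M N = \<lparr>carrier = a_rcosets\<^bsub>M\<^esub> N, monoid.mult = undefined, one = undefined,
     ring.zero = N, add = set_add M, module.smult = (\<lambda>a S. \<Union>x\<in>S. N +>\<^bsub>M\<^esub> (a \<odot>\<^bsub>M\<^esub> x))\<rparr>"

text \<open>The map induced on a quotient by a map \<open>h\<close> which is constant on cosets.\<close>

definition quotient_lift :: "('a \<Rightarrow> 'b) \<Rightarrow> 'a set \<Rightarrow> 'b"
  where "quotient_lift h S = the_elem (h ` S)"

definition free_module :: "('k,'r) ring_scheme \<Rightarrow> 'x set \<Rightarrow> ('k,'x \<Rightarrow> 'k) module"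
  where "free_module K S = \<lparr>
     carrier = {f. range f \<subseteq> carrier K \<and> finite {x. f x \<noteq> \<zero>\<^bsub>K\<^esub>} \<and> {x. f x \<noteq> \<zero>\<^bsub>K\<^esub>} \<subseteq> S},
     monoid.mult = undefined, one = undefined,
     ring.zero = (\<lambda>x. \<zero>\<^bsub>K\<^esub>), add = (\<lambda>f g x. f x \<oplus>\<^bsub>K\<^esub> g x), module.smult = (\<lambda>a f x. a \<otimes>\<^bsub>K\<^esub> f x)\<rparr>"

definition free_gen :: "('k,'r) ring_scheme \<Rightarrow> 'x \<Rightarrow> 'x \<Rightarrow> 'k"
  where "free_gen K x = (\<lambda>y. if y = x then \<one>\<^bsub>K\<^esub> else \<zero>\<^bsub>K\<^esub>)"

definition free_lift ::
  "('k,'r) ring_scheme \<Rightarrow> ('k,'p,'s) module_scheme \<Rightarrow> ('x \<Rightarrow> 'p) \<Rightarrow> ('x \<Rightarrow> 'k) \<Rightarrow> 'p"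
  where "free_lift K P g f = (\<Oplus>\<^bsub>P\<^esub>x\<in>{x. f x \<noteq> \<zero>\<^bsub>K\<^esub>}. f x \<odot>\<^bsub>P\<^esub> g x)"

section \<open>Tensor product of two modules\<close>

definition tensor_relations ::
  "('k,'r) ring_scheme \<Rightarrow> ('k,'a,'s) module_scheme \<Rightarrow> ('k,'b,'t) module_scheme \<Rightarrow> ('a \<times> 'b \<Rightarrow> 'k) set"
  where "tensor_relations K M N =
    (let F = free_module K (carrier M \<times> carrier N); e = free_gen K in
       {e (x \<oplus>\<^bsub>M\<^esub> x', y) \<ominus>\<^bsub>F\<^esub> (e (x, y) \<oplus>\<^bsub>F\<^esub> e (x', y)) | x x' y.
           x \<in> carrier M \<and> x' \<in> carrier M \<and> y \<in> carrier N}
     \<union> {e (x, y \<oplus>\<^bsub>N\<^esub> y') \<ominus>\<^bsub>F\<^esub> (e (x, y) \<oplus>\<^bsub>F\<^esub> e (x, y')) | x y y'.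
           x \<in> carrier M \<and> y \<in> carrier N \<and> y' \<in> carrier N}
     \<union> {e (a \<odot>\<^bsub>M\<^esub> x, y) \<ominus>\<^bsub>F\<^esub> (a \<odot>\<^bsub>F\<^esub> e (x, y)) | a x y.
           a \<in> carrier K \<and> x \<in> carrier M \<and> y \<in> carrier N}
     \<union> {e (x, a \<odot>\<^bsub>N\<^esub> y) \<ominus>\<^bsub>F\<^esub> (a \<odot>\<^bsub>F\<^esub> e (x, y)) | a x y.
           a \<in> carrier K \<and> x \<in> carrier M \<and> y \<in> carrier N})"

definition tensor_kernel ::
  "('k,'r) ring_scheme \<Rightarrow> ('k,'a,'s) module_scheme \<Rightarrow> ('k,'b,'t) module_scheme \<Rightarrow> ('a \<times> 'b \<Rightarrow> 'k) set"
  where "tensor_kernel K M N =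
    submodule_generated K (free_module K (carrier M \<times> carrier N)) (tensor_relations K M N)"

definition tensor_module ::
  "('k,'r) ring_scheme \<Rightarrow> ('k,'a,'s) module_scheme \<Rightarrow> ('k,'b,'t) module_scheme
     \<Rightarrow> ('k,('a \<times> 'b \<Rightarrow> 'k) set) module"
  where "tensor_module K M N =
    quotient_module (free_module K (carrier M \<times> carrier N)) (tensor_kernel K M N)"

definition pure_tensor ::
  "('k,'r) ring_scheme \<Rightarrow> ('k,'a,'s) module_scheme \<Rightarrow> ('k,'b,'t) module_scheme
     \<Rightarrow> 'a \<Rightarrow> 'b \<Rightarrow> ('a \<times> 'b \<Rightarrow> 'k) set"
  where "pure_tensor K M N x y =
    tensor_kernel K M N +>\<^bsub>free_module K (carrier M \<times> carrier N)\<^esub> free_gen K (x, y)"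

text \<open>The linear map from a tensor product into \<open>P\<close> induced by a bilinear map \<open>g\<close>.\<close>

definition tensor_lift ::
  "('k,'r) ring_scheme \<Rightarrow> ('k,'p,'s) module_scheme \<Rightarrow> ('a \<Rightarrow> 'b \<Rightarrow> 'p) \<Rightarrow> ('a \<times> 'b \<Rightarrow> 'k) set \<Rightarrow> 'p"
  where "tensor_lift K P g = quotient_lift (free_lift K P (\<lambda>(x, y). g x y))"

definition tensor_map ::
  "('k,'r) ring_scheme \<Rightarrow> ('k,'a,'s) module_scheme \<Rightarrow> ('k,'b,'t) module_scheme
     \<Rightarrow> ('c \<Rightarrow> 'a) \<Rightarrow> ('d \<Rightarrow> 'b) \<Rightarrow> ('c \<times> 'd \<Rightarrow> 'k) set \<Rightarrow> ('a \<times> 'b \<Rightarrow> 'k) set"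
  where "tensor_map K M N f g =
    tensor_lift K (tensor_module K M N) (\<lambda>x y. pure_tensor K M N (f x) (g y))"

text \<open>The associativity isomorphism from $(M \otimes N) \otimes P$ to $M \otimes (N \otimes P)$.\<close>

definition tensor_assoc ::
  "('k,'r) ring_scheme \<Rightarrow> ('k,'a,'s) module_scheme \<Rightarrow> ('k,'b,'t) module_scheme
     \<Rightarrow> ('k,'c,'u) module_scheme
     \<Rightarrow> (('a \<times> 'b \<Rightarrow> 'k) set \<times> 'c \<Rightarrow> 'k) set \<Rightarrow> ('a \<times> ('b \<times> 'c \<Rightarrow> 'k) set \<Rightarrow> 'k) set"
  where "tensor_assoc K M N P =
    (let NP = tensor_module K N P; T = tensor_module K M NP in
     tensor_lift K T (\<lambda>t z.
       tensor_lift K T (\<lambda>x y. pure_tensor K M NP x (pure_tensor K N P y z)) t))"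

text \<open>The form $f \otimes g$, with values in $K \otimes K = K$.\<close>

definition tensor_form ::
  "('k,'r) ring_scheme \<Rightarrow> ('a \<Rightarrow> 'k) \<Rightarrow> ('b \<Rightarrow> 'k) \<Rightarrow> ('a \<times> 'b \<Rightarrow> 'k) set \<Rightarrow> 'k"
  where "tensor_form K f g = tensor_lift K (regular_module K) (\<lambda>x y. f x \<otimes>\<^bsub>K\<^esub> g y)"

section \<open>Graded modules, coalgebras and algebras\<close>

text \<open>A graded module is given by the family of its components, indexed by degree.\<close>

definition dsum :: "('k,'r) ring_scheme \<Rightarrow> (nat \<Rightarrow> ('k,'a,'s) module_scheme) \<Rightarrow> ('k,nat \<Rightarrow> 'a) module"
  where "dsum K M = \<lparr>
     carrier = {f. (\<forall>d. f d \<in> carrier (M d)) \<and> finite {d. f d \<noteq> \<zero>\<^bsub>M d\<^esub>}},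
     monoid.mult = undefined, one = undefined,
     ring.zero = (\<lambda>d. \<zero>\<^bsub>M d\<^esub>),
     add = (\<lambda>f g d. f d \<oplus>\<^bsub>M d\<^esub> g d),
     module.smult = (\<lambda>a f d. a \<odot>\<^bsub>M d\<^esub> f d)\<rparr>"

definition dsum_in :: "(nat \<Rightarrow> ('k,'a,'s) module_scheme) \<Rightarrow> nat \<Rightarrow> 'a \<Rightarrow> nat \<Rightarrow> 'a"
  where "dsum_in M d x = (\<lambda>e. if e = d then x else \<zero>\<^bsub>M e\<^esub>)"

definition dsum_lift ::
  "(nat \<Rightarrow> ('k,'a,'s) module_scheme) \<Rightarrow> ('k,'p,'t) module_scheme \<Rightarrow> (nat \<Rightarrow> 'a \<Rightarrow> 'p) \<Rightarrow> (nat \<Rightarrow> 'a) \<Rightarrow> 'p"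
  where "dsum_lift M P h z = (\<Oplus>\<^bsub>P\<^esub>d\<in>{d. z d \<noteq> \<zero>\<^bsub>M d\<^esub>}. h d (z d))"

definition graded_coalgebra ::
  "('k,'r) ring_scheme \<Rightarrow> (nat \<Rightarrow> ('k,'a,'s) module_scheme)
     \<Rightarrow> ((nat \<Rightarrow> 'a) \<Rightarrow> ((nat \<Rightarrow> 'a) \<times> (nat \<Rightarrow> 'a) \<Rightarrow> 'k) set) \<Rightarrow> ((nat \<Rightarrow> 'a) \<Rightarrow> 'k) \<Rightarrow> bool"
  where "graded_coalgebra K M \<Delta> \<epsilon> \<longleftrightarrow>
    (let C = dsum K M; CC = tensor_module K C C; R = regular_module K in
      (\<forall>d. module K (M d)) \<and>
      \<Delta> \<in> module_hom K C CC \<and>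
      \<epsilon> \<in> module_hom K C R \<and>
      (\<forall>n. \<forall>x\<in>carrier (M n). \<Delta> (dsum_in M n x) \<in> submodule_generated K CC
         {pure_tensor K C C (dsum_in M p y) (dsum_in M h z) | p h y z.
            p + h = n \<and> y \<in> carrier (M p) \<and> z \<in> carrier (M h)}) \<and>
      (\<forall>n\<ge>1. \<forall>x\<in>carrier (M n). \<epsilon> (dsum_in M n x) = \<zero>\<^bsub>K\<^esub>) \<and>
      (\<forall>z\<in>carrier C. tensor_assoc K C C C (tensor_map K CC C \<Delta> (\<lambda>x. x) (\<Delta> z))
                     = tensor_map K C CC (\<lambda>x. x) \<Delta> (\<Delta> z)) \<and>
      (\<forall>z\<in>carrier C. tensor_map K R C \<epsilon> (\<lambda>x. x) (\<Delta> z) = pure_tensor K R C \<one>\<^bsub>K\<^esub> z) \<and>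
      (\<forall>z\<in>carrier C. tensor_map K C R (\<lambda>x. x) \<epsilon> (\<Delta> z) = pure_tensor K C R z \<one>\<^bsub>K\<^esub>))"

text \<open>
  In a graded algebra the fields \<open>mult\<close> and \<open>one\<close> of the record carry the multiplication and
  the unit. The unit map is then $a \mapsto a \cdot 1$.
\<close>

definition graded_alg ::
  "('k,'r) ring_scheme \<Rightarrow> (nat \<Rightarrow> ('k,'a,'s) module_scheme)
     \<Rightarrow> ((nat \<Rightarrow> 'a) \<Rightarrow> (nat \<Rightarrow> 'a) \<Rightarrow> (nat \<Rightarrow> 'a)) \<Rightarrow> (nat \<Rightarrow> 'a) \<Rightarrow> ('k,nat \<Rightarrow> 'a) module"
  where "graded_alg K M m u = (dsum K M)\<lparr>monoid.mult := m, one := u\<rparr>"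

definition graded_algebra ::
  "('k,'r) ring_scheme \<Rightarrow> (nat \<Rightarrow> ('k,'a,'s) module_scheme)
     \<Rightarrow> ((nat \<Rightarrow> 'a) \<Rightarrow> (nat \<Rightarrow> 'a) \<Rightarrow> (nat \<Rightarrow> 'a)) \<Rightarrow> (nat \<Rightarrow> 'a) \<Rightarrow> bool"
  where "graded_algebra K M m u \<longleftrightarrow>
    (let A = graded_alg K M m u in
      (\<forall>d. module K (M d)) \<and> module K A \<and> ring A \<and>
      (\<forall>a\<in>carrier K. \<forall>x\<in>carrier A. \<forall>y\<in>carrier A.
         (a \<odot>\<^bsub>A\<^esub> x) \<otimes>\<^bsub>A\<^esub> y = a \<odot>\<^bsub>A\<^esub> (x \<otimes>\<^bsub>A\<^esub> y) \<and> x \<otimes>\<^bsub>A\<^esub> (a \<odot>\<^bsub>A\<^esub> y) = a \<odot>\<^bsub>A\<^esub> (x \<otimes>\<^bsub>A\<^esub> y)) \<and>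
      u \<in> dsum_in M 0 ` carrier (M 0) \<and>
      (\<forall>p q. \<forall>x\<in>carrier (M p). \<forall>y\<in>carrier (M q).
         m (dsum_in M p x) (dsum_in M q y) \<in> dsum_in M (p + q) ` carrier (M (p + q))))"

text \<open>
  The graded dual has the modules \<open>dual_module K (M d)\<close> as components. An element of it is a
  linear form on the direct sum \<open>dsum K M\<close>, by \<open>gdual_form\<close>; conversely, \<open>form_components\<close>
  gives the components of a linear form.
\<close>

definition gdual ::
  "('k,'r) ring_scheme \<Rightarrow> (nat \<Rightarrow> ('k,'a,'s) module_scheme) \<Rightarrow> nat \<Rightarrow> ('k,'a \<Rightarrow> 'k) module"
  where "gdual K M d = dual_module K (M d)"

definition gdual_form ::
  "('k,'r) ring_scheme \<Rightarrow> (nat \<Rightarrow> ('k,'a,'s) module_scheme) \<Rightarrow> (nat \<Rightarrow> 'a \<Rightarrow> 'k) \<Rightarrow> (nat \<Rightarrow> 'a) \<Rightarrow> 'k"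
  where "gdual_form K M \<phi> = dsum_lift M (regular_module K) \<phi>"

definition form_components ::
  "(nat \<Rightarrow> ('k,'a,'s) module_scheme) \<Rightarrow> ((nat \<Rightarrow> 'a) \<Rightarrow> 'k) \<Rightarrow> nat \<Rightarrow> 'a \<Rightarrow> 'k"
  where "form_components M f = (\<lambda>d. \<lambda>x\<in>carrier (M d). f (dsum_in M d x))"

definition gdual_mult ::
  "('k,'r) ring_scheme \<Rightarrow> (nat \<Rightarrow> ('k,'a,'s) module_scheme)
     \<Rightarrow> ((nat \<Rightarrow> 'a) \<Rightarrow> ((nat \<Rightarrow> 'a) \<times> (nat \<Rightarrow> 'a) \<Rightarrow> 'k) set)
     \<Rightarrow> (nat \<Rightarrow> 'a \<Rightarrow> 'k) \<Rightarrow> (nat \<Rightarrow> 'a \<Rightarrow> 'k) \<Rightarrow> nat \<Rightarrow> 'a \<Rightarrow> 'k"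
  where "gdual_mult K M \<Delta> \<phi> \<psi> =
    form_components M (tensor_form K (gdual_form K M \<phi>) (gdual_form K M \<psi>) \<circ> \<Delta>)"

text \<open>Isomorphisms of graded algebras. Here \<open>M\<close> and \<open>N\<close> are the gradings of \<open>A\<close> and \<open>B\<close>.\<close>

definition graded_alg_iso ::
  "('k,'r) ring_scheme \<Rightarrow> (nat \<Rightarrow> ('k,'a,'s) module_scheme) \<Rightarrow> ('k,nat \<Rightarrow> 'a) module
     \<Rightarrow> (nat \<Rightarrow> ('k,'b,'t) module_scheme) \<Rightarrow> ('k,nat \<Rightarrow> 'b) module \<Rightarrow> ((nat \<Rightarrow> 'a) \<Rightarrow> nat \<Rightarrow> 'b) set"
  where "graded_alg_iso K M A N B =
    {h \<in> ring_iso A B \<inter> module_hom K A B.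
       \<forall>d. h ` (dsum_in M d ` carrier (M d)) = dsum_in N d ` carrier (N d)}"

section \<open>Invariant sequences of characters\<close>

text \<open>
  Permutations of the positive integers are functions on \<open>nat\<close> fixing \<open>0\<close>, and \<open>sym_group d\<close>
  consists of those which fix all \<open>t > d\<close>.
\<close>

definition omega :: "(nat \<Rightarrow> nat) \<Rightarrow> nat \<Rightarrow> nat"
  where "omega \<sigma> t = (if t \<le> 1 then t else Suc (\<sigma> (t - 1)))"

text \<open>
  The conditions range over all \<open>d\<close>, including \<open>0\<close>: as \<open>sym_group 0\<close> is trivial, for \<open>d = 0\<close>
  they only say that \<open>W 0\<close> and \<open>\<chi> 0\<close> are trivial.
\<close>

definition omega_invariant ::
  "('k,'r) ring_scheme \<Rightarrow> (nat \<Rightarrow> (nat \<Rightarrow> nat) set) \<Rightarrow> (nat \<Rightarrow> (nat \<Rightarrow> nat) \<Rightarrow> 'k) \<Rightarrow> bool"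
  where "omega_invariant K W \<chi> \<longleftrightarrow> (\<forall>d.
     subgroup (W d) (sym_group d) \<and>
     \<chi> d \<in> hom ((sym_group d)\<lparr>carrier := W d\<rparr>) (units_of K) \<and>
     W d \<subseteq> W (Suc d) \<and> omega ` W d \<subseteq> W (Suc d) \<and>
     (\<forall>\<sigma>\<in>W d. \<chi> (Suc d) \<sigma> = \<chi> d \<sigma> \<and> \<chi> (Suc d) (omega \<sigma>) = \<chi> d \<sigma>))"

definition young_subgroup :: "(nat \<Rightarrow> (nat \<Rightarrow> nat) set) \<Rightarrow> nat \<Rightarrow> nat \<Rightarrow> (nat \<Rightarrow> nat) set"
  where "young_subgroup W p h = {\<sigma> \<circ> (omega ^^ p) \<tau> | \<sigma> \<tau>. \<sigma> \<in> W p \<and> \<tau> \<in> W h}"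

definition perm_word :: "nat \<Rightarrow> (nat \<Rightarrow> nat) \<Rightarrow> nat list"
  where "perm_word n \<rho> = map \<rho> [1..<Suc n]"

definition min_reps :: "(nat \<Rightarrow> (nat \<Rightarrow> nat) set) \<Rightarrow> nat \<Rightarrow> nat \<Rightarrow> (nat \<Rightarrow> nat) set"
  where "min_reps W p h = (let n = p + h in
     {\<rho>. \<exists>C \<in> lcosets\<^bsub>(sym_group n)\<lparr>carrier := W n\<rparr>\<^esub> (young_subgroup W p h). \<rho> \<in> C \<and>
        (\<forall>\<rho>'\<in>C. perm_word n \<rho> = perm_word n \<rho>' \<or>
                 (perm_word n \<rho>, perm_word n \<rho>') \<in> lexord less_than)})"

section \<open>Tensor powers\<close>

definition words :: "('k,'e,'s) module_scheme \<Rightarrow> nat \<Rightarrow> 'e list set"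
  where "words E d = {xs. set xs \<subseteq> carrier E \<and> length xs = d}"

definition tpow_relations ::
  "('k,'r) ring_scheme \<Rightarrow> ('k,'e,'s) module_scheme \<Rightarrow> nat \<Rightarrow> ('e list \<Rightarrow> 'k) set"
  where "tpow_relations K E d =
    (let F = free_module K (words E d); e = free_gen K in
       {e (xs[i := x \<oplus>\<^bsub>E\<^esub> y]) \<ominus>\<^bsub>F\<^esub> (e (xs[i := x]) \<oplus>\<^bsub>F\<^esub> e (xs[i := y])) | xs i x y.
           xs \<in> words E d \<and> i < d \<and> x \<in> carrier E \<and> y \<in> carrier E}
     \<union> {e (xs[i := a \<odot>\<^bsub>E\<^esub> x]) \<ominus>\<^bsub>F\<^esub> (a \<odot>\<^bsub>F\<^esub> e (xs[i := x])) | xs i a x.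
           xs \<in> words E d \<and> i < d \<and> a \<in> carrier K \<and> x \<in> carrier E})"

definition tpow_kernel ::
  "('k,'r) ring_scheme \<Rightarrow> ('k,'e,'s) module_scheme \<Rightarrow> nat \<Rightarrow> ('e list \<Rightarrow> 'k) set"
  where "tpow_kernel K E d =
    submodule_generated K (free_module K (words E d)) (tpow_relations K E d)"

definition tpow ::
  "('k,'r) ring_scheme \<Rightarrow> ('k,'e,'s) module_scheme \<Rightarrow> nat \<Rightarrow> ('k,('e list \<Rightarrow> 'k) set) module"
  where "tpow K E d = quotient_module (free_module K (words E d)) (tpow_kernel K E d)"

text \<open>\<open>tpow_pure K E [x\<^sub>1, \<dots>, x\<^sub>d]\<close> is $x_1 \otimes \cdots \otimes x_d$.\<close>

definition tpow_pure ::
  "('k,'r) ring_scheme \<Rightarrow> ('k,'e,'s) module_scheme \<Rightarrow> 'e list \<Rightarrow> ('e list \<Rightarrow> 'k) set"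
  where "tpow_pure K E xs =
    tpow_kernel K E (length xs) +>\<^bsub>free_module K (words E (length xs))\<^esub> free_gen K xs"

text \<open>Positions in a word are numbered from \<open>1\<close>, list indices from \<open>0\<close>.\<close>

definition letter :: "'e list \<Rightarrow> nat \<Rightarrow> 'e"
  where "letter xs t = xs ! (t - 1)"

definition tpow_act ::
  "('k,'r) ring_scheme \<Rightarrow> ('k,'e,'s) module_scheme \<Rightarrow> nat \<Rightarrow> (nat \<Rightarrow> nat)
     \<Rightarrow> ('e list \<Rightarrow> 'k) set \<Rightarrow> ('e list \<Rightarrow> 'k) set"
  where "tpow_act K E d \<sigma> = quotient_lift (free_lift K (tpow K E d)
     (\<lambda>xs. tpow_pure K E (map (\<lambda>t. letter xs (inv' \<sigma> t)) [1..<Suc d])))"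

section \<open>The algebra of an invariant sequence of characters\<close>

definition chi_kernel ::
  "('k,'r) ring_scheme \<Rightarrow> (nat \<Rightarrow> (nat \<Rightarrow> nat) set) \<Rightarrow> (nat \<Rightarrow> (nat \<Rightarrow> nat) \<Rightarrow> 'k)
     \<Rightarrow> ('k,'e,'s) module_scheme \<Rightarrow> nat \<Rightarrow> ('e list \<Rightarrow> 'k) set set"
  where "chi_kernel K W \<chi> E d = submodule_generated K (tpow K E d)
     {(inv\<^bsub>K\<^esub> (\<chi> d \<sigma>) \<odot>\<^bsub>tpow K E d\<^esub> z) \<ominus>\<^bsub>tpow K E d\<^esub> tpow_act K E d \<sigma> z | \<sigma> z.
        \<sigma> \<in> W d \<and> z \<in> carrier (tpow K E d)}"

text \<open>
  In degree \<open>0\<close> this is a free module with the class of the empty word as basis. That class is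
  identified with the unit of \<open>K\<close>.
\<close>

definition chi_comp ::
  "('k,'r) ring_scheme \<Rightarrow> (nat \<Rightarrow> (nat \<Rightarrow> nat) set) \<Rightarrow> (nat \<Rightarrow> (nat \<Rightarrow> nat) \<Rightarrow> 'k)
     \<Rightarrow> ('k,'e,'s) module_scheme \<Rightarrow> nat \<Rightarrow> ('k,('e list \<Rightarrow> 'k) set set) module"
  where "chi_comp K W \<chi> E d = quotient_module (tpow K E d) (chi_kernel K W \<chi> E d)"

text \<open>
  The image of $x_1 \otimes \cdots \otimes x_d$, first as an element of the component of
  degree \<open>d\<close>, then as an element of the direct sum.
\<close>

definition chi_class ::
  "('k,'r) ring_scheme \<Rightarrow> (nat \<Rightarrow> (nat \<Rightarrow> nat) set) \<Rightarrow> (nat \<Rightarrow> (nat \<Rightarrow> nat) \<Rightarrow> 'k)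
     \<Rightarrow> ('k,'e,'s) module_scheme \<Rightarrow> 'e list \<Rightarrow> ('e list \<Rightarrow> 'k) set set"
  where "chi_class K W \<chi> E xs =
    chi_kernel K W \<chi> E (length xs) +>\<^bsub>tpow K E (length xs)\<^esub> tpow_pure K E xs"

definition chi_word ::
  "('k,'r) ring_scheme \<Rightarrow> (nat \<Rightarrow> (nat \<Rightarrow> nat) set) \<Rightarrow> (nat \<Rightarrow> (nat \<Rightarrow> nat) \<Rightarrow> 'k)
     \<Rightarrow> ('k,'e,'s) module_scheme \<Rightarrow> 'e list \<Rightarrow> nat \<Rightarrow> ('e list \<Rightarrow> 'k) set set"
  where "chi_word K W \<chi> E xs = dsum_in (chi_comp K W \<chi> E) (length xs) (chi_class K W \<chi> E xs)"

text \<open>The linear map on \<open>chi_comp K W \<chi> E d\<close> with prescribed values \<open>g xs\<close> on classes of words.\<close>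

definition chi_lift ::
  "('k,'r) ring_scheme \<Rightarrow> ('k,'p,'s) module_scheme \<Rightarrow> ('e list \<Rightarrow> 'p) \<Rightarrow> ('e list \<Rightarrow> 'k) set set \<Rightarrow> 'p"
  where "chi_lift K P g = quotient_lift (quotient_lift (free_lift K P g))"

definition chi_module ::
  "('k,'r) ring_scheme \<Rightarrow> (nat \<Rightarrow> (nat \<Rightarrow> nat) set) \<Rightarrow> (nat \<Rightarrow> (nat \<Rightarrow> nat) \<Rightarrow> 'k)
     \<Rightarrow> ('k,'e,'s) module_scheme \<Rightarrow> ('k,nat \<Rightarrow> ('e list \<Rightarrow> 'k) set set) module"
  where "chi_module K W \<chi> E = dsum K (chi_comp K W \<chi> E)"

definition chi_mult ::
  "('k,'r) ring_scheme \<Rightarrow> (nat \<Rightarrow> (nat \<Rightarrow> nat) set) \<Rightarrow> (nat \<Rightarrow> (nat \<Rightarrow> nat) \<Rightarrow> 'k)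
     \<Rightarrow> ('k,'e,'s) module_scheme \<Rightarrow> (nat \<Rightarrow> ('e list \<Rightarrow> 'k) set set) \<Rightarrow> (nat \<Rightarrow> ('e list \<Rightarrow> 'k) set set)
     \<Rightarrow> nat \<Rightarrow> ('e list \<Rightarrow> 'k) set set"
  where "chi_mult K W \<chi> E z u =
    (let M = chi_comp K W \<chi> E; C = chi_module K W \<chi> E in
     dsum_lift M C (\<lambda>d. chi_lift K C (\<lambda>xs.
       dsum_lift M C (\<lambda>e. chi_lift K C (\<lambda>ys. chi_word K W \<chi> E (xs @ ys))) u)) z)"

definition chi_comult ::
  "('k,'r) ring_scheme \<Rightarrow> (nat \<Rightarrow> (nat \<Rightarrow> nat) set) \<Rightarrow> (nat \<Rightarrow> (nat \<Rightarrow> nat) \<Rightarrow> 'k)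
     \<Rightarrow> ('k,'e,'s) module_scheme \<Rightarrow> (nat \<Rightarrow> ('e list \<Rightarrow> 'k) set set)
     \<Rightarrow> ((nat \<Rightarrow> ('e list \<Rightarrow> 'k) set set) \<times> (nat \<Rightarrow> ('e list \<Rightarrow> 'k) set set) \<Rightarrow> 'k) set"
  where "chi_comult K W \<chi> E =
    (let C = chi_module K W \<chi> E; CC = tensor_module K C C; w = chi_word K W \<chi> E in
     dsum_lift (chi_comp K W \<chi> E) CC (\<lambda>n. chi_lift K CC (\<lambda>xs.
       \<Oplus>\<^bsub>CC\<^esub>p\<in>{..n}. \<Oplus>\<^bsub>CC\<^esub>\<rho>\<in>min_reps W p (n - p).
         \<chi> n \<rho> \<odot>\<^bsub>CC\<^esub> pure_tensor K C C
           (w (map (\<lambda>t. letter xs (\<rho> t)) [1..<Suc p]))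
           (w (map (\<lambda>t. letter xs (\<rho> t)) [Suc p..<Suc n])))))"

text \<open>The projection onto the component of degree \<open>0\<close>, identified with \<open>K\<close>.\<close>

definition chi_counit ::
  "('k,'r) ring_scheme \<Rightarrow> (nat \<Rightarrow> (nat \<Rightarrow> nat) set) \<Rightarrow> (nat \<Rightarrow> (nat \<Rightarrow> nat) \<Rightarrow> 'k)
     \<Rightarrow> ('k,'e,'s) module_scheme \<Rightarrow> (nat \<Rightarrow> ('e list \<Rightarrow> 'k) set set) \<Rightarrow> 'k"
  where "chi_counit K W \<chi> E z =
    (THE a. a \<in> carrier K \<and> z 0 = a \<odot>\<^bsub>chi_comp K W \<chi> E 0\<^esub> chi_class K W \<chi> E [])"

text \<open>
  The bilinear form on $[\chi](E) \times [\chi](E^*)$, and the map from $[\chi](E^*)$ to the graded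
  dual of $[\chi](E)$ that it defines.
\<close>

definition chi_pairing ::
  "('k,'r) ring_scheme \<Rightarrow> (nat \<Rightarrow> (nat \<Rightarrow> nat) set) \<Rightarrow> (nat \<Rightarrow> (nat \<Rightarrow> nat) \<Rightarrow> 'k)
     \<Rightarrow> ('k,'e,'s) module_scheme \<Rightarrow> (nat \<Rightarrow> ('e list \<Rightarrow> 'k) set set)
     \<Rightarrow> (nat \<Rightarrow> (('e \<Rightarrow> 'k) list \<Rightarrow> 'k) set set) \<Rightarrow> 'k"
  where "chi_pairing K W \<chi> E z u =
    (let R = regular_module K in
     dsum_lift (chi_comp K W \<chi> E) R (\<lambda>d. chi_lift K R (\<lambda>xs. chi_lift K R (\<lambda>fs.
       \<Oplus>\<^bsub>K\<^esub>\<sigma>\<in>W d. \<chi> d \<sigma> \<otimes>\<^bsub>K\<^esub> (\<Otimes>\<^bsub>K\<^esub>t\<in>{1..d}. letter fs t (letter xs (inv' \<sigma> t)))) (u d))) z)"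

definition chi_to_gdual ::
  "('k,'r) ring_scheme \<Rightarrow> (nat \<Rightarrow> (nat \<Rightarrow> nat) set) \<Rightarrow> (nat \<Rightarrow> (nat \<Rightarrow> nat) \<Rightarrow> 'k)
     \<Rightarrow> ('k,'e,'s) module_scheme \<Rightarrow> (nat \<Rightarrow> (('e \<Rightarrow> 'k) list \<Rightarrow> 'k) set set)
     \<Rightarrow> nat \<Rightarrow> ('e list \<Rightarrow> 'k) set set \<Rightarrow> 'k"
  where "chi_to_gdual K W \<chi> E u =
    form_components (chi_comp K W \<chi> E) (\<lambda>z. chi_pairing K W \<chi> E z u)"

end

theory Submission
  imports Defs
begin

text \<open>
  The characters take values of square one: the commutator of a permutation with a suitable
  shift of itself is a three-cycle, so the common kernel contains enough three-cycles to reduce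
  every shifted element of \<open>W d\<close> to an involution. Hence the summands of the comultiplication
  depend only on the coset of \<open>\<rho>\<close>, and the sum over the minimal representatives is
  $1/(|W_p||W_h|)$ times the sum over all of $W_n$. In this symmetric form, equivariance,
  coassociativity and the compatibility of the pairing with the products all reduce to
  translations in the group $W_n$. The map from $[\chi]^d(E^*)$ to the dual of $[\chi]^d(E)$ is
  inverted by expanding in a basis of \<open>E\<close> and dividing by $|W_d|$, and the algebra structure of
  the graded dual is transported from that of $[\chi](E^*)$.
\<close>

section \<open>Linear maps, generated submodules and quotients\<close>

text \<open>Minimal representatives are not compatible with translation: left multiplication by an
  element of W_n permutes the cosets but in general does not carry minimal elements to minimal ones.
  Sums over the whole group avoid the choice. For this each summand must be unchanged when rho is
  replaced by rho x with x in the subgroup. Such a replacement creates chi(x) twice, once in the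
  coefficient chi(rho x) and once when x is moved out of the two factors, so exactly chi(x)^2 = 1 is
  required. A single group W_d would not force this; it comes from having room: omega preserves chi,
  hence a permutation may be shifted upwards, and the shifts of one three-cycle in the kernel join
  its points to far points that it fixes.

  The components [chi]^d(E) are quotients of quotients of free modules. Once their universal
  properties are available, cosets are no longer touched: a linear map on [chi]^d(E) is given by a
  multilinear map on words that is multiplied by chi(sigma) when the word is permuted by sigma, and
  two linear maps are compared on words only.\<close>

lemma module_homI:
  assumes "\<And>x. x \<in> carrier M \<Longrightarrow> f x \<in> carrier N"
    and "\<And>x y. \<lbrakk>x \<in> carrier M; y \<in> carrier M\<rbrakk> \<Longrightarrow> f (x \<oplus>\<^bsub>M\<^esub> y) = f x \<oplus>\<^bsub>N\<^esub> f y"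
    and "\<And>a x. \<lbrakk>a \<in> carrier K; x \<in> carrier M\<rbrakk> \<Longrightarrow> f (a \<odot>\<^bsub>M\<^esub> x) = a \<odot>\<^bsub>N\<^esub> f x"
  shows "f \<in> module_hom K M N"
  using assms by (auto simp: module_hom_def)

lemma module_homD:
  assumes "f \<in> module_hom K M N"
  shows "\<And>x. x \<in> carrier M \<Longrightarrow> f x \<in> carrier N"
    and "\<And>x y. \<lbrakk>x \<in> carrier M; y \<in> carrier M\<rbrakk> \<Longrightarrow> f (x \<oplus>\<^bsub>M\<^esub> y) = f x \<oplus>\<^bsub>N\<^esub> f y"
    and "\<And>a x. \<lbrakk>a \<in> carrier K; x \<in> carrier M\<rbrakk> \<Longrightarrow> f (a \<odot>\<^bsub>M\<^esub> x) = a \<odot>\<^bsub>N\<^esub> f x"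
  using assms by (auto simp: module_hom_def)

lemma module_hom_comp:
  assumes "f \<in> module_hom K M N" "g \<in> module_hom K N P"
  shows "(\<lambda>x. g (f x)) \<in> module_hom K M P"
  using assms by (intro module_homI) (auto simp: module_homD)

lemma module_hom_id: "(\<lambda>x. x) \<in> module_hom K M M"
  by (intro module_homI) auto

lemma module_hom_cong:
  assumes "f \<in> module_hom K M N" "module K M" "\<And>x. x \<in> carrier M \<Longrightarrow> g x = f x"
  shows "g \<in> module_hom K M N"
proof -
  interpret M: module K M by fact
  show ?thesis using assms by (intro module_homI) (auto simp: module_homD)
qed

lemma module_hom_zero:
  assumes "f \<in> module_hom K M N" "module K M" "module K N"
  shows "f \<zero>\<^bsub>M\<^esub> = \<zero>\<^bsub>N\<^esub>"
proof -
  interpret M: module K M by fact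
  interpret N: module K N by fact
  have "f (\<zero>\<^bsub>K\<^esub> \<odot>\<^bsub>M\<^esub> \<zero>\<^bsub>M\<^esub>) = \<zero>\<^bsub>K\<^esub> \<odot>\<^bsub>N\<^esub> f \<zero>\<^bsub>M\<^esub>"
    by (intro module_homD[OF assms(1)]) auto
  then show ?thesis using module_homD(1)[OF assms(1)] by simp
qed

lemma module_hom_neg:
  assumes "f \<in> module_hom K M N" "module K M" "module K N" "x \<in> carrier M"
  shows "f (\<ominus>\<^bsub>M\<^esub> x) = \<ominus>\<^bsub>N\<^esub> f x"
proof -
  interpret M: module K M by fact
  interpret N: module K N by fact
  have "f ((\<ominus>\<^bsub>K\<^esub> \<one>\<^bsub>K\<^esub>) \<odot>\<^bsub>M\<^esub> x) = (\<ominus>\<^bsub>K\<^esub> \<one>\<^bsub>K\<^esub>) \<odot>\<^bsub>N\<^esub> f x"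
    using assms(4) by (intro module_homD[OF assms(1)]) auto
  then show ?thesis using module_homD(1)[OF assms(1)] assms(4)
    by (simp add: M.smult_l_minus N.smult_l_minus)
qed

lemma module_hom_minus:
  assumes "f \<in> module_hom K M N" "module K M" "module K N" "x \<in> carrier M" "y \<in> carrier M"
  shows "f (x \<ominus>\<^bsub>M\<^esub> y) = f x \<ominus>\<^bsub>N\<^esub> f y"
proof -
  interpret M: module K M by fact
  show ?thesis using assms
    by (simp add: a_minus_def module_homD(2)[OF assms(1)] module_hom_neg)
qed

text \<open>Infinite index sets are covered by convention: there both sums are zero, and a linear
  map preserves zero.\<close>

lemma module_hom_finsum:
  assumes f: "f \<in> module_hom K M N" and M: "module K M" and N: "module K N"
    and g: "\<And>i. i \<in> A \<Longrightarrow> g i \<in> carrier M"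
  shows "f (\<Oplus>\<^bsub>M\<^esub>i\<in>A. g i) = (\<Oplus>\<^bsub>N\<^esub>i\<in>A. f (g i))"
proof -
  interpret M: module K M by fact
  interpret N: module K N by fact
  from g show ?thesis
  proof (induction A rule: infinite_finite_induct)
    case (insert a A)
    then show ?case
      using module_homD[OF f] by (simp add: Pi_def M.finsum_closed)
  qed (use module_hom_zero[OF f M N] in auto)
qed

lemma module_hom_const_zero:
  assumes "module K M" "module K N"
  shows "(\<lambda>x. \<zero>\<^bsub>N\<^esub>) \<in> module_hom K M N"
proof -
  interpret N: module K N by fact
  show ?thesis by (intro module_homI) auto
qed

lemma module_hom_plus:
  assumes "module K M" "module K N" "f \<in> module_hom K M N" "g \<in> module_hom K M N"
  shows "(\<lambda>x. f x \<oplus>\<^bsub>N\<^esub> g x) \<in> module_hom K M N"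
proof -
  interpret N: module K N by fact
  interpret M: module K M by fact
  show ?thesis using module_homD[OF assms(3)] module_homD[OF assms(4)]
    by (intro module_homI) (auto simp: N.smult_r_distr N.a_ac)
qed

lemma module_hom_smult:
  assumes "module K M" "module K N" "f \<in> module_hom K M N" "a \<in> carrier K"
  shows "(\<lambda>x. a \<odot>\<^bsub>N\<^esub> f x) \<in> module_hom K M N"
proof -
  interpret N: module K N by fact
  interpret M: module K M by fact
  show ?thesis using module_homD[OF assms(3)] assms(4)
    by (intro module_homI) (auto simp: N.smult_r_distr N.smult_assoc1[symmetric] N.R.m_comm)
qed

lemma module_hom_sum:
  assumes M: "module K M" and N: "module K N"
    and f: "\<And>i. i \<in> A \<Longrightarrow> f i \<in> module_hom K M N"
  shows "(\<lambda>x. \<Oplus>\<^bsub>N\<^esub>i\<in>A. f i x) \<in> module_hom K M N"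
proof -
  interpret N: module K N by fact
  interpret M: module K M by fact
  from f show ?thesis
  proof (induction A rule: infinite_finite_induct)
    case (insert a A)
    have "(\<lambda>x. f a x \<oplus>\<^bsub>N\<^esub> (\<Oplus>\<^bsub>N\<^esub>i\<in>A. f i x)) \<in> module_hom K M N"
      using insert by (intro module_hom_plus[OF M N]) auto
    then show ?case
    proof (rule module_hom_cong[OF _ M])
      fix x assume "x \<in> carrier M"
      with insert module_homD(1)
      show "(\<Oplus>\<^bsub>N\<^esub>i\<in>insert a A. f i x) = f a x \<oplus>\<^bsub>N\<^esub> (\<Oplus>\<^bsub>N\<^esub>i\<in>A. f i x)"
        by (intro N.finsum_insert) fastforce+
    qed
  qed (use module_hom_const_zero[OF M N] in auto)
qed

lemma regular_module_simps [simp]: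
  "carrier (regular_module K) = carrier K" "add (regular_module K) = add K"
  "ring.zero (regular_module K) = \<zero>\<^bsub>K\<^esub>" "module.smult (regular_module K) = monoid.mult K"
  by (auto simp: regular_module_def)

lemma finsum_regular_module [simp]: "finsum (regular_module K) = finsum K"
  by (intro ext) (simp add: finsum_def finprod_def)

lemma regular_module_module:
  assumes "cring K" shows "module K (regular_module K)"
proof -
  interpret K: cring K by fact
  show ?thesis
    by (intro moduleI assms abelian_groupI)
       (auto simp: K.a_ac K.m_ac K.l_distr K.r_distr intro: K.l_neg)
qed

section \<open>Generated submodules\<close>

lemma (in module) submodule_generated_submodule:
  assumes "S \<subseteq> carrier M" shows "submodule (submodule_generated R M S) R M"
proof (rule submoduleI)
  \<comment> \<open>The carrier belongs to the intersected family, so the intersection is not taken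
    over the empty family.\<close>
  have *: "submodule (carrier M) R M \<and> S \<subseteq> carrier M"
    using assms carrier_is_submodule by simp
  show "submodule_generated R M S \<subseteq> carrier M"
    using * by (auto simp: submodule_generated_def)
  show "\<zero>\<^bsub>M\<^esub> \<in> submodule_generated R M S"
    using submodule.axioms(1) subgroup.one_closed by (force simp: submodule_generated_def)
qed (auto simp: submodule_generated_def intro: submoduleE(3) submoduleE(4) submoduleE(5))

lemma submodule_generated_superset: "S \<subseteq> submodule_generated R M S"
  by (auto simp: submodule_generated_def)

lemma submodule_generated_minimal:
  "\<lbrakk>submodule N R M; S \<subseteq> N\<rbrakk> \<Longrightarrow> submodule_generated R M S \<subseteq> N"
  by (auto simp: submodule_generated_def)

text \<open>Closure under negatives comes from closure under scalars, the negative being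
  multiplication by minus one.\<close>

lemma (in module) submoduleI':
  assumes subset: "H \<subseteq> carrier M"
    and zero: "\<zero>\<^bsub>M\<^esub> \<in> H"
    and add: "\<And>a b. \<lbrakk>a \<in> H; b \<in> H\<rbrakk> \<Longrightarrow> a \<oplus>\<^bsub>M\<^esub> b \<in> H"
    and smult: "\<And>a x. \<lbrakk>a \<in> carrier R; x \<in> H\<rbrakk> \<Longrightarrow> a \<odot>\<^bsub>M\<^esub> x \<in> H"
  shows "submodule H R M"
proof (rule submoduleI[OF subset zero _ add smult])
  fix a assume a: "a \<in> H"
  then have "(\<ominus> \<one>) \<odot>\<^bsub>M\<^esub> a \<in> H" by (intro smult) auto
  moreover have "(\<ominus> \<one>) \<odot>\<^bsub>M\<^esub> a = \<ominus>\<^bsub>M\<^esub> a"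
    using a subset by (auto simp: smult_l_minus)
  ultimately show "\<ominus>\<^bsub>M\<^esub> a \<in> H" by simp
qed auto

text \<open>The elements of the carrier with the property \<open>P\<close> form a submodule
  containing \<open>S\<close>.\<close>

lemma (in module) submodule_generated_induct:
  assumes x: "x \<in> submodule_generated R M S" and S: "S \<subseteq> carrier M"
    and gen: "\<And>s. s \<in> S \<Longrightarrow> P s"
    and zero: "P \<zero>\<^bsub>M\<^esub>"
    and add: "\<And>a b. \<lbrakk>a \<in> carrier M; b \<in> carrier M; P a; P b\<rbrakk> \<Longrightarrow> P (a \<oplus>\<^bsub>M\<^esub> b)"
    and smult: "\<And>a x. \<lbrakk>a \<in> carrier R; x \<in> carrier M; P x\<rbrakk> \<Longrightarrow> P (a \<odot>\<^bsub>M\<^esub> x)"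
  shows "P x"
proof -
  have "submodule {x \<in> carrier M. P x} R M"
    by (rule submoduleI') (auto simp: zero add smult)
  then have "submodule_generated R M S \<subseteq> {x \<in> carrier M. P x}"
    using S gen by (intro submodule_generated_minimal) auto
  with x show ?thesis by auto
qed

section \<open>Quotient modules and maps out of them\<close>

lemma quotient_module_simps:
  "carrier (quotient_module M N) = a_rcosets\<^bsub>M\<^esub> N" "ring.zero (quotient_module M N) = N"
  "add (quotient_module M N) = set_add M"
  "module.smult (quotient_module M N) = (\<lambda>a S. \<Union>x\<in>S. N +>\<^bsub>M\<^esub> (a \<odot>\<^bsub>M\<^esub> x))"
  by (auto simp: quotient_module_def)

locale quotient_of_module = module K M for K (structure) and M (structure) and N +
  assumes subm: "submodule N K M"
begin

sublocale abelian_subgroup N M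
  using subm a_comm_group by (intro abelian_subgroupI2) (auto simp: submodule_def)

abbreviation "Q \<equiv> quotient_module M N"

lemma N_subset: "N \<subseteq> carrier M" using subm submoduleE(1) by auto

lemma coset_eq_iff:
  assumes "x \<in> carrier M" "y \<in> carrier M"
  shows "N +>\<^bsub>M\<^esub> x = N +>\<^bsub>M\<^esub> y \<longleftrightarrow> x \<ominus>\<^bsub>M\<^esub> y \<in> N"
proof
  assume "N +>\<^bsub>M\<^esub> x = N +>\<^bsub>M\<^esub> y"
  then have "N +>\<^bsub>M\<^esub> (x \<oplus>\<^bsub>M\<^esub> (\<ominus>\<^bsub>M\<^esub> y)) = N"
    using assms N_subset by (intro a_coset_add_inv2)
  then show "x \<ominus>\<^bsub>M\<^esub> y \<in> N"
    using assms a_coset_join1[of N] a_subgroup by (auto simp: a_minus_def)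
next
  assume "x \<ominus>\<^bsub>M\<^esub> y \<in> N"
  then have "N +>\<^bsub>M\<^esub> (x \<oplus>\<^bsub>M\<^esub> (\<ominus>\<^bsub>M\<^esub> y)) = N"
    by (intro a_rcos_const) (simp add: a_minus_def)
  then show "N +>\<^bsub>M\<^esub> x = N +>\<^bsub>M\<^esub> y"
    using assms N_subset by (intro a_coset_add_inv1)
qed

lemma carrier_Q: "carrier Q = (\<lambda>x. N +>\<^bsub>M\<^esub> x) ` carrier M"
  by (auto simp: quotient_module_simps A_RCOSETS_def')

lemma zero_Q: "\<zero>\<^bsub>Q\<^esub> = N +>\<^bsub>M\<^esub> \<zero>\<^bsub>M\<^esub>"
  using N_subset by (simp add: quotient_module_simps)

lemma add_Q: "\<lbrakk>x \<in> carrier M; y \<in> carrier M\<rbrakk> \<Longrightarrow>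
    (N +>\<^bsub>M\<^esub> x) \<oplus>\<^bsub>Q\<^esub> (N +>\<^bsub>M\<^esub> y) = N +>\<^bsub>M\<^esub> (x \<oplus>\<^bsub>M\<^esub> y)"
  by (simp add: quotient_module_simps a_rcos_sum)

text \<open>The scalar multiple of a coset is defined as a union over its elements. All members of
  that union coincide: two elements of a coset differ by an element of \<open>N\<close>, whose
  multiples stay in \<open>N\<close>.\<close>

lemma smult_Q:
  assumes a: "a \<in> carrier K" and x: "x \<in> carrier M"
  shows "a \<odot>\<^bsub>Q\<^esub> (N +>\<^bsub>M\<^esub> x) = N +>\<^bsub>M\<^esub> (a \<odot>\<^bsub>M\<^esub> x)"
proof -
  have *: "N +>\<^bsub>M\<^esub> (a \<odot>\<^bsub>M\<^esub> y) = N +>\<^bsub>M\<^esub> (a \<odot>\<^bsub>M\<^esub> x)" if y: "y \<in> N +>\<^bsub>M\<^esub> x" for y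
  proof -
    obtain n where n: "n \<in> N" "y = n \<oplus>\<^bsub>M\<^esub> x" using y by (auto simp: a_r_coset_def')
    then have nc: "n \<in> carrier M" using N_subset by auto
    have "a \<odot>\<^bsub>M\<^esub> y \<ominus>\<^bsub>M\<^esub> a \<odot>\<^bsub>M\<^esub> x = a \<odot>\<^bsub>M\<^esub> n"
      using n nc a x by (simp add: smult_r_distr a_minus_def M.a_assoc M.r_neg)
    then show ?thesis
      using n nc a x submoduleE(4)[OF subm] by (subst coset_eq_iff) auto
  qed
  \<comment> \<open>A union of equal cosets is that coset only if it has at least one
    member.\<close>
  have "N +>\<^bsub>M\<^esub> x \<noteq> {}" using a_rcos_self[OF x] by auto
  then show ?thesis unfolding quotient_module_simps using * by (intro SUP_eq_const) auto
qed

lemma module_Q: "module K Q"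
proof -
  have "\<exists>y\<in>carrier Q. y \<oplus>\<^bsub>Q\<^esub> x = \<zero>\<^bsub>Q\<^esub>" if "x \<in> carrier Q" for x
  proof -
    obtain z where "z \<in> carrier M" "x = N +>\<^bsub>M\<^esub> z" using \<open>x \<in> carrier Q\<close> carrier_Q by auto
    then show ?thesis
      by (intro bexI[of _ "N +>\<^bsub>M\<^esub> (\<ominus>\<^bsub>M\<^esub> z)"]) (auto simp: add_Q zero_Q M.l_neg carrier_Q)
  qed
  then have ab: "abelian_group Q"
  proof (intro abelian_groupI)
    fix x y assume "x \<in> carrier Q" "y \<in> carrier Q"
    then show "x \<oplus>\<^bsub>Q\<^esub> y = y \<oplus>\<^bsub>Q\<^esub> x"
      using M.a_comm by (auto simp: carrier_Q add_Q simp del: M.add.m_comm)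
  qed (auto simp: carrier_Q add_Q zero_Q M.a_assoc)
  show ?thesis
    by (rule moduleI[OF R.is_cring ab])
       (auto simp: carrier_Q add_Q smult_Q smult_l_distr smult_r_distr smult_assoc1)
qed

lemma proj_hom: "(\<lambda>x. N +>\<^bsub>M\<^esub> x) \<in> module_hom K M Q"
  by (intro module_homI) (auto simp: carrier_Q add_Q smult_Q)

text \<open>\<open>the_elem\<close> returns the common value because the image of a coset is a
  singleton as soon as \<open>h\<close> kills \<open>N\<close>.\<close>

lemma quotient_lift:
  assumes P: "module K P" and h: "h \<in> module_hom K M P" and ker: "\<forall>n\<in>N. h n = \<zero>\<^bsub>P\<^esub>"
  shows quotient_lift_coset: "\<And>x. x \<in> carrier M \<Longrightarrow> quotient_lift h (N +>\<^bsub>M\<^esub> x) = h x"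
    and quotient_lift_hom: "quotient_lift h \<in> module_hom K Q P"
proof -
  interpret P: module K P by fact
  show *: "quotient_lift h (N +>\<^bsub>M\<^esub> x) = h x" if x: "x \<in> carrier M" for x
  proof -
    have "h y \<in> {h x}" if y: "y \<in> N +>\<^bsub>M\<^esub> x" for y
    proof -
      obtain n where n: "n \<in> N" "y = n \<oplus>\<^bsub>M\<^esub> x" using y by (auto simp: a_r_coset_def')
      then have nc: "n \<in> carrier M" using N_subset by auto
      show ?thesis using n nc x module_homD[OF h] ker by simp
    qed
    then have "h ` (N +>\<^bsub>M\<^esub> x) = {h x}" using a_rcos_self[OF x] by blast
    then show ?thesis by (simp add: quotient_lift_def)
  qed
  show "quotient_lift h \<in> module_hom K Q P"
    using module_homD[OF h] by (intro module_homI) (auto simp: carrier_Q add_Q smult_Q *)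
qed

end

lemma quotient_of_moduleI:
  "\<lbrakk>module K M; S \<subseteq> carrier M\<rbrakk> \<Longrightarrow> quotient_of_module K M (submodule_generated K M S)"
  by (simp add: quotient_of_module_def quotient_of_module_axioms_def
      module.submodule_generated_submodule)

text \<open>The elements killed by a linear map form a submodule, so only the generating relations
  have to be tested. The universal properties of tensor products, of tensor powers and of
  \<open>chi_comp\<close> all rest on this.\<close>

lemma quotient_generated_lift:
  assumes "module K M" "S \<subseteq> carrier M" "module K P" "h \<in> module_hom K M P"
    "\<forall>s\<in>S. h s = \<zero>\<^bsub>P\<^esub>"
  defines "N \<equiv> submodule_generated K M S"
  shows "\<And>x. x \<in> carrier M \<Longrightarrow> quotient_lift h (N +>\<^bsub>M\<^esub> x) = h x"
    and "quotient_lift h \<in> module_hom K (quotient_module M N) P"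
proof -
  interpret Q: quotient_of_module K M N unfolding N_def using assms by (intro quotient_of_moduleI)
  interpret P: module K P by fact
  have "h n = \<zero>\<^bsub>P\<^esub>" if "n \<in> N" for n
    using that[unfolded N_def]
    by (rule module.submodule_generated_induct[OF assms(1)])
       (use assms(2) module_homD[OF assms(4)] assms(5) module_hom_zero[OF assms(4,1,3)] in auto)
  then have "\<forall>n\<in>N. h n = \<zero>\<^bsub>P\<^esub>" by blast
  note * = Q.quotient_lift[OF assms(3,4) this]
  show "\<And>x. x \<in> carrier M \<Longrightarrow> quotient_lift h (N +>\<^bsub>M\<^esub> x) = h x"
    and "quotient_lift h \<in> module_hom K (quotient_module M N) P" using * by auto
qed

section \<open>Spanning sets\<close>

definition spans :: "('k,'r) ring_scheme \<Rightarrow> ('k,'a,'s) module_scheme \<Rightarrow> 'a set \<Rightarrow> bool"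
  where "spans K M G \<longleftrightarrow> G \<subseteq> carrier M \<and> carrier M \<subseteq> submodule_generated K M G"

lemma spans_induct [consumes 3, case_names gen zero add smult]:
  assumes "module K M" "spans K M G" "x \<in> carrier M"
    and "\<And>s. s \<in> G \<Longrightarrow> P s"
    and "P \<zero>\<^bsub>M\<^esub>"
    and "\<And>a b. \<lbrakk>a \<in> carrier M; b \<in> carrier M; P a; P b\<rbrakk> \<Longrightarrow> P (a \<oplus>\<^bsub>M\<^esub> b)"
    and "\<And>a x. \<lbrakk>a \<in> carrier K; x \<in> carrier M; P x\<rbrakk> \<Longrightarrow> P (a \<odot>\<^bsub>M\<^esub> x)"
  shows "P x"
proof (rule module.submodule_generated_induct[OF assms(1), of x G])
  show "x \<in> submodule_generated K M G" using assms(2,3) by (auto simp: spans_def)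
  show "G \<subseteq> carrier M" using assms(2) by (auto simp: spans_def)
qed (use assms in auto)

lemma spans_hom_eq:
  assumes "module K M" "module K P" "spans K M G" "f \<in> module_hom K M P" "g \<in> module_hom K M P"
    and "\<And>s. s \<in> G \<Longrightarrow> f s = g s" and "x \<in> carrier M"
  shows "f x = g x"
  using assms(1,3,7)
  by (induction rule: spans_induct)
     (use assms(6) module_homD[OF assms(4)] module_homD[OF assms(5)]
        module_hom_zero[OF assms(4,1,2)] module_hom_zero[OF assms(5,1,2)] in auto)

lemma spans_image:
  assumes M: "module K M" and N: "module K N" and G: "spans K M G"
    and f: "f \<in> module_hom K M N" and surj: "f ` carrier M = carrier N"
  shows "spans K N (f ` G)"
proof -
  interpret M: module K M by fact
  interpret N: module K N by fact
  have G': "G \<subseteq> carrier M" using G by (simp add: spans_def)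
  then have fG: "f ` G \<subseteq> carrier N" using surj by auto
  note gen = N.submodule_generated_submodule[OF fG]
  have "f x \<in> submodule_generated K N (f ` G)" if "x \<in> carrier M" for x
    using M G that
  proof (induction rule: spans_induct)
    case (gen s) then show ?case using submodule_generated_superset[of "f ` G" K N] by auto
  next
    case zero then show ?case
      using module_hom_zero[OF f M N] subgroup.one_closed[OF submodule.axioms(1)[OF gen]] by simp
  qed (use N.submoduleE[OF gen] module_homD[OF f] in auto)
  then have "f ` carrier M \<subseteq> submodule_generated K N (f ` G)" by auto
  then show ?thesis using surj fG by (simp add: spans_def)
qed

lemma spans_subset_submodule:
  assumes "module K M" "module K N" "spans K M G" "f \<in> module_hom K M N"
    and S: "submodule S K N" and "\<And>s. s \<in> G \<Longrightarrow> f s \<in> S" "x \<in> carrier M"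
  shows "f x \<in> S"
proof -
  interpret N: module K N by fact
  show ?thesis
    using assms(1,3,7)
  proof (induction rule: spans_induct)
    case zero then show ?case
      using module_hom_zero[OF assms(4,1,2)] subgroup.one_closed[OF submodule.axioms(1)[OF S]] by simp
  qed (use assms(6) N.submoduleE[OF S] module_homD[OF assms(4)] in auto)
qed

section \<open>Free modules and tensor products\<close>

lemma free_module_simps:
  "carrier (free_module K S) = {f. range f \<subseteq> carrier K \<and> finite {x. f x \<noteq> \<zero>\<^bsub>K\<^esub>} \<and> {x. f x \<noteq> \<zero>\<^bsub>K\<^esub>} \<subseteq> S}"
  "\<zero>\<^bsub>free_module K S\<^esub> = (\<lambda>x. \<zero>\<^bsub>K\<^esub>)"
  "f \<oplus>\<^bsub>free_module K S\<^esub> g = (\<lambda>x. f x \<oplus>\<^bsub>K\<^esub> g x)"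
  "a \<odot>\<^bsub>free_module K S\<^esub> f = (\<lambda>x. a \<otimes>\<^bsub>K\<^esub> f x)"
  by (simp_all add: free_module_def)

lemma free_module_carrierI:
  assumes "\<And>x. f x \<in> carrier K" "{x. f x \<noteq> \<zero>\<^bsub>K\<^esub>} \<subseteq> A" "finite A" "A \<subseteq> S"
  shows "f \<in> carrier (free_module K S)"
  using assms finite_subset[OF assms(2,3)] by (auto simp: free_module_simps)

lemma free_module_carrierD:
  assumes "f \<in> carrier (free_module K S)"
  shows "f x \<in> carrier K" "finite {x. f x \<noteq> \<zero>\<^bsub>K\<^esub>}" "{x. f x \<noteq> \<zero>\<^bsub>K\<^esub>} \<subseteq> S"
  using assms by (auto simp: free_module_simps)

lemma free_module_module:
  assumes "cring K" shows "module K (free_module K S)"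
proof -
  interpret K: cring K by fact
  have ab: "abelian_group (free_module K S)"
  proof (rule abelian_groupI)
    fix f g assume fg: "f \<in> carrier (free_module K S)" "g \<in> carrier (free_module K S)"
    note fgD = free_module_carrierD[OF fg(1)] free_module_carrierD[OF fg(2)]
    show "f \<oplus>\<^bsub>free_module K S\<^esub> g \<in> carrier (free_module K S)"
      unfolding free_module_simps(3)
      by (rule free_module_carrierI[of _ _ "{x. f x \<noteq> \<zero>\<^bsub>K\<^esub>} \<union> {x. g x \<noteq> \<zero>\<^bsub>K\<^esub>}"])
         (use fgD in auto)
  next
    fix f assume f: "f \<in> carrier (free_module K S)"
    have "(\<lambda>x. \<ominus>\<^bsub>K\<^esub> f x) \<in> carrier (free_module K S)"
      by (rule free_module_carrierI[of _ _ "{x. f x \<noteq> \<zero>\<^bsub>K\<^esub>}"])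
         (use free_module_carrierD[OF f] in auto)
    then show "\<exists>g\<in>carrier (free_module K S). g \<oplus>\<^bsub>free_module K S\<^esub> f = \<zero>\<^bsub>free_module K S\<^esub>"
      by (rule bexI[rotated])
         (use free_module_carrierD(1)[OF f] in \<open>simp add: free_module_simps(2,3) K.l_neg\<close>)
  next
    show "\<zero>\<^bsub>free_module K S\<^esub> \<in> carrier (free_module K S)"
      by (auto simp: free_module_simps)
  next
    fix f g h assume "f \<in> carrier (free_module K S)" "g \<in> carrier (free_module K S)"
      "h \<in> carrier (free_module K S)"
    then show "f \<oplus>\<^bsub>free_module K S\<^esub> g \<oplus>\<^bsub>free_module K S\<^esub> h
        = f \<oplus>\<^bsub>free_module K S\<^esub> (g \<oplus>\<^bsub>free_module K S\<^esub> h)"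
      by (auto simp: free_module_simps fun_eq_iff image_subset_iff K.a_assoc)
  next
    fix f g assume "f \<in> carrier (free_module K S)" "g \<in> carrier (free_module K S)"
    then show "f \<oplus>\<^bsub>free_module K S\<^esub> g = g \<oplus>\<^bsub>free_module K S\<^esub> f"
      by (auto simp: free_module_simps fun_eq_iff image_subset_iff intro!: K.a_comm)
  qed (auto simp: free_module_simps fun_eq_iff image_subset_iff)
  show ?thesis
  proof (rule moduleI[OF assms ab])
    fix a f assume a: "a \<in> carrier K" and f: "f \<in> carrier (free_module K S)"
    show "a \<odot>\<^bsub>free_module K S\<^esub> f \<in> carrier (free_module K S)"
      unfolding free_module_simps(4)
      by (rule free_module_carrierI[of _ _ "{x. f x \<noteq> \<zero>\<^bsub>K\<^esub>}"])
         (use free_module_carrierD[OF f] a in auto)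
  qed (auto simp: free_module_simps fun_eq_iff image_subset_iff K.l_distr K.r_distr K.m_assoc)
qed

lemma free_gen_closed:
  assumes "cring K" "x \<in> S" shows "free_gen K x \<in> carrier (free_module K S)"
proof -
  interpret K: cring K by fact
  have "{y. free_gen K x y \<noteq> \<zero>\<^bsub>K\<^esub>} \<subseteq> {x}" by (auto simp: free_gen_def)
  then show ?thesis using assms(2) finite_subset[of _ "{x}"]
    by (auto simp: free_module_simps free_gen_def)
qed

lemma spans_free_module:
  assumes "cring K" shows "spans K (free_module K S) (free_gen K ` S)"
proof -
  interpret K: cring K by fact
  interpret F: module K "free_module K S" using assms by (rule free_module_module)
  let ?F = "free_module K S"
  have G: "free_gen K ` S \<subseteq> carrier ?F" using free_gen_closed[OF assms] by auto
  note gen = F.submodule_generated_submodule[OF G]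
  let ?N = "submodule_generated K ?F (free_gen K ` S)"
  \<comment> \<open>Induction over a finite set that contains the support: clearing the value at one
    point then leaves a function supported in the smaller set, whatever the exact support
    is.\<close>
  have "f \<in> ?N" if "finite A" "f \<in> carrier ?F" "{x. f x \<noteq> \<zero>\<^bsub>K\<^esub>} \<subseteq> A" for A f
    using that
  proof (induction A arbitrary: f)
    case empty
    then have "f = \<zero>\<^bsub>?F\<^esub>" by (auto simp: free_module_simps)
    then show ?case using subgroup.one_closed[OF submodule.axioms(1)[OF gen]] by simp
  next
    case (insert x A)
    let ?g = "f(x := \<zero>\<^bsub>K\<^esub>)"
    show ?case
    proof (cases "f x = \<zero>\<^bsub>K\<^esub>")
      case True
      then have "{x. f x \<noteq> \<zero>\<^bsub>K\<^esub>} \<subseteq> A" using insert.prems by auto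
      then show ?thesis using insert by auto
    next
      case False
      then have x: "x \<in> S" and fc: "\<And>y. f y \<in> carrier K"
        using insert.prems by (auto simp: free_module_simps)
      have supp: "{y. ?g y \<noteq> \<zero>\<^bsub>K\<^esub>} \<subseteq> A" using insert.prems by auto
      have "{y. ?g y \<noteq> \<zero>\<^bsub>K\<^esub>} \<subseteq> {y. f y \<noteq> \<zero>\<^bsub>K\<^esub>}" by auto
      then have "?g \<in> carrier ?F"
        using insert.prems(1) fc finite_subset[of "{y. ?g y \<noteq> \<zero>\<^bsub>K\<^esub>}" "{y. f y \<noteq> \<zero>\<^bsub>K\<^esub>}"]
        by (auto simp: free_module_simps)
      then have "?g \<in> ?N" using supp by (rule insert.IH)
      moreover have "f x \<odot>\<^bsub>?F\<^esub> free_gen K x \<in> ?N"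
        using x fc submodule_generated_superset[of "free_gen K ` S" K ?F]
        by (intro F.submoduleE(4)[OF gen]) auto
      moreover have "f = f x \<odot>\<^bsub>?F\<^esub> free_gen K x \<oplus>\<^bsub>?F\<^esub> ?g"
        using fc by (auto simp: free_module_simps free_gen_def fun_eq_iff)
      ultimately show ?thesis using F.submoduleE(5)[OF gen] by metis
    qed
  qed
  then have "carrier ?F \<subseteq> ?N" by (auto simp: free_module_simps)
  then show ?thesis using G by (simp add: spans_def)
qed

text \<open>The supports of two functions and of their sum differ. Additivity of
  \<open>free_lift\<close> becomes visible after all sums are extended to one finite set that
  contains these supports.\<close>

lemma free_lift_superset:
  assumes P: "module K P" and g: "\<And>x. x \<in> S \<Longrightarrow> g x \<in> carrier P"
    and f: "f \<in> carrier (free_module K S)"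
    and A: "finite A" "A \<subseteq> S" "{x. f x \<noteq> \<zero>\<^bsub>K\<^esub>} \<subseteq> A"
  shows "free_lift K P g f = (\<Oplus>\<^bsub>P\<^esub>x\<in>A. f x \<odot>\<^bsub>P\<^esub> g x)"
proof -
  interpret P: module K P by fact
  have "\<And>x. f x \<in> carrier K" using f by (auto simp: free_module_simps)
  then show ?thesis unfolding free_lift_def
    using A g by (intro P.add.finprod_mono_neutral_cong_left) (auto simp: subset_iff)
qed

lemma free_lift:
  assumes P: "module K P" and g: "\<And>x. x \<in> S \<Longrightarrow> g x \<in> carrier P"
  shows free_lift_gen: "x \<in> S \<Longrightarrow> free_lift K P g (free_gen K x) = g x"
    and free_lift_hom: "free_lift K P g \<in> module_hom K (free_module K S) P"
proof -
  interpret P: module K P by fact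
  let ?F = "free_module K S"
  interpret F: module K ?F by (intro free_module_module P.R.is_cring)
  show "free_lift K P g (free_gen K x) = g x" if "x \<in> S"
  proof -
    have "free_lift K P g (free_gen K x) = (\<Oplus>\<^bsub>P\<^esub>y\<in>{x}. free_gen K x y \<odot>\<^bsub>P\<^esub> g y)"
      using that by (intro free_lift_superset[OF P g] free_gen_closed P.R.is_cring)
        (auto simp: free_gen_def)
    then show ?thesis using g[OF that] by (simp add: free_gen_def)
  qed
  have supp: "finite {x. f x \<noteq> \<zero>\<^bsub>K\<^esub>}" "{x. f x \<noteq> \<zero>\<^bsub>K\<^esub>} \<subseteq> S" "\<And>x. f x \<in> carrier K"
    if "f \<in> carrier ?F" for f
    using that by (auto simp: free_module_simps)
  show "free_lift K P g \<in> module_hom K ?F P"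
  proof (rule module_homI)
    fix f assume f: "f \<in> carrier ?F"
    show "free_lift K P g f \<in> carrier P"
      unfolding free_lift_def using supp[OF f] g by (intro P.finsum_closed) (auto simp: subset_iff)
    fix h assume h: "h \<in> carrier ?F"
    let ?A = "{x. f x \<noteq> \<zero>\<^bsub>K\<^esub>} \<union> {x. h x \<noteq> \<zero>\<^bsub>K\<^esub>}"
    have A: "finite ?A" "?A \<subseteq> S" using supp[OF f] supp[OF h] by auto
    have "free_lift K P g (f \<oplus>\<^bsub>?F\<^esub> h) = (\<Oplus>\<^bsub>P\<^esub>x\<in>?A. (f x \<oplus>\<^bsub>K\<^esub> h x) \<odot>\<^bsub>P\<^esub> g x)"
      using A f h F.a_closed[OF f h]
      by (subst free_lift_superset[OF P g _ A]) (auto simp: free_module_simps(3))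
    also have "\<dots> = (\<Oplus>\<^bsub>P\<^esub>x\<in>?A. f x \<odot>\<^bsub>P\<^esub> g x \<oplus>\<^bsub>P\<^esub> h x \<odot>\<^bsub>P\<^esub> g x)"
      using A g supp(3)[OF f] supp(3)[OF h]
      by (intro P.finsum_cong') (auto simp: P.smult_l_distr subset_iff)
    also have "\<dots> = (\<Oplus>\<^bsub>P\<^esub>x\<in>?A. f x \<odot>\<^bsub>P\<^esub> g x) \<oplus>\<^bsub>P\<^esub> (\<Oplus>\<^bsub>P\<^esub>x\<in>?A. h x \<odot>\<^bsub>P\<^esub> g x)"
      using A g supp(3)[OF f] supp(3)[OF h]
      by (intro P.finsum_addf) (auto simp: subset_iff)
    also have "\<dots> = free_lift K P g f \<oplus>\<^bsub>P\<^esub> free_lift K P g h"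
      by (subst (1 2) free_lift_superset[OF P g _ A]) (use f h in auto)
    finally show "free_lift K P g (f \<oplus>\<^bsub>?F\<^esub> h) = free_lift K P g f \<oplus>\<^bsub>P\<^esub> free_lift K P g h" .
  next
    fix a f assume a: "a \<in> carrier K" and f: "f \<in> carrier ?F"
    let ?A = "{x. f x \<noteq> \<zero>\<^bsub>K\<^esub>}"
    have "free_lift K P g (a \<odot>\<^bsub>?F\<^esub> f) = (\<Oplus>\<^bsub>P\<^esub>x\<in>?A. (a \<otimes>\<^bsub>K\<^esub> f x) \<odot>\<^bsub>P\<^esub> g x)"
      using supp[OF f] a f F.smult_closed[OF a f] by (subst free_lift_superset[OF P g _ supp(1,2)[OF f]])
        (auto simp: free_module_simps(4))
    also have "\<dots> = (\<Oplus>\<^bsub>P\<^esub>x\<in>?A. a \<odot>\<^bsub>P\<^esub> (f x \<odot>\<^bsub>P\<^esub> g x))"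
      using supp[OF f] a g by (intro P.finsum_cong') (auto simp: P.smult_assoc1 subset_iff)
    also have "\<dots> = a \<odot>\<^bsub>P\<^esub> free_lift K P g f"
      unfolding free_lift_def
      using supp[OF f] a g by (intro P.finsum_smult_ldistr[symmetric]) (auto simp: subset_iff)
    finally show "free_lift K P g (a \<odot>\<^bsub>?F\<^esub> f) = a \<odot>\<^bsub>P\<^esub> free_lift K P g f" .
  qed
qed

section \<open>Bilinear maps and the tensor product of two modules\<close>

definition bilinear_map ::
  "('k,'r) ring_scheme \<Rightarrow> ('k,'a,'s) module_scheme \<Rightarrow> ('k,'b,'t) module_scheme
     \<Rightarrow> ('k,'c,'u) module_scheme \<Rightarrow> ('a \<Rightarrow> 'b \<Rightarrow> 'c) \<Rightarrow> bool"
  where "bilinear_map K M N P g \<longleftrightarrow>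
    (\<forall>y\<in>carrier N. (\<lambda>x. g x y) \<in> module_hom K M P) \<and> (\<forall>x\<in>carrier M. g x \<in> module_hom K N P)"

lemma bilinear_mapD:
  assumes "bilinear_map K M N P g"
  shows "y \<in> carrier N \<Longrightarrow> (\<lambda>x. g x y) \<in> module_hom K M P"
    and "x \<in> carrier M \<Longrightarrow> g x \<in> module_hom K N P"
    and "x \<in> carrier M \<Longrightarrow> y \<in> carrier N \<Longrightarrow> g x y \<in> carrier P"
  using assms module_homD(1)[of "g x" K N P] by (auto simp: bilinear_map_def)

locale two_modules = M: module K M + N: module K N
  for K :: "('k,'r) ring_scheme" (structure) and M :: "('k,'a,'s) module_scheme" (structure)
    and N :: "('k,'b,'t) module_scheme" (structure)
begin

abbreviation "F \<equiv> free_module K (carrier M \<times> carrier N)"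
abbreviation "T \<equiv> tensor_module K M N"
abbreviation "pt \<equiv> pure_tensor K M N"

sublocale F: module K F by (intro free_module_module M.R.is_cring)

lemma gen_closed: "\<lbrakk>x \<in> carrier M; y \<in> carrier N\<rbrakk> \<Longrightarrow> free_gen K (x, y) \<in> carrier F"
  by (intro free_gen_closed M.R.is_cring) auto

lemma tensor_relations_subset: "tensor_relations K M N \<subseteq> carrier F"
  unfolding tensor_relations_def Let_def
  by (intro Un_least subsetI) (auto intro!: F.minus_closed F.a_closed F.smult_closed gen_closed)

sublocale Q: quotient_of_module K F "tensor_kernel K M N"
  unfolding tensor_kernel_def
  by (intro quotient_of_moduleI tensor_relations_subset F.module_axioms)

lemma tensor_module: "module K T"
  unfolding tensor_module_def by (rule Q.module_Q)

lemma spans_tensor: "spans K T ((\<lambda>(x, y). pt x y) ` (carrier M \<times> carrier N))"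
proof -
  have "spans K T ((\<lambda>x. tensor_kernel K M N +>\<^bsub>F\<^esub> x) ` (free_gen K ` (carrier M \<times> carrier N)))"
    unfolding tensor_module_def
    by (rule spans_image[OF F.module_axioms Q.module_Q spans_free_module[OF M.R.is_cring] Q.proj_hom])
       (simp add: Q.carrier_Q)
  then show ?thesis by (simp add: image_image pure_tensor_def case_prod_unfold)
qed

lemma pure_tensor_closed: "\<lbrakk>x \<in> carrier M; y \<in> carrier N\<rbrakk> \<Longrightarrow> pt x y \<in> carrier T"
  using spans_tensor by (auto simp: spans_def)

lemma bilinear_pure_tensor: "bilinear_map K M N T pt"
proof -
  have rel: "r \<in> tensor_kernel K M N" if "r \<in> tensor_relations K M N" for r
    unfolding tensor_kernel_def using that by (rule subsetD[OF submodule_generated_superset])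
  show ?thesis
    unfolding bilinear_map_def
  proof (intro conjI ballI)
    fix y assume y: "y \<in> carrier N"
    show "(\<lambda>x. pt x y) \<in> module_hom K M T"
    proof (rule module_homI)
      fix x x' assume x: "x \<in> carrier M" "x' \<in> carrier M"
      have "free_gen K (x \<oplus>\<^bsub>M\<^esub> x', y) \<ominus>\<^bsub>F\<^esub> (free_gen K (x, y) \<oplus>\<^bsub>F\<^esub> free_gen K (x', y))
          \<in> tensor_relations K M N"
        unfolding tensor_relations_def Let_def using x y by blast
      then show "pt (x \<oplus>\<^bsub>M\<^esub> x') y = pt x y \<oplus>\<^bsub>T\<^esub> pt x' y"
        using x y unfolding pure_tensor_def tensor_module_def
        by (simp add: Q.add_Q Q.coset_eq_iff gen_closed rel)
    next
      fix a x assume x: "a \<in> carrier K" "x \<in> carrier M"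
      have "free_gen K (a \<odot>\<^bsub>M\<^esub> x, y) \<ominus>\<^bsub>F\<^esub> (a \<odot>\<^bsub>F\<^esub> free_gen K (x, y)) \<in> tensor_relations K M N"
        unfolding tensor_relations_def Let_def using x y by blast
      then show "pt (a \<odot>\<^bsub>M\<^esub> x) y = a \<odot>\<^bsub>T\<^esub> pt x y"
        using x y unfolding pure_tensor_def tensor_module_def
        by (simp add: Q.smult_Q Q.coset_eq_iff gen_closed rel)
    qed (use y pure_tensor_closed in auto)
  next
    fix x assume x: "x \<in> carrier M"
    show "pt x \<in> module_hom K N T"
    proof (rule module_homI)
      fix y y' assume y: "y \<in> carrier N" "y' \<in> carrier N"
      have "free_gen K (x, y \<oplus>\<^bsub>N\<^esub> y') \<ominus>\<^bsub>F\<^esub> (free_gen K (x, y) \<oplus>\<^bsub>F\<^esub> free_gen K (x, y'))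
          \<in> tensor_relations K M N"
        unfolding tensor_relations_def Let_def using x y by blast
      then show "pt x (y \<oplus>\<^bsub>N\<^esub> y') = pt x y \<oplus>\<^bsub>T\<^esub> pt x y'"
        using x y unfolding pure_tensor_def tensor_module_def
        by (simp add: Q.add_Q Q.coset_eq_iff gen_closed rel)
    next
      fix a y assume y: "a \<in> carrier K" "y \<in> carrier N"
      have "free_gen K (x, a \<odot>\<^bsub>N\<^esub> y) \<ominus>\<^bsub>F\<^esub> (a \<odot>\<^bsub>F\<^esub> free_gen K (x, y)) \<in> tensor_relations K M N"
        unfolding tensor_relations_def Let_def using x y by blast
      then show "pt x (a \<odot>\<^bsub>N\<^esub> y) = a \<odot>\<^bsub>T\<^esub> pt x y"
        using x y unfolding pure_tensor_def tensor_module_def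
        by (simp add: Q.smult_Q Q.coset_eq_iff gen_closed rel)
    qed (use x pure_tensor_closed in auto)
  qed
qed

lemma tensor_lift:
  assumes P: "module K P" and g: "bilinear_map K M N P g"
  shows tensor_lift_pure: "\<lbrakk>x \<in> carrier M; y \<in> carrier N\<rbrakk> \<Longrightarrow> tensor_lift K P g (pt x y) = g x y"
    and tensor_lift_hom: "tensor_lift K P g \<in> module_hom K T P"
proof -
  interpret P: module K P by fact
  let ?h = "free_lift K P (\<lambda>(x, y). g x y)"
  have gc: "(\<lambda>(x, y). g x y) z \<in> carrier P" if "z \<in> carrier M \<times> carrier N" for z
    using that bilinear_mapD(3)[OF g] by auto
  have h: "?h \<in> module_hom K F P" by (rule free_lift_hom[OF P gc])
  have gen: "?h (free_gen K (x, y)) = g x y" if "x \<in> carrier M" "y \<in> carrier N" for x y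
    using that free_lift_gen[of K P "carrier M \<times> carrier N" "\<lambda>(x, y). g x y" "(x, y)", OF P gc] by simp
  \<comment> \<open>Each defining relation is a difference of two elements, so it is killed as soon
    as both have the same image; the subtraction in the free module need not be unfolded.\<close>
  have zero: "?h (u \<ominus>\<^bsub>F\<^esub> v) = \<zero>\<^bsub>P\<^esub>" if "u \<in> carrier F" "v \<in> carrier F" "?h u = ?h v" for u v
    unfolding module_hom_minus[OF h F.module_axioms P that(1,2)] that(3)
    using module_homD(1)[OF h that(2)] by (simp add: P.r_neg a_minus_def)
  note simps = gen module_homD(2,3)[OF h] gen_closed module_homD(2,3)[OF bilinear_mapD(1)[OF g]]
    module_homD(2,3)[OF bilinear_mapD(2)[OF g]]
  have "?h s = \<zero>\<^bsub>P\<^esub>" if "s \<in> tensor_relations K M N" for s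
    using that unfolding tensor_relations_def Let_def
    by (elim UnE CollectE exE conjE; hypsubst; intro zero)
       (auto simp: simps)
  then have "\<forall>s\<in>tensor_relations K M N. ?h s = \<zero>\<^bsub>P\<^esub>" by blast
  note * = quotient_generated_lift[OF F.module_axioms tensor_relations_subset P h this,
      folded tensor_kernel_def]
  show "tensor_lift K P g \<in> module_hom K T P"
    using *(2) by (simp add: tensor_lift_def tensor_module_def)
  show "tensor_lift K P g (pt x y) = g x y" if "x \<in> carrier M" "y \<in> carrier N"
    using that *(1)[OF gen_closed[OF that]] gen[of x y]
    by (simp add: tensor_lift_def pure_tensor_def)
qed

lemma tensor_hom_eq:
  assumes "module K P" "f \<in> module_hom K T P" "g \<in> module_hom K T P"
    and "\<And>x y. \<lbrakk>x \<in> carrier M; y \<in> carrier N\<rbrakk> \<Longrightarrow> f (pt x y) = g (pt x y)" and "t \<in> carrier T"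
  shows "f t = g t"
  by (rule spans_hom_eq[OF tensor_module assms(1) spans_tensor assms(2,3) _ assms(5)])
     (use assms(4) in auto)

end

lemma two_modulesI: "\<lbrakk>module K M; module K N\<rbrakk> \<Longrightarrow> two_modules K M N"
  by (simp add: two_modules_def)

lemma tensor_map:
  assumes "module K M" "module K N" "module K M'" "module K N'"
    and f: "f \<in> module_hom K M M'" and g: "g \<in> module_hom K N N'"
  shows tensor_map_hom: "tensor_map K M' N' f g \<in> module_hom K (tensor_module K M N) (tensor_module K M' N')"
    and tensor_map_pure: "\<lbrakk>x \<in> carrier M; y \<in> carrier N\<rbrakk> \<Longrightarrow>
      tensor_map K M' N' f g (pure_tensor K M N x y) = pure_tensor K M' N' (f x) (g y)"
proof -
  interpret A: two_modules K M N using assms by (simp add: two_modules_def)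
  interpret B: two_modules K M' N' using assms by (simp add: two_modules_def)
  have "bilinear_map K M N B.T (\<lambda>x y. B.pt (f x) (g y))"
    unfolding bilinear_map_def
    using module_hom_comp[OF f bilinear_mapD(1)[OF B.bilinear_pure_tensor]]
      module_hom_comp[OF g bilinear_mapD(2)[OF B.bilinear_pure_tensor]]
      module_homD(1)[OF f] module_homD(1)[OF g] by blast
  note * = A.tensor_lift[OF B.tensor_module this]
  show "tensor_map K M' N' f g \<in> module_hom K A.T B.T"
    unfolding tensor_map_def by (rule *)
  show "tensor_map K M' N' f g (A.pt x y) = B.pt (f x) (g y)" if "x \<in> carrier M" "y \<in> carrier N"
    unfolding tensor_map_def using that by (rule *)
qed

text \<open>The map is a lift of a lift. For fixed \<open>z\<close> the inner lift is linear in the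
  element of the first tensor product by construction. Its linearity in \<open>z\<close> is an
  equation between two linear maps on that tensor product, and is checked on pure tensors.\<close>

lemma tensor_assoc:
  assumes M: "module K M" and N: "module K N" and P: "module K P"
  defines "NP \<equiv> tensor_module K N P"
  shows tensor_assoc_hom: "tensor_assoc K M N P \<in>
      module_hom K (tensor_module K (tensor_module K M N) P) (tensor_module K M NP)"
    and tensor_assoc_pure: "\<lbrakk>x \<in> carrier M; y \<in> carrier N; z \<in> carrier P\<rbrakk> \<Longrightarrow>
      tensor_assoc K M N P (pure_tensor K (tensor_module K M N) P (pure_tensor K M N x y) z)
      = pure_tensor K M NP x (pure_tensor K N P y z)"
proof -
  interpret MN: two_modules K M N using assms by (simp add: two_modules_def)
  interpret NP: two_modules K N P using assms by (simp add: two_modules_def)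
  interpret L: two_modules K MN.T P using assms MN.tensor_module by (simp add: two_modules_def)
  interpret R: two_modules K M NP unfolding NP_def using assms NP.tensor_module by (simp add: two_modules_def)
  let ?g = "\<lambda>z x y. R.pt x (NP.pt y z)"
  have g: "bilinear_map K M N R.T (?g z)" if z: "z \<in> carrier P" for z
    unfolding bilinear_map_def
  proof (intro conjI ballI)
    fix y assume "y \<in> carrier N"
    then have "NP.pt y z \<in> carrier NP" using z unfolding NP_def by (rule NP.pure_tensor_closed)
    then show "(\<lambda>x. R.pt x (NP.pt y z)) \<in> module_hom K M R.T"
      by (rule bilinear_mapD(1)[OF R.bilinear_pure_tensor])
  next
    fix x assume x: "x \<in> carrier M"
    have "(\<lambda>y. NP.pt y z) \<in> module_hom K N NP"
      unfolding NP_def using z by (rule bilinear_mapD(1)[OF NP.bilinear_pure_tensor])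
    then show "(\<lambda>y. R.pt x (NP.pt y z)) \<in> module_hom K N R.T"
      using bilinear_mapD(2)[OF R.bilinear_pure_tensor x] by (rule module_hom_comp)
  qed
  note lift = MN.tensor_lift[OF R.tensor_module g]
  let ?h = "\<lambda>t z. tensor_lift K R.T (?g z) t"
  have h: "bilinear_map K MN.T P R.T ?h"
    unfolding bilinear_map_def
  proof (intro conjI ballI)
    fix t assume t: "t \<in> carrier MN.T"
    interpret RT: module K R.T by (rule R.tensor_module)
    have gz: "NP.pt y \<in> module_hom K P NP" "R.pt x \<in> module_hom K NP R.T"
      if "y \<in> carrier N" "x \<in> carrier M" for x y
      unfolding NP_def
      by (rule bilinear_mapD(2)[OF NP.bilinear_pure_tensor that(1)],
          rule bilinear_mapD(2)[OF R.bilinear_pure_tensor that(2), unfolded NP_def])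
    note gz' = module_hom_comp[OF gz]
    show "?h t \<in> module_hom K P R.T"
    proof (rule module_homI)
      fix z z' assume z: "z \<in> carrier P" "z' \<in> carrier P"
      have zz: "z \<oplus>\<^bsub>P\<^esub> z' \<in> carrier P" using z by simp
      show "?h t (z \<oplus>\<^bsub>P\<^esub> z') = ?h t z \<oplus>\<^bsub>R.T\<^esub> ?h t z'"
      proof (rule MN.tensor_hom_eq[OF R.tensor_module lift(2)[OF zz] _ _ t])
        show "(\<lambda>t. ?h t z \<oplus>\<^bsub>R.T\<^esub> ?h t z') \<in> module_hom K MN.T R.T"
          by (intro module_hom_plus MN.tensor_module R.tensor_module lift z)
        fix x y assume "x \<in> carrier M" "y \<in> carrier N"
        then show "?h (MN.pt x y) (z \<oplus>\<^bsub>P\<^esub> z') = ?h (MN.pt x y) z \<oplus>\<^bsub>R.T\<^esub> ?h (MN.pt x y) z'"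
          using z zz lift(1) module_homD(2)[OF gz'] by auto
      qed
    next
      fix a z assume a: "a \<in> carrier K" and z: "z \<in> carrier P"
      have az: "a \<odot>\<^bsub>P\<^esub> z \<in> carrier P" using a z by simp
      show "?h t (a \<odot>\<^bsub>P\<^esub> z) = a \<odot>\<^bsub>R.T\<^esub> ?h t z"
      proof (rule MN.tensor_hom_eq[OF R.tensor_module lift(2)[OF az] _ _ t])
        show "(\<lambda>t. a \<odot>\<^bsub>R.T\<^esub> ?h t z) \<in> module_hom K MN.T R.T"
          by (intro module_hom_smult MN.tensor_module R.tensor_module lift z a)
        fix x y assume "x \<in> carrier M" "y \<in> carrier N"
        then show "?h (MN.pt x y) (a \<odot>\<^bsub>P\<^esub> z) = a \<odot>\<^bsub>R.T\<^esub> ?h (MN.pt x y) z"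
          using z a az lift(1) module_homD(3)[OF gz'] by auto
      qed
    qed (use module_homD(1)[OF lift(2)] t in auto)
  qed (use lift in auto)
  note * = L.tensor_lift[OF R.tensor_module h]
  have eq: "tensor_assoc K M N P = tensor_lift K R.T ?h"
    by (simp add: tensor_assoc_def NP_def Let_def)
  show "tensor_assoc K M N P \<in> module_hom K L.T R.T"
    unfolding eq by (rule *)
  show "tensor_assoc K M N P (L.pt (MN.pt x y) z) = R.pt x (NP.pt y z)"
    if "x \<in> carrier M" "y \<in> carrier N" "z \<in> carrier P"
    unfolding eq using that by (subst *) (auto simp: MN.pure_tensor_closed lift)
qed

lemma tensor_form:
  assumes "module K M" "module K N"
    and f: "f \<in> module_hom K M (regular_module K)" and g: "g \<in> module_hom K N (regular_module K)"
  shows tensor_form_hom: "tensor_form K f g \<in> module_hom K (tensor_module K M N) (regular_module K)"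
    and tensor_form_pure: "\<lbrakk>x \<in> carrier M; y \<in> carrier N\<rbrakk> \<Longrightarrow>
      tensor_form K f g (pure_tensor K M N x y) = f x \<otimes>\<^bsub>K\<^esub> g y"
proof -
  interpret A: two_modules K M N using assms by (simp add: two_modules_def)
  have "bilinear_map K M N (regular_module K) (\<lambda>x y. f x \<otimes>\<^bsub>K\<^esub> g y)"
    unfolding bilinear_map_def using module_homD[OF f] module_homD[OF g]
    by (auto intro!: module_homI simp: A.M.R.l_distr A.M.R.r_distr A.M.R.m_ac)
  note * = A.tensor_lift[OF regular_module_module[OF A.M.R.is_cring] this]
  show "tensor_form K f g \<in> module_hom K A.T (regular_module K)"
    unfolding tensor_form_def by (rule *)
  show "tensor_form K f g (A.pt x y) = f x \<otimes>\<^bsub>K\<^esub> g y" if "x \<in> carrier M" "y \<in> carrier N"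
    unfolding tensor_form_def using that by (rule *)
qed

section \<open>Direct sums\<close>

lemma dsum_simps:
  "carrier (dsum K M) = {f. (\<forall>d. f d \<in> carrier (M d)) \<and> finite {d. f d \<noteq> \<zero>\<^bsub>M d\<^esub>}}"
  "\<zero>\<^bsub>dsum K M\<^esub> = (\<lambda>d. \<zero>\<^bsub>M d\<^esub>)"
  "f \<oplus>\<^bsub>dsum K M\<^esub> g = (\<lambda>d. f d \<oplus>\<^bsub>M d\<^esub> g d)"
  "a \<odot>\<^bsub>dsum K M\<^esub> f = (\<lambda>d. a \<odot>\<^bsub>M d\<^esub> f d)"
  by (simp_all add: dsum_def)

lemma dsum_carrierI:
  assumes "\<And>d. f d \<in> carrier (M d)" "{d. f d \<noteq> \<zero>\<^bsub>M d\<^esub>} \<subseteq> A" "finite A"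
  shows "f \<in> carrier (dsum K M)"
  using assms finite_subset[OF assms(2,3)] by (auto simp: dsum_simps)

lemma dsum_carrierD:
  assumes "f \<in> carrier (dsum K M)"
  shows "f d \<in> carrier (M d)" "finite {d. f d \<noteq> \<zero>\<^bsub>M d\<^esub>}"
  using assms by (auto simp: dsum_simps)

locale graded_module = K: cring K for K :: "('k,'r) ring_scheme" (structure) and M :: "nat \<Rightarrow> ('k,'a,'s) module_scheme" +
  assumes component: "module K (M d)"
begin

abbreviation "D \<equiv> dsum K M"

lemma dsum_module: "module K D"
proof -
  interpret M: module K "M d" for d by (rule component)
  have ab: "abelian_group D"
  proof (rule abelian_groupI)
    fix f g assume fg: "f \<in> carrier D" "g \<in> carrier D"
    note fgD = dsum_carrierD[OF fg(1)] dsum_carrierD[OF fg(2)]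
    show "f \<oplus>\<^bsub>D\<^esub> g \<in> carrier D"
      unfolding dsum_simps(3)
      by (rule dsum_carrierI[of _ _ "{x. f x \<noteq> \<zero>\<^bsub>M x\<^esub>} \<union> {x. g x \<noteq> \<zero>\<^bsub>M x\<^esub>}"]) (use fgD in auto)
    show "f \<oplus>\<^bsub>D\<^esub> g = g \<oplus>\<^bsub>D\<^esub> f"
      unfolding dsum_simps(3) by (intro ext M.a_comm fgD)
    fix h assume h: "h \<in> carrier D"
    show "f \<oplus>\<^bsub>D\<^esub> g \<oplus>\<^bsub>D\<^esub> h = f \<oplus>\<^bsub>D\<^esub> (g \<oplus>\<^bsub>D\<^esub> h)"
      unfolding dsum_simps(3) by (intro ext M.a_assoc fgD dsum_carrierD(1)[OF h])
  next
    fix f assume f: "f \<in> carrier D"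
    have "(\<lambda>x. \<ominus>\<^bsub>M x\<^esub> f x) \<in> carrier D"
      by (rule dsum_carrierI[of _ _ "{x. f x \<noteq> \<zero>\<^bsub>M x\<^esub>}"]) (use dsum_carrierD[OF f] in auto)
    then show "\<exists>g\<in>carrier D. g \<oplus>\<^bsub>D\<^esub> f = \<zero>\<^bsub>D\<^esub>"
      by (rule bexI[rotated])
         (use dsum_carrierD(1)[OF f] in \<open>simp add: dsum_simps(2,3) M.l_neg\<close>)
    show "\<zero>\<^bsub>D\<^esub> \<oplus>\<^bsub>D\<^esub> f = f"
      using dsum_carrierD(1)[OF f] by (simp add: dsum_simps(2,3))
  qed (auto simp: dsum_simps(1,2))
  show ?thesis
  proof (rule moduleI[OF K.is_cring ab])
    fix a f assume a: "a \<in> carrier K" and f: "f \<in> carrier D"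
    show "a \<odot>\<^bsub>D\<^esub> f \<in> carrier D"
      unfolding dsum_simps(4)
      by (rule dsum_carrierI[of _ _ "{x. f x \<noteq> \<zero>\<^bsub>M x\<^esub>}"]) (use dsum_carrierD[OF f] a in auto)
  qed (auto simp: dsum_simps M.smult_l_distr M.smult_r_distr M.smult_assoc1)
qed

lemma dsum_in_support: "{e. dsum_in M d x e \<noteq> \<zero>\<^bsub>M e\<^esub>} \<subseteq> {d}"
  by (auto simp: dsum_in_def)

lemma dsum_in_closed:
  assumes "x \<in> carrier (M d)" shows "dsum_in M d x \<in> carrier D"
proof (rule dsum_carrierI[OF _ dsum_in_support])
  fix e
  interpret M: module K "M e" by (rule component)
  show "dsum_in M d x e \<in> carrier (M e)" using assms by (simp add: dsum_in_def)
qed simp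

lemma dsum_in_hom: "dsum_in M d \<in> module_hom K (M d) D"
proof -
  interpret M: module K "M d" for d by (rule component)
  show ?thesis
    by (rule module_homI[OF dsum_in_closed]) (auto simp: dsum_simps dsum_in_def fun_eq_iff)
qed

lemma dsum_proj_hom: "(\<lambda>z. z d) \<in> module_hom K D (M d)"
  by (rule module_homI) (auto simp: dsum_simps)

text \<open>Compared degree by degree: the projection to degree \<open>e\<close> is linear, and only
  the summand with index \<open>e\<close> can survive it.\<close>

lemma dsum_decompose:
  assumes "z \<in> carrier D" "finite A" "{d. z d \<noteq> \<zero>\<^bsub>M d\<^esub>} \<subseteq> A"
  shows "z = (\<Oplus>\<^bsub>D\<^esub>d\<in>A. dsum_in M d (z d))"
proof
  fix e
  interpret M: module K "M d" for d by (rule component)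
  note zc = dsum_carrierD(1)[OF assms(1)]
  have "(\<Oplus>\<^bsub>D\<^esub>d\<in>A. dsum_in M d (z d)) e = (\<Oplus>\<^bsub>M e\<^esub>d\<in>A. dsum_in M d (z d) e)"
    by (rule module_hom_finsum[OF dsum_proj_hom dsum_module component])
       (intro dsum_in_closed zc)
  also have "\<dots> = (\<Oplus>\<^bsub>M e\<^esub>d\<in>A. if e = d then z e else \<zero>\<^bsub>M e\<^esub>)"
    by (rule M.finsum_cong') (auto simp: dsum_in_def zc)
  also have "\<dots> = z e"
  proof (cases "e \<in> A")
    case True
    then show ?thesis using M.finsum_singleton[of e A "\<lambda>_. z e" e] assms(2) zc by auto
  next
    case False
    then have "(\<Oplus>\<^bsub>M e\<^esub>d\<in>A. if e = d then z e else \<zero>\<^bsub>M e\<^esub>) = \<zero>\<^bsub>M e\<^esub>"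
      by (intro M.add.finprod_one_eqI) auto
    moreover have "z e = \<zero>\<^bsub>M e\<^esub>" using False assms(3) by blast
    ultimately show ?thesis by simp
  qed
  finally show "z e = (\<Oplus>\<^bsub>D\<^esub>d\<in>A. dsum_in M d (z d)) e" ..
qed

lemma spans_dsum:
  assumes G: "\<And>d. spans K (M d) (G d)"
  shows "spans K D (\<Union>d. dsum_in M d ` G d)"
proof -
  interpret D: module K D by (rule dsum_module)
  let ?G = "\<Union>d. dsum_in M d ` G d"
  have sub: "?G \<subseteq> carrier D"
    using G dsum_in_closed by (fastforce simp: spans_def)
  note gen = D.submodule_generated_submodule[OF sub]
  have in_gen: "dsum_in M d x \<in> submodule_generated K D ?G" if "x \<in> carrier (M d)" for d x
    using component dsum_module G dsum_in_hom gen _ that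
  proof (rule spans_subset_submodule)
    fix s assume "s \<in> G d"
    then have "dsum_in M d s \<in> ?G" by blast
    then show "dsum_in M d s \<in> submodule_generated K D ?G"
      by (rule subsetD[OF submodule_generated_superset])
  qed
  have "z \<in> submodule_generated K D ?G" if z: "z \<in> carrier D" for z
  proof -
    have "(\<Oplus>\<^bsub>D\<^esub>d\<in>A. dsum_in M d (z d)) \<in> submodule_generated K D ?G" if "finite A" for A
      using that
    proof induction
      case empty
      then show ?case using subgroup.one_closed[OF submodule.axioms(1)[OF gen]] by simp
    next
      case (insert d A)
      then show ?case
        using D.submoduleE(5)[OF gen in_gen[OF dsum_carrierD(1)[OF z]] insert.IH]
          dsum_in_closed[OF dsum_carrierD(1)[OF z]] by (simp add: Pi_def)
    qed
    from this[OF dsum_carrierD(2)[OF z]] show ?thesis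
      by (subst dsum_decompose[OF z dsum_carrierD(2)[OF z] subset_refl])
  qed
  then have "carrier D \<subseteq> submodule_generated K D ?G" by (rule subsetI)
  with sub show ?thesis unfolding spans_def by (rule conjI)
qed

text \<open>Serves additivity in the same way as \<open>free_lift_superset\<close>: degrees outside
  the support contribute zero, because each \<open>h d\<close> is linear.\<close>

lemma dsum_lift_superset:
  assumes P: "module K P" and h: "\<And>d. h d \<in> module_hom K (M d) P"
    and z: "z \<in> carrier D" and A: "finite A" "{d. z d \<noteq> \<zero>\<^bsub>M d\<^esub>} \<subseteq> A"
  shows "dsum_lift M P h z = (\<Oplus>\<^bsub>P\<^esub>d\<in>A. h d (z d))"
proof -
  interpret P: module K P by fact
  show ?thesis unfolding dsum_lift_def
    using A module_homD(1)[OF h] dsum_carrierD(1)[OF z] module_hom_zero[OF h component P]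
    by (intro P.add.finprod_mono_neutral_cong_left) auto
qed

lemma dsum_lift:
  assumes P: "module K P" and h: "\<And>d. h d \<in> module_hom K (M d) P"
  shows dsum_lift_in: "x \<in> carrier (M d) \<Longrightarrow> dsum_lift M P h (dsum_in M d x) = h d x"
    and dsum_lift_hom: "dsum_lift M P h \<in> module_hom K D P"
proof -
  interpret P: module K P by fact
  interpret D: module K D by (rule dsum_module)
  note hc = module_homD(1)[OF h]
  show "dsum_lift M P h (dsum_in M d x) = h d x" if x: "x \<in> carrier (M d)"
    using dsum_lift_superset[OF P h dsum_in_closed[OF x] _ dsum_in_support] hc[OF x]
    by (simp add: dsum_in_def)
  show "dsum_lift M P h \<in> module_hom K D P"
  proof (rule module_homI)
    fix f assume f: "f \<in> carrier D"
    note fD = dsum_carrierD[OF f]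
    show "dsum_lift M P h f \<in> carrier P"
      unfolding dsum_lift_def using hc fD by (intro P.finsum_closed) auto
    fix g assume g: "g \<in> carrier D"
    note gD = dsum_carrierD[OF g]
    let ?A = "{d. f d \<noteq> \<zero>\<^bsub>M d\<^esub>} \<union> {d. g d \<noteq> \<zero>\<^bsub>M d\<^esub>}"
    interpret M: module K "M d" for d by (rule component)
    have A: "finite ?A" "{d. f d \<noteq> \<zero>\<^bsub>M d\<^esub>} \<subseteq> ?A" "{d. g d \<noteq> \<zero>\<^bsub>M d\<^esub>} \<subseteq> ?A"
      "{d. (f \<oplus>\<^bsub>D\<^esub> g) d \<noteq> \<zero>\<^bsub>M d\<^esub>} \<subseteq> ?A"
      using fD gD by (auto simp: dsum_simps(3))
    have "dsum_lift M P h (f \<oplus>\<^bsub>D\<^esub> g) = (\<Oplus>\<^bsub>P\<^esub>d\<in>?A. h d ((f \<oplus>\<^bsub>D\<^esub> g) d))"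
      by (rule dsum_lift_superset[OF P h D.a_closed[OF f g] A(1,4)])
    also have "\<dots> = (\<Oplus>\<^bsub>P\<^esub>d\<in>?A. h d (f d) \<oplus>\<^bsub>P\<^esub> h d (g d))"
      using fD gD hc by (intro P.finsum_cong') (auto simp: dsum_simps(3) module_homD(2)[OF h])
    also have "\<dots> = (\<Oplus>\<^bsub>P\<^esub>d\<in>?A. h d (f d)) \<oplus>\<^bsub>P\<^esub> (\<Oplus>\<^bsub>P\<^esub>d\<in>?A. h d (g d))"
      using fD gD hc by (intro P.finsum_addf) auto
    also have "\<dots> = dsum_lift M P h f \<oplus>\<^bsub>P\<^esub> dsum_lift M P h g"
      using dsum_lift_superset[OF P h f A(1,2)] dsum_lift_superset[OF P h g A(1,3)] by simp
    finally show "dsum_lift M P h (f \<oplus>\<^bsub>D\<^esub> g) = dsum_lift M P h f \<oplus>\<^bsub>P\<^esub> dsum_lift M P h g" .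
  next
    fix a f assume a: "a \<in> carrier K" and f: "f \<in> carrier D"
    note fD = dsum_carrierD[OF f]
    interpret M: module K "M d" for d by (rule component)
    have A: "{d. (a \<odot>\<^bsub>D\<^esub> f) d \<noteq> \<zero>\<^bsub>M d\<^esub>} \<subseteq> {d. f d \<noteq> \<zero>\<^bsub>M d\<^esub>}"
      using a by (auto simp: dsum_simps(4))
    have "dsum_lift M P h (a \<odot>\<^bsub>D\<^esub> f) = (\<Oplus>\<^bsub>P\<^esub>d\<in>{d. f d \<noteq> \<zero>\<^bsub>M d\<^esub>}. h d ((a \<odot>\<^bsub>D\<^esub> f) d))"
      by (rule dsum_lift_superset[OF P h D.smult_closed[OF a f] fD(2) A])
    also have "\<dots> = (\<Oplus>\<^bsub>P\<^esub>d\<in>{d. f d \<noteq> \<zero>\<^bsub>M d\<^esub>}. a \<odot>\<^bsub>P\<^esub> h d (f d))"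
      using fD hc a by (intro P.finsum_cong') (auto simp: dsum_simps(4) module_homD(3)[OF h])
    also have "\<dots> = a \<odot>\<^bsub>P\<^esub> dsum_lift M P h f"
      unfolding dsum_lift_def using fD hc a by (intro P.finsum_smult_ldistr[symmetric]) auto
    finally show "dsum_lift M P h (a \<odot>\<^bsub>D\<^esub> f) = a \<odot>\<^bsub>P\<^esub> dsum_lift M P h f" .
  qed
qed

end

section \<open>Three-cycles and the triviality of squares\<close>

text \<open>A cycle only for three distinct arguments; with repetitions it need not be injective, so
  the lemmas carry the distinctness along.\<close>

definition cyc :: "'a \<Rightarrow> 'a \<Rightarrow> 'a \<Rightarrow> 'a \<Rightarrow> 'a"
  where "cyc a b c x = (if x = a then b else if x = b then c else if x = c then a else x)"

locale perm_group =
  fixes P :: "('a \<Rightarrow> 'a) set"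
  assumes id_mem: "id \<in> P"
    and comp_mem: "\<lbrakk>g \<in> P; h \<in> P\<rbrakk> \<Longrightarrow> g \<circ> h \<in> P"
    and inv_mem: "g \<in> P \<Longrightarrow> inv' g \<in> P"
    and bij_mem: "g \<in> P \<Longrightarrow> bij g"
begin

text \<open>The relation is meant to be an equivalence on whose classes the group contains every
  three-cycle; \<open>linked_sym\<close>, \<open>linked_trans\<close> and
  \<open>cyc_of_linked\<close> establish this. The third point \<open>c\<close> is arbitrary, which
  makes the relation easy to produce from a single cycle.\<close>

definition linked :: "'a \<Rightarrow> 'a \<Rightarrow> bool"
  where "linked a b \<longleftrightarrow> a = b \<or> (\<exists>c. c \<noteq> a \<and> c \<noteq> b \<and> cyc a b c \<in> P)"

lemma cyc_rotate: "\<lbrakk>a \<noteq> b; b \<noteq> c; c \<noteq> a\<rbrakk> \<Longrightarrow> cyc b c a = cyc a b c"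
  by (auto simp: cyc_def fun_eq_iff)

lemma cyc_reverse:
  assumes "cyc a b c \<in> P" "a \<noteq> b" "b \<noteq> c" "c \<noteq> a" shows "cyc b a c \<in> P"
proof -
  have "inv' (cyc a b c) = cyc b a c"
    using assms by (intro inv_unique_comp) (auto simp: cyc_def fun_eq_iff)
  then show ?thesis using inv_mem[OF assms(1)] by simp
qed

lemma cyc_conj_eq:
  assumes "bij g" shows "g \<circ> cyc a b c \<circ> inv' g = cyc (g a) (g b) (g c)"
proof
  fix x
  obtain y where y: "x = g y" using assms by (metis bij_pointE)
  have "inj g" using assms by (rule bij_is_inj)
  then show "(g \<circ> cyc a b c \<circ> inv' g) x = cyc (g a) (g b) (g c) x"
    by (auto simp: y cyc_def inj_eq)
qed

lemma cyc_conj: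
  assumes "cyc a b c \<in> P" "g \<in> P" shows "cyc (g a) (g b) (g c) \<in> P"
  using cyc_conj_eq[OF bij_mem[OF assms(2)], of a b c] comp_mem[OF comp_mem[OF assms(2,1)] inv_mem[OF assms(2)]]
  by simp

lemma linked_sym: "linked a b \<Longrightarrow> linked b a"
  unfolding linked_def using cyc_reverse by metis

text \<open>Conjugating the cycle on \<open>a, b, c\<close> by the cycle on \<open>b, e, f\<close>
  keeps \<open>a\<close> and turns \<open>b\<close> into \<open>e\<close>, unless
  \<open>a = f\<close>; in that case the second cycle already passes through \<open>a\<close> and
  \<open>e\<close>.\<close>

lemma linked_trans:
  assumes "linked a b" "linked b e" shows "linked a e"
proof (cases "a = b \<or> b = e \<or> a = e")
  case False
  then obtain c f where c: "c \<noteq> a" "c \<noteq> b" "cyc a b c \<in> P" and f: "f \<noteq> b" "f \<noteq> e" "cyc b e f \<in> P"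
    using assms unfolding linked_def by blast
  show ?thesis
  proof (cases "a = f")
    case True
    then have "cyc e a b \<in> P" using f False cyc_rotate[of b e a] by simp
    then have "linked e a" unfolding linked_def using False by blast
    then show ?thesis by (rule linked_sym)
  next
    case True': False
    have "cyc (cyc b e f a) (cyc b e f b) (cyc b e f c) \<in> P" by (rule cyc_conj[OF c(3) f(3)])
    then have *: "cyc a e (cyc b e f c) \<in> P" using False True' by (auto simp: cyc_def)
    have "inj (cyc b e f)" using bij_mem[OF f(3)] by (rule bij_is_inj)
    moreover have "cyc b e f a = a" "cyc b e f b = e" using False True' by (auto simp: cyc_def)
    ultimately have "cyc b e f c \<noteq> a" "cyc b e f c \<noteq> e" using c by (metis injD)+
    with * show ?thesis unfolding linked_def by blast
  qed
qed (use assms linked_def in metis)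

text \<open>Let \<open>x\<close> and \<open>y\<close> be the third points of cycles through
  \<open>a, b\<close> and through \<open>b, c\<close>. If neither cycle is the wanted one, conjugate
  the first by the second. For \<open>x = y\<close> this gives the inverse of the wanted cycle.
  Otherwise it gives \<open>cyc a c x\<close>, and conjugating \<open>cyc a b x\<close> by that one
  yields \<open>cyc c b a\<close>, again the inverse.\<close>

lemma cyc_of_linked:
  assumes "linked a b" "linked b c" "a \<noteq> b" "b \<noteq> c" "c \<noteq> a"
  shows "cyc a b c \<in> P"
proof -
  obtain x where x: "x \<noteq> a" "x \<noteq> b" "cyc a b x \<in> P" using assms by (auto simp: linked_def)
  obtain y where y: "y \<noteq> b" "y \<noteq> c" "cyc b c y \<in> P" using assms by (auto simp: linked_def)
  consider "x = c" | "y = a" | "x \<noteq> c" "y \<noteq> a" "x = y" | "x \<noteq> c" "y \<noteq> a" "x \<noteq> y" by blast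
  then show ?thesis
  proof cases
    case 1 then show ?thesis using x by simp
  next
    case 2 then show ?thesis using y cyc_rotate[of a b c] assms by simp
  next
    case 3
    then have "cyc a c b \<in> P" using cyc_conj[OF x(3) y(3)] assms x y by (auto simp: cyc_def)
    then show ?thesis using cyc_reverse[of a c b] cyc_rotate[of c a b] cyc_rotate[of a b c] assms by auto
  next
    case 4
    then have "cyc a c x \<in> P" using cyc_conj[OF x(3) y(3)] assms x y by (auto simp: cyc_def)
    then have "cyc c b a \<in> P" using cyc_conj[OF x(3)] 4 assms x y by (force simp: cyc_def)
    then show ?thesis using cyc_reverse[of c b a] cyc_rotate[of a b c] assms by auto
  qed
qed

text \<open>
  Composing with a three-cycle on consecutive points of an orbit shrinks the support, until an
  involution is left.
\<close>

lemma exists_involution: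
  assumes "finite {x. g x \<noteq> x}" "bij g" "\<And>x. linked x (g x)"
  shows "\<exists>k\<in>P. (k \<circ> g) \<circ> (k \<circ> g) = id"
  using assms
proof (induction "card {x. g x \<noteq> x}" arbitrary: g rule: less_induct)
  case less
  note g = less.prems
  have inj: "g x = g y \<longleftrightarrow> x = y" for x y using bij_is_inj[OF g(2)] by (rule inj_eq)
  show ?case
  proof (cases "\<forall>a. g (g a) = a")
    case True
    then show ?thesis using id_mem by (intro bexI[of _ id]) (auto simp: fun_eq_iff)
  next
    case False
    then obtain a where a: "g (g a) \<noteq> a" by auto
    define b c where "b = g a" and "c = g b"
    have "g a \<noteq> a" using a by auto
    then have ab: "a \<noteq> b" by (simp add: b_def)
    then have "g b \<noteq> g a" using inj by simp
    then have bc: "b \<noteq> c" by (simp add: b_def c_def)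
    then have "g c \<noteq> g b" using inj by simp
    then have gc: "g c \<noteq> c" by (simp add: c_def)
    have "c \<noteq> a" using a by (simp add: b_def c_def)
    note d = ab bc this
    have l: "linked a b" "linked b c" unfolding b_def c_def by (rule g(3))+
    have "cyc a b c \<in> P" by (rule cyc_of_linked[OF l d])
    then have t: "cyc b a c \<in> P" using d by (rule cyc_reverse)
    \<comment> \<open>\<open>?t\<close> sends \<open>b = g a\<close> back to \<open>a\<close>, so
      \<open>a\<close> becomes a fixed point. No new point is moved, because \<open>a\<close>,
      \<open>b\<close> and \<open>c\<close> are all moved by \<open>g\<close> already.\<close>
    let ?t = "cyc b a c" let ?h = "?t \<circ> g"
    have lt: "linked y (?t y)" for y
    proof -
      have "linked b a" by (rule linked_sym[OF l(1)])
      moreover have "linked a c" by (rule linked_trans[OF l])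
      moreover have "linked c b" by (rule linked_sym[OF l(2)])
      moreover have "linked y y" by (simp add: linked_def)
      ultimately show ?thesis by (simp add: cyc_def)
    qed
    have ga: "g a = b" "g b = c" by (simp_all add: b_def c_def)
    have "?h a = a" by (simp add: cyc_def ga)
    moreover have "?h x = x" if "g x = x" for x
    proof -
      have "x \<noteq> a" "x \<noteq> b" "x \<noteq> c" using that ga d gc by auto
      then show ?thesis using that by (simp add: cyc_def)
    qed
    ultimately have sub: "{x. ?h x \<noteq> x} \<subseteq> {x. g x \<noteq> x} - {a}" by blast
    moreover have "a \<in> {x. g x \<noteq> x}" using d ga by simp
    ultimately have "card {x. ?h x \<noteq> x} < card {x. g x \<noteq> x}"
      using g(1) by (intro psubset_card_mono) auto
    moreover have "finite {x. ?h x \<noteq> x}" using finite_subset[OF sub] g(1) by simp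
    moreover have "bij ?h" using bij_mem[OF t] g(2) bij_comp by blast
    moreover have "linked x (?h x)" for x
      using linked_trans[OF g(3) lt, of x] by simp
    ultimately obtain k where "k \<in> P" "(k \<circ> ?h) \<circ> (k \<circ> ?h) = id" using less.hyps by meson
    then show ?thesis using comp_mem[OF _ t] by (intro bexI[of _ "k \<circ> ?t"]) (auto simp: o_assoc)
  qed
qed

end

section \<open>Shifts of permutations and the common kernel of the characters\<close>

lemma omega_funpow:
  assumes "\<sigma> 0 = 0"
  shows "(omega ^^ p) \<sigma> t = (if t \<le> p then t else \<sigma> (t - p) + p)"
proof (induction p arbitrary: t)
  case (Suc p)
  then show ?case by (cases t) (auto simp: omega_def)
qed (use assms in auto)

lemma omega_funpow_cyc:
  assumes "a > 0" "b > 0" "c > 0"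
  shows "(omega ^^ i) (cyc a b c) = cyc (a + i) (b + i) (c + i)"
  using assms by (auto simp: omega_funpow cyc_def fun_eq_iff)

locale omega_chars = K: cring K for K :: "('k,'r) ring_scheme" (structure) +
  fixes W :: "nat \<Rightarrow> (nat \<Rightarrow> nat) set" and \<chi> :: "nat \<Rightarrow> (nat \<Rightarrow> nat) \<Rightarrow> 'k"
  assumes inv: "omega_invariant K W \<chi>"
begin

lemma W_subgroup: "subgroup (W d) (sym_group d)"
  using inv by (auto simp: omega_invariant_def)

lemma W_permutes: "\<sigma> \<in> W d \<Longrightarrow> \<sigma> permutes {1..d}"
  using subgroup.subset[OF W_subgroup, of d] sym_group_carrier by blast

lemma W_bij: "\<sigma> \<in> W d \<Longrightarrow> bij \<sigma>"
  using W_permutes permutes_bij by blast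

lemma W_support_finite: "\<sigma> \<in> W d \<Longrightarrow> finite {x. \<sigma> x \<noteq> x}"
proof (rule finite_subset[OF _ finite_atLeastAtMost[of 1 d]])
  assume "\<sigma> \<in> W d"
  then show "{x. \<sigma> x \<noteq> x} \<subseteq> {1..d}"
    using permutes_not_in[OF W_permutes] by blast
qed

lemma W_zero: "\<sigma> \<in> W d \<Longrightarrow> \<sigma> 0 = 0"
  using W_permutes by (auto simp: permutes_def)

lemma W_id: "id \<in> W d"
  using subgroup.one_closed[OF W_subgroup] by (simp add: sym_group_one)

lemma W_comp: "\<lbrakk>\<sigma> \<in> W d; \<tau> \<in> W d\<rbrakk> \<Longrightarrow> \<sigma> \<circ> \<tau> \<in> W d"
  using subgroup.m_closed[OF W_subgroup] by (simp add: sym_group_mult)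

lemma W_inv: "\<sigma> \<in> W d \<Longrightarrow> inv' \<sigma> \<in> W d"
  using subgroup.m_inv_closed[OF W_subgroup] subgroup.subset[OF W_subgroup] sym_group_inv_equality
  by (metis subsetD)

lemma W_finite: "finite (W d)"
  using W_permutes finite_permutations[of "{1..d}"] by (rule_tac finite_subset) auto

lemma chi_Units: "\<sigma> \<in> W d \<Longrightarrow> \<chi> d \<sigma> \<in> Units K"
  using inv by (auto simp: omega_invariant_def hom_def units_of_def)

lemma chi_closed: "\<sigma> \<in> W d \<Longrightarrow> \<chi> d \<sigma> \<in> carrier K"
  using chi_Units by auto

lemma chi_comp: "\<lbrakk>\<sigma> \<in> W d; \<tau> \<in> W d\<rbrakk> \<Longrightarrow> \<chi> d (\<sigma> \<circ> \<tau>) = \<chi> d \<sigma> \<otimes> \<chi> d \<tau>"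
  using inv by (auto simp: omega_invariant_def hom_def units_of_def sym_group_mult)

lemma chi_id: "\<chi> d id = \<one>"
proof -
  have "\<chi> d id \<otimes> \<chi> d id = \<chi> d id" using chi_comp[of id d id] W_id by simp
  then show ?thesis using chi_Units[OF W_id, of d]
    by (metis K.Units_closed K.Units_l_cancel K.one_closed K.r_one)
qed

lemma chi_inv: "\<sigma> \<in> W d \<Longrightarrow> \<chi> d (inv' \<sigma>) = inv\<^bsub>K\<^esub> (\<chi> d \<sigma>)"
proof -
  assume s: "\<sigma> \<in> W d"
  have "\<sigma> \<circ> inv' \<sigma> = id" using W_permutes[OF s] permutes_inv_o(1) by blast
  then have "\<chi> d \<sigma> \<otimes> \<chi> d (inv' \<sigma>) = \<one>"
    using chi_comp[OF s W_inv[OF s]] chi_id by simp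
  then show ?thesis using K.comm_inv_char chi_closed s W_inv by metis
qed

lemma W_Suc: "\<sigma> \<in> W d \<Longrightarrow> \<sigma> \<in> W (Suc d)" "\<sigma> \<in> W d \<Longrightarrow> \<chi> (Suc d) \<sigma> = \<chi> d \<sigma>"
  "\<sigma> \<in> W d \<Longrightarrow> omega \<sigma> \<in> W (Suc d)" "\<sigma> \<in> W d \<Longrightarrow> \<chi> (Suc d) (omega \<sigma>) = \<chi> d \<sigma>"
  using inv by (auto simp: omega_invariant_def)

lemma W_mono:
  assumes "\<sigma> \<in> W d" "d \<le> e" shows "\<sigma> \<in> W e \<and> \<chi> e \<sigma> = \<chi> d \<sigma>"
  using assms(2) by (induction rule: dec_induct) (use assms(1) W_Suc in auto)

lemma W_omega: "\<sigma> \<in> W d \<Longrightarrow> (omega ^^ k) \<sigma> \<in> W (d + k) \<and> \<chi> (d + k) ((omega ^^ k) \<sigma>) = \<chi> d \<sigma>"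
  by (induction k) (auto simp: W_Suc)

text \<open>The union of the kernels of all the characters. By \<open>W_mono\<close> the value on
  \<open>g\<close> does not depend on \<open>n\<close>, so that two members can be compared inside a
  common group \<open>W n\<close>.\<close>

definition Ker where "Ker = {g. \<exists>n. g \<in> W n \<and> \<chi> n g = \<one>}"

lemma Ker_perm_group: "perm_group Ker"
proof
  show "id \<in> Ker" using W_id chi_id by (auto simp: Ker_def)
  show "g \<circ> h \<in> Ker" if "g \<in> Ker" "h \<in> Ker" for g h
  proof -
    obtain m n where "g \<in> W m" "\<chi> m g = \<one>" "h \<in> W n" "\<chi> n h = \<one>"
      using \<open>g \<in> Ker\<close> \<open>h \<in> Ker\<close> unfolding Ker_def by blast
    then have "g \<in> W (max m n)" "\<chi> (max m n) g = \<one>" "h \<in> W (max m n)" "\<chi> (max m n) h = \<one>"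
      using W_mono[of g m "max m n"] W_mono[of h n "max m n"] by auto
    then show ?thesis unfolding Ker_def using W_comp chi_comp by (auto intro!: exI[of _ "max m n"])
  qed
  show "inv' g \<in> Ker" if "g \<in> Ker" for g
    using that W_inv chi_inv unfolding Ker_def by force
  show "bij g" if "g \<in> Ker" for g using that W_bij by (auto simp: Ker_def)
qed

sublocale Ker: perm_group Ker by (rule Ker_perm_group)

text \<open>The values of the character commute, so conjugation by any \<open>\<sigma>\<close>
  leaves the value of \<open>g\<close> unchanged once both lie in a common group.\<close>

lemma Ker_conj:
  assumes "g \<in> Ker" "\<sigma> \<in> W d" shows "\<sigma> \<circ> g \<circ> inv' \<sigma> \<in> Ker"
proof -
  obtain m where m: "g \<in> W m" "\<chi> m g = \<one>" using assms by (auto simp: Ker_def)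
  let ?n = "max m d"
  have g: "g \<in> W ?n" "\<chi> ?n g = \<one>" using W_mono[OF m(1), of ?n] m(2) by auto
  have s: "\<sigma> \<in> W ?n" using W_mono[OF assms(2), of ?n] by auto
  have "\<chi> ?n (\<sigma> \<circ> g \<circ> inv' \<sigma>) = \<chi> ?n \<sigma> \<otimes> inv\<^bsub>K\<^esub> (\<chi> ?n \<sigma>)"
    using g s by (simp add: chi_comp W_comp W_inv chi_inv chi_closed)
  also have "\<dots> = \<one>" using chi_Units[OF s] by simp
  finally have "\<chi> ?n (\<sigma> \<circ> g \<circ> inv' \<sigma>) = \<one>" .
  moreover have "\<sigma> \<circ> g \<circ> inv' \<sigma> \<in> W ?n" by (intro W_comp W_inv s g)
  ultimately show ?thesis unfolding Ker_def by blast
qed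

lemma linked_conj:
  assumes "Ker.linked a b" "\<sigma> \<in> W d" shows "Ker.linked (\<sigma> a) (\<sigma> b)"
proof -
  have "bij \<sigma>" using assms(2) by (rule W_bij)
  then show ?thesis
    using assms Ker_conj[OF _ assms(2)] Ker.cyc_conj_eq[of \<sigma>] bij_is_inj[of \<sigma>]
    unfolding Ker.linked_def by (metis injD)
qed

text \<open>The supports of \<open>\<sigma>\<close> and of its shift by \<open>M - m\<close>, where \<open>m\<close> and \<open>M\<close> are the extreme points of the
  support of \<open>\<sigma>\<close>, meet only in \<open>M\<close>, hence their commutator is a three-cycle.\<close>

lemma commutator_cyc:
  assumes s: "\<sigma> \<in> W d" and M: "\<sigma> M \<noteq> M" "\<And>x. \<sigma> x \<noteq> x \<Longrightarrow> x \<le> M"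
    and m: "\<sigma> m \<noteq> m" "\<And>x. \<sigma> x \<noteq> x \<Longrightarrow> m \<le> x"
  defines "\<tau> \<equiv> (omega ^^ (M - m)) \<sigma>"
  shows "cyc M (\<sigma> M) (\<tau> M) \<in> Ker" "\<tau> M > M" "\<sigma> M < M"
proof -
  have inj: "inj \<sigma>" using W_bij[OF s] by (rule bij_is_inj)
  have le: "m \<le> M" using M m by blast
  have ts: "\<tau> x = (if x \<le> M - m then x else \<sigma> (x - (M - m)) + (M - m))" for x
    unfolding \<tau>_def using W_zero[OF s] by (rule omega_funpow)
  have t: "\<tau> \<in> W (d + (M - m))" using W_omega[OF s, of "M - m"] by (simp add: \<tau>_def)
  have s': "\<sigma> \<in> W (d + (M - m))" using W_mono[OF s, of "d + (M - m)"] by simp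
  have injt: "inj \<tau>" using W_bij[OF t] by (rule bij_is_inj)
  have supp_s: "\<sigma> x = x" if "x > M \<or> x < m" for x using that M(2)[of x] m(2)[of x] by linarith
  have m0: "m > 0" using m W_zero[OF s] by (metis gr0I)
  have supp_t: "\<tau> x = x" if "x < M" for x
  proof (cases "x \<le> M - m")
    case False
    then have "x - (M - m) < m" using that le by linarith
    then show ?thesis using False supp_s by (simp add: ts)
  qed (simp add: ts)
  have "\<sigma> (\<sigma> M) \<noteq> \<sigma> M" using M(1) inj by (metis injD)
  then show sM: "\<sigma> M < M" using M by (metis le_neq_implies_less)
  have tM': "\<tau> M \<noteq> M" using le m0 m(1) by (auto simp: ts)
  have "\<tau> (\<tau> M) \<noteq> \<tau> M" using tM' injt by (metis injD)
  then show tM: "\<tau> M > M" using supp_t tM' by (metis linorder_neqE_nat)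
  let ?k = "\<sigma> \<circ> \<tau> \<circ> inv' \<sigma> \<circ> inv' \<tau>"
  \<comment> \<open>The commutator identity in a form without inverses. Only three points feel both
    permutations: \<open>M\<close>, the point that \<open>\<sigma>\<close> sends to
    \<open>M\<close>, and the point that \<open>\<tau>\<close> sends to \<open>M\<close>. At every
    other point the two products agree and their common value is fixed by the cycle.\<close>
  have c: "\<sigma> (\<tau> x) = cyc M (\<sigma> M) (\<tau> M) (\<tau> (\<sigma> x))" for x
  proof -
    consider "x = M" | "x < M" "\<sigma> x = M" | "x < M" "\<sigma> x \<noteq> M" | "x > M" by linarith
    then show ?thesis
    proof cases
      case 1
      then show ?thesis using supp_t[OF sM] supp_s tM sM by (auto simp: cyc_def)
    next
      case 2
      then show ?thesis using supp_t tM sM by (auto simp: cyc_def)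
    next
      case 3
      have "\<sigma> x \<le> M"
      proof (cases "\<sigma> x = x")
        case False
        then have "\<sigma> (\<sigma> x) \<noteq> \<sigma> x" using inj by (metis injD)
        then show ?thesis using M(2) by blast
      qed (use 3 in simp)
      then have "\<sigma> x < M" using 3 by simp
      moreover have "\<sigma> x \<noteq> \<sigma> M" using 3 inj by (metis injD less_irrefl)
      ultimately show ?thesis using supp_t 3 tM by (auto simp: cyc_def)
    next
      case 4
      then have sx: "\<sigma> x = x" using supp_s by simp
      have "\<tau> x \<noteq> \<tau> M" using 4 injt by (metis injD less_irrefl)
      have ge: "\<tau> x \<ge> M"
      proof (rule ccontr)
        assume "\<not> \<tau> x \<ge> M"
        then have "\<tau> (\<tau> x) = \<tau> x" using supp_t by simp
        then have "\<tau> x = x" using injt by (metis injD)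
        then show False using 4 \<open>\<not> \<tau> x \<ge> M\<close> by simp
      qed
      show ?thesis
      proof (cases "\<tau> x = M")
        case True then show ?thesis using sx by (simp add: cyc_def)
      next
        case False
        then have "\<tau> x > M" using ge by simp
        then show ?thesis using sx \<open>\<tau> x \<noteq> \<tau> M\<close> sM supp_s by (auto simp: cyc_def)
      qed
    qed
  qed
  have "?k = cyc M (\<sigma> M) (\<tau> M)"
  proof
    fix y
    have "\<tau> (\<sigma> (inv' \<sigma> (inv' \<tau> y))) = y"
      using W_bij[OF s] W_bij[OF t] by (metis bij_inv_eq_iff)
    then show "?k y = cyc M (\<sigma> M) (\<tau> M) y" using c[of "inv' \<sigma> (inv' \<tau> y)"] by simp
  qed
  moreover have "\<chi> (d + (M - m)) ?k = \<one>"
  proof -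
    let ?n = "d + (M - m)"
    have "\<chi> ?n ?k = \<chi> ?n \<sigma> \<otimes> \<chi> ?n \<tau> \<otimes> inv\<^bsub>K\<^esub> \<chi> ?n \<sigma> \<otimes> inv\<^bsub>K\<^esub> \<chi> ?n \<tau>"
      using s' t by (simp add: chi_comp W_comp W_inv chi_inv)
    also have "\<chi> ?n \<tau> = \<chi> ?n \<sigma>" using W_omega[OF s, of "M - m"] W_mono[OF s, of ?n] by (simp add: \<tau>_def)
    finally have "\<chi> ?n ?k = \<chi> ?n \<sigma> \<otimes> \<chi> ?n \<sigma> \<otimes> inv\<^bsub>K\<^esub> \<chi> ?n \<sigma> \<otimes> inv\<^bsub>K\<^esub> \<chi> ?n \<sigma>" .
    moreover have "\<chi> ?n \<sigma> \<otimes> \<chi> ?n \<sigma> \<otimes> inv\<^bsub>K\<^esub> \<chi> ?n \<sigma> = \<chi> ?n \<sigma>"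
      using chi_Units[OF s'] by (simp add: K.m_assoc K.Units_closed)
    ultimately show ?thesis using K.Units_r_inv[OF chi_Units[OF s']] by (simp only:)
  qed
  moreover have "?k \<in> W (d + (M - m))" using s' t by (intro W_comp W_inv)
  ultimately show "cyc M (\<sigma> M) (\<tau> M) \<in> Ker" by (auto simp: Ker_def)
qed

lemma Ker_omega: "g \<in> Ker \<Longrightarrow> (omega ^^ k) g \<in> Ker"
  using W_omega unfolding Ker_def by force

text \<open>The three-cycle found in the kernel links \<open>M\<close> with
  \<open>\<sigma> M\<close>. Its shifts link \<open>a\<close> with \<open>a + r\<close> for all
  \<open>a \<ge> M\<close>, where \<open>r = M - \<sigma> M\<close>. Climbing this ladder leads to
  points fixed by the shifted permutation, and through such a point each \<open>a\<close> is linked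
  to its image. Then \<open>exists_involution\<close> applies, and the kernel element it supplies
  does not change the character.\<close>

theorem chi_square:
  assumes s: "\<sigma> \<in> W d" shows "\<chi> d \<sigma> \<otimes> \<chi> d \<sigma> = \<one>"
proof (cases "\<sigma> = id")
  case False
  have fin: "finite {x. \<sigma> x \<noteq> x}"
    by (rule W_support_finite[OF s])
  define M m where "M = Max {x. \<sigma> x \<noteq> x}" and "m = Min {x. \<sigma> x \<noteq> x}"
  have ne: "{x. \<sigma> x \<noteq> x} \<noteq> {}" using False by (auto simp: fun_eq_iff)
  have M: "\<sigma> M \<noteq> M" "\<And>x. \<sigma> x \<noteq> x \<Longrightarrow> x \<le> M"
    using Max_in[OF fin ne] Max_ge[OF fin] by (auto simp: M_def)
  have m: "\<sigma> m \<noteq> m" "\<And>x. \<sigma> x \<noteq> x \<Longrightarrow> m \<le> x"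
    using Min_in[OF fin ne] Min_le[OF fin] by (auto simp: m_def)
  define \<tau> where "\<tau> = (omega ^^ (M - m)) \<sigma>"
  note k = commutator_cyc[OF s M m, folded \<tau>_def]
  \<comment> \<open>\<open>omega_funpow_cyc\<close> needs positive entries: the shift of a
    three-cycle is a shift of its entries only if \<open>0\<close> is not among them.\<close>
  have "\<sigma> M \<noteq> \<sigma> 0" using W_zero[OF s] inj_eq[OF bij_is_inj[OF W_bij[OF s]], of M 0] M(1) by auto
  then have pos: "\<sigma> M > 0" using W_zero[OF s] by simp
  define r where "r = M - \<sigma> M"
  have r: "r > 0" "M = \<sigma> M + r" using k(3) by (auto simp: r_def)
  have step: "Ker.linked a (a + r)" if "a \<ge> M" for a
  proof -
    define i where "i = a + r - M"
    have i: "a + r = M + i" "a = \<sigma> M + i" using that r by (auto simp: i_def)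
    have "cyc (M + i) (\<sigma> M + i) (\<tau> M + i) \<in> Ker"
      using Ker_omega[OF k(1), of i] pos k(2,3) by (simp add: omega_funpow_cyc)
    then have "Ker.linked (M + i) (\<sigma> M + i)" unfolding Ker.linked_def
      using k(2,3) by (intro disjI2 exI[of _ "\<tau> M + i"]) auto
    then show ?thesis using Ker.linked_sym i by metis
  qed
  have steps: "Ker.linked a (a + j * r)" if "a \<ge> M" for a j
  proof (induction j)
    case (Suc j)
    show ?case using Ker.linked_trans[OF Suc.IH step[of "a + j * r"]] that by (simp add: algebra_simps)
  qed (simp add: Ker.linked_def)
  \<comment> \<open>Shifting by \<open>M\<close> moves the whole support above \<open>M\<close>,
    which is where the ladder of linked points begins.\<close>
  define \<sigma>' where "\<sigma>' = (omega ^^ M) \<sigma>"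
  have s': "\<sigma>' \<in> W (d + M)" "\<chi> (d + M) \<sigma>' = \<chi> d \<sigma>" using W_omega[OF s, of M] by (auto simp: \<sigma>'_def)
  have lnk: "Ker.linked a (\<sigma>' a)" for a
  proof (cases "a \<le> M")
    case True
    then show ?thesis by (simp add: \<sigma>'_def omega_funpow W_zero[OF s] Ker.linked_def)
  next
    case False
    \<comment> \<open>Since \<open>r \<ge> 1\<close>, climbing \<open>d + M\<close> steps leaves
      \<open>{1..d + M}\<close>, so \<open>\<sigma>'\<close> fixes \<open>?b\<close>. Conjugating
      the link between \<open>a\<close> and \<open>?b\<close> by \<open>\<sigma>'\<close> therefore
      moves only the end at \<open>a\<close>.\<close>
    let ?b = "a + (d + M) * r"
    have "(d + M) * 1 \<le> (d + M) * r" using r(1) by (intro mult_le_mono) auto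
    then have "d + M \<le> (d + M) * r" by (simp only: mult_1_right)
    then have "?b > d + M" using False by (rule_tac order.strict_trans1[of _ "(d + M) * r"]) simp_all
    then have fb: "\<sigma>' ?b = ?b" by (intro permutes_not_in[OF W_permutes[OF s'(1)]]) simp
    have "Ker.linked (\<sigma>' a) (\<sigma>' ?b)" using False by (intro linked_conj[OF steps s'(1)]) simp
    then have "Ker.linked ?b (\<sigma>' a)" using fb Ker.linked_sym by metis
    then show ?thesis using Ker.linked_trans[OF steps[of a "d + M"]] False by simp
  qed
  have fin': "finite {x. \<sigma>' x \<noteq> x}"
    by (rule W_support_finite[OF s'(1)])
  obtain g where g: "g \<in> Ker" "(g \<circ> \<sigma>') \<circ> (g \<circ> \<sigma>') = id"
    using Ker.exists_involution[OF fin' W_bij[OF s'(1)] lnk] by blast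
  obtain n where n: "g \<in> W n" "\<chi> n g = \<one>" using g by (auto simp: Ker_def)
  let ?N = "max n (d + M)"
  have gN: "g \<in> W ?N" "\<chi> ?N g = \<one>" using W_mono[OF n(1), of ?N] n(2) by auto
  have sN: "\<sigma>' \<in> W ?N" "\<chi> ?N \<sigma>' = \<chi> d \<sigma>" using W_mono[OF s'(1), of ?N] s'(2) by auto
  \<comment> \<open>\<open>g\<close> has character value one, hence the square of
    \<open>g \<circ> \<sigma>'\<close>, which is the identity, has the value of the square of
    \<open>\<sigma>\<close>.\<close>
  have "\<chi> ?N ((g \<circ> \<sigma>') \<circ> (g \<circ> \<sigma>')) = \<chi> d \<sigma> \<otimes> \<chi> d \<sigma>"
    using gN sN by (simp add: chi_comp W_comp chi_closed[OF s])
  then show ?thesis using g(2) chi_id by simp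
qed (simp add: chi_id)

lemma chi_inv': "\<sigma> \<in> W d \<Longrightarrow> \<chi> d (inv' \<sigma>) = \<chi> d \<sigma>"
  using chi_square chi_inv chi_closed K.comm_inv_char by metis

end

section \<open>Finite sums\<close>

context abelian_monoid
begin

lemma finsum_Sigma:
  assumes "finite A" "\<And>a. a \<in> A \<Longrightarrow> finite (B a)"
    and "\<And>a b. \<lbrakk>a \<in> A; b \<in> B a\<rbrakk> \<Longrightarrow> f a b \<in> carrier G"
  shows "(\<Oplus>a\<in>A. \<Oplus>b\<in>B a. f a b) = (\<Oplus>z\<in>Sigma A B. f (fst z) (snd z))"
  using assms
proof (induction A)
  case (insert x A)
  have S: "Sigma (insert x A) B = Pair x ` B x \<union> Sigma A B" by auto
  have "(\<Oplus>z\<in>Sigma (insert x A) B. f (fst z) (snd z))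
      = (\<Oplus>z\<in>Pair x ` B x. f (fst z) (snd z)) \<oplus> (\<Oplus>z\<in>Sigma A B. f (fst z) (snd z))"
    unfolding S using insert.prems insert.hyps by (intro finsum_Un_disjoint) auto
  also have "(\<Oplus>z\<in>Pair x ` B x. f (fst z) (snd z)) = (\<Oplus>b\<in>B x. f x b)"
    using insert.prems by (subst finsum_reindex) (auto simp: inj_on_def)
  also have "(\<Oplus>z\<in>Sigma A B. f (fst z) (snd z)) = (\<Oplus>a\<in>A. \<Oplus>b\<in>B a. f a b)"
    using insert by simp
  finally show ?case using insert by (simp add: Pi_def finsum_closed)
qed simp

lemma finsum_bij_betw:
  assumes "bij_betw h A B" "\<And>b. b \<in> B \<Longrightarrow> f b \<in> carrier G"
  shows "(\<Oplus>a\<in>A. f (h a)) = (\<Oplus>b\<in>B. f b)"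
  using assms finsum_reindex[of f h A] by (auto simp: bij_betw_def)

lemma finsum_swap:
  assumes "finite A" "finite B" "\<And>a b. \<lbrakk>a \<in> A; b \<in> B\<rbrakk> \<Longrightarrow> f a b \<in> carrier G"
  shows "(\<Oplus>a\<in>A. \<Oplus>b\<in>B. f a b) = (\<Oplus>b\<in>B. \<Oplus>a\<in>A. f a b)"
proof -
  have "(\<Oplus>z\<in>A \<times> B. f (fst z) (snd z)) = (\<Oplus>z\<in>B \<times> A. f (snd z) (fst z))"
    by (rule finsum_bij_betw[of prod.swap "A \<times> B" "B \<times> A" "\<lambda>z. f (snd z) (fst z)", simplified])
       (auto simp: assms(3) intro!: bij_betwI[of _ _ _ prod.swap])
  then show ?thesis using assms by (simp add: finsum_Sigma)
qed

lemma finsum_single: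
  assumes "finite A" "a \<in> A" "f a \<in> carrier G" "\<And>b. \<lbrakk>b \<in> A; b \<noteq> a\<rbrakk> \<Longrightarrow> f b = \<zero>"
  shows "(\<Oplus>b\<in>A. f b) = f a"
proof -
  have "(\<Oplus>b\<in>A. f b) = (\<Oplus>b\<in>A. if a = b then f a else \<zero>)"
    using assms by (intro finsum_cong') auto
  then show ?thesis using assms finsum_singleton[of a A "\<lambda>_. f a"] by auto
qed

text \<open>The substitution is \<open>p = q + s\<close>. Cutting a word at \<open>p\<close> and
  then its head at \<open>q\<close> is the same as cutting at \<open>q\<close> and then its tail
  \<open>s\<close> places later; the two iterated comultiplications lead to the two orders of
  summation.\<close>

lemma finsum_triangle:
  assumes "\<And>p q. q \<le> p \<Longrightarrow> p \<le> n \<Longrightarrow> f p q \<in> carrier G"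
  shows "(\<Oplus>p\<in>{..n::nat}. \<Oplus>q\<in>{..p}. f p q) = (\<Oplus>q\<in>{..n}. \<Oplus>s\<in>{..n - q}. f (q + s) q)"
proof -
  have "(\<Oplus>p\<in>{..n::nat}. \<Oplus>q\<in>{..p}. f p q) = (\<Oplus>z\<in>Sigma {..n} (\<lambda>p. {..p}). f (fst z) (snd z))"
    using assms by (intro finsum_Sigma) auto
  also have "\<dots> = (\<Oplus>z\<in>Sigma {..n} (\<lambda>q. {..n - q}). f (fst z + snd z) (fst z))"
  proof -
    have "bij_betw (\<lambda>(q, s). (q + s, q)) (Sigma {..n} (\<lambda>q. {..n - q})) (Sigma {..n} (\<lambda>p. {..p}))"
      by (rule bij_betwI[of _ _ _ "\<lambda>(p, q). (q, p - q)"]) auto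
    from finsum_bij_betw[OF this, of "\<lambda>z. f (fst z) (snd z)"] show ?thesis
      using assms by (auto simp: case_prod_unfold)
  qed
  also have "\<dots> = (\<Oplus>q\<in>{..n}. \<Oplus>s\<in>{..n - q}. f (q + s) q)"
    using assms by (intro finsum_Sigma[symmetric]) auto
  finally show ?thesis .
qed

end

lemma (in module) finsum_const_smult:
  assumes "x \<in> carrier M"
  shows "(\<Oplus>\<^bsub>M\<^esub>i\<in>A. x) = ([card A] \<cdot>\<^bsub>R\<^esub> \<one>) \<odot>\<^bsub>M\<^esub> x"
proof (induction A rule: infinite_finite_induct)
  case (insert a A)
  then show ?case using assms by (simp add: Pi_def smult_l_distr M.a_comm)
qed (use assms in auto)

section \<open>Permuted words\<close>

text \<open>Position \<open>t\<close> receives the letter with number \<open>\<rho> t\<close>, as in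
  the comultiplication formula. In the convention of \<open>tpow_act\<close> this is the action of
  the inverse of \<open>\<rho>\<close>, so it is a right action:
  \<open>permw \<pi> (permw \<rho> xs)\<close> is
  \<open>permw (\<rho> \<circ> \<pi>) xs\<close>.\<close>

definition permw :: "(nat \<Rightarrow> nat) \<Rightarrow> 'e list \<Rightarrow> 'e list"
  where "permw \<rho> xs = map (\<lambda>t. letter xs (\<rho> t)) [1..<Suc (length xs)]"

lemma length_permw [simp]: "length (permw \<rho> xs) = length xs"
  by (simp add: permw_def del: upt_Suc)

lemma nth_permw: "i < length xs \<Longrightarrow> permw \<rho> xs ! i = letter xs (\<rho> (Suc i))"
  by (simp add: permw_def del: upt_Suc)

lemma letter_permw: "\<lbrakk>1 \<le> t; t \<le> length xs\<rbrakk> \<Longrightarrow> letter (permw \<rho> xs) t = letter xs (\<rho> t)"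
  by (simp add: letter_def[of "permw \<rho> xs"] nth_permw)

lemma permw_id [simp]: "permw id xs = xs"
  by (rule nth_equalityI) (auto simp: nth_permw letter_def)

lemma permutes_atLeastAtMost_nat:
  assumes "\<rho> permutes {1..n}" "i < n" shows "1 \<le> \<rho> (Suc i)" "\<rho> (Suc i) \<le> n"
  using permutes_in_image[OF assms(1), of "Suc i"] assms(2) by auto

lemma permw_permw:
  assumes "\<pi> permutes {1..length xs}"
  shows "permw \<pi> (permw \<rho> xs) = permw (\<rho> \<circ> \<pi>) xs"
  by (rule nth_equalityI)
     (use permutes_atLeastAtMost_nat[OF assms] in \<open>auto simp: nth_permw letter_permw\<close>)

lemma set_permw:
  assumes "\<rho> permutes {1..length xs}" shows "set (permw \<rho> xs) \<subseteq> set xs"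
proof
  fix x assume "x \<in> set (permw \<rho> xs)"
  then obtain i where i: "i < length xs" "x = letter xs (\<rho> (Suc i))"
    by (auto simp: in_set_conv_nth nth_permw)
  then show "x \<in> set xs"
    unfolding letter_def using permutes_atLeastAtMost_nat[OF assms i(1)] by (auto intro!: nth_mem)
qed

lemma permw_words:
  "\<lbrakk>xs \<in> words E n; \<rho> permutes {1..n}\<rbrakk> \<Longrightarrow> permw \<rho> xs \<in> words E n"
  using set_permw[of \<rho> xs] by (auto simp: words_def)

lemma take_words: "\<lbrakk>xs \<in> words E n; p \<le> n\<rbrakk> \<Longrightarrow> take p xs \<in> words E p"
  by (auto simp: words_def dest: in_set_takeD)

lemma drop_words: "xs \<in> words E n \<Longrightarrow> drop p xs \<in> words E (n - p)"
  by (auto simp: words_def dest: in_set_dropD)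

lemma take_permw:
  "p \<le> length xs \<Longrightarrow> take p (permw \<rho> xs) = map (\<lambda>t. letter xs (\<rho> t)) [1..<Suc p]"
  by (rule nth_equalityI) (auto simp: nth_permw simp del: upt_Suc)

lemma drop_permw:
  "p \<le> length xs \<Longrightarrow> drop p (permw \<rho> xs) = map (\<lambda>t. letter xs (\<rho> t)) [Suc p..<Suc (length xs)]"
  by (rule nth_equalityI) (auto simp: nth_permw simp del: upt_Suc)

lemma permw_take:
  assumes "\<sigma> permutes {1..p}" "p \<le> length xs"
  shows "permw \<sigma> (take p xs) = take p (permw \<sigma> xs)"
proof (rule nth_equalityI)
  fix i assume "i < length (permw \<sigma> (take p xs))"
  then have i: "i < p" using assms(2) by simp
  then have "\<sigma> (Suc i) - 1 < p" using permutes_atLeastAtMost_nat[OF assms(1) i] by linarith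
  with i show "permw \<sigma> (take p xs) ! i = take p (permw \<sigma> xs) ! i"
    using assms(2) by (simp add: nth_permw letter_def)
qed (use assms(2) in simp)

lemma drop_permw_permutes:
  assumes "\<sigma> permutes {1..p}"
  shows "drop p (permw \<sigma> xs) = drop p xs"
  by (rule nth_equalityI)
     (use assms in \<open>auto simp: nth_permw letter_def permutes_not_in\<close>)

lemma take_permw_omega:
  assumes "\<tau> 0 = 0" shows "take p (permw ((omega ^^ p) \<tau>) xs) = take p xs"
  by (rule nth_equalityI) (use assms in \<open>auto simp: nth_permw letter_def omega_funpow\<close>)

text \<open>Position \<open>t\<close> of the tail is position \<open>p + t\<close> of the whole
  word, and on the positions beyond \<open>p\<close> the \<open>p\<close>-fold shift is
  \<open>\<tau>\<close> carried along by this renumbering.\<close>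

lemma permw_drop:
  assumes "\<tau> permutes {1..length xs - p}"
  shows "permw \<tau> (drop p xs) = drop p (permw ((omega ^^ p) \<tau>) xs)"
proof (rule nth_equalityI)
  fix i assume i: "i < length (permw \<tau> (drop p xs))"
  have "\<tau> 0 = 0" using assms by (auto simp: permutes_def)
  with i permutes_atLeastAtMost_nat[OF assms, of i]
  show "permw \<tau> (drop p xs) ! i = drop p (permw ((omega ^^ p) \<tau>) xs) ! i"
    by (simp add: nth_permw letter_def omega_funpow add.commute)
qed simp

section \<open>Minimal representatives\<close>

lemma perm_word_inject:
  assumes "\<rho> permutes {1..n}" "\<rho>' permutes {1..n}" "perm_word n \<rho> = perm_word n \<rho>'"
  shows "\<rho> = \<rho>'"
proof
  fix t
  show "\<rho> t = \<rho>' t"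
  proof (cases "t \<in> {1..n}")
    case True
    then show ?thesis using assms(3) by (auto simp: perm_word_def simp del: upt_Suc)
  next
    case False
    then show ?thesis using assms(1,2) by (metis permutes_not_in)
  qed
qed

text \<open>\<open>lexord\<close> is not well-founded on words of varying length. All words here
  have the same length, where it agrees with the well-founded \<open>lex\<close>; since it is
  linear, an element with nothing below it is comparable to all others in the required
  direction.\<close>

lemma lex_min_exists:
  assumes "C \<noteq> {}"
  shows "\<exists>\<rho>\<in>C. \<forall>\<rho>'\<in>C. perm_word n \<rho> = perm_word n \<rho>' \<or>
    (perm_word n \<rho>, perm_word n \<rho>') \<in> lexord less_than"
proof -
  have "wf (lex less_than)" by (intro wf_lex wf_less_than)
  then obtain z where z: "z \<in> perm_word n ` C" "\<And>y. (y, z) \<in> lex less_than \<Longrightarrow> y \<notin> perm_word n ` C"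
    using assms wfE_min[of "lex less_than" _ "perm_word n ` C"] by (metis ex_in_conv image_is_empty)
  then obtain \<rho> where r: "\<rho> \<in> C" "z = perm_word n \<rho>" by auto
  have "perm_word n \<rho> = perm_word n \<rho>' \<or> (perm_word n \<rho>, perm_word n \<rho>') \<in> lexord less_than"
    if "\<rho>' \<in> C" for \<rho>'
  proof -
    have "(perm_word n \<rho>', z) \<notin> lex less_than" using z that by auto
    then have "(perm_word n \<rho>', z) \<notin> lexord less_than"
      by (simp add: lexord_lex r perm_word_def)
    moreover have "\<forall>a b. (a, b) \<in> less_than \<or> a = b \<or> (b, a) \<in> less_than" by auto
    ultimately show ?thesis unfolding r(2) using lexord_linear by blast
  qed
  then show ?thesis using r by blast
qed

section \<open>Young subgroups, their cosets, and sums over the groups\<close>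

context omega_chars
begin

text \<open>The first factor moves only points up to \<open>p\<close>, the shifted one only points
  beyond \<open>p\<close>. They commute, so products are formed factor by factor.\<close>

lemma young_comp:
  assumes "\<sigma> \<in> W p" "\<tau> \<in> W h" "\<sigma>' \<in> W p" "\<tau>' \<in> W h"
  shows "(\<sigma> \<circ> (omega ^^ p) \<tau>) \<circ> (\<sigma>' \<circ> (omega ^^ p) \<tau>') = (\<sigma> \<circ> \<sigma>') \<circ> (omega ^^ p) (\<tau> \<circ> \<tau>')"
proof
  fix t
  have z: "\<tau> 0 = 0" "\<tau>' 0 = 0" "(\<tau> \<circ> \<tau>') 0 = 0"
    using W_zero[OF assms(2)] W_zero[OF assms(4)] by auto
  have *: "\<sigma>' t = t" "\<sigma> t = t" if "t > p" for t
    using that permutes_not_in[OF W_permutes[OF assms(1)]] permutes_not_in[OF W_permutes[OF assms(3)]]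
    by auto
  have le: "\<sigma>' t \<le> p" if "t \<le> p" for t
  proof (cases "t = 0")
    case True then show ?thesis using W_zero[OF assms(3)] by simp
  next
    case False
    then show ?thesis using permutes_in_image[OF W_permutes[OF assms(3)], of t] that by auto
  qed
  \<comment> \<open>Positivity ensures that a shifted factor sends points beyond \<open>p\<close> to
    points beyond \<open>p\<close>, so the second shifted factor is evaluated by the same branch and
    the first factors act trivially.\<close>
  have pos: "\<tau>' s > 0" if "s > 0" for s
    using W_bij[OF assms(4)] that z by (metis bij_is_inj gr0I injD less_irrefl)
  show "((\<sigma> \<circ> (omega ^^ p) \<tau>) \<circ> (\<sigma>' \<circ> (omega ^^ p) \<tau>')) t = ((\<sigma> \<circ> \<sigma>') \<circ> (omega ^^ p) (\<tau> \<circ> \<tau>')) t"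
  proof (cases "t \<le> p")
    case True
    then show ?thesis using le by (simp add: omega_funpow z)
  next
    case False
    then have "\<tau>' (t - p) > 0" "\<tau> (\<tau>' (t - p)) > 0" 
      using pos[of "t - p"] W_bij[OF assms(2)] z by auto (metis bij_is_inj gr0I injD less_irrefl)
    then show ?thesis using False * by (simp add: omega_funpow z)
  qed
qed

definition N :: "nat \<Rightarrow> 'k" where "N d = [card (W d)] \<cdot> \<one>"

lemma young_mem:
  assumes "\<sigma> \<in> W p" "\<tau> \<in> W h"
  shows "\<sigma> \<circ> (omega ^^ p) \<tau> \<in> W (p + h)" 
    "\<chi> (p + h) (\<sigma> \<circ> (omega ^^ p) \<tau>) = \<chi> p \<sigma> \<otimes> \<chi> h \<tau>"
  using W_mono[OF assms(1), of "p + h"] W_omega[OF assms(2), of p]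
  by (simp_all add: W_comp chi_comp add.commute)

lemma young_subset: "young_subgroup W p h \<subseteq> W (p + h)"
  using young_mem by (auto simp: young_subgroup_def)

lemma young_id: "id \<in> young_subgroup W p h"
proof -
  have "(omega ^^ p) id = id" by (auto simp: omega_funpow fun_eq_iff)
  then have "id = id \<circ> (omega ^^ p) id" by simp
  then show ?thesis unfolding young_subgroup_def using W_id by blast
qed

lemma young_mult: "\<lbrakk>x \<in> young_subgroup W p h; y \<in> young_subgroup W p h\<rbrakk> \<Longrightarrow> x \<circ> y \<in> young_subgroup W p h"
  unfolding young_subgroup_def using young_comp W_comp by blast

lemma young_inv: 
  assumes "x \<in> young_subgroup W p h" shows "inv' x \<in> young_subgroup W p h"
proof -
  obtain \<sigma> \<tau> where x: "\<sigma> \<in> W p" "\<tau> \<in> W h" "x = \<sigma> \<circ> (omega ^^ p) \<tau>"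
    using assms by (auto simp: young_subgroup_def)
  let ?y = "inv' \<sigma> \<circ> (omega ^^ p) (inv' \<tau>)"
  have id: "(omega ^^ p) id = id" by (auto simp: omega_funpow fun_eq_iff)
  have "\<sigma> \<circ> inv' \<sigma> = id" "inv' \<sigma> \<circ> \<sigma> = id" "\<tau> \<circ> inv' \<tau> = id" "inv' \<tau> \<circ> \<tau> = id"
    using permutes_inv_o[OF W_permutes[OF x(1)]] permutes_inv_o[OF W_permutes[OF x(2)]] by auto
  then have "x \<circ> ?y = id" "?y \<circ> x = id"
    unfolding x(3) by (simp_all only: young_comp[OF x(1,2) W_inv[OF x(1)] W_inv[OF x(2)]]
        young_comp[OF W_inv[OF x(1)] W_inv[OF x(2)] x(1,2)] id comp_id)
  then have "inv' x = ?y" by (intro inv_unique_comp)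
  then show ?thesis using x W_inv by (auto simp: young_subgroup_def)
qed

text \<open>A product determines its factors: on points up to \<open>p\<close> the shifted factor is
  the identity, which recovers \<open>\<sigma>\<close>, and then \<open>\<sigma>\<close> can be
  cancelled. Hence the order of the subgroup is the product of the two orders.\<close>

lemma young_bij: "bij_betw (\<lambda>(\<sigma>, \<tau>). \<sigma> \<circ> (omega ^^ p) \<tau>) (W p \<times> W h) (young_subgroup W p h)"
proof -
  have "inj_on (\<lambda>(\<sigma>, \<tau>). \<sigma> \<circ> (omega ^^ p) \<tau>) (W p \<times> W h)"
  proof (clarsimp simp: inj_on_def)
    fix \<sigma> \<tau> \<sigma>' \<tau>' assume a: "\<sigma> \<in> W p" "\<tau> \<in> W h" "\<sigma>' \<in> W p" "\<tau>' \<in> W h"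
      and eq: "\<sigma> \<circ> (omega ^^ p) \<tau> = \<sigma>' \<circ> (omega ^^ p) \<tau>'"
    have fixp: "\<sigma> t = t" "\<sigma>' t = t" if "t > p" for t
      using that permutes_not_in[OF W_permutes[OF a(1)]] permutes_not_in[OF W_permutes[OF a(3)]]
      by auto
    have s: "\<sigma> t = \<sigma>' t" for t
      using fun_cong[OF eq, of t] fixp[of t] W_zero[OF a(2)] W_zero[OF a(4)]
      by (cases "t \<le> p") (auto simp: omega_funpow)
    then have "\<sigma> = \<sigma>'" by auto
    moreover have o: "(omega ^^ p) \<tau> t = (omega ^^ p) \<tau>' t" for t
      using fun_cong[OF eq, of t] inj_eq[OF bij_is_inj[OF W_bij[OF a(1)]]] \<open>\<sigma> = \<sigma>'\<close> by simp
    have "\<tau> t = \<tau>' t" for t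
      using o[of "t + p"] W_zero[OF a(2)] W_zero[OF a(4)]
      by (cases "t = 0") (simp_all add: omega_funpow)
    ultimately show "\<sigma> = \<sigma>' \<and> \<tau> = \<tau>'" by auto
  qed
  then show ?thesis by (auto simp: bij_betw_def young_subgroup_def)
qed

lemma lcosets_eq: "lcosets\<^bsub>(sym_group n)\<lparr>carrier := W n\<rparr>\<^esub> H = (\<lambda>g. (\<lambda>x. g \<circ> x) ` H) ` W n"
  by (auto simp: LCOSETS_def l_coset_def sym_group_mult)

text \<open>Every coset has exactly one minimal element: existence is \<open>lex_min_exists\<close>,
  and uniqueness holds because the strict order is transitive and irreflexive and a permutation is
  determined by its word. So each group element is uniquely a representative times an element of the
  subgroup.\<close>

lemma min_reps_bij:
  "bij_betw (\<lambda>(\<rho>, x). \<rho> \<circ> x) (min_reps W p h \<times> young_subgroup W p h) (W (p + h))"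
proof -
  let ?X = "young_subgroup W p h"
  have mem: "\<rho> \<in> W (p + h)" if "\<rho> \<in> min_reps W p h" for \<rho>
    using that W_comp young_subset unfolding min_reps_def Let_def lcosets_eq by blast
  have Xbij: "bij x" if "x \<in> ?X" for x using that young_subset W_bij by blast
  have Xinv: "x \<circ> inv' x = id" if "x \<in> ?X" for x
    using bij_is_surj[OF Xbij[OF that]] surj_iff by blast
  \<comment> \<open>The definition of \<open>min_reps\<close> presents a class through some unknown
    member \<open>g\<close>. Absorbing subgroup elements lets the representative itself take the
    place of \<open>g\<close>.\<close>
  have coset: "(\<lambda>x. (\<rho> \<circ> y) \<circ> x) ` ?X = (\<lambda>x. \<rho> \<circ> x) ` ?X" if y: "y \<in> ?X" for \<rho> y
  proof -
    have "\<rho> \<circ> x = (\<rho> \<circ> y) \<circ> (inv' y \<circ> x)" for x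
      using Xinv[OF y] by (metis comp_assoc comp_id)
    moreover have "inv' y \<circ> x \<in> ?X" if "x \<in> ?X" for x
      using young_mult[OF young_inv[OF y] that] .
    ultimately show ?thesis using young_mult[OF y] by (auto simp: comp_assoc image_iff)
  qed
  have uniq: "\<rho> = \<rho>'" if r: "\<rho> \<in> min_reps W p h" "\<rho>' \<in> min_reps W p h"
    and eq: "\<rho> \<circ> x = \<rho>' \<circ> x'" and x: "x \<in> ?X" "x' \<in> ?X" for \<rho> \<rho>' x x'
  proof -
    let ?min = "\<lambda>\<rho> C. \<forall>\<rho>'\<in>C. perm_word (p + h) \<rho> = perm_word (p + h) \<rho>' \<or>
                 (perm_word (p + h) \<rho>, perm_word (p + h) \<rho>') \<in> lexord less_than"
    have min: "?min \<rho> ((\<lambda>x. \<rho> \<circ> x) ` ?X)" if "\<rho> \<in> min_reps W p h" for \<rho>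
    proof -
      obtain g y where "y \<in> ?X" "\<rho> = g \<circ> y" "?min \<rho> ((\<lambda>x. g \<circ> x) ` ?X)"
        using \<open>\<rho> \<in> min_reps W p h\<close> unfolding min_reps_def Let_def lcosets_eq by blast
      then show ?thesis using coset[of y g] by simp
    qed
    have same: "(\<lambda>x. \<rho> \<circ> x) ` ?X = (\<lambda>x. \<rho>' \<circ> x) ` ?X"
      using coset[OF x(1), of \<rho>] coset[OF x(2), of \<rho>'] eq by simp
    have in1: "\<rho> \<in> (\<lambda>x. \<rho> \<circ> x) ` ?X" "\<rho>' \<in> (\<lambda>x. \<rho>' \<circ> x) ` ?X"
      using young_id by (force intro: image_eqI[of _ _ id])+
    have "perm_word (p + h) \<rho> = perm_word (p + h) \<rho>'"
    proof (rule ccontr)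
      assume "perm_word (p + h) \<rho> \<noteq> perm_word (p + h) \<rho>'"
      then have "(perm_word (p + h) \<rho>, perm_word (p + h) \<rho>') \<in> lexord less_than"
        "(perm_word (p + h) \<rho>', perm_word (p + h) \<rho>) \<in> lexord less_than"
        using min[OF r(1)] min[OF r(2)] in1 same by auto
      then have "(perm_word (p + h) \<rho>, perm_word (p + h) \<rho>) \<in> lexord less_than"
        using lexord_trans[of _ _ less_than] by (meson trans_less_than)
      then show False using lexord_irreflexive[of less_than] by simp
    qed
    then show ?thesis using perm_word_inject W_permutes mem r by metis
  qed
  show ?thesis
  proof (rule bij_betw_imageI)
    show "inj_on (\<lambda>(\<rho>, x). \<rho> \<circ> x) (min_reps W p h \<times> ?X)"
    proof (clarsimp simp: inj_on_def)
      fix \<rho> x \<rho>' x' assume a: "\<rho> \<in> min_reps W p h" "\<rho>' \<in> min_reps W p h" "x \<in> ?X" "x' \<in> ?X"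
        "\<rho> \<circ> x = \<rho>' \<circ> x'"
      then have "\<rho> = \<rho>'" using uniq by blast
      moreover have "\<rho> (x t) = \<rho> (x' t)" for t using fun_cong[OF a(5), of t] \<open>\<rho> = \<rho>'\<close> by simp
      then have "x = x'" using inj_eq[OF bij_is_inj[OF W_bij[OF mem[OF a(1)]]]] by auto
      ultimately show "\<rho> = \<rho>' \<and> x = x'" by simp
    qed
    show "(\<lambda>(\<rho>, x). \<rho> \<circ> x) ` (min_reps W p h \<times> ?X) = W (p + h)"
    proof (intro equalityI subsetI)
      fix g assume "g \<in> (\<lambda>(\<rho>, x). \<rho> \<circ> x) ` (min_reps W p h \<times> ?X)"
      then show "g \<in> W (p + h)" using mem subsetD[OF young_subset] W_comp by auto
    next
      fix g assume g: "g \<in> W (p + h)"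
      have ne: "(\<lambda>x. g \<circ> x) ` ?X \<noteq> {}" using young_id by auto
      obtain \<rho> where r: "\<rho> \<in> (\<lambda>x. g \<circ> x) ` ?X" "\<forall>\<rho>'\<in>(\<lambda>x. g \<circ> x) ` ?X.
          perm_word (p + h) \<rho> = perm_word (p + h) \<rho>' \<or>
          (perm_word (p + h) \<rho>, perm_word (p + h) \<rho>') \<in> lexord less_than"
        using lex_min_exists[OF ne, of "p + h"] by blast
      then have "\<rho> \<in> min_reps W p h"
        unfolding min_reps_def Let_def lcosets_eq using g by blast
      moreover obtain x where x: "x \<in> ?X" "\<rho> = g \<circ> x" using r by auto
      ultimately have "(\<rho>, inv' x) \<in> min_reps W p h \<times> ?X" using young_inv by blast
      moreover have "g = (\<lambda>(\<rho>, x). \<rho> \<circ> x) (\<rho>, inv' x)"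
        using Xinv[OF x(1)] by (simp add: x(2) comp_assoc)
      ultimately show "g \<in> (\<lambda>(\<rho>, x). \<rho> \<circ> x) ` (min_reps W p h \<times> ?X)" by blast
    qed
  qed
qed

lemma min_reps_subset: "min_reps W p h \<subseteq> W (p + h)"
  using W_comp young_subset unfolding min_reps_def Let_def lcosets_eq by blast

lemma min_reps_finite: "finite (min_reps W p h)"
  using finite_subset[OF min_reps_subset W_finite] .

lemma young_finite: "finite (young_subgroup W p h)"
  using finite_subset[OF young_subset W_finite] .

lemma N_closed [simp]: "N d \<in> carrier K" by (simp add: N_def)

lemma card_young: "[card (young_subgroup W p h)] \<cdot> \<one> = N p \<otimes> N h"
proof -
  have "card (young_subgroup W p h) = card (W p) * card (W h)"
    using bij_betw_same_card[OF young_bij] by (metis card_cartesian_product)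
  then show ?thesis by (simp add: N_def K.add_pow_ldistr K.add_pow_rdistr K.add.nat_pow_pow mult.commute)
qed

text \<open>Each representative stands for as many group elements as the Young subgroup has, and
  \<open>F\<close> takes the same value on all of them.\<close>

lemma sum_min_reps:
  assumes P: "module K P" and F: "\<And>\<rho>. \<rho> \<in> W (p + h) \<Longrightarrow> F \<rho> \<in> carrier P"
    and const: "\<And>\<rho> \<sigma> \<tau>. \<lbrakk>\<rho> \<in> W (p + h); \<sigma> \<in> W p; \<tau> \<in> W h\<rbrakk> \<Longrightarrow> F (\<rho> \<circ> (\<sigma> \<circ> (omega ^^ p) \<tau>)) = F \<rho>"
  shows "(\<Oplus>\<^bsub>P\<^esub>\<rho>\<in>W (p + h). F \<rho>) = (N p \<otimes> N h) \<odot>\<^bsub>P\<^esub> (\<Oplus>\<^bsub>P\<^esub>\<rho>\<in>min_reps W p h. F \<rho>)"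
proof -
  interpret P: module K P by fact
  let ?X = "young_subgroup W p h"
  have const': "F (\<rho> \<circ> x) = F \<rho>" if "\<rho> \<in> min_reps W p h" "x \<in> ?X" for \<rho> x
    using that const min_reps_subset[THEN subsetD] unfolding young_subgroup_def by blast
  have Fm: "F \<rho> \<in> carrier P" if "\<rho> \<in> min_reps W p h" for \<rho> using that F min_reps_subset by blast
  have "(\<Oplus>\<^bsub>P\<^esub>\<rho>\<in>W (p + h). F \<rho>) = (\<Oplus>\<^bsub>P\<^esub>z\<in>min_reps W p h \<times> ?X. F (fst z \<circ> snd z))"
    using P.finsum_bij_betw[where f = F, OF min_reps_bij] F by (simp add: case_prod_unfold)
  also have "\<dots> = (\<Oplus>\<^bsub>P\<^esub>z\<in>min_reps W p h \<times> ?X. F (fst z))"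
    using const' Fm by (intro P.finsum_cong') auto
  also have "\<dots> = (\<Oplus>\<^bsub>P\<^esub>\<rho>\<in>min_reps W p h. \<Oplus>\<^bsub>P\<^esub>x\<in>?X. F \<rho>)"
    using Fm min_reps_finite young_finite by (intro P.finsum_Sigma[symmetric]) auto
  also have "\<dots> = (\<Oplus>\<^bsub>P\<^esub>\<rho>\<in>min_reps W p h. (N p \<otimes> N h) \<odot>\<^bsub>P\<^esub> F \<rho>)"
    using Fm by (intro P.finsum_cong') (auto simp: P.finsum_const_smult card_young)
  also have "\<dots> = (N p \<otimes> N h) \<odot>\<^bsub>P\<^esub> (\<Oplus>\<^bsub>P\<^esub>\<rho>\<in>min_reps W p h. F \<rho>)"
    using Fm min_reps_finite by (intro P.finsum_smult_ldistr[symmetric]) auto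
  finally show ?thesis .
qed

lemma W_translate_bij:
  assumes "g \<in> W n" shows "bij_betw (\<lambda>\<rho>. \<rho> \<circ> g) (W n) (W n)"
    and "bij_betw (\<lambda>\<rho>. g \<circ> \<rho>) (W n) (W n)"
proof -
  note gi = permutes_inv_o[OF W_permutes[OF assms]]
  have "(\<rho> \<circ> g) \<circ> inv' g = \<rho>" "(\<rho> \<circ> inv' g) \<circ> g = \<rho>"
    "g \<circ> (inv' g \<circ> \<rho>) = \<rho>" "inv' g \<circ> (g \<circ> \<rho>) = \<rho>" for \<rho>
    by (simp_all only: comp_assoc gi comp_id) (simp_all only: comp_assoc[symmetric] gi id_comp)
  then show "bij_betw (\<lambda>\<rho>. \<rho> \<circ> g) (W n) (W n)" "bij_betw (\<lambda>\<rho>. g \<circ> \<rho>) (W n) (W n)"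
    using W_comp W_inv[OF assms] assms
    by (intro bij_betwI[of _ _ _ "\<lambda>\<rho>. \<rho> \<circ> inv' g"] bij_betwI[of _ _ _ "\<lambda>\<rho>. inv' g \<circ> \<rho>"]; simp)+
qed

lemma W_inv_bij: "bij_betw inv' (W n) (W n)"
proof -
  have "inv' (inv' \<sigma>) = \<sigma>" if "\<sigma> \<in> W n" for \<sigma> using W_bij[OF that] by (rule inv_inv_eq)
  then show ?thesis using W_inv by (intro bij_betwI[of _ _ _ inv']) auto
qed

end

section \<open>Multilinear maps and tensor powers\<close>

text \<open>A slot is varied by updating the list. In degree zero there is no slot, and the first
  clause alone says that the value on the empty word lies in the target.\<close>

definition multilinear ::
  "('k,'r) ring_scheme \<Rightarrow> ('k,'e,'s) module_scheme \<Rightarrow> nat \<Rightarrow> ('k,'p,'t) module_scheme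
     \<Rightarrow> ('e list \<Rightarrow> 'p) \<Rightarrow> bool"
  where "multilinear K E d P g \<longleftrightarrow> (\<forall>xs\<in>words E d. g xs \<in> carrier P) \<and>
    (\<forall>xs\<in>words E d. \<forall>i<d. (\<lambda>x. g (xs[i := x])) \<in> module_hom K E P)"

lemma multilinear_closed: "\<lbrakk>multilinear K E d P g; xs \<in> words E d\<rbrakk> \<Longrightarrow> g xs \<in> carrier P"
  by (auto simp: multilinear_def)

lemma multilinear_hom:
  "\<lbrakk>multilinear K E d P g; xs \<in> words E d; i < d\<rbrakk> \<Longrightarrow> (\<lambda>x. g (xs[i := x])) \<in> module_hom K E P"
  by (auto simp: multilinear_def)

lemma words_update: "\<lbrakk>xs \<in> words E d; x \<in> carrier E\<rbrakk> \<Longrightarrow> xs[i := x] \<in> words E d"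
  using set_update_subset_insert[of xs i x] by (auto simp: words_def)

lemma words_length: "xs \<in> words E d \<Longrightarrow> length xs = d"
  by (simp add: words_def)

lemma words_append: "\<lbrakk>xs \<in> words E d; ys \<in> words E e\<rbrakk> \<Longrightarrow> xs @ ys \<in> words E (d + e)"
  by (auto simp: words_def)

lemma multilinear_cong:
  assumes "multilinear K E d P g" "module K E" "\<And>xs. xs \<in> words E d \<Longrightarrow> f xs = g xs"
  shows "multilinear K E d P f"
  unfolding multilinear_def
proof (intro conjI ballI allI impI)
  fix xs i assume xs: "xs \<in> words E d" and i: "i < d"
  show "(\<lambda>x. f (xs[i := x])) \<in> module_hom K E P"
    by (rule module_hom_cong[OF multilinear_hom[OF assms(1) xs i] assms(2)])
       (use assms(3) words_update[OF xs] in auto)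
qed (use assms multilinear_closed in force)

lemma multilinear_compose:
  assumes "multilinear K E d P g" "f \<in> module_hom K P Q"
  shows "multilinear K E d Q (\<lambda>xs. f (g xs))"
  unfolding multilinear_def
  using multilinear_closed[OF assms(1)] module_homD(1)[OF assms(2)]
    module_hom_comp[OF multilinear_hom[OF assms(1)] assms(2)] by auto

lemma multilinear_sum:
  assumes "module K E" "module K P" "\<And>i. i \<in> A \<Longrightarrow> multilinear K E d P (g i)"
  shows "multilinear K E d P (\<lambda>xs. \<Oplus>\<^bsub>P\<^esub>i\<in>A. g i xs)"
proof -
  interpret P: module K P by fact
  show ?thesis
    unfolding multilinear_def
    using multilinear_closed[OF assms(3)]
      module_hom_sum[OF assms(1,2) multilinear_hom[OF assms(3)]] by (auto intro!: P.finsum_closed)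
qed

lemma multilinear_smult:
  assumes "module K E" "module K P" "multilinear K E d P g" "a \<in> carrier K"
  shows "multilinear K E d P (\<lambda>xs. a \<odot>\<^bsub>P\<^esub> g xs)"
proof -
  interpret P: module K P by fact
  show ?thesis
    by (rule multilinear_compose[OF assms(3)])
       (use assms(4) in \<open>auto intro!: module_homI simp: P.smult_r_distr P.smult_assoc1[symmetric] P.R.m_comm\<close>)
qed

text \<open>The letter in position \<open>Suc i\<close> reappears in the position that
  \<open>\<rho>\<close> maps to \<open>Suc i\<close>; subtracting one turns this position into a
  list index. Hence varying one slot before the permutation is varying one slot after it.\<close>

lemma permw_update:
  assumes "\<rho> permutes {1..length xs}" "i < length xs"
  shows "permw \<rho> (xs[i := x]) = (permw \<rho> xs)[inv' \<rho> (Suc i) - 1 := x]"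
    "inv' \<rho> (Suc i) - 1 < length xs"
proof -
  have inv: "inv' \<rho> (Suc i) \<in> {1..length xs}"
    using permutes_in_image[OF permutes_inv[OF assms(1)], of "Suc i"] assms(2) by auto
  then show "inv' \<rho> (Suc i) - 1 < length xs" by auto
  show "permw \<rho> (xs[i := x]) = (permw \<rho> xs)[inv' \<rho> (Suc i) - 1 := x]"
  proof (rule nth_equalityI)
    fix j assume j: "j < length (permw \<rho> (xs[i := x]))"
    have "\<rho> (Suc j) - 1 = i \<longleftrightarrow> j = inv' \<rho> (Suc i) - 1"
    proof
      assume "\<rho> (Suc j) - 1 = i"
      then have "\<rho> (Suc j) = Suc i"
        using permutes_atLeastAtMost_nat[OF assms(1), of j] j by simp
      then have "inv' \<rho> (Suc i) = Suc j" using permutes_inverses(2)[OF assms(1)] by metis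
      then show "j = inv' \<rho> (Suc i) - 1" by simp
    next
      assume "j = inv' \<rho> (Suc i) - 1"
      then have "Suc j = inv' \<rho> (Suc i)" using inv by auto
      then have "\<rho> (Suc j) = Suc i" using permutes_inverses(1)[OF assms(1)] by metis
      then show "\<rho> (Suc j) - 1 = i" by simp
    qed
    moreover have "\<rho> (Suc j) - 1 < length xs"
      using permutes_atLeastAtMost_nat[OF assms(1), of j] j by auto
    ultimately show "permw \<rho> (xs[i := x]) ! j = ((permw \<rho> xs)[inv' \<rho> (Suc i) - 1 := x]) ! j"
      using j by (auto simp: nth_permw letter_def nth_list_update)
  qed simp
qed

lemma multilinear_permw:
  assumes g: "multilinear K E d P g" and r: "\<rho> permutes {1..d}"
  shows "multilinear K E d P (\<lambda>xs. g (permw \<rho> xs))"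
  unfolding multilinear_def
proof (intro conjI ballI allI impI)
  fix xs i assume xs: "xs \<in> words E d" and i: "i < d"
  note r' = r[folded words_length[OF xs]] and i' = i[folded words_length[OF xs]]
  show "(\<lambda>x. g (permw \<rho> (xs[i := x]))) \<in> module_hom K E P"
    using multilinear_hom[OF g permw_words[OF xs r]] permw_update(2)[OF r' i']
    by (simp add: permw_update(1)[OF r' i'] words_length[OF xs])
qed (use multilinear_closed[OF g] permw_words r in blast)

lemma multilinear_split:
  assumes "\<And>ys. ys \<in> words E h \<Longrightarrow> multilinear K E p P (\<lambda>xs. B xs ys)"
    and "\<And>xs. xs \<in> words E p \<Longrightarrow> multilinear K E h P (B xs)"
  shows "multilinear K E (p + h) P (\<lambda>zs. B (take p zs) (drop p zs))"
  unfolding multilinear_def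
proof (intro conjI ballI allI impI)
  fix zs assume zs: "zs \<in> words E (p + h)"
  have t: "take p zs \<in> words E p" and d: "drop p zs \<in> words E h"
    using take_words[OF zs, of p] drop_words[OF zs, of p] by auto
  show "B (take p zs) (drop p zs) \<in> carrier P" using multilinear_closed[OF assms(2)[OF t] d] .
  fix i assume i: "i < p + h"
  show "(\<lambda>x. B (take p (zs[i := x])) (drop p (zs[i := x]))) \<in> module_hom K E P"
  proof (cases "i < p")
    case True
    then show ?thesis
      using multilinear_hom[OF assms(1)[OF d] t True] by (simp add: take_update_swap)
  next
    case False
    then have "i - p < h" using i by simp
    then show ?thesis
      using multilinear_hom[OF assms(2)[OF t] d, of "i - p"] False by (simp add: drop_update_swap)
  qed
qed

lemma multilinear_bilinear:
  assumes B: "bilinear_map K M N P B"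
    and f: "multilinear K E p M f" and g: "multilinear K E h N g"
  shows "multilinear K E (p + h) P (\<lambda>zs. B (f (take p zs)) (g (drop p zs)))"
proof (rule multilinear_split)
  show "multilinear K E p P (\<lambda>xs. B (f xs) (g ys))" if "ys \<in> words E h" for ys
    using multilinear_compose[OF f bilinear_mapD(1)[OF B multilinear_closed[OF g that]]] .
  show "multilinear K E h P (\<lambda>ys. B (f xs) (g ys))" if "xs \<in> words E p" for xs
    using multilinear_compose[OF g bilinear_mapD(2)[OF B multilinear_closed[OF f that]]] .
qed

section \<open>Tensor powers and their universal property\<close>

locale letters = E: module K E
  for K :: "('k,'r) ring_scheme" (structure) and E :: "('k,'e,'s) module_scheme" (structure)
begin

abbreviation "F \<equiv> \<lambda>d. free_module K (words E d)"
abbreviation "T \<equiv> tpow K E"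

lemma F_module: "module K (F d)" by (intro free_module_module E.R.is_cring)

sublocale F: module K "F d" for d by (rule F_module)

lemma gen_closed: "xs \<in> words E d \<Longrightarrow> free_gen K xs \<in> carrier (F d)"
  by (intro free_gen_closed E.R.is_cring)

lemma tpow_relations_subset: "tpow_relations K E d \<subseteq> carrier (F d)"
  unfolding tpow_relations_def Let_def
  by (intro Un_least subsetI)
     (auto intro!: F.minus_closed F.a_closed F.smult_closed gen_closed words_update)

sublocale Q: quotient_of_module K "F d" "tpow_kernel K E d" for d
  unfolding tpow_kernel_def by (intro quotient_of_moduleI tpow_relations_subset F_module)

lemma tpow_module: "module K (T d)"
  unfolding tpow_def by (rule Q.module_Q)

lemma spans_tpow: "spans K (T d) (tpow_pure K E ` words E d)"
proof -
  have "spans K (T d) ((\<lambda>x. tpow_kernel K E d +>\<^bsub>F d\<^esub> x) ` (free_gen K ` words E d))"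
    unfolding tpow_def
    by (rule spans_image[OF F_module Q.module_Q spans_free_module[OF E.R.is_cring] Q.proj_hom])
       (simp add: Q.carrier_Q)
  moreover have "(\<lambda>x. tpow_kernel K E d +>\<^bsub>F d\<^esub> x) ` (free_gen K ` words E d) = tpow_pure K E ` words E d"
    unfolding image_image tpow_pure_def by (intro image_cong refl) (simp add: words_length)
  ultimately show ?thesis by simp
qed

lemma tpow_pure_closed: "xs \<in> words E d \<Longrightarrow> tpow_pure K E xs \<in> carrier (T d)"
  using spans_tpow by (auto simp: spans_def)

lemma tpow_pure_multilinear: "multilinear K E d (T d) (tpow_pure K E)"
  unfolding multilinear_def
proof (intro conjI ballI allI impI tpow_pure_closed)
  have rel: "r \<in> tpow_kernel K E d" if "r \<in> tpow_relations K E d" for r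
    unfolding tpow_kernel_def using that by (rule subsetD[OF submodule_generated_superset])
  fix xs i assume xs: "xs \<in> words E d" and i: "i < d"
  note len = words_length[OF words_update[OF xs]]
  note c = gen_closed[OF words_update[OF xs]]
  show "(\<lambda>x. tpow_pure K E (xs[i := x])) \<in> module_hom K E (T d)"
  proof (rule module_homI)
    fix x y assume xy: "x \<in> carrier E" "y \<in> carrier E"
    have "free_gen K (xs[i := x \<oplus>\<^bsub>E\<^esub> y]) \<ominus>\<^bsub>F d\<^esub> (free_gen K (xs[i := x]) \<oplus>\<^bsub>F d\<^esub> free_gen K (xs[i := y]))
        \<in> tpow_relations K E d"
      unfolding tpow_relations_def Let_def using xs i xy by blast
    then show "tpow_pure K E (xs[i := x \<oplus>\<^bsub>E\<^esub> y]) = tpow_pure K E (xs[i := x]) \<oplus>\<^bsub>T d\<^esub> tpow_pure K E (xs[i := y])"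
      using xy unfolding tpow_pure_def tpow_def
      by (simp add: words_length[OF xs] Q.add_Q Q.coset_eq_iff c rel)
  next
    fix a x assume ax: "a \<in> carrier K" "x \<in> carrier E"
    have "free_gen K (xs[i := a \<odot>\<^bsub>E\<^esub> x]) \<ominus>\<^bsub>F d\<^esub> (a \<odot>\<^bsub>F d\<^esub> free_gen K (xs[i := x])) \<in> tpow_relations K E d"
      unfolding tpow_relations_def Let_def using xs i ax by blast
    then show "tpow_pure K E (xs[i := a \<odot>\<^bsub>E\<^esub> x]) = a \<odot>\<^bsub>T d\<^esub> tpow_pure K E (xs[i := x])"
      using ax unfolding tpow_pure_def tpow_def
      by (simp add: words_length[OF xs] Q.smult_Q Q.coset_eq_iff c rel)
  qed (rule tpow_pure_closed[OF words_update[OF xs]])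
qed

lemma tpow_lift:
  assumes P: "module K P" and g: "multilinear K E d P g"
  shows tpow_lift_pure: "xs \<in> words E d \<Longrightarrow> quotient_lift (free_lift K P g) (tpow_pure K E xs) = g xs"
    and tpow_lift_hom: "quotient_lift (free_lift K P g) \<in> module_hom K (T d) P"
proof -
  interpret P: module K P by fact
  let ?h = "free_lift K P g"
  have gc: "g z \<in> carrier P" if "z \<in> words E d" for z
    using that multilinear_closed[OF g] by auto
  have h: "?h \<in> module_hom K (F d) P" by (rule free_lift_hom[OF P gc])
  have gen: "?h (free_gen K xs) = g xs" if "xs \<in> words E d" for xs
    using that free_lift_gen[of K P "words E d" g xs, OF P gc] by simp
  have zero: "?h (u \<ominus>\<^bsub>F d\<^esub> v) = \<zero>\<^bsub>P\<^esub>" if "u \<in> carrier (F d)" "v \<in> carrier (F d)" "?h u = ?h v" for u v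
    unfolding module_hom_minus[OF h F_module P that(1,2)] that(3)
    using module_homD(1)[OF h that(2)] by (simp add: P.r_neg a_minus_def)
  note simps = gen module_homD(2,3)[OF h] gen_closed module_homD(2,3)[OF multilinear_hom[OF g]] words_update
  have "?h s = \<zero>\<^bsub>P\<^esub>" if "s \<in> tpow_relations K E d" for s
    using that unfolding tpow_relations_def Let_def
    by (elim UnE CollectE exE conjE; hypsubst; intro zero) (auto simp: simps)
  then have "\<forall>s\<in>tpow_relations K E d. ?h s = \<zero>\<^bsub>P\<^esub>" by blast
  note * = quotient_generated_lift[OF F_module tpow_relations_subset P h this, folded tpow_kernel_def]
  show "quotient_lift ?h \<in> module_hom K (T d) P"
    using *(2) by (simp add: tpow_def)
  show "quotient_lift ?h (tpow_pure K E xs) = g xs" if "xs \<in> words E d"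
    using that *(1)[OF gen_closed[OF that]] gen[OF that]
    by (simp add: tpow_pure_def words_length[OF that])
qed

lemma tpow_act:
  assumes s: "\<sigma> permutes {1..d}"
  shows tpow_act_pure: "xs \<in> words E d \<Longrightarrow> tpow_act K E d \<sigma> (tpow_pure K E xs) = tpow_pure K E (permw (inv' \<sigma>) xs)"
    and tpow_act_hom: "tpow_act K E d \<sigma> \<in> module_hom K (T d) (T d)"
proof -
  let ?g = "\<lambda>xs. tpow_pure K E (map (\<lambda>t. letter xs (inv' \<sigma> t)) [1..<Suc d])"
  have eq: "?g xs = tpow_pure K E (permw (inv' \<sigma>) xs)" if "xs \<in> words E d" for xs
    by (simp add: permw_def words_length[OF that] del: upt_Suc)
  have "multilinear K E d (T d) ?g"
    by (rule multilinear_cong[OF multilinear_permw[OF tpow_pure_multilinear permutes_inv[OF s]] E.module_axioms])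
       (rule eq)
  note * = tpow_lift[OF tpow_module this]
  show "tpow_act K E d \<sigma> \<in> module_hom K (T d) (T d)" unfolding tpow_act_def by (rule *)
  show "tpow_act K E d \<sigma> (tpow_pure K E xs) = tpow_pure K E (permw (inv' \<sigma>) xs)" if "xs \<in> words E d"
    unfolding tpow_act_def using *(1)[OF that] eq[OF that] by simp
qed

end

section \<open>The components of the algebra\<close>

locale chi_letters = omega_chars K W \<chi> + letters K E
  for K :: "('k,'r) ring_scheme" (structure) and W \<chi> and E :: "('k,'e,'s) module_scheme"
begin

abbreviation "A \<equiv> chi_comp K W \<chi> E"
abbreviation "cls \<equiv> chi_class K W \<chi> E"

text \<open>These are the maps on words that factor through \<open>chi_comp\<close>. No inverse
  occurs on the right: \<open>permw \<sigma>\<close> is the action of the inverse of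
  \<open>\<sigma>\<close>, and for that element the defining relation gives the inverse of the
  inverse of \<open>\<chi> d \<sigma>\<close>.\<close>

definition chi_form :: "nat \<Rightarrow> ('k,'p,'t) module_scheme \<Rightarrow> ('e list \<Rightarrow> 'p) \<Rightarrow> bool"
  where "chi_form d P g \<longleftrightarrow> multilinear K E d P g \<and>
    (\<forall>xs\<in>words E d. \<forall>\<sigma>\<in>W d. g (permw \<sigma> xs) = \<chi> d \<sigma> \<odot>\<^bsub>P\<^esub> g xs)"

definition "chi_relations d =
  {(inv\<^bsub>K\<^esub> (\<chi> d \<sigma>) \<odot>\<^bsub>T d\<^esub> z) \<ominus>\<^bsub>T d\<^esub> tpow_act K E d \<sigma> z | \<sigma> z. \<sigma> \<in> W d \<and> z \<in> carrier (T d)}"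

sublocale T: module K "T d" for d by (rule tpow_module)

lemma inv_chi: "\<sigma> \<in> W d \<Longrightarrow> inv\<^bsub>K\<^esub> (\<chi> d \<sigma>) = \<chi> d \<sigma>"
  using chi_inv chi_inv' by simp

lemma chi_relations_subset: "chi_relations d \<subseteq> carrier (T d)"
  unfolding chi_relations_def
  using module_homD(1)[OF tpow_act_hom[OF W_permutes]]
  by (auto intro!: T.minus_closed T.smult_closed simp: inv_chi chi_closed)

sublocale QA: quotient_of_module K "T d" "chi_kernel K W \<chi> E d" for d
  unfolding chi_kernel_def chi_relations_def[symmetric]
  by (intro quotient_of_moduleI chi_relations_subset tpow_module)

lemma chi_comp_module: "module K (A d)"
  unfolding chi_comp_def by (rule QA.module_Q)

lemma cls_eq: "xs \<in> words E d \<Longrightarrow> cls xs = chi_kernel K W \<chi> E d +>\<^bsub>T d\<^esub> tpow_pure K E xs"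
  by (simp add: chi_class_def words_length)

lemma spans_cls: "spans K (A d) (cls ` words E d)"
proof -
  have "spans K (A d) ((\<lambda>x. chi_kernel K W \<chi> E d +>\<^bsub>T d\<^esub> x) ` (tpow_pure K E ` words E d))"
    unfolding chi_comp_def
    by (rule spans_image[OF tpow_module QA.module_Q spans_tpow QA.proj_hom]) (simp add: QA.carrier_Q)
  moreover have "(\<lambda>x. chi_kernel K W \<chi> E d +>\<^bsub>T d\<^esub> x) ` (tpow_pure K E ` words E d) = cls ` words E d"
    unfolding image_image by (intro image_cong refl) (simp add: cls_eq)
  ultimately show ?thesis by simp
qed

lemma cls_closed: "xs \<in> words E d \<Longrightarrow> cls xs \<in> carrier (A d)"
  using spans_cls by (auto simp: spans_def)

lemma cls_multilinear: "multilinear K E d (A d) cls"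
proof (rule multilinear_cong[OF _ E.module_axioms])
  show "multilinear K E d (A d) (\<lambda>xs. chi_kernel K W \<chi> E d +>\<^bsub>T d\<^esub> tpow_pure K E xs)"
    unfolding chi_comp_def by (rule multilinear_compose[OF tpow_pure_multilinear QA.proj_hom])
qed (rule cls_eq)

lemma cls_permw:
  assumes xs: "xs \<in> words E d" and s: "\<sigma> \<in> W d"
  shows "cls (permw \<sigma> xs) = \<chi> d \<sigma> \<odot>\<^bsub>A d\<^esub> cls xs"
proof -
  let ?s = "inv' \<sigma>" let ?z = "tpow_pure K E xs"
  have ss: "?s \<in> W d" using s by (rule W_inv)
  have z: "?z \<in> carrier (T d)" using xs by (rule tpow_pure_closed)
  have xs': "permw \<sigma> xs \<in> words E d" using xs W_permutes[OF s] by (rule permw_words)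
  \<comment> \<open>The relation is applied to \<open>?s\<close>, because acting by the inverse of
    \<open>\<sigma>\<close> is what \<open>permw \<sigma>\<close> does.\<close>
  have "tpow_act K E d ?s ?z = tpow_pure K E (permw \<sigma> xs)"
    using tpow_act_pure[OF W_permutes[OF ss] xs] inv_inv_eq[OF W_bij[OF s]] by simp
  then have "(\<chi> d \<sigma> \<odot>\<^bsub>T d\<^esub> ?z) \<ominus>\<^bsub>T d\<^esub> tpow_pure K E (permw \<sigma> xs) \<in> chi_relations d"
    unfolding chi_relations_def using ss z inv_chi[OF ss] chi_inv'[OF s] by (auto intro!: exI[of _ ?s] exI[of _ ?z])
  then have "(\<chi> d \<sigma> \<odot>\<^bsub>T d\<^esub> ?z) \<ominus>\<^bsub>T d\<^esub> tpow_pure K E (permw \<sigma> xs) \<in> chi_kernel K W \<chi> E d"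
    unfolding chi_kernel_def chi_relations_def[symmetric]
    by (rule subsetD[OF submodule_generated_superset])
  then have "chi_kernel K W \<chi> E d +>\<^bsub>T d\<^esub> (\<chi> d \<sigma> \<odot>\<^bsub>T d\<^esub> ?z)
      = chi_kernel K W \<chi> E d +>\<^bsub>T d\<^esub> tpow_pure K E (permw \<sigma> xs)"
    using z chi_closed[OF s] tpow_pure_closed[OF xs'] by (simp add: QA.coset_eq_iff)
  then show ?thesis
    unfolding cls_eq[OF xs] cls_eq[OF xs'] chi_comp_def
    using z chi_closed[OF s] by (simp add: QA.smult_Q)
qed

lemma cls_form: "chi_form d (A d) cls"
  by (simp add: chi_form_def cls_multilinear cls_permw)

lemma chi_lift:
  assumes P: "module K P" and g: "chi_form d P g"
  shows chi_lift_cls: "xs \<in> words E d \<Longrightarrow> chi_lift K P g (cls xs) = g xs"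
    and chi_lift_hom: "chi_lift K P g \<in> module_hom K (A d) P"
proof -
  interpret P: module K P by fact
  have gm: "multilinear K E d P g" and gp: "\<And>xs \<sigma>. \<lbrakk>xs \<in> words E d; \<sigma> \<in> W d\<rbrakk> \<Longrightarrow> g (permw \<sigma> xs) = \<chi> d \<sigma> \<odot>\<^bsub>P\<^esub> g xs"
    using g by (auto simp: chi_form_def)
  let ?h = "quotient_lift (free_lift K P g)"
  note h = tpow_lift_hom[OF P gm] and hp = tpow_lift_pure[OF P gm]
  have "?h ((inv\<^bsub>K\<^esub> (\<chi> d \<sigma>) \<odot>\<^bsub>T d\<^esub> z) \<ominus>\<^bsub>T d\<^esub> tpow_act K E d \<sigma> z) = \<zero>\<^bsub>P\<^esub>"
    if s: "\<sigma> \<in> W d" and z: "z \<in> carrier (T d)" for \<sigma> z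
  proof -
    note act = tpow_act_hom[OF W_permutes[OF s]]
    have hz: "?h z \<in> carrier P" using module_homD(1)[OF h z] .
    \<comment> \<open>Both sides are linear in \<open>z\<close>, so the equivariance of
      \<open>g\<close> on words is enough.\<close>
    have "?h (tpow_act K E d \<sigma> z) = \<chi> d \<sigma> \<odot>\<^bsub>P\<^esub> ?h z"
    proof (rule spans_hom_eq[OF tpow_module P spans_tpow module_hom_comp[OF act h] _ _ z])
      show "(\<lambda>z. \<chi> d \<sigma> \<odot>\<^bsub>P\<^esub> ?h z) \<in> module_hom K (T d) P"
        by (rule module_hom_smult[OF tpow_module P h chi_closed[OF s]])
      fix u assume "u \<in> tpow_pure K E ` words E d"
      then obtain xs where xs: "xs \<in> words E d" "u = tpow_pure K E xs" by auto
      have "permw (inv' \<sigma>) xs \<in> words E d"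
        using xs(1) W_permutes[OF W_inv[OF s]] by (rule permw_words)
      then show "?h (tpow_act K E d \<sigma> u) = \<chi> d \<sigma> \<odot>\<^bsub>P\<^esub> ?h u"
        using xs W_inv[OF s] by (simp add: tpow_act_pure[OF W_permutes[OF s]] hp gp chi_inv'[OF s])
    qed
    then have "?h (inv\<^bsub>K\<^esub> (\<chi> d \<sigma>) \<odot>\<^bsub>T d\<^esub> z) = ?h (tpow_act K E d \<sigma> z)"
      using z chi_closed[OF s] by (simp add: inv_chi[OF s] module_homD(3)[OF h])
    then show ?thesis
      using z chi_closed[OF s] module_homD(1)[OF act] module_homD(1)[OF h]
      by (subst module_hom_minus[OF h tpow_module P]) (simp_all add: inv_chi[OF s] a_minus_def P.r_neg)
  qed
  then have "\<forall>s\<in>chi_relations d. ?h s = \<zero>\<^bsub>P\<^esub>" by (auto simp: chi_relations_def)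
  note * = quotient_generated_lift[OF tpow_module chi_relations_subset P h this,
      unfolded chi_relations_def, folded chi_kernel_def]
  show "chi_lift K P g \<in> module_hom K (A d) P"
    using *(2) by (simp add: chi_lift_def chi_comp_def)
  show "chi_lift K P g (cls xs) = g xs" if "xs \<in> words E d"
    using that *(1)[OF tpow_pure_closed[OF that]] hp[OF that] by (simp add: chi_lift_def cls_eq)
qed

lemma chi_comp_hom_eq:
  assumes "module K P" "f \<in> module_hom K (A d) P" "g \<in> module_hom K (A d) P"
    and "\<And>xs. xs \<in> words E d \<Longrightarrow> f (cls xs) = g (cls xs)" and "z \<in> carrier (A d)"
  shows "f z = g z"
  by (rule spans_hom_eq[OF chi_comp_module assms(1) spans_cls assms(2,3) _ assms(5)])
     (use assms(4) in auto)

abbreviation "C \<equiv> chi_module K W \<chi> E"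
abbreviation "w \<equiv> chi_word K W \<chi> E"

sublocale G: graded_module K A
  by (simp add: graded_module_def graded_module_axioms_def chi_comp_module K.is_cring)

lemma C_eq: "C = dsum K A" by (simp add: chi_module_def)

lemma C_module: "module K C" unfolding C_eq by (rule G.dsum_module)

lemma w_eq: "xs \<in> words E d \<Longrightarrow> w xs = dsum_in A d (cls xs)"
  by (simp add: chi_word_def words_length)

lemma w_closed: "xs \<in> words E d \<Longrightarrow> w xs \<in> carrier C"
  unfolding C_eq by (simp add: w_eq G.dsum_in_closed cls_closed)

lemma w_form: "chi_form d C w"
proof -
  have "multilinear K E d C (\<lambda>xs. dsum_in A d (cls xs))"
    unfolding C_eq by (rule multilinear_compose[OF cls_multilinear G.dsum_in_hom])
  then have "multilinear K E d C w"
    by (rule multilinear_cong[OF _ E.module_axioms]) (rule w_eq)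
  moreover have "w (permw \<sigma> xs) = \<chi> d \<sigma> \<odot>\<^bsub>C\<^esub> w xs" if "xs \<in> words E d" "\<sigma> \<in> W d" for xs \<sigma>
    using that module_homD(3)[OF G.dsum_in_hom, of "\<chi> d \<sigma>" "cls xs" d]
      w_eq[OF permw_words[OF that(1) W_permutes[OF that(2)]]]
    by (simp add: w_eq cls_permw chi_closed cls_closed C_eq)
  ultimately show ?thesis by (simp add: chi_form_def)
qed

lemma C_hom_eq:
  assumes "module K P" "f \<in> module_hom K C P" "g \<in> module_hom K C P"
    and "\<And>d xs. xs \<in> words E d \<Longrightarrow> f (w xs) = g (w xs)" and "z \<in> carrier C"
  shows "f z = g z"
proof (rule spans_hom_eq[OF C_module assms(1) _ assms(2,3) _ assms(5)])
  show "spans K C (\<Union>d. dsum_in A d ` (cls ` words E d))"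
    unfolding C_eq by (rule G.spans_dsum[OF spans_cls])
qed (use assms(4) w_eq in fastforce)

lemma chi_form_dsum_lift:
  assumes P: "module K P" and g: "\<And>d. chi_form d P (g d)"
  defines "f \<equiv> dsum_lift A P (\<lambda>d. chi_lift K P (g d))"
  shows "xs \<in> words E d \<Longrightarrow> f (w xs) = g d xs" and "f \<in> module_hom K C P"
  unfolding f_def C_eq using G.dsum_lift[OF P chi_lift_hom[OF P g]] chi_lift_cls[OF P g]
  by (auto simp: w_eq cls_closed)

end

section \<open>Comultiplication\<close>

text \<open>The form in which the rational numbers enter: positive integers are units, so the orders
  of the groups \<open>W d\<close> can be inverted.\<close>

locale rational_chars = omega_chars K W \<chi>
  for K :: "('k,'r) ring_scheme" (structure) and W \<chi> +
  assumes div: "(n::nat) > 0 \<Longrightarrow> [n] \<cdot> \<one> \<in> Units K"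
begin

definition iN :: "nat \<Rightarrow> 'k" where "iN d = inv\<^bsub>K\<^esub> (N d)"

lemma N_Units: "N d \<in> Units K"
proof -
  have "card (W d) > 0" using W_id[of d] W_finite[of d] by (auto simp: card_gt_0_iff)
  then show ?thesis unfolding N_def by (rule div)
qed

lemma iN_closed [simp]: "iN d \<in> carrier K"
  using N_Units by (simp add: iN_def)

lemma iN_N: "iN d \<otimes> N d = \<one>" "N d \<otimes> iN d = \<one>"
  using N_Units by (simp_all add: iN_def)

lemma W_0: "W 0 = {id}"
proof -
  have "\<sigma> = id" if "\<sigma> \<in> W 0" for \<sigma>
    using W_permutes[OF that] by simp
  then show ?thesis using W_id by blast
qed

lemma iN_0: "iN 0 = \<one>"
proof -
  have "N 0 = \<one>" by (simp add: N_def W_0)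
  then show ?thesis by (simp add: iN_def)
qed

end

locale rational_letters = rational_chars K W \<chi> + chi_letters K W \<chi> E
  for K :: "('k,'r) ring_scheme" (structure) and W \<chi> and E :: "('k,'e,'s) module_scheme"
begin

text \<open>
  Sums over \<open>W n\<close> stand in for those over minimal representatives; \<open>iN\<close> compensates for the
  repetitions.
\<close>

definition twisted_sum :: "('k,'p,'t) module_scheme \<Rightarrow> nat \<Rightarrow> ('e list \<Rightarrow> 'p) \<Rightarrow> 'e list \<Rightarrow> 'p"
  where "twisted_sum P n B xs = (\<Oplus>\<^bsub>P\<^esub>\<rho>\<in>W n. \<chi> n \<rho> \<odot>\<^bsub>P\<^esub> B (permw \<rho> xs))"

lemma permw_W: "\<lbrakk>xs \<in> words E n; \<rho> \<in> W n\<rbrakk> \<Longrightarrow> permw \<rho> xs \<in> words E n"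
  by (rule permw_words[OF _ W_permutes])

lemma permw_comp_W: "\<lbrakk>xs \<in> words E n; \<pi> \<in> W n\<rbrakk> \<Longrightarrow> permw \<pi> (permw \<rho> xs) = permw (\<rho> \<circ> \<pi>) xs"
  using permw_permw[of \<pi> xs \<rho>] W_permutes by (simp add: words_length)

lemma twisted_sum_closed:
  assumes "module K P" "xs \<in> words E n" "\<And>ys. ys \<in> words E n \<Longrightarrow> B ys \<in> carrier P"
  shows "twisted_sum P n B xs \<in> carrier P"
proof -
  interpret P: module K P by fact
  show ?thesis unfolding twisted_sum_def
    using assms(2,3) by (intro P.finsum_closed) (auto simp: permw_W chi_closed)
qed

lemma twisted_sum_cong:
  assumes "module K P" "xs \<in> words E n" "\<And>ys. ys \<in> words E n \<Longrightarrow> B ys \<in> carrier P"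
    "\<And>ys. ys \<in> words E n \<Longrightarrow> A' ys = B ys"
  shows "twisted_sum P n A' xs = twisted_sum P n B xs"
proof -
  interpret P: module K P by fact
  show ?thesis unfolding twisted_sum_def
    using assms(2,3,4) by (intro P.finsum_cong') (auto simp: permw_W chi_closed)
qed

lemma twisted_sum_hom:
  assumes "module K P" "module K Q" "f \<in> module_hom K P Q" "xs \<in> words E n"
    "\<And>ys. ys \<in> words E n \<Longrightarrow> B ys \<in> carrier P"
  shows "f (twisted_sum P n B xs) = twisted_sum Q n (\<lambda>ys. f (B ys)) xs"
proof -
  interpret P: module K P by fact
  interpret Q: module K Q by fact
  have "f (twisted_sum P n B xs) = (\<Oplus>\<^bsub>Q\<^esub>\<rho>\<in>W n. f (\<chi> n \<rho> \<odot>\<^bsub>P\<^esub> B (permw \<rho> xs)))"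
    unfolding twisted_sum_def using assms(4,5)
    by (intro module_hom_finsum[OF assms(3,1,2)]) (auto simp: permw_W chi_closed)
  also have "\<dots> = twisted_sum Q n (\<lambda>ys. f (B ys)) xs"
    unfolding twisted_sum_def using assms(4,5) module_homD[OF assms(3)]
    by (intro Q.finsum_cong') (auto simp: permw_W chi_closed)
  finally show ?thesis .
qed

lemma twisted_sum_sum:
  assumes P: "module K P" and xs: "xs \<in> words E n" and fin: "finite I"
    and B: "\<And>i ys. i \<in> I \<Longrightarrow> ys \<in> words E n \<Longrightarrow> B i ys \<in> carrier P"
    and a: "\<And>i. i \<in> I \<Longrightarrow> a i \<in> carrier K"
  shows "twisted_sum P n (\<lambda>ys. \<Oplus>\<^bsub>P\<^esub>i\<in>I. a i \<odot>\<^bsub>P\<^esub> B i ys) xs = (\<Oplus>\<^bsub>P\<^esub>i\<in>I. a i \<odot>\<^bsub>P\<^esub> twisted_sum P n (B i) xs)"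
proof -
  interpret P: module K P by fact
  have "twisted_sum P n (\<lambda>ys. \<Oplus>\<^bsub>P\<^esub>i\<in>I. a i \<odot>\<^bsub>P\<^esub> B i ys) xs
      = (\<Oplus>\<^bsub>P\<^esub>\<rho>\<in>W n. \<Oplus>\<^bsub>P\<^esub>i\<in>I. a i \<odot>\<^bsub>P\<^esub> (\<chi> n \<rho> \<odot>\<^bsub>P\<^esub> B i (permw \<rho> xs)))"
    unfolding twisted_sum_def
  proof (rule P.finsum_cong'[OF refl])
    fix \<rho> assume r: "\<rho> \<in> W n"
    note xr = permw_W[OF xs r] and c = chi_closed[OF r]
    have "\<chi> n \<rho> \<odot>\<^bsub>P\<^esub> (\<Oplus>\<^bsub>P\<^esub>i\<in>I. a i \<odot>\<^bsub>P\<^esub> B i (permw \<rho> xs))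
        = (\<Oplus>\<^bsub>P\<^esub>i\<in>I. \<chi> n \<rho> \<odot>\<^bsub>P\<^esub> (a i \<odot>\<^bsub>P\<^esub> B i (permw \<rho> xs)))"
      using fin c a B xr by (intro P.finsum_smult_ldistr) auto
    also have "\<dots> = (\<Oplus>\<^bsub>P\<^esub>i\<in>I. a i \<odot>\<^bsub>P\<^esub> (\<chi> n \<rho> \<odot>\<^bsub>P\<^esub> B i (permw \<rho> xs)))"
      using c a B xr by (intro P.finsum_cong') (auto simp: P.smult_assoc1[symmetric] K.m_comm)
    finally show "\<chi> n \<rho> \<odot>\<^bsub>P\<^esub> (\<Oplus>\<^bsub>P\<^esub>i\<in>I. a i \<odot>\<^bsub>P\<^esub> B i (permw \<rho> xs))
        = (\<Oplus>\<^bsub>P\<^esub>i\<in>I. a i \<odot>\<^bsub>P\<^esub> (\<chi> n \<rho> \<odot>\<^bsub>P\<^esub> B i (permw \<rho> xs)))" .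
  qed (use a B xs in \<open>auto intro!: P.finsum_closed simp: chi_closed permw_W\<close>)
  also have "\<dots> = (\<Oplus>\<^bsub>P\<^esub>i\<in>I. \<Oplus>\<^bsub>P\<^esub>\<rho>\<in>W n. a i \<odot>\<^bsub>P\<^esub> (\<chi> n \<rho> \<odot>\<^bsub>P\<^esub> B i (permw \<rho> xs)))"
    using a B xs fin W_finite by (intro P.finsum_swap) (auto simp: chi_closed permw_W)
  also have "\<dots> = (\<Oplus>\<^bsub>P\<^esub>i\<in>I. a i \<odot>\<^bsub>P\<^esub> twisted_sum P n (B i) xs)"
    unfolding twisted_sum_def using a B xs W_finite
    by (intro P.finsum_cong' P.finsum_smult_ldistr[symmetric] refl)
       (auto simp: chi_closed permw_W intro!: P.finsum_closed)
  finally show ?thesis .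
qed

text \<open>Permuting the word first replaces \<open>\<rho>\<close> by
  \<open>\<sigma> \<circ> \<rho>\<close> in the argument. The coefficient follows at the price of a
  factor \<open>\<chi> n \<sigma>\<close>, which is its own inverse, and left translation is a
  bijection of the group.\<close>

lemma twisted_sum_permw:
  assumes P: "module K P" and xs: "xs \<in> words E n" and s: "\<sigma> \<in> W n"
    and B: "\<And>ys. ys \<in> words E n \<Longrightarrow> B ys \<in> carrier P"
  shows "twisted_sum P n B (permw \<sigma> xs) = \<chi> n \<sigma> \<odot>\<^bsub>P\<^esub> twisted_sum P n B xs"
proof -
  interpret P: module K P by fact
  have "twisted_sum P n B (permw \<sigma> xs)
      = (\<Oplus>\<^bsub>P\<^esub>\<rho>\<in>W n. \<chi> n \<sigma> \<odot>\<^bsub>P\<^esub> (\<chi> n (\<sigma> \<circ> \<rho>) \<odot>\<^bsub>P\<^esub> B (permw (\<sigma> \<circ> \<rho>) xs)))"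
    unfolding twisted_sum_def
  proof (rule P.finsum_cong'[OF refl])
    fix \<rho> assume r: "\<rho> \<in> W n"
    have "\<chi> n \<sigma> \<otimes> (\<chi> n \<sigma> \<otimes> \<chi> n \<rho>) = \<chi> n \<rho>"
      using s r by (simp add: K.m_assoc[symmetric] chi_square chi_closed)
    then show "\<chi> n \<rho> \<odot>\<^bsub>P\<^esub> B (permw \<rho> (permw \<sigma> xs))
        = \<chi> n \<sigma> \<odot>\<^bsub>P\<^esub> (\<chi> n (\<sigma> \<circ> \<rho>) \<odot>\<^bsub>P\<^esub> B (permw (\<sigma> \<circ> \<rho>) xs))"
      using r s xs B permw_W[OF xs W_comp[OF s r]]
      by (simp add: permw_comp_W chi_comp chi_closed P.smult_assoc1[symmetric])
  qed (use s B xs in \<open>auto simp: chi_closed permw_W W_comp\<close>)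
  also have "\<dots> = (\<Oplus>\<^bsub>P\<^esub>\<rho>\<in>W n. \<chi> n \<sigma> \<odot>\<^bsub>P\<^esub> (\<chi> n \<rho> \<odot>\<^bsub>P\<^esub> B (permw \<rho> xs)))"
    using s B xs by (intro P.finsum_bij_betw[OF W_translate_bij(2)[OF s],
        where f = "\<lambda>\<rho>. \<chi> n \<sigma> \<odot>\<^bsub>P\<^esub> (\<chi> n \<rho> \<odot>\<^bsub>P\<^esub> B (permw \<rho> xs))"]) (auto simp: chi_closed permw_W)
  also have "\<dots> = \<chi> n \<sigma> \<odot>\<^bsub>P\<^esub> twisted_sum P n B xs"
    unfolding twisted_sum_def using s B xs W_finite
    by (intro P.finsum_smult_ldistr[symmetric]) (auto simp: chi_closed permw_W)
  finally show ?thesis .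
qed

lemma twisted_sum_form:
  assumes P: "module K P" and B: "multilinear K E n P B"
  shows "chi_form n P (twisted_sum P n B)"
proof -
  have "multilinear K E n P (\<lambda>xs. \<Oplus>\<^bsub>P\<^esub>\<rho>\<in>W n. \<chi> n \<rho> \<odot>\<^bsub>P\<^esub> B (permw \<rho> xs))"
    by (intro multilinear_sum[OF E.module_axioms P] multilinear_smult[OF E.module_axioms P]
        multilinear_permw[OF B] chi_closed W_permutes)
  then show ?thesis
    using twisted_sum_permw[OF P _ _ multilinear_closed[OF B]] by (auto simp: chi_form_def twisted_sum_def[abs_def])
qed

text \<open>A twisted sum over a smaller group inside one over \<open>W n\<close> collapses. For
  each \<open>\<pi>\<close> the two characters multiply to that of
  \<open>\<rho> \<circ> emb \<pi>\<close>, and right translation by \<open>emb \<pi>\<close>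
  restores the outer sum, so that there remain as many equal copies as \<open>W p\<close> has
  elements. It is applied to the inclusion of one group in another and to an iterated shift.\<close>

lemma twisted_sum_absorb:
  assumes P: "module K P" and xs: "xs \<in> words E n"
    and B: "\<And>ys. ys \<in> words E n \<Longrightarrow> B ys \<in> carrier P"
    and emb: "\<And>\<pi>. \<pi> \<in> W p \<Longrightarrow> emb \<pi> \<in> W n" "\<And>\<pi>. \<pi> \<in> W p \<Longrightarrow> \<chi> n (emb \<pi>) = \<chi> p \<pi>"
  shows "twisted_sum P n (\<lambda>ys. \<Oplus>\<^bsub>P\<^esub>\<pi>\<in>W p. \<chi> p \<pi> \<odot>\<^bsub>P\<^esub> B (permw (emb \<pi>) ys)) xs = N p \<odot>\<^bsub>P\<^esub> twisted_sum P n B xs"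
proof -
  interpret P: module K P by fact
  let ?H = "\<lambda>\<rho>. \<chi> n \<rho> \<odot>\<^bsub>P\<^esub> B (permw \<rho> xs)"
  have H: "?H \<rho> \<in> carrier P" if "\<rho> \<in> W n" for \<rho> using that xs B by (simp add: chi_closed permw_W)
  have "twisted_sum P n (\<lambda>ys. \<Oplus>\<^bsub>P\<^esub>\<pi>\<in>W p. \<chi> p \<pi> \<odot>\<^bsub>P\<^esub> B (permw (emb \<pi>) ys)) xs
      = (\<Oplus>\<^bsub>P\<^esub>\<pi>\<in>W p. \<chi> p \<pi> \<odot>\<^bsub>P\<^esub> twisted_sum P n (\<lambda>ys. B (permw (emb \<pi>) ys)) xs)"
    using emb(1) B xs W_finite by (intro twisted_sum_sum[OF P xs]) (auto simp: permw_W chi_closed)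
  also have "\<dots> = (\<Oplus>\<^bsub>P\<^esub>\<pi>\<in>W p. twisted_sum P n B xs)"
  proof (rule P.finsum_cong'[OF refl])
    fix \<pi> assume pi: "\<pi> \<in> W p"
    note e = emb(1)[OF pi]
    have "\<chi> p \<pi> \<odot>\<^bsub>P\<^esub> twisted_sum P n (\<lambda>ys. B (permw (emb \<pi>) ys)) xs
        = (\<Oplus>\<^bsub>P\<^esub>\<rho>\<in>W n. \<chi> p \<pi> \<odot>\<^bsub>P\<^esub> (\<chi> n \<rho> \<odot>\<^bsub>P\<^esub> B (permw (emb \<pi>) (permw \<rho> xs))))"
      unfolding twisted_sum_def using pi e B xs W_finite
      by (intro P.finsum_smult_ldistr) (auto simp: permw_W chi_closed)
    also have "\<dots> = (\<Oplus>\<^bsub>P\<^esub>\<rho>\<in>W n. ?H (\<rho> \<circ> emb \<pi>))"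
    proof (rule P.finsum_cong'[OF refl])
      fix \<rho> assume r: "\<rho> \<in> W n"
      show "\<chi> p \<pi> \<odot>\<^bsub>P\<^esub> (\<chi> n \<rho> \<odot>\<^bsub>P\<^esub> B (permw (emb \<pi>) (permw \<rho> xs))) = ?H (\<rho> \<circ> emb \<pi>)"
        using r e pi B permw_W[OF xs W_comp[OF r e]]
        by (simp add: permw_comp_W[OF xs e] chi_comp emb(2) chi_closed P.smult_assoc1[symmetric] K.m_comm)
    qed (use H W_comp e in blast)
    also have "\<dots> = twisted_sum P n B xs"
      unfolding twisted_sum_def by (rule P.finsum_bij_betw[OF W_translate_bij(1)[OF e], where f = ?H]) (rule H)
    finally show "\<chi> p \<pi> \<odot>\<^bsub>P\<^esub> twisted_sum P n (\<lambda>ys. B (permw (emb \<pi>) ys)) xs = twisted_sum P n B xs" .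
  qed (use twisted_sum_closed[OF P xs B] in auto)
  also have "\<dots> = N p \<odot>\<^bsub>P\<^esub> twisted_sum P n B xs"
    unfolding N_def by (rule P.finsum_const_smult[OF twisted_sum_closed[OF P xs B]])
  finally show ?thesis .
qed

sublocale C: module K C by (rule C_module)
sublocale CC: two_modules K C C by (rule two_modulesI[OF C_module C_module])

abbreviation "CC \<equiv> tensor_module K C C"

sublocale CCm: module K CC by (rule CC.tensor_module)

definition cut :: "nat \<Rightarrow> 'e list \<Rightarrow> _"
  where "cut p xs = pure_tensor K C C (w (take p xs)) (w (drop p xs))"

lemma w_multilinear: "multilinear K E d C w" using w_form by (simp add: chi_form_def)

lemma w_permw: "\<lbrakk>xs \<in> words E d; \<sigma> \<in> W d\<rbrakk> \<Longrightarrow> w (permw \<sigma> xs) = \<chi> d \<sigma> \<odot>\<^bsub>C\<^esub> w xs"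
  using w_form by (simp add: chi_form_def)

lemma cut_multilinear: "multilinear K E (p + h) CC (cut p)"
  unfolding cut_def[abs_def]
  by (rule multilinear_bilinear[OF CC.bilinear_pure_tensor w_multilinear w_multilinear])

lemma cut_closed: "\<lbrakk>xs \<in> words E n; p \<le> n\<rbrakk> \<Longrightarrow> cut p xs \<in> carrier CC"
  using multilinear_closed[OF cut_multilinear, of xs p "n - p"] by simp

lemma take_drop_young:
  assumes xs: "xs \<in> words E (p + h)" and s: "\<sigma> \<in> W p" and t: "\<tau> \<in> W h"
  shows "take p (permw (\<sigma> \<circ> (omega ^^ p) \<tau>) xs) = permw \<sigma> (take p xs)"
    and "drop p (permw (\<sigma> \<circ> (omega ^^ p) \<tau>) xs) = permw \<tau> (drop p xs)"
proof -
  have len: "length xs = p + h" using xs by (rule words_length)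
  have t': "(omega ^^ p) \<tau> \<in> W (p + h)" using W_omega[OF t, of p] by (simp add: add.commute)
  have eq: "permw (\<sigma> \<circ> (omega ^^ p) \<tau>) xs = permw ((omega ^^ p) \<tau>) (permw \<sigma> xs)"
    using permw_comp_W[OF xs t'] by simp
  show "take p (permw (\<sigma> \<circ> (omega ^^ p) \<tau>) xs) = permw \<sigma> (take p xs)"
    unfolding eq take_permw_omega[of \<tau>, OF W_zero[OF t]] using len
    by (intro permw_take[symmetric] W_permutes s) simp
  have "\<tau> permutes {1..length (permw \<sigma> xs) - p}" using W_permutes[OF t] len by simp
  then show "drop p (permw (\<sigma> \<circ> (omega ^^ p) \<tau>) xs) = permw \<tau> (drop p xs)"
    unfolding eq using permw_drop[of \<tau> "permw \<sigma> xs" p]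
    by (simp add: drop_permw_permutes[OF W_permutes[OF s]])
qed

lemma cut_young:
  assumes xs: "xs \<in> words E (p + h)" and s: "\<sigma> \<in> W p" and t: "\<tau> \<in> W h"
  shows "cut p (permw (\<sigma> \<circ> (omega ^^ p) \<tau>) xs) = (\<chi> p \<sigma> \<otimes> \<chi> h \<tau>) \<odot>\<^bsub>CC\<^esub> cut p xs"
proof -
  have t1: "take p xs \<in> words E p" and d1: "drop p xs \<in> words E h"
    using take_words[OF xs, of p] drop_words[OF xs, of p] by auto
  note wc = w_closed[OF t1] w_closed[OF d1]
  show ?thesis
    unfolding cut_def take_drop_young[OF assms] w_permw[OF t1 s] w_permw[OF d1 t]
    using wc chi_closed[OF s] chi_closed[OF t] CC.pure_tensor_closed[OF wc]
      module_homD(3)[OF bilinear_mapD(1)[OF CC.bilinear_pure_tensor]]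
      module_homD(3)[OF bilinear_mapD(2)[OF CC.bilinear_pure_tensor]]
    by (simp add: CCm.smult_assoc1[symmetric] K.m_comm)
qed

abbreviation "min_sum \<equiv> \<lambda>xs p h. \<Oplus>\<^bsub>CC\<^esub>\<rho>\<in>min_reps W p h.
         \<chi> (p + h) \<rho> \<odot>\<^bsub>CC\<^esub> pure_tensor K C C
           (w (map (\<lambda>t. letter xs (\<rho> t)) [1..<Suc p]))
           (w (map (\<lambda>t. letter xs (\<rho> t)) [Suc p..<Suc (p + h)]))"

lemma min_sum_eq:
  assumes xs: "xs \<in> words E (p + h)"
  shows "min_sum xs p h = (iN p \<otimes> iN h) \<odot>\<^bsub>CC\<^esub> twisted_sum CC (p + h) (cut p) xs"
proof -
  let ?F = "\<lambda>\<rho>. \<chi> (p + h) \<rho> \<odot>\<^bsub>CC\<^esub> cut p (permw \<rho> xs)"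
  have Fc: "?F \<rho> \<in> carrier CC" if "\<rho> \<in> W (p + h)" for \<rho>
    using that cut_closed[OF permw_W[OF xs that], of p] by (simp add: chi_closed)
  have "min_sum xs p h = (\<Oplus>\<^bsub>CC\<^esub>\<rho>\<in>min_reps W p h. ?F \<rho>)" (is "_ = ?S")
    unfolding cut_def using words_length[OF xs]
    by (simp add: take_permw drop_permw del: upt_Suc)
  have Sc: "?S \<in> carrier CC" using Fc min_reps_subset by (intro CCm.finsum_closed) blast
  have "twisted_sum CC (p + h) (cut p) xs = (N p \<otimes> N h) \<odot>\<^bsub>CC\<^esub> ?S"
    unfolding twisted_sum_def
  proof (rule sum_min_reps[OF CCm.module_axioms Fc])
    fix \<rho> \<sigma> \<tau> assume r: "\<rho> \<in> W (p + h)" and s: "\<sigma> \<in> W p" and t: "\<tau> \<in> W h"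
    let ?y = "\<sigma> \<circ> (omega ^^ p) \<tau>"
    note y = young_mem[OF s t]
    have c: "\<chi> p \<sigma> \<otimes> \<chi> h \<tau> \<in> carrier K" using chi_closed s t by simp
    \<comment> \<open>The factor occurs twice, in the character of \<open>\<rho> \<circ> ?y\<close>
      and when \<open>cut_young\<close> moves \<open>?y\<close> out of the two words. Being a value
      of the character, it has square one.\<close>
    have sq: "(\<chi> p \<sigma> \<otimes> \<chi> h \<tau>) \<otimes> (\<chi> p \<sigma> \<otimes> \<chi> h \<tau>) = \<one>"
      using chi_square[OF y(1)] y(2) by simp
    have "permw (\<rho> \<circ> ?y) xs = permw ?y (permw \<rho> xs)" using permw_comp_W[OF xs y(1)] by simp
    then have "?F (\<rho> \<circ> ?y) = (\<chi> (p + h) \<rho> \<otimes> (\<chi> p \<sigma> \<otimes> \<chi> h \<tau>)) \<odot>\<^bsub>CC\<^esub> ((\<chi> p \<sigma> \<otimes> \<chi> h \<tau>) \<odot>\<^bsub>CC\<^esub> cut p (permw \<rho> xs))"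
      using cut_young[OF permw_W[OF xs r] s t] chi_comp[OF r y(1)] y(2) by simp
    also have "\<dots> = ?F \<rho>"
      using c sq chi_closed[OF r] cut_closed[OF permw_W[OF xs r], of p]
      by (simp add: CCm.smult_assoc1[symmetric] K.m_assoc del: CCm.smult_assoc1)
    finally show "?F (\<rho> \<circ> ?y) = ?F \<rho>" .
  qed
  then have "(iN p \<otimes> iN h) \<odot>\<^bsub>CC\<^esub> twisted_sum CC (p + h) (cut p) xs = ((iN p \<otimes> iN h) \<otimes> (N p \<otimes> N h)) \<odot>\<^bsub>CC\<^esub> ?S"
    using Sc by (simp add: CCm.smult_assoc1)
  also have "(iN p \<otimes> iN h) \<otimes> (N p \<otimes> N h) = (iN p \<otimes> N p) \<otimes> (iN h \<otimes> N h)"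
    by (simp add: K.m_ac)
  also have "\<dots> = \<one>" by (simp add: iN_N)
  finally show ?thesis using Sc \<open>min_sum xs p h = ?S\<close> by simp
qed

definition comp_c :: "nat \<Rightarrow> 'e list \<Rightarrow> _"
  where "comp_c n xs = (\<Oplus>\<^bsub>CC\<^esub>p\<in>{..n}. (iN p \<otimes> iN (n - p)) \<odot>\<^bsub>CC\<^esub> twisted_sum CC n (cut p) xs)"

lemma chi_form_sum:
  assumes P: "module K P" and g: "\<And>i. i \<in> I \<Longrightarrow> chi_form n P (g i)" and fin: "finite I"
    and a: "\<And>i. i \<in> I \<Longrightarrow> a i \<in> carrier K"
  shows "chi_form n P (\<lambda>xs. \<Oplus>\<^bsub>P\<^esub>i\<in>I. a i \<odot>\<^bsub>P\<^esub> g i xs)"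
proof -
  interpret P: module K P by fact
  have gm: "multilinear K E n P (g i)" if "i \<in> I" for i using g[OF that] by (simp add: chi_form_def)
  have "(\<Oplus>\<^bsub>P\<^esub>i\<in>I. a i \<odot>\<^bsub>P\<^esub> g i (permw \<sigma> xs)) = \<chi> n \<sigma> \<odot>\<^bsub>P\<^esub> (\<Oplus>\<^bsub>P\<^esub>i\<in>I. a i \<odot>\<^bsub>P\<^esub> g i xs)"
    if xs: "xs \<in> words E n" and s: "\<sigma> \<in> W n" for xs \<sigma>
  proof -
    note c = chi_closed[OF s] and gc = multilinear_closed[OF gm xs]
    have "(\<Oplus>\<^bsub>P\<^esub>i\<in>I. a i \<odot>\<^bsub>P\<^esub> g i (permw \<sigma> xs)) = (\<Oplus>\<^bsub>P\<^esub>i\<in>I. \<chi> n \<sigma> \<odot>\<^bsub>P\<^esub> (a i \<odot>\<^bsub>P\<^esub> g i xs))"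
      using g xs s a c gc unfolding chi_form_def
      by (intro P.finsum_cong') (auto simp: P.smult_assoc1[symmetric] K.m_comm)
    also have "\<dots> = \<chi> n \<sigma> \<odot>\<^bsub>P\<^esub> (\<Oplus>\<^bsub>P\<^esub>i\<in>I. a i \<odot>\<^bsub>P\<^esub> g i xs)"
      using a gc c fin by (intro P.finsum_smult_ldistr[symmetric]) auto
    finally show ?thesis .
  qed
  moreover have "multilinear K E n P (\<lambda>xs. \<Oplus>\<^bsub>P\<^esub>i\<in>I. a i \<odot>\<^bsub>P\<^esub> g i xs)"
    by (intro multilinear_sum multilinear_smult E.module_axioms P gm a)
  ultimately show ?thesis by (simp add: chi_form_def)
qed

lemma chi_form_cong:
  assumes "chi_form n P g" "\<And>xs. xs \<in> words E n \<Longrightarrow> f xs = g xs"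
  shows "chi_form n P f"
  using assms multilinear_cong[OF _ E.module_axioms, of n P g f] permw_W
  by (auto simp: chi_form_def)

lemma twisted_sum_cut_form: "p \<le> n \<Longrightarrow> chi_form n CC (twisted_sum CC n (cut p))"
  using cut_multilinear[of p "n - p"] by (intro twisted_sum_form CCm.module_axioms) simp

lemma comp_c_form: "chi_form n CC (comp_c n)"
  unfolding comp_c_def[abs_def] by (intro chi_form_sum CCm.module_axioms twisted_sum_cut_form) auto

lemma comp_c_min:
  assumes xs: "xs \<in> words E n"
  shows "(\<Oplus>\<^bsub>CC\<^esub>p\<in>{..n}. \<Oplus>\<^bsub>CC\<^esub>\<rho>\<in>min_reps W p (n - p).
         \<chi> n \<rho> \<odot>\<^bsub>CC\<^esub> pure_tensor K C C
           (w (map (\<lambda>t. letter xs (\<rho> t)) [1..<Suc p]))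
           (w (map (\<lambda>t. letter xs (\<rho> t)) [Suc p..<Suc n]))) = comp_c n xs"
  unfolding comp_c_def
proof (rule CCm.finsum_cong'[OF refl])
  fix p assume p: "p \<in> {..n}"
  then show "(\<Oplus>\<^bsub>CC\<^esub>\<rho>\<in>min_reps W p (n - p).
         \<chi> n \<rho> \<odot>\<^bsub>CC\<^esub> pure_tensor K C C
           (w (map (\<lambda>t. letter xs (\<rho> t)) [1..<Suc p]))
           (w (map (\<lambda>t. letter xs (\<rho> t)) [Suc p..<Suc n])))
       = (iN p \<otimes> iN (n - p)) \<odot>\<^bsub>CC\<^esub> twisted_sum CC n (cut p) xs"
    using min_sum_eq[of xs p "n - p"] xs by (simp del: upt_Suc)
qed (use twisted_sum_closed[OF CCm.module_axioms xs] cut_closed in auto)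

abbreviation "c \<equiv> chi_comult K W \<chi> E"

lemma c_hom: "c \<in> module_hom K C CC"
  and c_w: "xs \<in> words E n \<Longrightarrow> c (w xs) = comp_c n xs"
proof -
  let ?g = "\<lambda>n xs. \<Oplus>\<^bsub>CC\<^esub>p\<in>{..n}. \<Oplus>\<^bsub>CC\<^esub>\<rho>\<in>min_reps W p (n - p).
         \<chi> n \<rho> \<odot>\<^bsub>CC\<^esub> pure_tensor K C C
           (w (map (\<lambda>t. letter xs (\<rho> t)) [1..<Suc p]))
           (w (map (\<lambda>t. letter xs (\<rho> t)) [Suc p..<Suc n]))"
  \<comment> \<open>The comultiplication is a lift of the literal sum over minimal representatives.
    Its equivariance is invisible there and is borrowed from \<open>comp_c\<close>, which agrees
    with it on words.\<close>
  have "chi_form n CC (?g n)" for n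
    by (rule chi_form_cong[OF comp_c_form comp_c_min])
  note * = chi_form_dsum_lift[OF CCm.module_axioms this]
  have eq: "c = dsum_lift A CC (\<lambda>n. chi_lift K CC (?g n))"
    by (simp add: chi_comult_def Let_def)
  show "c \<in> module_hom K C CC" unfolding eq by (rule *(2))
  show "c (w xs) = comp_c n xs" if "xs \<in> words E n"
    unfolding eq *(1)[OF that] by (rule comp_c_min[OF that])
qed

text \<open>Reduces every computation with the comultiplication to single cuts: coassociativity,
  both counit laws and the pairing with a product only need the value of a linear map on
  \<open>cut p ys\<close>.\<close>

lemma hom_comp_c:
  assumes P: "module K P" and f: "f \<in> module_hom K CC P" and xs: "xs \<in> words E n"
  shows "f (comp_c n xs) = (\<Oplus>\<^bsub>P\<^esub>p\<in>{..n}. (iN p \<otimes> iN (n - p)) \<odot>\<^bsub>P\<^esub> twisted_sum P n (\<lambda>ys. f (cut p ys)) xs)"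
proof -
  interpret P: module K P by fact
  have Avc: "twisted_sum CC n (cut p) xs \<in> carrier CC" if "p \<in> {..n}" for p
    using that twisted_sum_closed[OF CCm.module_axioms xs] cut_closed by auto
  have "f (comp_c n xs) = (\<Oplus>\<^bsub>P\<^esub>p\<in>{..n}. f ((iN p \<otimes> iN (n - p)) \<odot>\<^bsub>CC\<^esub> twisted_sum CC n (cut p) xs))"
    unfolding comp_c_def using Avc by (intro module_hom_finsum[OF f CCm.module_axioms P]) auto
  also have "\<dots> = (\<Oplus>\<^bsub>P\<^esub>p\<in>{..n}. (iN p \<otimes> iN (n - p)) \<odot>\<^bsub>P\<^esub> twisted_sum P n (\<lambda>ys. f (cut p ys)) xs)"
  proof (rule P.finsum_cong'[OF refl])
    fix p assume p: "p \<in> {..n}"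
    have "f (twisted_sum CC n (cut p) xs) = twisted_sum P n (\<lambda>ys. f (cut p ys)) xs"
      by (rule twisted_sum_hom[OF CCm.module_axioms P f xs]) (use p cut_closed in auto)
    then show "f ((iN p \<otimes> iN (n - p)) \<odot>\<^bsub>CC\<^esub> twisted_sum CC n (cut p) xs)
        = (iN p \<otimes> iN (n - p)) \<odot>\<^bsub>P\<^esub> twisted_sum P n (\<lambda>ys. f (cut p ys)) xs"
      using Avc[OF p] by (simp add: module_homD(3)[OF f])
  next
    have "twisted_sum P n (\<lambda>ys. f (cut p ys)) xs \<in> carrier P" if "p \<in> {..n}" for p
      by (rule twisted_sum_closed[OF P xs]) (use that cut_closed module_homD(1)[OF f] in auto)
    then show "(\<lambda>p. (iN p \<otimes> iN (n - p)) \<odot>\<^bsub>P\<^esub> twisted_sum P n (\<lambda>ys. f (cut p ys)) xs) \<in> {..n} \<rightarrow> carrier P"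
      by auto
  qed
  finally show ?thesis .
qed

section \<open>Coassociativity\<close>

sublocale L: two_modules K CC C by (rule two_modulesI[OF CCm.module_axioms C_module])
sublocale R3: two_modules K C CC by (rule two_modulesI[OF C_module CCm.module_axioms])

abbreviation "T3 \<equiv> tensor_module K C CC"
sublocale T3: module K T3 by (rule R3.tensor_module)

abbreviation "t3 a b z \<equiv> pure_tensor K C CC a (pure_tensor K C C b z)"

definition tri :: "nat \<Rightarrow> nat \<Rightarrow> 'e list \<Rightarrow> _"
  where "tri q p zs = t3 (w (take q zs)) (w (take (p - q) (drop q zs))) (w (drop p zs))"

lemma tri_closed:
  assumes "zs \<in> words E n" "q \<le> p" "p \<le> n" shows "tri q p zs \<in> carrier T3"
proof -
  have "take q zs \<in> words E q" "take (p - q) (drop q zs) \<in> words E (p - q)" "drop p zs \<in> words E (n - p)"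
    using assms take_words[OF assms(1), of q] drop_words[OF assms(1)]
      take_words[OF drop_words[OF assms(1), of q], of "p - q"] by auto
  then show ?thesis unfolding tri_def
    by (intro R3.pure_tensor_closed CC.pure_tensor_closed w_closed)
qed

text \<open>Comultiplying the left factor permutes the first \<open>p\<close> letters. Elements of
  \<open>W p\<close> fix all later positions, so these permutations may be applied to the whole word
  instead; in this shape the sum can be absorbed by the outer one.\<close>

lemma left_cut:
  assumes xs: "xs \<in> words E n" and p: "p \<le> n"
  shows "tensor_assoc K C C C (tensor_map K CC C c (\<lambda>x. x) (cut p xs))
    = (\<Oplus>\<^bsub>T3\<^esub>q\<in>{..p}. (iN q \<otimes> iN (p - q)) \<odot>\<^bsub>T3\<^esub>
        (\<Oplus>\<^bsub>T3\<^esub>\<pi>\<in>W p. \<chi> p \<pi> \<odot>\<^bsub>T3\<^esub> tri q p (permw \<pi> xs)))"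
proof -
  let ?b = "w (drop p xs)"
  have t: "take p xs \<in> words E p" and b: "?b \<in> carrier C"
    using take_words[OF xs p] w_closed[OF drop_words[OF xs]] by auto
  let ?f = "\<lambda>u. tensor_assoc K C C C (pure_tensor K CC C u ?b)"
  have f: "?f \<in> module_hom K CC T3"
    by (rule module_hom_comp[OF bilinear_mapD(1)[OF L.bilinear_pure_tensor b]
        tensor_assoc_hom[OF C_module C_module C_module]])
  have fcut: "?f (cut q ys) = t3 (w (take q ys)) (w (drop q ys)) ?b" if "ys \<in> words E p" "q \<le> p" for q ys
    unfolding cut_def using that
    by (intro tensor_assoc_pure C_module b) (auto intro: w_closed take_words drop_words)
  have "tensor_map K CC C c (\<lambda>x. x) (cut p xs) = pure_tensor K CC C (c (w (take p xs))) ?b"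
    unfolding cut_def
    by (rule tensor_map_pure[OF C_module C_module CCm.module_axioms C_module c_hom module_hom_id w_closed[OF t] b])
  then have "tensor_assoc K C C C (tensor_map K CC C c (\<lambda>x. x) (cut p xs)) = ?f (comp_c p (take p xs))"
    by (simp add: c_w[OF t])
  also have "\<dots> = (\<Oplus>\<^bsub>T3\<^esub>q\<in>{..p}. (iN q \<otimes> iN (p - q)) \<odot>\<^bsub>T3\<^esub> twisted_sum T3 p (\<lambda>ys. ?f (cut q ys)) (take p xs))"
    by (rule hom_comp_c[OF T3.module_axioms f t])
  also have "\<dots> = (\<Oplus>\<^bsub>T3\<^esub>q\<in>{..p}. (iN q \<otimes> iN (p - q)) \<odot>\<^bsub>T3\<^esub>
        (\<Oplus>\<^bsub>T3\<^esub>\<pi>\<in>W p. \<chi> p \<pi> \<odot>\<^bsub>T3\<^esub> tri q p (permw \<pi> xs)))"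
  proof (rule T3.finsum_cong'[OF refl])
    have px: "permw \<pi> xs \<in> words E n" if "\<pi> \<in> W p" for \<pi>
      using W_mono[OF that p] permw_W[OF xs] by blast
    show "(iN q \<otimes> iN (p - q)) \<odot>\<^bsub>T3\<^esub> twisted_sum T3 p (\<lambda>ys. ?f (cut q ys)) (take p xs) = (iN q \<otimes> iN (p - q)) \<odot>\<^bsub>T3\<^esub>
        (\<Oplus>\<^bsub>T3\<^esub>\<pi>\<in>W p. \<chi> p \<pi> \<odot>\<^bsub>T3\<^esub> tri q p (permw \<pi> xs))" if q: "q \<in> {..p}" for q
    proof -
      have "twisted_sum T3 p (\<lambda>ys. ?f (cut q ys)) (take p xs) = (\<Oplus>\<^bsub>T3\<^esub>\<pi>\<in>W p. \<chi> p \<pi> \<odot>\<^bsub>T3\<^esub> tri q p (permw \<pi> xs))"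
        unfolding twisted_sum_def
      proof (rule T3.finsum_cong'[OF refl])
        fix \<pi> assume pi: "\<pi> \<in> W p"
        have pt: "permw \<pi> (take p xs) = take p (permw \<pi> xs)"
          using W_permutes[OF pi] p words_length[OF xs] by (intro permw_take) auto
        have pd: "drop p xs = drop p (permw \<pi> xs)"
          using drop_permw_permutes[OF W_permutes[OF pi], of xs] by simp
        have tt: "take p (permw \<pi> xs) \<in> words E p" using px[OF pi] p by (rule take_words)
        show "\<chi> p \<pi> \<odot>\<^bsub>T3\<^esub> ?f (cut q (permw \<pi> (take p xs))) = \<chi> p \<pi> \<odot>\<^bsub>T3\<^esub> tri q p (permw \<pi> xs)"
          unfolding pt fcut[OF tt q[unfolded atMost_iff]] tri_def pd[symmetric]
          using q by (simp add: min_def drop_take)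
      qed (use q tri_closed[OF px _ p] chi_closed in auto)
      then show ?thesis by simp
    qed
    show "(\<lambda>q. (iN q \<otimes> iN (p - q)) \<odot>\<^bsub>T3\<^esub>
        (\<Oplus>\<^bsub>T3\<^esub>\<pi>\<in>W p. \<chi> p \<pi> \<odot>\<^bsub>T3\<^esub> tri q p (permw \<pi> xs))) \<in> {..p} \<rightarrow> carrier T3"
      using tri_closed[OF px _ p] chi_closed by (auto intro!: T3.smult_closed T3.finsum_closed)
  qed
  finally show ?thesis .
qed

text \<open>Here the letters after the first \<open>q\<close> are permuted. On the whole word the
  same effect is produced by the \<open>q\<close>-fold shift of the permutation, which leaves the
  first \<open>q\<close> positions alone.\<close>

lemma right_cut:
  assumes xs: "xs \<in> words E n" and q: "q \<le> n"
  shows "tensor_map K C CC (\<lambda>x. x) c (cut q xs)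
    = (\<Oplus>\<^bsub>T3\<^esub>s\<in>{..n - q}. (iN s \<otimes> iN (n - q - s)) \<odot>\<^bsub>T3\<^esub>
        (\<Oplus>\<^bsub>T3\<^esub>\<pi>\<in>W (n - q). \<chi> (n - q) \<pi> \<odot>\<^bsub>T3\<^esub> tri q (q + s) (permw ((omega ^^ q) \<pi>) xs)))"
proof -
  let ?a = "w (take q xs)"
  have d: "drop q xs \<in> words E (n - q)" and a: "?a \<in> carrier C"
    using drop_words[OF xs] w_closed[OF take_words[OF xs q]] by auto
  let ?f = "\<lambda>u. pure_tensor K C CC ?a u"
  have f: "?f \<in> module_hom K CC T3" by (rule bilinear_mapD(2)[OF R3.bilinear_pure_tensor a])
  have "tensor_map K C CC (\<lambda>x. x) c (cut q xs) = ?f (c (w (drop q xs)))"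
    unfolding cut_def
    by (rule tensor_map_pure[OF C_module C_module C_module CCm.module_axioms module_hom_id c_hom a w_closed[OF d]])
  also have "\<dots> = ?f (comp_c (n - q) (drop q xs))" by (simp add: c_w[OF d])
  also have "\<dots> = (\<Oplus>\<^bsub>T3\<^esub>s\<in>{..n - q}. (iN s \<otimes> iN (n - q - s)) \<odot>\<^bsub>T3\<^esub> twisted_sum T3 (n - q) (\<lambda>ys. ?f (cut s ys)) (drop q xs))"
    by (rule hom_comp_c[OF T3.module_axioms f d])
  also have "\<dots> = (\<Oplus>\<^bsub>T3\<^esub>s\<in>{..n - q}. (iN s \<otimes> iN (n - q - s)) \<odot>\<^bsub>T3\<^esub>
        (\<Oplus>\<^bsub>T3\<^esub>\<pi>\<in>W (n - q). \<chi> (n - q) \<pi> \<odot>\<^bsub>T3\<^esub> tri q (q + s) (permw ((omega ^^ q) \<pi>) xs)))"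
  proof (rule T3.finsum_cong'[OF refl])
    have px: "permw ((omega ^^ q) \<pi>) xs \<in> words E n" if "\<pi> \<in> W (n - q)" for \<pi>
      using W_omega[OF that, of q] q permw_W[OF xs] by simp
    show "(iN s \<otimes> iN (n - q - s)) \<odot>\<^bsub>T3\<^esub> twisted_sum T3 (n - q) (\<lambda>ys. ?f (cut s ys)) (drop q xs)
        = (iN s \<otimes> iN (n - q - s)) \<odot>\<^bsub>T3\<^esub>
        (\<Oplus>\<^bsub>T3\<^esub>\<pi>\<in>W (n - q). \<chi> (n - q) \<pi> \<odot>\<^bsub>T3\<^esub> tri q (q + s) (permw ((omega ^^ q) \<pi>) xs))"
      if s: "s \<in> {..n - q}" for s
    proof -
      have "twisted_sum T3 (n - q) (\<lambda>ys. ?f (cut s ys)) (drop q xs)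
          = (\<Oplus>\<^bsub>T3\<^esub>\<pi>\<in>W (n - q). \<chi> (n - q) \<pi> \<odot>\<^bsub>T3\<^esub> tri q (q + s) (permw ((omega ^^ q) \<pi>) xs))"
        unfolding twisted_sum_def
      proof (rule T3.finsum_cong'[OF refl])
        fix \<pi> assume pi: "\<pi> \<in> W (n - q)"
        have pd: "permw \<pi> (drop q xs) = drop q (permw ((omega ^^ q) \<pi>) xs)"
          using W_permutes[OF pi] words_length[OF xs] by (intro permw_drop) simp
        have pt: "take q xs = take q (permw ((omega ^^ q) \<pi>) xs)"
          by (rule take_permw_omega[of \<pi>, OF W_zero[OF pi], symmetric])
        show "\<chi> (n - q) \<pi> \<odot>\<^bsub>T3\<^esub> ?f (cut s (permw \<pi> (drop q xs)))
            = \<chi> (n - q) \<pi> \<odot>\<^bsub>T3\<^esub> tri q (q + s) (permw ((omega ^^ q) \<pi>) xs)"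
          unfolding pd cut_def tri_def pt by (simp add: add.commute)
      next
        have "tri q (q + s) (permw ((omega ^^ q) \<pi>) xs) \<in> carrier T3" if "\<pi> \<in> W (n - q)" for \<pi>
          by (rule tri_closed[OF px[OF that]]) (use s q in auto)
        then show "(\<lambda>\<pi>. \<chi> (n - q) \<pi> \<odot>\<^bsub>T3\<^esub> tri q (q + s) (permw ((omega ^^ q) \<pi>) xs)) \<in> W (n - q) \<rightarrow> carrier T3"
          using chi_closed by auto
      qed
      then show ?thesis by simp
    qed
    have "tri q (q + s) (permw ((omega ^^ q) \<pi>) xs) \<in> carrier T3" if "\<pi> \<in> W (n - q)" "s \<le> n - q" for \<pi> s
      by (rule tri_closed[OF px[OF that(1)]]) (use that q in auto)
    then show "(\<lambda>s. (iN s \<otimes> iN (n - q - s)) \<odot>\<^bsub>T3\<^esub>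
        (\<Oplus>\<^bsub>T3\<^esub>\<pi>\<in>W (n - q). \<chi> (n - q) \<pi> \<odot>\<^bsub>T3\<^esub> tri q (q + s) (permw ((omega ^^ q) \<pi>) xs)))
        \<in> {..n - q} \<rightarrow> carrier T3"
      using chi_closed by (auto intro!: T3.smult_closed T3.finsum_closed)
  qed
  finally show ?thesis .
qed

text \<open>The group order produced by \<open>twisted_sum_absorb\<close> cancels against the
  inverse order \<open>iN m\<close> belonging to the piece that was cut a second time. Only the
  inverse orders for the three final pieces survive.\<close>

lemma iN_collapse:
  assumes P: "module K P" and fin: "finite I" and u: "u \<in> carrier K"
    and k: "\<And>i. i \<in> I \<Longrightarrow> k i \<in> carrier K" and Y: "\<And>i. i \<in> I \<Longrightarrow> Y i \<in> carrier P"
  shows "(iN m \<otimes> u) \<odot>\<^bsub>P\<^esub> (\<Oplus>\<^bsub>P\<^esub>i\<in>I. k i \<odot>\<^bsub>P\<^esub> (N m \<odot>\<^bsub>P\<^esub> Y i)) = (\<Oplus>\<^bsub>P\<^esub>i\<in>I. (k i \<otimes> u) \<odot>\<^bsub>P\<^esub> Y i)"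
proof -
  interpret P: module K P by fact
  have "(iN m \<otimes> u) \<odot>\<^bsub>P\<^esub> (\<Oplus>\<^bsub>P\<^esub>i\<in>I. k i \<odot>\<^bsub>P\<^esub> (N m \<odot>\<^bsub>P\<^esub> Y i))
      = (\<Oplus>\<^bsub>P\<^esub>i\<in>I. (iN m \<otimes> u) \<odot>\<^bsub>P\<^esub> (k i \<odot>\<^bsub>P\<^esub> (N m \<odot>\<^bsub>P\<^esub> Y i)))"
    using fin u k Y by (intro P.finsum_smult_ldistr) auto
  also have "\<dots> = (\<Oplus>\<^bsub>P\<^esub>i\<in>I. (k i \<otimes> u) \<odot>\<^bsub>P\<^esub> Y i)"
  proof (rule P.finsum_cong'[OF refl])
    fix i assume i: "i \<in> I"
    have "(iN m \<otimes> u) \<otimes> (k i \<otimes> N m) = (iN m \<otimes> N m) \<otimes> (k i \<otimes> u)"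
      using u k[OF i] iN_closed[of m] N_closed[of m] by algebra
    then show "(iN m \<otimes> u) \<odot>\<^bsub>P\<^esub> (k i \<odot>\<^bsub>P\<^esub> (N m \<odot>\<^bsub>P\<^esub> Y i)) = (k i \<otimes> u) \<odot>\<^bsub>P\<^esub> Y i"
      using u k[OF i] Y[OF i] by (simp add: P.smult_assoc1[symmetric] iN_N)
  qed (use u k Y in auto)
  finally show ?thesis .
qed

lemma left_words:
  assumes xs: "xs \<in> words E n"
  shows "tensor_assoc K C C C (tensor_map K CC C c (\<lambda>x. x) (c (w xs)))
    = (\<Oplus>\<^bsub>T3\<^esub>p\<in>{..n}. \<Oplus>\<^bsub>T3\<^esub>q\<in>{..p}. ((iN q \<otimes> iN (p - q)) \<otimes> iN (n - p)) \<odot>\<^bsub>T3\<^esub> twisted_sum T3 n (tri q p) xs)"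
proof -
  let ?f = "\<lambda>u. tensor_assoc K C C C (tensor_map K CC C c (\<lambda>x. x) u)"
  have f: "?f \<in> module_hom K CC T3"
    by (rule module_hom_comp[OF tensor_map_hom[OF C_module C_module CCm.module_axioms C_module c_hom module_hom_id]
          tensor_assoc_hom[OF C_module C_module C_module]])
  have "?f (c (w xs)) = (\<Oplus>\<^bsub>T3\<^esub>p\<in>{..n}. (iN p \<otimes> iN (n - p)) \<odot>\<^bsub>T3\<^esub> twisted_sum T3 n (\<lambda>ys. ?f (cut p ys)) xs)"
    unfolding c_w[OF xs] by (rule hom_comp_c[OF T3.module_axioms f xs])
  also have "\<dots> = (\<Oplus>\<^bsub>T3\<^esub>p\<in>{..n}. \<Oplus>\<^bsub>T3\<^esub>q\<in>{..p}. ((iN q \<otimes> iN (p - q)) \<otimes> iN (n - p)) \<odot>\<^bsub>T3\<^esub> twisted_sum T3 n (tri q p) xs)"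
  proof (rule T3.finsum_cong'[OF refl])
    fix p assume "p \<in> {..n}"
    then have p: "p \<le> n" by simp
    have tc: "tri q p ys \<in> carrier T3" if "q \<in> {..p}" "ys \<in> words E n" for q ys
      using tri_closed[OF that(2) _ p] that(1) by simp
    have px: "permw \<pi> ys \<in> words E n" if "\<pi> \<in> W p" "ys \<in> words E n" for \<pi> ys
      using W_mono[OF that(1) p] permw_W[OF that(2)] by blast
    let ?B = "\<lambda>q ys. \<Oplus>\<^bsub>T3\<^esub>\<pi>\<in>W p. \<chi> p \<pi> \<odot>\<^bsub>T3\<^esub> tri q p (permw \<pi> ys)"
    have Bc: "?B q ys \<in> carrier T3" if "q \<in> {..p}" "ys \<in> words E n" for q ys
      using tc[OF that(1) px[OF _ that(2)]] chi_closed by (auto intro!: T3.finsum_closed)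
    have Avc: "twisted_sum T3 n (tri q p) xs \<in> carrier T3" if "q \<in> {..p}" for q
      by (rule twisted_sum_closed[OF T3.module_axioms xs tc[OF that]])
    have "twisted_sum T3 n (\<lambda>ys. ?f (cut p ys)) xs = twisted_sum T3 n (\<lambda>ys. \<Oplus>\<^bsub>T3\<^esub>q\<in>{..p}. (iN q \<otimes> iN (p - q)) \<odot>\<^bsub>T3\<^esub> ?B q ys) xs"
      using Bc by (intro twisted_sum_cong[OF T3.module_axioms xs] T3.finsum_closed left_cut[OF _ p]) auto
    also have "\<dots> = (\<Oplus>\<^bsub>T3\<^esub>q\<in>{..p}. (iN q \<otimes> iN (p - q)) \<odot>\<^bsub>T3\<^esub> twisted_sum T3 n (?B q) xs)"
      using Bc by (intro twisted_sum_sum[OF T3.module_axioms xs]) auto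
    also have "\<dots> = (\<Oplus>\<^bsub>T3\<^esub>q\<in>{..p}. (iN q \<otimes> iN (p - q)) \<odot>\<^bsub>T3\<^esub> (N p \<odot>\<^bsub>T3\<^esub> twisted_sum T3 n (tri q p) xs))"
    proof (rule T3.finsum_cong'[OF refl])
      fix q assume q: "q \<in> {..p}"
      have "twisted_sum T3 n (?B q) xs = N p \<odot>\<^bsub>T3\<^esub> twisted_sum T3 n (tri q p) xs"
        by (rule twisted_sum_absorb[OF T3.module_axioms xs tc[OF q], where emb = "\<lambda>\<pi>. \<pi>"])
           (use W_mono[OF _ p] in auto)
      then show "(iN q \<otimes> iN (p - q)) \<odot>\<^bsub>T3\<^esub> twisted_sum T3 n (?B q) xs
          = (iN q \<otimes> iN (p - q)) \<odot>\<^bsub>T3\<^esub> (N p \<odot>\<^bsub>T3\<^esub> twisted_sum T3 n (tri q p) xs)" by simp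
    qed (use Avc in auto)
    finally have "twisted_sum T3 n (\<lambda>ys. ?f (cut p ys)) xs = \<dots>" .
    then show "(iN p \<otimes> iN (n - p)) \<odot>\<^bsub>T3\<^esub> twisted_sum T3 n (\<lambda>ys. ?f (cut p ys)) xs
        = (\<Oplus>\<^bsub>T3\<^esub>q\<in>{..p}. ((iN q \<otimes> iN (p - q)) \<otimes> iN (n - p)) \<odot>\<^bsub>T3\<^esub> twisted_sum T3 n (tri q p) xs)"
      using iN_collapse[OF T3.module_axioms, of "{..p}" "iN (n - p)" "\<lambda>q. iN q \<otimes> iN (p - q)"
          "\<lambda>q. twisted_sum T3 n (tri q p) xs" p] Avc by simp
  next
    have "twisted_sum T3 n (tri q p) xs \<in> carrier T3" if "p \<in> {..n}" "q \<in> {..p}" for p q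
      by (rule twisted_sum_closed[OF T3.module_axioms xs tri_closed]) (use that in auto)
    then show "(\<lambda>p. \<Oplus>\<^bsub>T3\<^esub>q\<in>{..p}. ((iN q \<otimes> iN (p - q)) \<otimes> iN (n - p)) \<odot>\<^bsub>T3\<^esub> twisted_sum T3 n (tri q p) xs)
        \<in> {..n} \<rightarrow> carrier T3"
      by (auto intro!: T3.finsum_closed)
  qed
  finally show ?thesis .
qed

lemma right_words:
  assumes xs: "xs \<in> words E n"
  shows "tensor_map K C CC (\<lambda>x. x) c (c (w xs))
    = (\<Oplus>\<^bsub>T3\<^esub>q\<in>{..n}. \<Oplus>\<^bsub>T3\<^esub>s\<in>{..n - q}. ((iN s \<otimes> iN (n - q - s)) \<otimes> iN q) \<odot>\<^bsub>T3\<^esub> twisted_sum T3 n (tri q (q + s)) xs)"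
proof -
  let ?f = "\<lambda>u. tensor_map K C CC (\<lambda>x. x) c u"
  have f: "?f \<in> module_hom K CC T3"
    by (rule tensor_map_hom[OF C_module C_module C_module CCm.module_axioms module_hom_id c_hom])
  have "?f (c (w xs)) = (\<Oplus>\<^bsub>T3\<^esub>q\<in>{..n}. (iN q \<otimes> iN (n - q)) \<odot>\<^bsub>T3\<^esub> twisted_sum T3 n (\<lambda>ys. ?f (cut q ys)) xs)"
    unfolding c_w[OF xs] by (rule hom_comp_c[OF T3.module_axioms f xs])
  also have "\<dots> = (\<Oplus>\<^bsub>T3\<^esub>q\<in>{..n}. \<Oplus>\<^bsub>T3\<^esub>s\<in>{..n - q}. ((iN s \<otimes> iN (n - q - s)) \<otimes> iN q) \<odot>\<^bsub>T3\<^esub> twisted_sum T3 n (tri q (q + s)) xs)"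
  proof (rule T3.finsum_cong'[OF refl])
    fix q assume "q \<in> {..n}"
    then have q: "q \<le> n" by simp
    have tc: "tri q (q + s) ys \<in> carrier T3" if "s \<in> {..n - q}" "ys \<in> words E n" for s ys
      by (rule tri_closed[OF that(2)]) (use that(1) q in auto)
    have emb: "(omega ^^ q) \<pi> \<in> W n" "\<chi> n ((omega ^^ q) \<pi>) = \<chi> (n - q) \<pi>" if "\<pi> \<in> W (n - q)" for \<pi>
      using W_omega[OF that, of q] q by auto
    let ?B = "\<lambda>s ys. \<Oplus>\<^bsub>T3\<^esub>\<pi>\<in>W (n - q). \<chi> (n - q) \<pi> \<odot>\<^bsub>T3\<^esub> tri q (q + s) (permw ((omega ^^ q) \<pi>) ys)"
    have Bc: "?B s ys \<in> carrier T3" if "s \<in> {..n - q}" "ys \<in> words E n" for s ys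
      using tc[OF that(1) permw_W[OF that(2) emb(1)]] chi_closed by (auto intro!: T3.finsum_closed)
    have Avc: "twisted_sum T3 n (tri q (q + s)) xs \<in> carrier T3" if "s \<in> {..n - q}" for s
      by (rule twisted_sum_closed[OF T3.module_axioms xs tc[OF that]])
    have "twisted_sum T3 n (\<lambda>ys. ?f (cut q ys)) xs
        = twisted_sum T3 n (\<lambda>ys. \<Oplus>\<^bsub>T3\<^esub>s\<in>{..n - q}. (iN s \<otimes> iN (n - q - s)) \<odot>\<^bsub>T3\<^esub> ?B s ys) xs"
      using Bc by (intro twisted_sum_cong[OF T3.module_axioms xs] T3.finsum_closed right_cut[OF _ q]) auto
    also have "\<dots> = (\<Oplus>\<^bsub>T3\<^esub>s\<in>{..n - q}. (iN s \<otimes> iN (n - q - s)) \<odot>\<^bsub>T3\<^esub> twisted_sum T3 n (?B s) xs)"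
      using Bc by (intro twisted_sum_sum[OF T3.module_axioms xs]) auto
    also have "\<dots> = (\<Oplus>\<^bsub>T3\<^esub>s\<in>{..n - q}. (iN s \<otimes> iN (n - q - s)) \<odot>\<^bsub>T3\<^esub> (N (n - q) \<odot>\<^bsub>T3\<^esub> twisted_sum T3 n (tri q (q + s)) xs))"
    proof (rule T3.finsum_cong'[OF refl])
      fix s assume s: "s \<in> {..n - q}"
      have "twisted_sum T3 n (?B s) xs = N (n - q) \<odot>\<^bsub>T3\<^esub> twisted_sum T3 n (tri q (q + s)) xs"
        by (rule twisted_sum_absorb[OF T3.module_axioms xs tc[OF s] emb])
      then show "(iN s \<otimes> iN (n - q - s)) \<odot>\<^bsub>T3\<^esub> twisted_sum T3 n (?B s) xs
          = (iN s \<otimes> iN (n - q - s)) \<odot>\<^bsub>T3\<^esub> (N (n - q) \<odot>\<^bsub>T3\<^esub> twisted_sum T3 n (tri q (q + s)) xs)" by simp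
    qed (use Avc in auto)
    finally have "twisted_sum T3 n (\<lambda>ys. ?f (cut q ys)) xs = \<dots>" .
    then show "(iN q \<otimes> iN (n - q)) \<odot>\<^bsub>T3\<^esub> twisted_sum T3 n (\<lambda>ys. ?f (cut q ys)) xs
        = (\<Oplus>\<^bsub>T3\<^esub>s\<in>{..n - q}. ((iN s \<otimes> iN (n - q - s)) \<otimes> iN q) \<odot>\<^bsub>T3\<^esub> twisted_sum T3 n (tri q (q + s)) xs)"
      using iN_collapse[OF T3.module_axioms, of "{..n - q}" "iN q" "\<lambda>s. iN s \<otimes> iN (n - q - s)"
          "\<lambda>s. twisted_sum T3 n (tri q (q + s)) xs" "n - q"] Avc K.m_comm[of "iN q" "iN (n - q)"] by simp
  next
    have "twisted_sum T3 n (tri q (q + s)) xs \<in> carrier T3" if "q \<in> {..n}" "s \<in> {..n - q}" for q s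
      by (rule twisted_sum_closed[OF T3.module_axioms xs tri_closed]) (use that in auto)
    then show "(\<lambda>q. \<Oplus>\<^bsub>T3\<^esub>s\<in>{..n - q}. ((iN s \<otimes> iN (n - q - s)) \<otimes> iN q) \<odot>\<^bsub>T3\<^esub> twisted_sum T3 n (tri q (q + s)) xs)
        \<in> {..n} \<rightarrow> carrier T3"
      by (auto intro!: T3.finsum_closed)
  qed
  finally show ?thesis .
qed

theorem coassociative:
  assumes "z \<in> carrier C"
  shows "tensor_assoc K C C C (tensor_map K CC C c (\<lambda>x. x) (c z)) = tensor_map K C CC (\<lambda>x. x) c (c z)"
proof (rule C_hom_eq[OF T3.module_axioms _ _ _ assms])
  show "(\<lambda>z. tensor_map K C CC (\<lambda>x. x) c (c z)) \<in> module_hom K C T3"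
    by (rule module_hom_comp[OF c_hom
        tensor_map_hom[OF C_module C_module C_module CCm.module_axioms module_hom_id c_hom]])
  show "(\<lambda>z. tensor_assoc K C C C (tensor_map K CC C c (\<lambda>x. x) (c z))) \<in> module_hom K C T3"
    by (rule module_hom_comp[OF module_hom_comp[OF c_hom
          tensor_map_hom[OF C_module C_module CCm.module_axioms C_module c_hom module_hom_id]]
          tensor_assoc_hom[OF C_module C_module C_module]])
  fix n xs assume xs: "xs \<in> words E n"
  have Avc: "twisted_sum T3 n (tri q p) xs \<in> carrier T3" if "q \<le> p" "p \<le> n" for q p
    by (rule twisted_sum_closed[OF T3.module_axioms xs tri_closed]) (use that in auto)
  show "tensor_assoc K C C C (tensor_map K CC C c (\<lambda>x. x) (c (w xs))) = tensor_map K C CC (\<lambda>x. x) c (c (w xs))"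
    unfolding left_words[OF xs] right_words[OF xs]
  proof (subst T3.finsum_triangle)
    show "((iN q \<otimes> iN (p - q)) \<otimes> iN (n - p)) \<odot>\<^bsub>T3\<^esub> twisted_sum T3 n (tri q p) xs \<in> carrier T3"
      if "q \<le> p" "p \<le> n" for p q using Avc[OF that] by simp
    \<comment> \<open>With \<open>p = q + s\<close> both sides carry the inverse orders for the same
      three lengths \<open>q\<close>, \<open>s\<close> and \<open>n - (q + s)\<close>.\<close>
    have eq: "(iN q \<otimes> iN s) \<otimes> iN (n - (q + s)) = (iN s \<otimes> iN (n - (q + s))) \<otimes> iN q" for q s
      by (simp add: K.m_ac)
    show "(\<Oplus>\<^bsub>T3\<^esub>q\<in>{..n}. \<Oplus>\<^bsub>T3\<^esub>s\<in>{..n - q}. ((iN q \<otimes> iN (q + s - q)) \<otimes> iN (n - (q + s))) \<odot>\<^bsub>T3\<^esub> twisted_sum T3 n (tri q (q + s)) xs)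
      = (\<Oplus>\<^bsub>T3\<^esub>q\<in>{..n}. \<Oplus>\<^bsub>T3\<^esub>s\<in>{..n - q}. ((iN s \<otimes> iN (n - q - s)) \<otimes> iN q) \<odot>\<^bsub>T3\<^esub> twisted_sum T3 n (tri q (q + s)) xs)"
      by (simp only: add_diff_cancel_left' diff_diff_left eq)
  qed
qed

section \<open>Counit\<close>

abbreviation "R \<equiv> regular_module K"
abbreviation "eps \<equiv> chi_counit K W \<chi> E"

lemma R_module: "module K R" by (rule regular_module_module[OF K.is_cring])

sublocale R: module K R by (rule R_module)

text \<open>The coordinate with respect to the class of the empty word. The constant one is a
  legitimate form in degree zero because \<open>W 0\<close> is trivial.\<close>

definition unit_coeff where "unit_coeff = chi_lift K R (\<lambda>xs. \<one>)"

lemma words_0: "words E 0 = {[]}" by (auto simp: words_def)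

lemma unit_coeff_form: "chi_form 0 R (\<lambda>xs. \<one>)"
  by (auto simp: chi_form_def multilinear_def W_0 chi_id)

lemma unit_coeff_hom: "unit_coeff \<in> module_hom K (A 0) R" and unit_coeff_cls: "unit_coeff (cls []) = \<one>"
  using chi_lift[OF R_module unit_coeff_form] by (auto simp: unit_coeff_def words_0)

lemma A0_basis:
  assumes "x \<in> carrier (A 0)" shows "x = unit_coeff x \<odot>\<^bsub>A 0\<^esub> cls []"
proof -
  interpret A0: module K "A 0" by (rule chi_comp_module)
  have c0: "cls [] \<in> carrier (A 0)" using cls_closed[of "[]" 0] by (simp add: words_0)
  show ?thesis
  proof (rule chi_comp_hom_eq[OF chi_comp_module module_hom_id _ _ assms])
    show "(\<lambda>x. unit_coeff x \<odot>\<^bsub>A 0\<^esub> cls []) \<in> module_hom K (A 0) (A 0)"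
      using module_homD[OF unit_coeff_hom] c0
      by (intro module_homI) (auto simp: A0.smult_l_distr A0.smult_assoc1)
  qed (use c0 unit_coeff_cls in \<open>auto simp: words_0\<close>)
qed

text \<open>Applying \<open>unit_coeff\<close> to a multiple of the class of the empty word returns
  the coefficient, so the description in \<open>chi_counit\<close> is met by exactly one
  scalar.\<close>

lemma eps_eq:
  assumes "z \<in> carrier C" shows "eps z = unit_coeff (z 0)"
proof -
  have z0: "z 0 \<in> carrier (A 0)" using assms by (simp add: C_eq dsum_simps)
  have c0: "cls [] \<in> carrier (A 0)" using cls_closed[of "[]" 0] by (simp add: words_0)
  show ?thesis
    unfolding chi_counit_def
  proof (rule the_equality)
    show "unit_coeff (z 0) \<in> carrier K \<and> z 0 = unit_coeff (z 0) \<odot>\<^bsub>A 0\<^esub> cls []"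
      using module_homD(1)[OF unit_coeff_hom z0] A0_basis[OF z0] by simp
    fix a assume a: "a \<in> carrier K \<and> z 0 = a \<odot>\<^bsub>A 0\<^esub> cls []"
    then have "unit_coeff (z 0) = a \<otimes> unit_coeff (cls [])" using module_homD(3)[OF unit_coeff_hom _ c0, of a] by simp
    then show "a = unit_coeff (z 0)" using a by (simp add: unit_coeff_cls)
  qed
qed

lemma eps_hom: "eps \<in> module_hom K C R"
proof (rule module_hom_cong[OF _ C_module eps_eq])
  show "(\<lambda>z. unit_coeff (z 0)) \<in> module_hom K C R"
    unfolding C_eq by (rule module_hom_comp[OF G.dsum_proj_hom unit_coeff_hom])
qed

lemma eps_dsum_in:
  assumes "x \<in> carrier (A n)"
  shows "eps (dsum_in A n x) = (if n = 0 then unit_coeff x else \<zero>)"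
  using assms eps_eq[of "dsum_in A n x"] G.dsum_in_closed[OF assms]
    module_hom_zero[OF unit_coeff_hom chi_comp_module R_module]
  by (simp add: C_eq dsum_in_def)

lemma eps_w: "xs \<in> words E n \<Longrightarrow> eps (w xs) = (if n = 0 then \<one> else \<zero>)"
  using eps_dsum_in[OF cls_closed] by (auto simp: w_eq words_0 unit_coeff_cls)

text \<open>All summands are equal: the character of \<open>\<rho>\<close> occurs once as
  coefficient and once through the equivariance of \<open>g\<close>.\<close>

lemma twisted_sum_equivariant:
  assumes P: "module K P" and g: "chi_form d P g" and xs: "xs \<in> words E d"
  shows "twisted_sum P d g xs = N d \<odot>\<^bsub>P\<^esub> g xs"
proof -
  interpret P: module K P by fact
  have gc: "g xs \<in> carrier P" using g xs multilinear_closed[of K E d P g] by (simp add: chi_form_def)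
  have "twisted_sum P d g xs = (\<Oplus>\<^bsub>P\<^esub>\<rho>\<in>W d. g xs)"
    unfolding twisted_sum_def
    by (rule P.finsum_cong') (use gc g xs in \<open>auto simp: chi_form_def chi_closed
        P.smult_assoc1[symmetric] chi_square\<close>)
  then show ?thesis using P.finsum_const_smult[OF gc] by (simp add: N_def)
qed

lemma twisted_sum_w:
  assumes P: "module K P" and f: "f \<in> module_hom K C P" and xs: "xs \<in> words E n"
  shows "twisted_sum P n (\<lambda>ys. f (w ys)) xs = N n \<odot>\<^bsub>P\<^esub> f (w xs)"
proof -
  have "twisted_sum P n (\<lambda>ys. f (w ys)) xs = f (twisted_sum C n w xs)"
    by (rule twisted_sum_hom[symmetric, OF C_module P f xs w_closed])
  also have "twisted_sum C n w xs = N n \<odot>\<^bsub>C\<^esub> w xs" by (rule twisted_sum_equivariant[OF C_module w_form xs])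
  finally show ?thesis using module_homD(3)[OF f N_closed w_closed[OF xs]] by simp
qed

text \<open>The counit kills every piece of positive length, so only the cut at \<open>p = 0\<close>
  remains. Its coefficient is \<open>iN 0 \<otimes> iN n\<close> with \<open>iN 0 = \<one>\<close>,
  and the sum over \<open>W n\<close> contributes the factor \<open>N n\<close> that cancels
  it.\<close>

lemma counit_left:
  assumes "z \<in> carrier C"
  shows "tensor_map K R C eps (\<lambda>x. x) (c z) = pure_tensor K R C \<one> z"
proof -
  interpret RC: two_modules K R C by (rule two_modulesI[OF R_module C_module])
  interpret TT: module K RC.T by (rule RC.tensor_module)
  let ?f = "tensor_map K R C eps (\<lambda>x. x)"
  have f: "?f \<in> module_hom K CC RC.T"
    by (rule tensor_map_hom[OF C_module C_module R_module C_module eps_hom module_hom_id])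
  have g: "RC.pt a \<in> module_hom K C RC.T" if "a \<in> carrier K" for a
    using bilinear_mapD(2)[OF RC.bilinear_pure_tensor] that by simp
  show ?thesis
  proof (rule C_hom_eq[OF RC.tensor_module module_hom_comp[OF c_hom f] g _ assms])
    fix n xs assume xs: "xs \<in> words E n"
    have fcut: "?f (cut p ys) = (if p = 0 then RC.pt \<one> (w ys) else \<zero>\<^bsub>RC.T\<^esub>)"
      if "ys \<in> words E n" "p \<le> n" for p ys
    proof -
      note t = take_words[OF that] and d = w_closed[OF drop_words[OF that(1)], of p]
      have "?f (cut p ys) = RC.pt (eps (w (take p ys))) (w (drop p ys))"
        unfolding cut_def
        by (rule tensor_map_pure[OF C_module C_module R_module C_module eps_hom module_hom_id w_closed[OF t] d])
      moreover have "RC.pt \<zero> (w (drop p ys)) = \<zero>\<^bsub>RC.T\<^esub>"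
        using module_hom_zero[OF bilinear_mapD(1)[OF RC.bilinear_pure_tensor d] R_module RC.tensor_module] by simp
      ultimately show ?thesis using eps_w[OF t] by auto
    qed
    have "?f (c (w xs)) = (\<Oplus>\<^bsub>RC.T\<^esub>p\<in>{..n}. (iN p \<otimes> iN (n - p)) \<odot>\<^bsub>RC.T\<^esub> twisted_sum RC.T n (\<lambda>ys. ?f (cut p ys)) xs)"
      unfolding c_w[OF xs] by (rule hom_comp_c[OF RC.tensor_module f xs])
    also have "\<dots> = (iN 0 \<otimes> iN (n - 0)) \<odot>\<^bsub>RC.T\<^esub> twisted_sum RC.T n (\<lambda>ys. ?f (cut 0 ys)) xs"
    proof (rule TT.finsum_single)
      show "(iN 0 \<otimes> iN (n - 0)) \<odot>\<^bsub>RC.T\<^esub> twisted_sum RC.T n (\<lambda>ys. ?f (cut 0 ys)) xs \<in> carrier RC.T"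
        using twisted_sum_closed[OF RC.tensor_module xs, of "\<lambda>ys. ?f (cut 0 ys)"] cut_closed[of _ n 0] module_homD(1)[OF f] by simp
      fix p assume p: "p \<in> {..n}" "p \<noteq> 0"
      have "twisted_sum RC.T n (\<lambda>ys. ?f (cut p ys)) xs = twisted_sum RC.T n (\<lambda>ys. \<zero>\<^bsub>RC.T\<^esub>) xs"
        by (rule twisted_sum_cong[OF RC.tensor_module xs]) (use p fcut in auto)
      also have "\<dots> = \<zero>\<^bsub>RC.T\<^esub>"
        unfolding twisted_sum_def by (rule TT.add.finprod_one_eqI) (simp add: chi_closed)
      finally show "(iN p \<otimes> iN (n - p)) \<odot>\<^bsub>RC.T\<^esub> twisted_sum RC.T n (\<lambda>ys. ?f (cut p ys)) xs = \<zero>\<^bsub>RC.T\<^esub>"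
        by simp
    qed simp_all
    also have "twisted_sum RC.T n (\<lambda>ys. ?f (cut 0 ys)) xs = twisted_sum RC.T n (\<lambda>ys. RC.pt \<one> (w ys)) xs"
      by (rule twisted_sum_cong[OF RC.tensor_module xs]) (use fcut RC.pure_tensor_closed w_closed in auto)
    also have "\<dots> = N n \<odot>\<^bsub>RC.T\<^esub> RC.pt \<one> (w xs)"
      by (rule twisted_sum_w[OF RC.tensor_module g xs]) simp
    also have "(iN 0 \<otimes> iN (n - 0)) \<odot>\<^bsub>RC.T\<^esub> (N n \<odot>\<^bsub>RC.T\<^esub> RC.pt \<one> (w xs)) = RC.pt \<one> (w xs)"
      using RC.pure_tensor_closed[of \<one> "w xs"] w_closed[OF xs]
      by (simp add: iN_0 TT.smult_assoc1[symmetric] iN_N)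
    finally show "?f (c (w xs)) = RC.pt \<one> (w xs)" .
  qed simp
qed

lemma counit_right:
  assumes "z \<in> carrier C"
  shows "tensor_map K C R (\<lambda>x. x) eps (c z) = pure_tensor K C R z \<one>"
proof -
  interpret CR: two_modules K C R by (rule two_modulesI[OF C_module R_module])
  interpret TT: module K CR.T by (rule CR.tensor_module)
  let ?f = "tensor_map K C R (\<lambda>x. x) eps"
  have f: "?f \<in> module_hom K CC CR.T"
    by (rule tensor_map_hom[OF C_module C_module C_module R_module module_hom_id eps_hom])
  have g: "(\<lambda>z. CR.pt z a) \<in> module_hom K C CR.T" if "a \<in> carrier K" for a
    using bilinear_mapD(1)[OF CR.bilinear_pure_tensor] that by simp
  show ?thesis
  proof (rule C_hom_eq[OF CR.tensor_module module_hom_comp[OF c_hom f] g _ assms])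
    fix n xs assume xs: "xs \<in> words E n"
    have fcut: "?f (cut p ys) = (if p = n then CR.pt (w ys) \<one> else \<zero>\<^bsub>CR.T\<^esub>)"
      if "ys \<in> words E n" "p \<le> n" for p ys
    proof -
      note t = w_closed[OF take_words[OF that]] and d = drop_words[OF that(1), of p]
      have "?f (cut p ys) = CR.pt (w (take p ys)) (eps (w (drop p ys)))"
        unfolding cut_def
        by (rule tensor_map_pure[OF C_module C_module C_module R_module module_hom_id eps_hom t w_closed[OF d]])
      moreover have "CR.pt (w (take p ys)) \<zero> = \<zero>\<^bsub>CR.T\<^esub>"
        using module_hom_zero[OF bilinear_mapD(2)[OF CR.bilinear_pure_tensor t] R_module CR.tensor_module] by simp
      ultimately show ?thesis using eps_w[OF d] that words_length[OF that(1)] by auto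
    qed
    have "?f (c (w xs)) = (\<Oplus>\<^bsub>CR.T\<^esub>p\<in>{..n}. (iN p \<otimes> iN (n - p)) \<odot>\<^bsub>CR.T\<^esub> twisted_sum CR.T n (\<lambda>ys. ?f (cut p ys)) xs)"
      unfolding c_w[OF xs] by (rule hom_comp_c[OF CR.tensor_module f xs])
    also have "\<dots> = (iN n \<otimes> iN (n - n)) \<odot>\<^bsub>CR.T\<^esub> twisted_sum CR.T n (\<lambda>ys. ?f (cut n ys)) xs"
    proof (rule TT.finsum_single)
      show "(iN n \<otimes> iN (n - n)) \<odot>\<^bsub>CR.T\<^esub> twisted_sum CR.T n (\<lambda>ys. ?f (cut n ys)) xs \<in> carrier CR.T"
        using twisted_sum_closed[OF CR.tensor_module xs, of "\<lambda>ys. ?f (cut n ys)"] cut_closed[of _ n n] module_homD(1)[OF f] by simp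
      fix p assume p: "p \<in> {..n}" "p \<noteq> n"
      have "twisted_sum CR.T n (\<lambda>ys. ?f (cut p ys)) xs = twisted_sum CR.T n (\<lambda>ys. \<zero>\<^bsub>CR.T\<^esub>) xs"
        by (rule twisted_sum_cong[OF CR.tensor_module xs]) (use p fcut in auto)
      also have "\<dots> = \<zero>\<^bsub>CR.T\<^esub>"
        unfolding twisted_sum_def by (rule TT.add.finprod_one_eqI) (simp add: chi_closed)
      finally show "(iN p \<otimes> iN (n - p)) \<odot>\<^bsub>CR.T\<^esub> twisted_sum CR.T n (\<lambda>ys. ?f (cut p ys)) xs = \<zero>\<^bsub>CR.T\<^esub>"
        by simp
    qed simp_all
    also have "twisted_sum CR.T n (\<lambda>ys. ?f (cut n ys)) xs = twisted_sum CR.T n (\<lambda>ys. CR.pt (w ys) \<one>) xs"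
      by (rule twisted_sum_cong[OF CR.tensor_module xs]) (use fcut CR.pure_tensor_closed w_closed in auto)
    also have "\<dots> = N n \<odot>\<^bsub>CR.T\<^esub> CR.pt (w xs) \<one>"
      by (rule twisted_sum_w[OF CR.tensor_module g xs]) simp
    also have "(iN n \<otimes> iN (n - n)) \<odot>\<^bsub>CR.T\<^esub> (N n \<odot>\<^bsub>CR.T\<^esub> CR.pt (w xs) \<one>) = CR.pt (w xs) \<one>"
      using CR.pure_tensor_closed[of "w xs" \<one>] w_closed[OF xs]
      by (simp add: iN_0 TT.smult_assoc1[symmetric] iN_N)
    finally show "?f (c (w xs)) = CR.pt (w xs) \<one>" .
  qed simp
qed

lemma submodule_finsum:
  assumes "module K P" "submodule S K P" "\<And>i. i \<in> I \<Longrightarrow> g i \<in> S"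
  shows "(\<Oplus>\<^bsub>P\<^esub>i\<in>I. g i) \<in> S"
proof -
  interpret P: module K P by fact
  note S = P.submoduleE[OF assms(2)]
  show ?thesis
    using assms(3)
  proof (induction I rule: infinite_finite_induct)
    case (insert i I)
    then have "g i \<in> S" "(\<Oplus>\<^bsub>P\<^esub>i\<in>I. g i) \<in> S" by auto
    moreover have "(\<Oplus>\<^bsub>P\<^esub>i\<in>insert i I. g i) = g i \<oplus>\<^bsub>P\<^esub> (\<Oplus>\<^bsub>P\<^esub>i\<in>I. g i)"
      using insert S(1) by (intro P.finsum_insert) auto
    ultimately show ?case using S(5) by simp
  qed (use subgroup.one_closed[OF submodule.axioms(1)[OF assms(2)]] in auto)
qed

text \<open>On a word each cut is one of the generators with \<open>p + h = n\<close>; the rest is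
  closure of a submodule under sums and scalars, and words span the component.\<close>

lemma c_graded:
  assumes "x \<in> carrier (A n)"
  shows "c (dsum_in A n x) \<in> submodule_generated K CC
         {pure_tensor K C C (dsum_in A p y) (dsum_in A h z) | p h y z.
            p + h = n \<and> y \<in> carrier (A p) \<and> z \<in> carrier (A h)}" (is "_ \<in> submodule_generated K CC ?S")
proof -
  have S: "?S \<subseteq> carrier CC"
    using G.dsum_in_closed by (auto simp: C_eq[symmetric] intro!: CC.pure_tensor_closed)
  note gen = CCm.submodule_generated_submodule[OF S]
  show ?thesis
  proof (rule spans_subset_submodule[OF chi_comp_module CCm.module_axioms spans_cls _ gen _ assms])
    show "(\<lambda>x. c (dsum_in A n x)) \<in> module_hom K (A n) CC"
      using G.dsum_in_hom c_hom unfolding C_eq by (rule module_hom_comp)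
    fix s assume "s \<in> cls ` words E n"
    then obtain xs where xs: "xs \<in> words E n" "s = cls xs" by auto
    have cutS: "cut p ys \<in> submodule_generated K CC ?S" if "p \<le> n" "ys \<in> words E n" for p ys
    proof -
      note t = take_words[OF that(2,1)] and d = drop_words[OF that(2), of p]
      have "cut p ys \<in> ?S"
        unfolding cut_def w_eq[OF t] w_eq[OF d]
        by (intro CollectI exI[of _ p] exI[of _ "n - p"] exI[of _ "cls (take p ys)"] exI[of _ "cls (drop p ys)"])
           (use that t d cls_closed in auto)
      then show ?thesis by (rule subsetD[OF submodule_generated_superset])
    qed
    have "comp_c n xs \<in> submodule_generated K CC ?S"
      unfolding comp_c_def twisted_sum_def
      by (intro submodule_finsum[OF CCm.module_axioms gen] CCm.submoduleE(4)[OF gen] cutS)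
         (auto simp: chi_closed xs permw_W)
    then show "c (dsum_in A n s) \<in> submodule_generated K CC ?S"
      using c_w[OF xs(1)] w_eq[OF xs(1)] xs(2) by simp
  qed
qed

theorem graded_coalgebra: "graded_coalgebra K A c eps"
  unfolding graded_coalgebra_def Let_def C_eq[symmetric]
  using chi_comp_module c_hom eps_hom c_graded eps_dsum_in coassociative counit_left counit_right
  by auto

end

section \<open>Multiplication\<close>

text \<open>For fixed second arguments, additivity in them is an equation between maps that are
  linear in the first argument, so a spanning set is enough. Nested lifts require this: they are
  linear in the outer argument by construction, in the inner one at first only on words.\<close>

lemma spans_hom_second:
  assumes C: "module K C" and Q: "module K Q" and P: "module K P" and G: "spans K C G"
    and h1: "\<And>u. u \<in> carrier Q \<Longrightarrow> (\<lambda>z. h z u) \<in> module_hom K C P"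
    and h2: "\<And>z. z \<in> G \<Longrightarrow> h z \<in> module_hom K Q P" and z: "z \<in> carrier C"
  shows "h z \<in> module_hom K Q P"
proof -
  interpret Q: module K Q by fact
  show ?thesis
  proof (rule module_homI)
    show "h z u \<in> carrier P" if "u \<in> carrier Q" for u
      using module_homD(1)[OF h1[OF that] z] .
    show "h z (u \<oplus>\<^bsub>Q\<^esub> v) = h z u \<oplus>\<^bsub>P\<^esub> h z v" if uv: "u \<in> carrier Q" "v \<in> carrier Q" for u v
    proof (rule spans_hom_eq[OF C P G h1 module_hom_plus[OF C P h1 h1] _ z])
      show "h s (u \<oplus>\<^bsub>Q\<^esub> v) = h s u \<oplus>\<^bsub>P\<^esub> h s v" if "s \<in> G" for s
        using module_homD(2)[OF h2[OF that] uv] .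
    qed (use uv in auto)
    show "h z (a \<odot>\<^bsub>Q\<^esub> u) = a \<odot>\<^bsub>P\<^esub> h z u" if au: "a \<in> carrier K" "u \<in> carrier Q" for a u
    proof (rule spans_hom_eq[OF C P G h1 module_hom_smult[OF C P h1] _ z])
      show "h s (a \<odot>\<^bsub>Q\<^esub> u) = a \<odot>\<^bsub>P\<^esub> h s u" if "s \<in> G" for s
        using module_homD(3)[OF h2[OF that] au] .
    qed (use au in auto)
  qed
qed

context rational_letters
begin

lemma spans_w: "spans K C (\<Union>d. w ` words E d)"
proof -
  have "spans K C (\<Union>d. dsum_in A d ` (cls ` words E d))"
    unfolding C_eq by (rule G.spans_dsum[OF spans_cls])
  moreover have "(\<Union>d. dsum_in A d ` (cls ` words E d)) = (\<Union>d. w ` words E d)"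
    unfolding image_image by (intro SUP_cong image_cong refl) (simp add: w_eq)
  ultimately show ?thesis by simp
qed

text \<open>Multilinearity and equivariance in \<open>xs\<close> are equations linear in
  \<open>u\<close>. The outer of two nested lifts needs them for every \<open>u\<close>, while the
  formulas provide them only for \<open>u\<close> in a spanning set.\<close>

lemma chi_form_of_spans:
  assumes P: "module K P" and Q: "module K Q" and S: "spans K Q S"
    and G: "\<And>xs. xs \<in> words E d \<Longrightarrow> G xs \<in> module_hom K Q P"
    and base: "\<And>s. s \<in> S \<Longrightarrow> chi_form d P (\<lambda>xs. G xs s)" and u: "u \<in> carrier Q"
  shows "chi_form d P (\<lambda>xs. G xs u)"
proof -
  interpret P: module K P by fact
  interpret Q: module K Q by fact
  have "multilinear K E d P (\<lambda>xs. G xs u)"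
    unfolding multilinear_def
  proof (intro conjI ballI allI impI)
    fix xs i assume xs: "xs \<in> words E d" and i: "i < d"
    note up = words_update[OF xs]
    have base': "(\<lambda>x. G (xs[i := x]) s) \<in> module_hom K E P" if "s \<in> S" for s
    proof -
      have "multilinear K E d P (\<lambda>xs. G xs s)" using base[OF that] by (simp add: chi_form_def)
      then show ?thesis by (rule multilinear_hom[OF _ xs i])
    qed
    show "(\<lambda>x. G (xs[i := x]) u) \<in> module_hom K E P"
      by (rule spans_hom_second[OF Q E.module_axioms P S, where h = "\<lambda>u x. G (xs[i := x]) u", OF _ base' u])
         (use G[OF up] in auto)
  qed (use module_homD(1)[OF G u] in auto)
  moreover have "G (permw \<sigma> xs) u = \<chi> d \<sigma> \<odot>\<^bsub>P\<^esub> G xs u" if "xs \<in> words E d" "\<sigma> \<in> W d" for xs \<sigma>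
    by (rule spans_hom_eq[OF Q P S G[OF permw_W[OF that]] module_hom_smult[OF Q P G[OF that(1)] chi_closed[OF that(2)]] _ u])
       (use base that in \<open>auto simp: chi_form_def\<close>)
  ultimately show ?thesis by (simp add: chi_form_def)
qed

lemma append_update:
  "length xs = d \<Longrightarrow> xs @ ys[i := y] = (xs @ ys)[d + i := y]"
  by (simp add: list_update_append)

lemma append_permw_right:
  assumes "ys \<in> words E e" "length xs = d" "\<tau> \<in> W e"
  shows "xs @ permw \<tau> ys = permw ((omega ^^ d) \<tau>) (xs @ ys)"
proof -
  have "drop d (permw ((omega ^^ d) \<tau>) (xs @ ys)) = permw \<tau> (drop d (xs @ ys))"
    using assms W_permutes[OF assms(3)] words_length[OF assms(1)]
    by (intro permw_drop[symmetric]) simp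
  moreover have "take d (permw ((omega ^^ d) \<tau>) (xs @ ys)) = take d (xs @ ys)"
    by (rule take_permw_omega[of \<tau>, OF W_zero[OF assms(3)]])
  ultimately show ?thesis
    using append_take_drop_id[of d "permw ((omega ^^ d) \<tau>) (xs @ ys)"] assms(2) by simp
qed

lemma append_permw_left:
  assumes "xs \<in> words E d" "\<sigma> \<in> W d"
  shows "permw \<sigma> xs @ ys = permw \<sigma> (xs @ ys)"
proof -
  have "take d (permw \<sigma> (xs @ ys)) = permw \<sigma> (take d (xs @ ys))"
    using W_permutes[OF assms(2)] words_length[OF assms(1)] by (intro permw_take[symmetric]) auto
  moreover have "drop d (permw \<sigma> (xs @ ys)) = drop d (xs @ ys)"
    by (rule drop_permw_permutes[OF W_permutes[OF assms(2)]])
  ultimately show ?thesis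
    using append_take_drop_id[of d "permw \<sigma> (xs @ ys)"] words_length[OF assms(1)] by simp
qed

text \<open>Permuting \<open>ys\<close> inside \<open>xs @ ys\<close> is a permutation shifted by
  \<open>d\<close>, so the invariance of the character under \<open>omega\<close> makes the product
  well defined in its second factor.\<close>

lemma append_form_right:
  assumes xs: "xs \<in> words E d" shows "chi_form e C (\<lambda>ys. w (xs @ ys))"
proof -
  note app = words_append[OF xs] and len = words_length[OF xs]
  have "multilinear K E e C (\<lambda>ys. w (xs @ ys))"
    unfolding multilinear_def
  proof (intro conjI ballI allI impI)
    fix ys i assume ys: "ys \<in> words E e" and i: "i < e"
    show "(\<lambda>y. w (xs @ ys[i := y])) \<in> module_hom K E C"
      using multilinear_hom[OF w_multilinear app[OF ys], of "d + i"] i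
      by (simp add: append_update[OF len])
  qed (use w_closed app in blast)
  moreover have "w (xs @ permw \<tau> ys) = \<chi> e \<tau> \<odot>\<^bsub>C\<^esub> w (xs @ ys)" if "ys \<in> words E e" "\<tau> \<in> W e" for ys \<tau>
    using w_permw[OF app[OF that(1)], of "(omega ^^ d) \<tau>"] W_omega[OF that(2), of d]
    by (simp add: append_permw_right[OF that(1) len that(2)] add.commute)
  ultimately show ?thesis by (simp add: chi_form_def)
qed

text \<open>Permuting the head needs no shift; here the compatibility of the characters under the
  inclusion of \<open>W d\<close> in \<open>W (d + e)\<close> is what counts.\<close>

lemma append_form_left:
  assumes ys: "ys \<in> words E e" shows "chi_form d C (\<lambda>xs. w (xs @ ys))"
proof -
  have "multilinear K E d C (\<lambda>xs. w (xs @ ys))"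
    unfolding multilinear_def
  proof (intro conjI ballI allI impI)
    fix xs i assume xs: "xs \<in> words E d" and i: "i < d"
    show "(\<lambda>x. w (xs[i := x] @ ys)) \<in> module_hom K E C"
      using multilinear_hom[OF w_multilinear words_append[OF xs ys], of i] i words_length[OF xs]
      by (simp add: list_update_append)
  qed (use w_closed words_append ys in blast)
  moreover have "w (permw \<sigma> xs @ ys) = \<chi> d \<sigma> \<odot>\<^bsub>C\<^esub> w (xs @ ys)" if "xs \<in> words E d" "\<sigma> \<in> W d" for xs \<sigma>
    using w_permw[OF words_append[OF that(1) ys], of \<sigma>] W_mono[OF that(2), of "d + e"]
    by (simp add: append_permw_left[OF that])
  ultimately show ?thesis by (simp add: chi_form_def)
qed

abbreviation "mul \<equiv> chi_mult K W \<chi> E"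

lemma mul_bilinear: "bilinear_map K C C C mul"
  and mul_w: "\<lbrakk>xs \<in> words E d; ys \<in> words E e\<rbrakk> \<Longrightarrow> mul (w xs) (w ys) = w (xs @ ys)"
proof -
  let ?J = "\<lambda>xs. dsum_lift A C (\<lambda>e. chi_lift K C (\<lambda>ys. w (xs @ ys)))"
  have J: "?J xs (w ys) = w (xs @ ys)" if "xs \<in> words E d" "ys \<in> words E e" for d e xs ys
    by (rule chi_form_dsum_lift(1)[OF C_module append_form_right[OF that(1)] that(2)])
  have Jh: "?J xs \<in> module_hom K C C" if "xs \<in> words E d" for d xs
    by (rule chi_form_dsum_lift(2)[OF C_module append_form_right[OF that(1)]])
  have Jf: "chi_form d C (\<lambda>xs. ?J xs u)" if "u \<in> carrier C" for d u
  proof (rule chi_form_of_spans[OF C_module C_module spans_w Jh _ that])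
    fix s assume "s \<in> (\<Union>d. w ` words E d)"
    then obtain e ys where ys: "ys \<in> words E e" "s = w ys" by auto
    then show "chi_form d C (\<lambda>xs. ?J xs s)"
      using chi_form_cong[OF append_form_left[OF ys(1)]] J by simp
  qed
  have eq: "mul z u = dsum_lift A C (\<lambda>d. chi_lift K C (\<lambda>xs. ?J xs u)) z" for z u
    by (simp add: chi_mult_def Let_def)
  have m1: "(\<lambda>z. mul z u) \<in> module_hom K C C" if "u \<in> carrier C" for u
    unfolding eq by (rule chi_form_dsum_lift(2)[OF C_module Jf[OF that]])
  have mw: "mul (w xs) u = ?J xs u" if "u \<in> carrier C" "xs \<in> words E d" for u xs d
    unfolding eq by (rule chi_form_dsum_lift(1)[OF C_module Jf[OF that(1)] that(2)])
  have "mul z \<in> module_hom K C C" if "z \<in> carrier C" for z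
  proof (rule spans_hom_second[OF C_module C_module C_module spans_w, where h = mul, OF m1 _ that])
    fix s assume "s \<in> (\<Union>d. w ` words E d)"
    then obtain d xs where xs: "xs \<in> words E d" "s = w xs" by auto
    show "mul s \<in> module_hom K C C"
      by (rule module_hom_cong[OF Jh[OF xs(1)] C_module]) (simp add: xs(2) mw[OF _ xs(1)])
  qed
  then show "bilinear_map K C C C mul" using m1 by (simp add: bilinear_map_def)
  show "mul (w xs) (w ys) = w (xs @ ys)" if "xs \<in> words E d" "ys \<in> words E e"
    using mw[OF w_closed[OF that(2)] that(1)] J[OF that] by simp
qed

text \<open>The law is associativity of concatenation. Each reduction to words treats one argument
  as the variable of a linear map, the others being held fixed.\<close>

lemma mul_assoc:
  assumes "x \<in> carrier C" "y \<in> carrier C" "z \<in> carrier C"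
  shows "mul (mul x y) z = mul x (mul y z)"
proof -
  note h1 = bilinear_mapD(1)[OF mul_bilinear] and h2 = bilinear_mapD(2)[OF mul_bilinear]
    and cl = bilinear_mapD(3)[OF mul_bilinear]
  have 1: "mul (mul x y) (w zs) = mul x (mul y (w zs))"
    if x: "x \<in> carrier C" and y: "y \<in> carrier C" and zs: "zs \<in> words E e" for x y zs e
  proof -
    have 2: "mul (mul (w xs) y) (w zs) = mul (w xs) (mul y (w zs))" if xs: "xs \<in> words E d" for xs d
    proof (rule C_hom_eq[OF C_module _ _ _ y])
      show "(\<lambda>y. mul (mul (w xs) y) (w zs)) \<in> module_hom K C C"
        using h2[OF w_closed[OF xs]] h1[OF w_closed[OF zs]] by (rule module_hom_comp)
      show "(\<lambda>y. mul (w xs) (mul y (w zs))) \<in> module_hom K C C"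
        using h1[OF w_closed[OF zs]] h2[OF w_closed[OF xs]] by (rule module_hom_comp)
      fix e' ys assume ys: "ys \<in> words E e'"
      show "mul (mul (w xs) (w ys)) (w zs) = mul (w xs) (mul (w ys) (w zs))"
        unfolding mul_w[OF xs ys] mul_w[OF ys zs] mul_w[OF words_append[OF xs ys] zs]
          mul_w[OF xs words_append[OF ys zs]] by simp
    qed
    show ?thesis
    proof (rule C_hom_eq[OF C_module _ _ _ x])
      show "(\<lambda>x. mul (mul x y) (w zs)) \<in> module_hom K C C"
        using h1[OF y] h1[OF w_closed[OF zs]] by (rule module_hom_comp)
      show "(\<lambda>x. mul x (mul y (w zs))) \<in> module_hom K C C"
        by (rule h1[OF cl[OF y w_closed[OF zs]]])
    qed (rule 2)
  qed
  show ?thesis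
  proof (rule C_hom_eq[OF C_module _ _ _ assms(3)])
    show "mul (mul x y) \<in> module_hom K C C" by (rule h2[OF cl[OF assms(1,2)]])
    show "(\<lambda>z. mul x (mul y z)) \<in> module_hom K C C"
      using h2[OF assms(2)] h2[OF assms(1)] by (rule module_hom_comp)
  qed (rule 1[OF assms(1,2)])
qed

lemma Nil_words: "[] \<in> words E 0" by (simp add: words_def)

lemma mul_one:
  assumes "x \<in> carrier C" shows "mul (w []) x = x" "mul x (w []) = x"
proof -
  note h1 = bilinear_mapD(1)[OF mul_bilinear w_closed[OF Nil_words]]
    and h2 = bilinear_mapD(2)[OF mul_bilinear w_closed[OF Nil_words]]
  show "mul (w []) x = x"
    by (rule C_hom_eq[OF C_module h2 module_hom_id _ assms]) (simp add: mul_w[OF Nil_words])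
  show "mul x (w []) = x"
    by (rule C_hom_eq[OF C_module h1 module_hom_id _ assms]) (simp add: mul_w[OF _ Nil_words])
qed

lemma dsum_in_range:
  assumes "x \<in> carrier C" "\<And>e. e \<noteq> d \<Longrightarrow> x e = \<zero>\<^bsub>A e\<^esub>"
  shows "x \<in> dsum_in A d ` carrier (A d)"
proof
  show "x = dsum_in A d (x d)" using assms(2) by (auto simp: dsum_in_def fun_eq_iff)
  show "x d \<in> carrier (A d)" using assms(1) by (simp add: C_eq dsum_simps)
qed

lemma mul_graded:
  assumes x: "x \<in> carrier (A p)" and y: "y \<in> carrier (A q)"
  shows "mul (dsum_in A p x) (dsum_in A q y) \<in> dsum_in A (p + q) ` carrier (A (p + q))"
proof (rule dsum_in_range)
  have xy: "dsum_in A p x \<in> carrier C" "dsum_in A q y \<in> carrier C"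
    unfolding C_eq by (simp_all add: G.dsum_in_closed x y)
  then show "mul (dsum_in A p x) (dsum_in A q y) \<in> carrier C"
    by (rule bilinear_mapD(3)[OF mul_bilinear])
  \<comment> \<open>A component in a wrong degree depends linearly on each factor, so it vanishes
    once it vanishes on words.\<close>
  fix e assume e: "e \<noteq> p + q"
  note din = G.dsum_in_hom[folded C_eq] and pr = G.dsum_proj_hom[folded C_eq, of e]
  note h1 = bilinear_mapD(1)[OF mul_bilinear] and h2 = bilinear_mapD(2)[OF mul_bilinear]
  have 1: "mul (w xs) (dsum_in A q y) e = \<zero>\<^bsub>A e\<^esub>" if xs: "xs \<in> words E p" for xs
  proof (rule chi_comp_hom_eq[OF chi_comp_module
        module_hom_comp[OF module_hom_comp[OF din h2[OF w_closed[OF xs]]] pr]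
        module_hom_const_zero[OF chi_comp_module chi_comp_module] _ y])
    fix ys assume ys: "ys \<in> words E q"
    show "mul (w xs) (dsum_in A q (cls ys)) e = \<zero>\<^bsub>A e\<^esub>"
      using mul_w[OF xs ys] e w_eq[OF words_append[OF xs ys]]
      by (simp add: w_eq[OF ys, symmetric]) (simp add: dsum_in_def)
  qed
  show "mul (dsum_in A p x) (dsum_in A q y) e = \<zero>\<^bsub>A e\<^esub>"
  proof (rule chi_comp_hom_eq[OF chi_comp_module
        module_hom_comp[OF module_hom_comp[OF din h1[OF xy(2)]] pr]
        module_hom_const_zero[OF chi_comp_module chi_comp_module] _ x])
    show "mul (dsum_in A p (cls xs)) (dsum_in A q y) e = \<zero>\<^bsub>A e\<^esub>" if "xs \<in> words E p" for xs
      using 1[OF that] by (simp add: w_eq[OF that])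
  qed
qed

end

section \<open>Graded algebras from a bilinear product\<close>

lemma graded_alg_simps:
  "carrier (graded_alg K M m u) = carrier (dsum K M)" "add (graded_alg K M m u) = add (dsum K M)"
  "\<zero>\<^bsub>graded_alg K M m u\<^esub> = \<zero>\<^bsub>dsum K M\<^esub>" "module.smult (graded_alg K M m u) = module.smult (dsum K M)"
  "monoid.mult (graded_alg K M m u) = m" "\<one>\<^bsub>graded_alg K M m u\<^esub> = u"
  by (simp_all add: graded_alg_def)

lemma graded_algebraI:
  assumes M: "\<And>d. module K (M d)" and K: "cring K"
    and m: "bilinear_map K (dsum K M) (dsum K M) (dsum K M) m"
    and assoc: "\<And>x y z. \<lbrakk>x \<in> carrier (dsum K M); y \<in> carrier (dsum K M); z \<in> carrier (dsum K M)\<rbrakk> \<Longrightarrow>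
      m (m x y) z = m x (m y z)"
    and u: "u \<in> dsum_in M 0 ` carrier (M 0)"
    and one: "\<And>x. x \<in> carrier (dsum K M) \<Longrightarrow> m u x = x" "\<And>x. x \<in> carrier (dsum K M) \<Longrightarrow> m x u = x"
    and graded: "\<And>p q x y. \<lbrakk>x \<in> carrier (M p); y \<in> carrier (M q)\<rbrakk> \<Longrightarrow>
      m (dsum_in M p x) (dsum_in M q y) \<in> dsum_in M (p + q) ` carrier (M (p + q))"
  shows "graded_algebra K M m u"
proof -
  interpret K: cring K by fact
  interpret G: graded_module K M
    using M K by (simp add: graded_module_def graded_module_axioms_def)
  interpret D: module K "dsum K M" by (rule G.dsum_module)
  let ?A = "graded_alg K M m u"
  note h1 = bilinear_mapD(1)[OF m] and h2 = bilinear_mapD(2)[OF m] and cl = bilinear_mapD(3)[OF m]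
  have uc: "u \<in> carrier (dsum K M)" using u G.dsum_in_closed by auto
  have ab: "abelian_group ?A"
  proof (rule abelian_groupI)
    show "x \<oplus>\<^bsub>?A\<^esub> y = y \<oplus>\<^bsub>?A\<^esub> x" if "x \<in> carrier ?A" "y \<in> carrier ?A" for x y
      using D.M.a_comm[of x y] that by (simp add: graded_alg_simps)
    show "\<exists>y\<in>carrier ?A. y \<oplus>\<^bsub>?A\<^esub> x = \<zero>\<^bsub>?A\<^esub>" if "x \<in> carrier ?A" for x
      using D.M.l_neg[of x] D.M.a_inv_closed[of x] that by (auto simp: graded_alg_simps)
  qed (auto simp: graded_alg_simps D.M.a_assoc)
  have mod: "module K ?A"
    by (rule moduleI[OF K ab])
       (auto simp: graded_alg_simps D.smult_l_distr D.smult_r_distr D.smult_assoc1)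
  have "Group.monoid ?A"
    by (rule monoidI) (auto simp: graded_alg_simps cl uc assoc one)
  then have ring: "ring ?A"
    by (rule ringI[OF ab])
       (auto simp: graded_alg_simps module_homD(2)[OF h1] module_homD(2)[OF h2])
  show ?thesis
    unfolding graded_algebra_def Let_def
    using M mod ring u graded module_homD(3)[OF h1] module_homD(3)[OF h2]
    by (simp add: graded_alg_simps)
qed

theorem (in rational_letters) chi_graded_algebra: "graded_algebra K A mul (w [])"
proof (rule graded_algebraI[OF chi_comp_module K.is_cring])
  show "w [] \<in> dsum_in A 0 ` carrier (A 0)"
    using w_eq[OF Nil_words] cls_closed[OF Nil_words] by auto
qed (use mul_bilinear mul_assoc mul_one mul_graded in \<open>auto simp: C_eq[symmetric]\<close>)

section \<open>Transport along an isomorphism of graded modules\<close>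

text \<open>Degreewise linear bijections send zero to zero in both directions, so they preserve
  finiteness of support. The map \<open>h\<close> is prescribed on the carrier only, since the
  identification with the graded dual is a total function whose other values are arbitrary.\<close>

lemma graded_iso_dsum:
  fixes M :: "nat \<Rightarrow> ('k,'a,'s) module_scheme" and N :: "nat \<Rightarrow> ('k,'b,'t) module_scheme"
  assumes M: "\<And>d. module K (M d)" and N: "\<And>d. module K (N d)" and K: "cring K"
    and f: "\<And>d. f d \<in> module_hom K (M d) (N d)"
    and g: "\<And>d y. y \<in> carrier (N d) \<Longrightarrow> g d y \<in> carrier (M d) \<and> f d (g d y) = y"
    and gf: "\<And>d x. x \<in> carrier (M d) \<Longrightarrow> g d (f d x) = x"
    and h: "\<And>z. z \<in> carrier (dsum K M) \<Longrightarrow> h z = (\<lambda>d. f d (z d))"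
  shows "h \<in> module_hom K (dsum K M) (dsum K N)"
    and "bij_betw h (carrier (dsum K M)) (carrier (dsum K N))"
    and "h ` (dsum_in M d ` carrier (M d)) = dsum_in N d ` carrier (N d)"
proof -
  interpret GM: graded_module K M using M K by (simp add: graded_module_def graded_module_axioms_def)
  interpret GN: graded_module K N using N K by (simp add: graded_module_def graded_module_axioms_def)
  interpret D: module K "dsum K M" by (rule GM.dsum_module)
  interpret Mm: module K "M d" for d by (rule M)
  interpret Nm: module K "N d" for d by (rule N)
  have f0: "f d \<zero>\<^bsub>M d\<^esub> = \<zero>\<^bsub>N d\<^esub>" for d by (rule module_hom_zero[OF f M N])
  have g0: "g d \<zero>\<^bsub>N d\<^esub> = \<zero>\<^bsub>M d\<^esub>" for d using gf[of "\<zero>\<^bsub>M d\<^esub>" d] f0 by simp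
  have hc: "h z \<in> carrier (dsum K N)" if z: "z \<in> carrier (dsum K M)" for z
    unfolding h[OF z]
    by (rule dsum_carrierI[of _ _ "{d. z d \<noteq> \<zero>\<^bsub>M d\<^esub>}"])
       (use dsum_carrierD[OF z] f0 module_homD(1)[OF f] in auto)
  show "h \<in> module_hom K (dsum K M) (dsum K N)"
  proof (rule module_homI[OF hc])
    fix x y assume "x \<in> carrier (dsum K M)" "y \<in> carrier (dsum K M)"
    then show "h (x \<oplus>\<^bsub>dsum K M\<^esub> y) = h x \<oplus>\<^bsub>dsum K N\<^esub> h y"
      using dsum_carrierD(1)[of x K M] dsum_carrierD(1)[of y K M]
      by (simp add: h) (simp add: dsum_simps(3) module_homD(2)[OF f])
  next
    fix a x assume "a \<in> carrier K" "x \<in> carrier (dsum K M)"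
    then show "h (a \<odot>\<^bsub>dsum K M\<^esub> x) = a \<odot>\<^bsub>dsum K N\<^esub> h x"
      using dsum_carrierD(1)[of x K M]
      by (simp add: h) (simp add: dsum_simps(4) module_homD(3)[OF f])
  qed
  have gc: "(\<lambda>d. g d (y d)) \<in> carrier (dsum K M)" if y: "y \<in> carrier (dsum K N)" for y
    by (rule dsum_carrierI[of _ _ "{d. y d \<noteq> \<zero>\<^bsub>N d\<^esub>}"])
       (use dsum_carrierD[OF y] g0 g in auto)
  show "bij_betw h (carrier (dsum K M)) (carrier (dsum K N))"
  proof (rule bij_betwI[where g = "\<lambda>y d. g d (y d)"])
    show "(\<lambda>d. g d (h x d)) = x" if "x \<in> carrier (dsum K M)" for x
      using gf dsum_carrierD(1)[OF that] by (simp add: h[OF that])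
    show "h (\<lambda>d. g d (y d)) = y" if "y \<in> carrier (dsum K N)" for y
      using g dsum_carrierD(1)[OF that] by (simp add: h[OF gc[OF that]])
  qed (use hc gc in auto)
  have hin: "h (dsum_in M d x) = dsum_in N d (f d x)" if "x \<in> carrier (M d)" for x
    using h[OF GM.dsum_in_closed[OF that]] f0 by (auto simp: dsum_in_def fun_eq_iff)
  have "f d ` carrier (M d) = carrier (N d)"
  proof (intro equalityI subsetI)
    fix y assume "y \<in> carrier (N d)"
    then show "y \<in> f d ` carrier (M d)" using g[of y d] by (metis imageI)
  qed (use module_homD(1)[OF f] in auto)
  moreover have "h ` (dsum_in M d ` carrier (M d)) = dsum_in N d ` (f d ` carrier (M d))"
    unfolding image_image by (intro image_cong refl hin)
  ultimately show "h ` (dsum_in M d ` carrier (M d)) = dsum_in N d ` carrier (N d)"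
    by simp
qed

text \<open>About \<open>m'\<close> it is assumed that \<open>h\<close> carries \<open>m\<close> to
  it. As \<open>h\<close> is onto, every element of the target is an image, and each axiom for
  \<open>m'\<close> is the image of the same axiom for \<open>m\<close>.\<close>

lemma graded_algebra_transport:
  assumes alg: "graded_algebra K M m u" and N: "\<And>d. module K (N d)" and K: "cring K"
    and hom: "h \<in> module_hom K (dsum K M) (dsum K N)"
    and bij: "bij_betw h (carrier (dsum K M)) (carrier (dsum K N))"
    and deg: "\<And>d. h ` (dsum_in M d ` carrier (M d)) = dsum_in N d ` carrier (N d)"
    and mult: "\<And>x y. \<lbrakk>x \<in> carrier (dsum K M); y \<in> carrier (dsum K M)\<rbrakk> \<Longrightarrow> h (m x y) = m' (h x) (h y)"
    and unit: "h u = u'"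
  shows "graded_algebra K N m' u'"
    and "h \<in> graded_alg_iso K M (graded_alg K M m u) N (graded_alg K N m' u')"
proof -
  let ?D = "dsum K M" and ?D' = "dsum K N" and ?A = "graded_alg K M m u"
  have M: "\<And>d. module K (M d)" and ring: "ring ?A"
    and sm: "\<And>a x y. \<lbrakk>a \<in> carrier K; x \<in> carrier ?D; y \<in> carrier ?D\<rbrakk> \<Longrightarrow>
       m (a \<odot>\<^bsub>?D\<^esub> x) y = a \<odot>\<^bsub>?D\<^esub> m x y \<and> m x (a \<odot>\<^bsub>?D\<^esub> y) = a \<odot>\<^bsub>?D\<^esub> m x y"
    and u: "u \<in> dsum_in M 0 ` carrier (M 0)"
    and gr: "\<And>p q x y. \<lbrakk>x \<in> carrier (M p); y \<in> carrier (M q)\<rbrakk> \<Longrightarrow>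
      m (dsum_in M p x) (dsum_in M q y) \<in> dsum_in M (p + q) ` carrier (M (p + q))"
    using alg by (auto simp: graded_algebra_def Let_def graded_alg_simps)
  interpret A: ring ?A by fact
  interpret GM: graded_module K M using M K by (simp add: graded_module_def graded_module_axioms_def)
  interpret GN: graded_module K N using N K by (simp add: graded_module_def graded_module_axioms_def)
  interpret D: module K ?D by (rule GM.dsum_module)
  interpret D': module K ?D' by (rule GN.dsum_module)
  note hD = module_homD[OF hom]
  have mc: "m x y \<in> carrier ?D" if "x \<in> carrier ?D" "y \<in> carrier ?D" for x y
    using A.m_closed that by (simp add: graded_alg_simps)
  have ml: "m (x \<oplus>\<^bsub>?D\<^esub> y) z = m x z \<oplus>\<^bsub>?D\<^esub> m y z" "m z (x \<oplus>\<^bsub>?D\<^esub> y) = m z x \<oplus>\<^bsub>?D\<^esub> m z y"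
    if "x \<in> carrier ?D" "y \<in> carrier ?D" "z \<in> carrier ?D" for x y z
    using A.l_distr[of x y z] A.r_distr[of x y z] that by (simp_all add: graded_alg_simps)
  have uc: "u \<in> carrier ?D" using A.one_closed by (simp add: graded_alg_simps)
  have surj: "\<exists>x\<in>carrier ?D. y = h x" if "y \<in> carrier ?D'" for y
    using bij that by (auto simp: bij_betw_def)
  have m'c: "m' x y \<in> carrier ?D'" if xy: "x \<in> carrier ?D'" "y \<in> carrier ?D'" for x y
  proof -
    obtain a b where "a \<in> carrier ?D" "x = h a" "b \<in> carrier ?D" "y = h b" using surj xy by blast
    then show ?thesis using mult[of a b] hD(1)[OF mc[of a b]] by simp
  qed
  have bil: "bilinear_map K ?D' ?D' ?D' m'"
    unfolding bilinear_map_def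
  proof (intro conjI ballI)
    fix y assume "y \<in> carrier ?D'"
    then obtain b where b: "b \<in> carrier ?D" "y = h b" using surj by blast
    show "(\<lambda>x. m' x y) \<in> module_hom K ?D' ?D'"
    proof (rule module_homI)
      fix x z assume "x \<in> carrier ?D'" "z \<in> carrier ?D'"
      then obtain a e where "a \<in> carrier ?D" "x = h a" "e \<in> carrier ?D" "z = h e" using surj by blast
      then show "m' (x \<oplus>\<^bsub>?D'\<^esub> z) y = m' x y \<oplus>\<^bsub>?D'\<^esub> m' z y"
        using b ml(1)[of a e b] mc by (simp add: hD(2)[symmetric] mult[symmetric])
    next
      fix k x assume k: "k \<in> carrier K" and "x \<in> carrier ?D'"
      then obtain a where "a \<in> carrier ?D" "x = h a" using surj by blast
      then show "m' (k \<odot>\<^bsub>?D'\<^esub> x) y = k \<odot>\<^bsub>?D'\<^esub> m' x y"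
        using b sm[of k a b] mc k by (simp add: hD(3)[symmetric] mult[symmetric])
    qed (use m'c b hD(1) in auto)
  next
    fix y assume "y \<in> carrier ?D'"
    then obtain b where b: "b \<in> carrier ?D" "y = h b" using surj by blast
    show "m' y \<in> module_hom K ?D' ?D'"
    proof (rule module_homI)
      fix x z assume "x \<in> carrier ?D'" "z \<in> carrier ?D'"
      then obtain a e where "a \<in> carrier ?D" "x = h a" "e \<in> carrier ?D" "z = h e" using surj by blast
      then show "m' y (x \<oplus>\<^bsub>?D'\<^esub> z) = m' y x \<oplus>\<^bsub>?D'\<^esub> m' y z"
        using b ml(2)[of a e b] mc by (simp add: hD(2)[symmetric] mult[symmetric])
    next
      fix k x assume k: "k \<in> carrier K" and "x \<in> carrier ?D'"
      then obtain a where "a \<in> carrier ?D" "x = h a" using surj by blast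
      then show "m' y (k \<odot>\<^bsub>?D'\<^esub> x) = k \<odot>\<^bsub>?D'\<^esub> m' y x"
        using b sm[of k b a] mc k by (simp add: hD(3)[symmetric] mult[symmetric])
    qed (use m'c b hD(1) in auto)
  qed
  show "graded_algebra K N m' u'"
  proof (rule graded_algebraI[OF N K bil])
    fix x y z assume "x \<in> carrier ?D'" "y \<in> carrier ?D'" "z \<in> carrier ?D'"
    then obtain a b e where "a \<in> carrier ?D" "x = h a" "b \<in> carrier ?D" "y = h b" "e \<in> carrier ?D" "z = h e"
      using surj by meson
    then show "m' (m' x y) z = m' x (m' y z)"
      using A.m_assoc[of a b e] mc by (simp add: mult[symmetric] graded_alg_simps)
  next
    show "u' \<in> dsum_in N 0 ` carrier (N 0)" using u deg[of 0] unit by blast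
  next
    fix x assume "x \<in> carrier ?D'"
    then obtain a where a: "a \<in> carrier ?D" "x = h a" using surj by blast
    show "m' u' x = x" "m' x u' = x"
      using a A.l_one[of a] A.r_one[of a] uc unfolding unit[symmetric]
      by (simp_all add: mult[symmetric] graded_alg_simps)
  next
    fix p q x y assume x: "x \<in> carrier (N p)" and y: "y \<in> carrier (N q)"
    have "dsum_in N p x \<in> h ` (dsum_in M p ` carrier (M p))"
      "dsum_in N q y \<in> h ` (dsum_in M q ` carrier (M q))"
      unfolding deg using x y by auto
    then obtain a b where a: "a \<in> carrier (M p)" "dsum_in N p x = h (dsum_in M p a)"
      and b: "b \<in> carrier (M q)" "dsum_in N q y = h (dsum_in M q b)" by auto
    have "h (m (dsum_in M p a) (dsum_in M q b)) \<in> dsum_in N (p + q) ` carrier (N (p + q))"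
      unfolding deg[symmetric] using gr[OF a(1) b(1)] by (rule imageI)
    then show "m' (dsum_in N p x) (dsum_in N q y) \<in> dsum_in N (p + q) ` carrier (N (p + q))"
      using mult[OF GM.dsum_in_closed[OF a(1)] GM.dsum_in_closed[OF b(1)]] a(2) b(2) by simp
  qed
  have "h \<in> ring_iso ?A (graded_alg K N m' u')"
    using bij hD mult unit by (auto simp: ring_iso_def ring_hom_def graded_alg_simps)
  moreover have "h \<in> module_hom K ?A (graded_alg K N m' u')"
    using hom by (simp add: module_hom_def graded_alg_simps)
  ultimately show "h \<in> graded_alg_iso K M ?A N (graded_alg K N m' u')"
    using deg by (simp add: graded_alg_iso_def)
qed

section \<open>Expansion in a basis\<close>

lemma (in comm_monoid) finprod_shift:
  assumes "\<And>t. t \<in> {1..Suc d} \<Longrightarrow> f t \<in> carrier G"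
  shows "(\<Otimes>t\<in>{1..Suc d}. f t) = f 1 \<otimes> (\<Otimes>t\<in>{1..d}. f (Suc t))"
proof -
  have "{1..Suc d} = insert 1 (Suc ` {1..d})" by (auto simp: image_Suc_atLeastAtMost)
  moreover have "(\<Otimes>t\<in>insert 1 (Suc ` {1..d}). f t) = f 1 \<otimes> (\<Otimes>t\<in>Suc ` {1..d}. f t)"
    using assms by (intro finprod_insert) auto
  moreover have "(\<Otimes>t\<in>Suc ` {1..d}. f t) = (\<Otimes>t\<in>{1..d}. f (Suc t))"
    using assms by (intro finprod_reindex) auto
  ultimately show ?thesis by simp
qed

lemma (in comm_monoid) finprod_bij_betw:
  assumes "bij_betw h A B" "\<And>b. b \<in> B \<Longrightarrow> f b \<in> carrier G"
  shows "(\<Otimes>a\<in>A. f (h a)) = (\<Otimes>b\<in>B. f b)"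
  using assms finprod_reindex[of f h A] by (auto simp: bij_betw_def)

lemma letter_closed: "\<lbrakk>xs \<in> words E d; t \<in> {1..d}\<rbrakk> \<Longrightarrow> letter xs t \<in> carrier E"
  by (auto simp: words_def letter_def intro!: subsetD[OF _ nth_mem])

lemma Cons_words: "x # xs \<in> words E (Suc d) \<longleftrightarrow> x \<in> carrier E \<and> xs \<in> words E d"
  by (auto simp: words_def)

lemma multilinear_Cons:
  assumes g: "multilinear K E (Suc d) P g"
  shows "x \<in> carrier E \<Longrightarrow> multilinear K E d P (\<lambda>xs. g (x # xs))"
    and "xs \<in> words E d \<Longrightarrow> x \<in> carrier E \<Longrightarrow> (\<lambda>y. g (y # xs)) \<in> module_hom K E P"
proof -
  show "multilinear K E d P (\<lambda>xs. g (x # xs))" if x: "x \<in> carrier E"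
    unfolding multilinear_def
  proof (intro conjI ballI allI impI)
    fix xs i assume "xs \<in> words E d" "i < d"
    then show "(\<lambda>y. g (x # xs[i := y])) \<in> module_hom K E P"
      using multilinear_hom[OF g, of "x # xs" "Suc i"] x by (simp add: Cons_words)
  qed (simp add: multilinear_closed[OF g] Cons_words x)
  show "(\<lambda>y. g (y # xs)) \<in> module_hom K E P" if "xs \<in> words E d" "x \<in> carrier E"
    using multilinear_hom[OF g, of "x # xs" 0] that by (simp add: Cons_words)
qed

definition index_words :: "'i set \<Rightarrow> nat \<Rightarrow> 'i list set"
  where "index_words I d = {ws. set ws \<subseteq> I \<and> length ws = d}"

lemma index_words_finite: "finite I \<Longrightarrow> finite (index_words I d)"
  unfolding index_words_def by (rule finite_lists_length_eq)

lemma index_words_0 [simp]: "index_words I 0 = {[]}"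
  by (auto simp: index_words_def)

lemma index_words_Suc_bij: "bij_betw (\<lambda>(i, ws). i # ws) (I \<times> index_words I d) (index_words I (Suc d))"
  by (rule bij_betwI[of _ _ _ "\<lambda>ws. (hd ws, tl ws)"]) (auto simp: index_words_def length_Suc_conv)

lemma map_index_words: "\<lbrakk>v ` I \<subseteq> carrier E; ws \<in> index_words I d\<rbrakk> \<Longrightarrow> map v ws \<in> words E d"
  by (auto simp: index_words_def words_def)

lemma index_letter: "\<lbrakk>ws \<in> index_words I d; t \<in> {1..d}\<rbrakk> \<Longrightarrow> letter ws t \<in> I"
  by (auto simp: index_words_def letter_def intro!: subsetD[OF _ nth_mem])

text \<open>Index set, vectors and coefficients stay abstract because there are two uses: a basis of
  \<open>E\<close> with its coordinates, and the dual vectors, where the coefficients of a form are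
  its values on the basis. The induction splits off the first letter.\<close>

lemma multilinear_expand:
  assumes E: "module K E" and P: "module K P" and fin: "finite I" and v: "v ` I \<subseteq> carrier E"
    and co: "\<And>i x. \<lbrakk>i \<in> I; x \<in> carrier E\<rbrakk> \<Longrightarrow> co i x \<in> carrier K"
    and expand: "\<And>x. x \<in> carrier E \<Longrightarrow> x = (\<Oplus>\<^bsub>E\<^esub>i\<in>I. co i x \<odot>\<^bsub>E\<^esub> v i)"
    and g: "multilinear K E d P g" and xs: "xs \<in> words E d"
  shows "g xs = (\<Oplus>\<^bsub>P\<^esub>ws\<in>index_words I d. (\<Otimes>\<^bsub>K\<^esub>t\<in>{1..d}. co (letter ws t) (letter xs t)) \<odot>\<^bsub>P\<^esub> g (map v ws))"
  using g xs
proof (induction d arbitrary: g xs)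
  case 0
  interpret P: module K P by fact
  have "xs = []" using 0 by (simp add: words_def)
  then show ?case using multilinear_closed[OF 0] by simp
next
  case (Suc d)
  interpret E: module K E by fact
  interpret P: module K P by fact
  obtain x ys where x: "xs = x # ys" "x \<in> carrier E" "ys \<in> words E d"
    using Suc.prems(2) by (cases xs) (auto simp: words_def)
  note hom = multilinear_Cons(2)[OF Suc.prems(1) x(3,2)]
  have vc: "v i \<in> carrier E" if "i \<in> I" for i using v that by auto
  let ?pr = "\<lambda>ws. \<Otimes>\<^bsub>K\<^esub>t\<in>{1..d}. co (letter ws t) (letter ys t)"
  have prc: "?pr ws \<in> carrier K" if "ws \<in> index_words I d" for ws
    using index_letter[OF that] letter_closed[OF x(3)] co by (intro E.R.finprod_closed) auto
  have gc: "g (v i # map v ws) \<in> carrier P" if "i \<in> I" "ws \<in> index_words I d" for i ws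
    using vc[OF that(1)] map_index_words[OF v that(2)]
    by (intro multilinear_closed[OF Suc.prems(1)]) (simp add: Cons_words)
  have "g xs = g ((\<Oplus>\<^bsub>E\<^esub>i\<in>I. co i x \<odot>\<^bsub>E\<^esub> v i) # ys)" using expand[OF x(2)] x(1) by simp
  also have "\<dots> = (\<Oplus>\<^bsub>P\<^esub>i\<in>I. g (co i x \<odot>\<^bsub>E\<^esub> v i # ys))"
    using co x(2) vc by (intro module_hom_finsum[OF hom E P]) auto
  also have "\<dots> = (\<Oplus>\<^bsub>P\<^esub>i\<in>I. \<Oplus>\<^bsub>P\<^esub>ws\<in>index_words I d. co i x \<odot>\<^bsub>P\<^esub> (?pr ws \<odot>\<^bsub>P\<^esub> g (v i # map v ws)))"
  proof (rule P.finsum_cong'[OF refl])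
    fix i assume i: "i \<in> I"
    have "g (co i x \<odot>\<^bsub>E\<^esub> v i # ys) = co i x \<odot>\<^bsub>P\<^esub> g (v i # ys)"
      using module_homD(3)[OF hom] co[OF i x(2)] vc[OF i] by simp
    also have "g (v i # ys) = (\<Oplus>\<^bsub>P\<^esub>ws\<in>index_words I d. ?pr ws \<odot>\<^bsub>P\<^esub> g (v i # map v ws))"
      by (rule Suc.IH[OF multilinear_Cons(1)[OF Suc.prems(1) vc[OF i]] x(3)])
    also have "co i x \<odot>\<^bsub>P\<^esub> \<dots> = (\<Oplus>\<^bsub>P\<^esub>ws\<in>index_words I d. co i x \<odot>\<^bsub>P\<^esub> (?pr ws \<odot>\<^bsub>P\<^esub> g (v i # map v ws)))"
      using co[OF i x(2)] prc gc[OF i] index_words_finite[OF fin]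
      by (intro P.finsum_smult_ldistr) auto
    finally show "g (co i x \<odot>\<^bsub>E\<^esub> v i # ys) = \<dots>" .
  qed (use co x(2) prc gc in \<open>auto intro!: P.finsum_closed\<close>)
  also have "\<dots> = (\<Oplus>\<^bsub>P\<^esub>z\<in>I \<times> index_words I d. co (fst z) x \<odot>\<^bsub>P\<^esub> (?pr (snd z) \<odot>\<^bsub>P\<^esub> g (v (fst z) # map v (snd z))))"
    using co x(2) prc gc fin index_words_finite[OF fin] by (intro P.finsum_Sigma) auto
  also have "\<dots> = (\<Oplus>\<^bsub>P\<^esub>z\<in>I \<times> index_words I d. (\<lambda>ws. (\<Otimes>\<^bsub>K\<^esub>t\<in>{1..Suc d}. co (letter ws t) (letter xs t)) \<odot>\<^bsub>P\<^esub> g (map v ws))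
      ((\<lambda>(i, ws). i # ws) z))"
  proof (rule P.finsum_cong'[OF refl])
    let ?T = "\<lambda>ws. (\<Otimes>\<^bsub>K\<^esub>t\<in>{1..Suc d}. co (letter ws t) (letter xs t)) \<odot>\<^bsub>P\<^esub> g (map v ws)"
    have key: "co i x \<odot>\<^bsub>P\<^esub> (?pr ws \<odot>\<^bsub>P\<^esub> g (v i # map v ws)) = ?T (i # ws)"
      and key_closed: "?T (i # ws) \<in> carrier P" if i: "i \<in> I" and ws: "ws \<in> index_words I d" for i ws
    proof -
      have iw: "i # ws \<in> index_words I (Suc d)" using i ws by (auto simp: index_words_def)
      have "(\<Otimes>\<^bsub>K\<^esub>t\<in>{1..Suc d}. co (letter (i # ws) t) (letter xs t))
          = co (letter (i # ws) 1) (letter xs 1) \<otimes>\<^bsub>K\<^esub> (\<Otimes>\<^bsub>K\<^esub>t\<in>{1..d}. co (letter (i # ws) (Suc t)) (letter xs (Suc t)))"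
        by (rule E.R.finprod_shift) (use index_letter[OF iw] letter_closed[OF Suc.prems(2)] co in auto)
      also have "(\<Otimes>\<^bsub>K\<^esub>t\<in>{1..d}. co (letter (i # ws) (Suc t)) (letter xs (Suc t))) = ?pr ws"
        by (rule E.R.finprod_cong')
           (use index_letter[OF ws] letter_closed[OF x(3)] co in \<open>auto simp: x(1) letter_def nth_Cons'\<close>)
      finally have eq: "(\<Otimes>\<^bsub>K\<^esub>t\<in>{1..Suc d}. co (letter (i # ws) t) (letter xs t)) = co i x \<otimes>\<^bsub>K\<^esub> ?pr ws"
        by (simp add: letter_def x(1))
      show "co i x \<odot>\<^bsub>P\<^esub> (?pr ws \<odot>\<^bsub>P\<^esub> g (v i # map v ws)) = ?T (i # ws)"
        unfolding eq using co[OF i x(2)] prc[OF ws] gc[OF i ws] by (simp add: P.smult_assoc1)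
      show "?T (i # ws) \<in> carrier P"
        unfolding eq using co[OF i x(2)] prc[OF ws] gc[OF i ws] by simp
    qed
    show "co (fst z) x \<odot>\<^bsub>P\<^esub> (?pr (snd z) \<odot>\<^bsub>P\<^esub> g (v (fst z) # map v (snd z)))
        = (\<lambda>ws. (\<Otimes>\<^bsub>K\<^esub>t\<in>{1..Suc d}. co (letter ws t) (letter xs t)) \<odot>\<^bsub>P\<^esub> g (map v ws)) ((\<lambda>(i, ws). i # ws) z)"
      if "z \<in> I \<times> index_words I d" for z
      using key[of "fst z" "snd z"] that by (simp add: mem_Times_iff case_prod_unfold)
    show "(\<lambda>z. (\<lambda>ws. (\<Otimes>\<^bsub>K\<^esub>t\<in>{1..Suc d}. co (letter ws t) (letter xs t)) \<odot>\<^bsub>P\<^esub> g (map v ws)) ((\<lambda>(i, ws). i # ws) z))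
        \<in> I \<times> index_words I d \<rightarrow> carrier P"
      using key_closed by auto
  qed
  also have "\<dots> = (\<Oplus>\<^bsub>P\<^esub>ws\<in>index_words I (Suc d). (\<Otimes>\<^bsub>K\<^esub>t\<in>{1..Suc d}. co (letter ws t) (letter xs t)) \<odot>\<^bsub>P\<^esub> g (map v ws))"
  proof (rule P.finsum_bij_betw[OF index_words_Suc_bij])
    fix ws assume ws: "ws \<in> index_words I (Suc d)"
    have "(\<Otimes>\<^bsub>K\<^esub>t\<in>{1..Suc d}. co (letter ws t) (letter xs t)) \<in> carrier K"
      using index_letter[OF ws] letter_closed[OF Suc.prems(2)] co by (intro E.R.finprod_closed) auto
    then show "(\<Otimes>\<^bsub>K\<^esub>t\<in>{1..Suc d}. co (letter ws t) (letter xs t)) \<odot>\<^bsub>P\<^esub> g (map v ws) \<in> carrier P"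
      using multilinear_closed[OF Suc.prems(1) map_index_words[OF v ws]] by simp
  qed
  finally show ?case .
qed

text \<open>The factor may depend on the position. If \<open>h t\<close> is the form in place
  \<open>t\<close>, the product is multilinear in the vectors; if \<open>h t\<close> is evaluation
  at the vector in place \<open>t\<close>, it is multilinear in the forms.\<close>

lemma product_multilinear:
  assumes E: "module K E" and h: "\<And>t. t \<in> {1..d} \<Longrightarrow> h t \<in> module_hom K E (regular_module K)"
  shows "multilinear K E d (regular_module K) (\<lambda>xs. \<Otimes>\<^bsub>K\<^esub>t\<in>{1..d}. h t (letter xs t))"
proof -
  interpret E: module K E by fact
  have hc: "h t x \<in> carrier K" if "t \<in> {1..d}" "x \<in> carrier E" for t x
    using module_homD(1)[OF h[OF that(1)] that(2)] by simp
  show ?thesis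
    unfolding multilinear_def
  proof (intro conjI ballI allI impI)
    fix xs assume xs: "xs \<in> words E d"
    show "(\<Otimes>\<^bsub>K\<^esub>t\<in>{1..d}. h t (letter xs t)) \<in> carrier (regular_module K)"
      using hc letter_closed[OF xs] by (auto intro!: E.R.finprod_closed)
    fix i assume i: "i < d"
    \<comment> \<open>List index \<open>i\<close> is position \<open>Suc i\<close>; this is the one
      factor that varies.\<close>
    have S: "{1..d} = insert (Suc i) ({1..d} - {Suc i})" using i by auto
    let ?r = "\<Otimes>\<^bsub>K\<^esub>t\<in>{1..d} - {Suc i}. h t (letter xs t)"
    have rc: "?r \<in> carrier K" using hc letter_closed[OF xs] by (intro E.R.finprod_closed) auto
    have eq: "(\<Otimes>\<^bsub>K\<^esub>t\<in>{1..d}. h t (letter (xs[i := x]) t)) = ?r \<otimes>\<^bsub>K\<^esub> h (Suc i) x" if x: "x \<in> carrier E" for x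
    proof -
      note up = words_update[OF xs x, of i]
      have "(\<Otimes>\<^bsub>K\<^esub>t\<in>{1..d}. h t (letter (xs[i := x]) t))
          = h (Suc i) (letter (xs[i := x]) (Suc i)) \<otimes>\<^bsub>K\<^esub> (\<Otimes>\<^bsub>K\<^esub>t\<in>{1..d} - {Suc i}. h t (letter (xs[i := x]) t))"
        by (subst S, rule E.R.finprod_insert) (use hc letter_closed[OF up] i in auto)
      also have "letter (xs[i := x]) (Suc i) = x" using i words_length[OF xs] by (simp add: letter_def)
      also have "(\<Otimes>\<^bsub>K\<^esub>t\<in>{1..d} - {Suc i}. h t (letter (xs[i := x]) t)) = ?r"
      proof (rule E.R.finprod_cong'[OF refl])
        fix t assume "t \<in> {1..d} - {Suc i}"
        then have "letter (xs[i := x]) t = letter xs t" unfolding letter_def by (intro nth_list_update_neq) auto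
        then show "h t (letter (xs[i := x]) t) = h t (letter xs t)" by simp
      qed (use hc letter_closed[OF xs] in auto)
      finally show ?thesis using rc hc[of "Suc i" x] x i by (simp add: E.R.m_comm)
    qed
    have "(\<lambda>x. ?r \<odot>\<^bsub>regular_module K\<^esub> h (Suc i) x) \<in> module_hom K E (regular_module K)"
      by (rule module_hom_smult[OF E regular_module_module[OF E.R.is_cring] h rc]) (use i in auto)
    then show "(\<lambda>x. \<Otimes>\<^bsub>K\<^esub>t\<in>{1..d}. h t (letter (xs[i := x]) t)) \<in> module_hom K E (regular_module K)"
      by (rule module_hom_cong[OF _ E]) (simp only: eq regular_module_simps)
  qed
qed

section \<open>Dual modules\<close>

lemma dual_module_simps:
  "carrier (dual_module K M) = module_hom K M (regular_module K) \<inter> extensional (carrier M)"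
  "\<zero>\<^bsub>dual_module K M\<^esub> = (\<lambda>x\<in>carrier M. \<zero>\<^bsub>K\<^esub>)"
  "f \<oplus>\<^bsub>dual_module K M\<^esub> g = (\<lambda>x\<in>carrier M. f x \<oplus>\<^bsub>K\<^esub> g x)"
  "a \<odot>\<^bsub>dual_module K M\<^esub> f = (\<lambda>x\<in>carrier M. a \<otimes>\<^bsub>K\<^esub> f x)"
  by (simp_all add: dual_module_def)

lemma dual_module_eqI:
  assumes "f \<in> carrier (dual_module K M)" "g \<in> carrier (dual_module K M)"
    "\<And>x. x \<in> carrier M \<Longrightarrow> f x = g x"
  shows "f = g"
  using assms by (auto simp: dual_module_simps intro: extensionalityI)

lemma restrict_dual:
  assumes "module K M" "f \<in> module_hom K M (regular_module K)"
  shows "restrict f (carrier M) \<in> carrier (dual_module K M)"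
  using module_hom_cong[OF assms(2,1)] by (simp add: dual_module_simps)

lemma dual_closed: "\<lbrakk>f \<in> carrier (dual_module K M); x \<in> carrier M\<rbrakk> \<Longrightarrow> f x \<in> carrier K"
  using module_homD(1)[of f K M "regular_module K" x] by (simp add: dual_module_simps)

lemma dual_hom: "f \<in> carrier (dual_module K M) \<Longrightarrow> f \<in> module_hom K M (regular_module K)"
  by (simp add: dual_module_simps)

lemma dual_module_module:
  assumes M: "module K M" shows "module K (dual_module K M)"
proof -
  interpret M: module K M by fact
  let ?D = "dual_module K M"
  note R = regular_module_module[OF M.R.is_cring]
  note [simp] = dual_closed
  have add: "f \<oplus>\<^bsub>?D\<^esub> g \<in> carrier ?D" if "f \<in> carrier ?D" "g \<in> carrier ?D" for f g
    using restrict_dual[OF M module_hom_plus[OF M R dual_hom[OF that(1)] dual_hom[OF that(2)]]]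
    by (simp add: dual_module_simps(3))
  have smult: "a \<odot>\<^bsub>?D\<^esub> f \<in> carrier ?D" if "a \<in> carrier K" "f \<in> carrier ?D" for a f
    using restrict_dual[OF M module_hom_smult[OF M R dual_hom[OF that(2)] that(1)]]
    by (simp add: dual_module_simps(4))
  have zero: "\<zero>\<^bsub>?D\<^esub> \<in> carrier ?D"
    using restrict_dual[OF M module_hom_const_zero[OF M R]] by (simp add: dual_module_simps(2))
  note s = dual_module_simps(2,3,4)
  have ab: "abelian_group ?D"
  proof (rule abelian_groupI[OF add zero])
    fix f assume f: "f \<in> carrier ?D"
    show "\<exists>g\<in>carrier ?D. g \<oplus>\<^bsub>?D\<^esub> f = \<zero>\<^bsub>?D\<^esub>"
    \<comment> \<open>The negative is taken as a scalar multiple, for which membership in the dual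
      is already known.\<close>
    proof (intro bexI[of _ "(\<ominus>\<^bsub>K\<^esub> \<one>\<^bsub>K\<^esub>) \<odot>\<^bsub>?D\<^esub> f"])
      show "(\<ominus>\<^bsub>K\<^esub> \<one>\<^bsub>K\<^esub>) \<odot>\<^bsub>?D\<^esub> f \<oplus>\<^bsub>?D\<^esub> f = \<zero>\<^bsub>?D\<^esub>"
        using f by (auto simp: s M.R.l_minus M.R.l_neg intro!: restrict_ext)
    qed (use f smult in auto)
    show "\<zero>\<^bsub>?D\<^esub> \<oplus>\<^bsub>?D\<^esub> f = f"
      by (rule dual_module_eqI[OF add[OF zero f] f]) (use f in \<open>simp add: s\<close>)
  next
    fix f g assume fg: "f \<in> carrier ?D" "g \<in> carrier ?D"
    show "f \<oplus>\<^bsub>?D\<^esub> g = g \<oplus>\<^bsub>?D\<^esub> f"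
      by (rule dual_module_eqI[OF add[OF fg] add[OF fg(2,1)]]) (use fg in \<open>simp add: s M.R.a_comm\<close>)
    fix h assume h: "h \<in> carrier ?D"
    show "f \<oplus>\<^bsub>?D\<^esub> g \<oplus>\<^bsub>?D\<^esub> h = f \<oplus>\<^bsub>?D\<^esub> (g \<oplus>\<^bsub>?D\<^esub> h)"
      by (rule dual_module_eqI[OF add[OF add[OF fg] h] add[OF fg(1) add[OF fg(2) h]]])
         (use fg h in \<open>simp add: s M.R.a_assoc\<close>)
  qed
  show ?thesis
  proof (rule moduleI[OF M.R.is_cring ab smult])
    fix a b f assume a: "a \<in> carrier K" and b: "b \<in> carrier K" and f: "f \<in> carrier ?D"
    show "(a \<oplus>\<^bsub>K\<^esub> b) \<odot>\<^bsub>?D\<^esub> f = a \<odot>\<^bsub>?D\<^esub> f \<oplus>\<^bsub>?D\<^esub> b \<odot>\<^bsub>?D\<^esub> f"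
      by (rule dual_module_eqI[OF smult[OF _ f] add[OF smult[OF a f] smult[OF b f]]])
         (use a b f in \<open>simp_all add: s M.R.l_distr\<close>)
    show "(a \<otimes>\<^bsub>K\<^esub> b) \<odot>\<^bsub>?D\<^esub> f = a \<odot>\<^bsub>?D\<^esub> (b \<odot>\<^bsub>?D\<^esub> f)"
      by (rule dual_module_eqI[OF smult[OF _ f] smult[OF a smult[OF b f]]])
         (use a b f in \<open>simp_all add: s M.R.m_assoc\<close>)
  next
    fix a f g assume a: "a \<in> carrier K" and f: "f \<in> carrier ?D" and g: "g \<in> carrier ?D"
    show "a \<odot>\<^bsub>?D\<^esub> (f \<oplus>\<^bsub>?D\<^esub> g) = a \<odot>\<^bsub>?D\<^esub> f \<oplus>\<^bsub>?D\<^esub> a \<odot>\<^bsub>?D\<^esub> g"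
      by (rule dual_module_eqI[OF smult[OF a add[OF f g]] add[OF smult[OF a f] smult[OF a g]]])
         (use a f g in \<open>simp add: s M.R.r_distr\<close>)
  next
    fix f assume f: "f \<in> carrier ?D"
    show "\<one>\<^bsub>K\<^esub> \<odot>\<^bsub>?D\<^esub> f = f"
      by (rule dual_module_eqI[OF smult[OF _ f] f]) (use f in \<open>simp_all add: s\<close>)
  qed
qed

lemma dual_eval_hom: "x \<in> carrier M \<Longrightarrow> (\<lambda>f. f x) \<in> module_hom K (dual_module K M) (regular_module K)"
  by (rule module_homI) (simp_all add: dual_closed dual_module_simps(3,4))

section \<open>Coordinates and dual vectors\<close>

locale based_module = E: module K E
  for K :: "('k,'r) ring_scheme" (structure) and E :: "('k,'e,'s) module_scheme" (structure) +
  fixes B assumes basis: "is_finite_basis K E B"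
begin

definition coord :: "'e \<Rightarrow> 'e \<Rightarrow> 'k"
  where "coord x = (THE a. a \<in> B \<rightarrow>\<^sub>E carrier K \<and> x = (\<Oplus>\<^bsub>E\<^esub>b\<in>B. a b \<odot>\<^bsub>E\<^esub> b))"

lemma B_finite: "finite B" and B_subset: "B \<subseteq> carrier E"
  using basis by (auto simp: is_finite_basis_def)

lemma coord_ex1: "x \<in> carrier E \<Longrightarrow> \<exists>!a. a \<in> B \<rightarrow>\<^sub>E carrier K \<and> x = (\<Oplus>\<^bsub>E\<^esub>b\<in>B. a b \<odot>\<^bsub>E\<^esub> b)"
  using basis by (auto simp: is_finite_basis_def)

lemma coord: 
  assumes "x \<in> carrier E"
  shows "coord x \<in> B \<rightarrow>\<^sub>E carrier K" "x = (\<Oplus>\<^bsub>E\<^esub>b\<in>B. coord x b \<odot>\<^bsub>E\<^esub> b)"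
  using theI'[OF coord_ex1[OF assms]] unfolding coord_def[symmetric] by blast+

lemma coord_closed: "\<lbrakk>x \<in> carrier E; b \<in> B\<rbrakk> \<Longrightarrow> coord x b \<in> carrier K"
  using coord(1) by auto

lemma coord_unique:
  assumes x: "x \<in> carrier E" and a: "\<And>b. b \<in> B \<Longrightarrow> a b \<in> carrier K" 
    and eq: "x = (\<Oplus>\<^bsub>E\<^esub>b\<in>B. a b \<odot>\<^bsub>E\<^esub> b)" and b: "b \<in> B"
  shows "coord x b = a b"
proof -
  \<comment> \<open>Uniqueness of coordinates is stated for functions that are
    \<open>undefined\<close> off \<open>B\<close>, so \<open>a\<close> is restricted to
    \<open>B\<close> first.\<close>
  have "x = (\<Oplus>\<^bsub>E\<^esub>b\<in>B. restrict a B b \<odot>\<^bsub>E\<^esub> b)"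
    unfolding eq using a B_subset by (intro E.M.finsum_cong') auto
  moreover have "restrict a B \<in> B \<rightarrow>\<^sub>E carrier K" using a by auto
  ultimately have "coord x = restrict a B" using coord_ex1[OF x] coord[OF x] by blast
  then show ?thesis using b by simp
qed

lemma coord_hom:
  assumes b: "b \<in> B" shows "(\<lambda>x. coord x b) \<in> module_hom K E (regular_module K)"
proof (rule module_homI)
  fix x y assume x: "x \<in> carrier E" and y: "y \<in> carrier E"
  have Bc: "b \<in> carrier E" if "b \<in> B" for b using that B_subset by auto
  have "x \<oplus>\<^bsub>E\<^esub> y = (\<Oplus>\<^bsub>E\<^esub>b\<in>B. coord x b \<odot>\<^bsub>E\<^esub> b) \<oplus>\<^bsub>E\<^esub> (\<Oplus>\<^bsub>E\<^esub>b\<in>B. coord y b \<odot>\<^bsub>E\<^esub> b)"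
    using coord(2)[OF x] coord(2)[OF y] by simp
  also have "\<dots> = (\<Oplus>\<^bsub>E\<^esub>b\<in>B. coord x b \<odot>\<^bsub>E\<^esub> b \<oplus>\<^bsub>E\<^esub> coord y b \<odot>\<^bsub>E\<^esub> b)"
    using coord_closed[OF x] coord_closed[OF y] Bc by (intro E.finsum_addf[symmetric]) auto
  also have "\<dots> = (\<Oplus>\<^bsub>E\<^esub>b\<in>B. (coord x b \<oplus> coord y b) \<odot>\<^bsub>E\<^esub> b)"
    using coord_closed[OF x] coord_closed[OF y] Bc by (intro E.M.finsum_cong') (auto simp: E.smult_l_distr)
  finally have eq: "x \<oplus>\<^bsub>E\<^esub> y = (\<Oplus>\<^bsub>E\<^esub>b\<in>B. (coord x b \<oplus> coord y b) \<odot>\<^bsub>E\<^esub> b)" .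
  show "coord (x \<oplus>\<^bsub>E\<^esub> y) b = coord x b \<oplus>\<^bsub>regular_module K\<^esub> coord y b"
    unfolding regular_module_simps
    by (rule coord_unique[OF _ _ eq b]) (use x y coord_closed in auto)
next
  fix a x assume a: "a \<in> carrier K" and x: "x \<in> carrier E"
  have Bc: "b \<in> carrier E" if "b \<in> B" for b using that B_subset by auto
  have "a \<odot>\<^bsub>E\<^esub> x = a \<odot>\<^bsub>E\<^esub> (\<Oplus>\<^bsub>E\<^esub>b\<in>B. coord x b \<odot>\<^bsub>E\<^esub> b)"
    using coord(2)[OF x] by simp
  also have "\<dots> = (\<Oplus>\<^bsub>E\<^esub>b\<in>B. a \<odot>\<^bsub>E\<^esub> (coord x b \<odot>\<^bsub>E\<^esub> b))"
    using coord_closed[OF x] Bc a B_finite by (intro E.finsum_smult_ldistr) auto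
  also have "\<dots> = (\<Oplus>\<^bsub>E\<^esub>b\<in>B. (a \<otimes> coord x b) \<odot>\<^bsub>E\<^esub> b)"
    using coord_closed[OF x] Bc a by (intro E.M.finsum_cong') (auto simp: E.smult_assoc1)
  finally have eq: "a \<odot>\<^bsub>E\<^esub> x = (\<Oplus>\<^bsub>E\<^esub>b\<in>B. (a \<otimes> coord x b) \<odot>\<^bsub>E\<^esub> b)" .
  show "coord (a \<odot>\<^bsub>E\<^esub> x) b = a \<odot>\<^bsub>regular_module K\<^esub> coord x b"
    unfolding regular_module_simps
    by (rule coord_unique[OF _ _ eq b]) (use x a coord_closed in auto)
qed (use b coord_closed in simp)

definition dual_vector :: "'e \<Rightarrow> 'e \<Rightarrow> 'k"
  where "dual_vector b = (\<lambda>x\<in>carrier E. coord x b)"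

lemma dual_vector_closed: "b \<in> B \<Longrightarrow> dual_vector b \<in> carrier (dual_module K E)"
  unfolding dual_vector_def by (rule restrict_dual[OF E.module_axioms coord_hom])

text \<open>Apply \<open>f\<close> to the expansion of a vector in the basis: the value of
  \<open>f\<close> is the sum of the coordinates times the values \<open>f b\<close>.\<close>

lemma dual_expand:
  assumes f: "f \<in> carrier (dual_module K E)"
  shows "f = (\<Oplus>\<^bsub>dual_module K E\<^esub>b\<in>B. f b \<odot>\<^bsub>dual_module K E\<^esub> dual_vector b)"
proof -
  interpret D: module K "dual_module K E" by (rule dual_module_module[OF E.module_axioms])
  have Bc: "b \<in> carrier E" if "b \<in> B" for b using that B_subset by auto
  have fb: "f b \<in> carrier K" if "b \<in> B" for b using dual_closed[OF f Bc[OF that]] .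
  have tc: "f b \<odot>\<^bsub>dual_module K E\<^esub> dual_vector b \<in> carrier (dual_module K E)" if "b \<in> B" for b
    using fb[OF that] dual_vector_closed[OF that] by simp
  show ?thesis
  proof (rule dual_module_eqI[OF f])
    show "(\<Oplus>\<^bsub>dual_module K E\<^esub>b\<in>B. f b \<odot>\<^bsub>dual_module K E\<^esub> dual_vector b) \<in> carrier (dual_module K E)"
      using tc by (intro D.finsum_closed) auto
    fix x assume x: "x \<in> carrier E"
    have "(\<Oplus>\<^bsub>dual_module K E\<^esub>b\<in>B. f b \<odot>\<^bsub>dual_module K E\<^esub> dual_vector b) x
        = (\<Oplus>\<^bsub>K\<^esub>b\<in>B. (f b \<odot>\<^bsub>dual_module K E\<^esub> dual_vector b) x)"
      using module_hom_finsum[OF dual_eval_hom[OF x] D.module_axioms regular_module_module[OF E.R.is_cring] tc] by simp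
    also have "\<dots> = (\<Oplus>\<^bsub>K\<^esub>b\<in>B. f (coord x b \<odot>\<^bsub>E\<^esub> b))"
      using module_homD(3)[OF dual_hom[OF f] coord_closed[OF x] Bc] fb coord_closed[OF x] x dual_closed[OF f] Bc
      by (intro E.R.finsum_cong') (auto simp: dual_module_simps(4) dual_vector_def E.R.m_comm)
    also have "\<dots> = f (\<Oplus>\<^bsub>E\<^esub>b\<in>B. coord x b \<odot>\<^bsub>E\<^esub> b)"
      using module_hom_finsum[OF dual_hom[OF f] E.module_axioms regular_module_module[OF E.R.is_cring], of B "\<lambda>b. coord x b \<odot>\<^bsub>E\<^esub> b"]
        coord_closed[OF x] Bc by simp
    finally show "f x = (\<Oplus>\<^bsub>dual_module K E\<^esub>b\<in>B. f b \<odot>\<^bsub>dual_module K E\<^esub> dual_vector b) x"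
      using coord(2)[OF x] by simp
  qed
qed

end

section \<open>The pairing\<close>

context rational_letters
begin

text \<open>A fixed expansion can be averaged coefficient by coefficient. Read from right to left it
  recognises the sum over basis words, arising when \<open>to_dual\<close> and
  \<open>from_dual\<close> are composed, as a twisted sum.\<close>

lemma twisted_sum_expand:
  assumes P: "module K P" and xs: "xs \<in> words E d" and fin: "finite S"
    and g: "\<And>ys. ys \<in> words E d \<Longrightarrow> g ys = (\<Oplus>\<^bsub>P\<^esub>ws\<in>S. k ws ys \<odot>\<^bsub>P\<^esub> b ws)"
    and k: "\<And>ws ys. \<lbrakk>ws \<in> S; ys \<in> words E d\<rbrakk> \<Longrightarrow> k ws ys \<in> carrier K"
    and b: "\<And>ws. ws \<in> S \<Longrightarrow> b ws \<in> carrier P"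
  shows "twisted_sum P d g xs = (\<Oplus>\<^bsub>P\<^esub>ws\<in>S. twisted_sum R d (k ws) xs \<odot>\<^bsub>P\<^esub> b ws)"
proof -
  interpret P: module K P by fact
  have kb: "(\<lambda>a. a \<odot>\<^bsub>P\<^esub> b ws) \<in> module_hom K R P" if "ws \<in> S" for ws
    using b[OF that] by (intro module_homI) (auto simp: P.smult_l_distr P.smult_assoc1)
  \<comment> \<open>The scalar one is inserted because \<open>twisted_sum_sum\<close> expects
    coefficients that do not depend on the word; those of the expansion do depend on it and stay
    inside.\<close>
  have "twisted_sum P d g xs = twisted_sum P d (\<lambda>ys. \<Oplus>\<^bsub>P\<^esub>ws\<in>S. \<one> \<odot>\<^bsub>P\<^esub> (k ws ys \<odot>\<^bsub>P\<^esub> b ws)) xs"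
  proof (rule twisted_sum_cong[OF P xs])
    fix ys assume ys: "ys \<in> words E d"
    have t: "\<one> \<odot>\<^bsub>P\<^esub> (k ws ys \<odot>\<^bsub>P\<^esub> b ws) = k ws ys \<odot>\<^bsub>P\<^esub> b ws" "k ws ys \<odot>\<^bsub>P\<^esub> b ws \<in> carrier P"
      if "ws \<in> S" for ws using k[OF that ys] b[OF that] by simp_all
    then show "(\<Oplus>\<^bsub>P\<^esub>ws\<in>S. \<one> \<odot>\<^bsub>P\<^esub> (k ws ys \<odot>\<^bsub>P\<^esub> b ws)) \<in> carrier P"
      by (intro P.finsum_closed) auto
    show "g ys = (\<Oplus>\<^bsub>P\<^esub>ws\<in>S. \<one> \<odot>\<^bsub>P\<^esub> (k ws ys \<odot>\<^bsub>P\<^esub> b ws))"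
      unfolding g[OF ys] using t by (intro P.finsum_cong') auto
  qed
  also have "\<dots> = (\<Oplus>\<^bsub>P\<^esub>ws\<in>S. \<one> \<odot>\<^bsub>P\<^esub> twisted_sum P d (\<lambda>ys. k ws ys \<odot>\<^bsub>P\<^esub> b ws) xs)"
    using k b by (intro twisted_sum_sum[OF P xs fin]) auto
  also have "\<dots> = (\<Oplus>\<^bsub>P\<^esub>ws\<in>S. twisted_sum R d (k ws) xs \<odot>\<^bsub>P\<^esub> b ws)"
  proof (rule P.finsum_cong'[OF refl])
    fix ws assume ws: "ws \<in> S"
    have c: "twisted_sum R d (k ws) xs \<in> carrier R" by (rule twisted_sum_closed[OF R_module xs]) (use k ws in simp)
    have "twisted_sum R d (k ws) xs \<odot>\<^bsub>P\<^esub> b ws = twisted_sum P d (\<lambda>ys. k ws ys \<odot>\<^bsub>P\<^esub> b ws) xs"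
      by (rule twisted_sum_hom[OF R_module P kb[OF ws] xs]) (use k ws in simp)
    then show "\<one> \<odot>\<^bsub>P\<^esub> twisted_sum P d (\<lambda>ys. k ws ys \<odot>\<^bsub>P\<^esub> b ws) xs = twisted_sum R d (k ws) xs \<odot>\<^bsub>P\<^esub> b ws"
      using c b[OF ws] by (metis P.smult_closed P.smult_one regular_module_simps(1))
  next
    have "twisted_sum R d (k ws) xs \<in> carrier R" if "ws \<in> S" for ws
      by (rule twisted_sum_closed[OF R_module xs]) (use k that in simp)
    then show "(\<lambda>ws. twisted_sum R d (k ws) xs \<odot>\<^bsub>P\<^esub> b ws) \<in> S \<rightarrow> carrier P" using b by auto
  qed
  finally show ?thesis .
qed

lemma comult_word:
  assumes "xs \<in> words E n"
  shows "c (w xs) = (\<Oplus>\<^bsub>CC\<^esub>p\<in>{..n}. \<Oplus>\<^bsub>CC\<^esub>\<rho>\<in>min_reps W p (n - p).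
     \<chi> n \<rho> \<odot>\<^bsub>CC\<^esub> pure_tensor K C C
       (w (map (\<lambda>t. letter xs (\<rho> t)) [1..<Suc p]))
       (w (map (\<lambda>t. letter xs (\<rho> t)) [Suc p..<Suc n])))"
  unfolding c_w[OF assms] by (rule comp_c_min[OF assms, symmetric])

lemma counit_scalar: "a \<in> carrier K \<Longrightarrow> eps (a \<odot>\<^bsub>C\<^esub> w []) = a"
  using module_homD(3)[OF eps_hom _ w_closed[OF Nil_words]] eps_w[OF Nil_words] by simp

lemma counit_positive: "\<lbrakk>z \<in> carrier C; z 0 = \<zero>\<^bsub>A 0\<^esub>\<rbrakk> \<Longrightarrow> eps z = \<zero>"
  using eps_eq module_hom_zero[OF unit_coeff_hom chi_comp_module R_module] by simp

end

locale dual_letters = rational_letters K W \<chi> E + based_module K E B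
  for K :: "('k,'r) ring_scheme" (structure) and W \<chi> and E :: "('k,'e,'s) module_scheme" and B
begin

abbreviation "E' \<equiv> dual_module K E"

lemma E'_module: "module K E'" by (rule dual_module_module[OF E.module_axioms])

text \<open>The results for \<open>E\<close> become available for its dual, with the same groups and
  characters; the prefix \<open>D\<close> marks the algebra on the dual.\<close>

sublocale D: rational_letters K W \<chi> "dual_module K E"
  by (intro rational_letters.intro chi_letters.intro letters.intro
      rational_chars_axioms omega_chars_axioms E'_module)

section \<open>Evaluating words of forms on words of vectors\<close>

definition ev :: "('e \<Rightarrow> 'k) list \<Rightarrow> 'e list \<Rightarrow> 'k"
  where "ev fs xs = (\<Otimes>t\<in>{1..length xs}. letter fs t (letter xs t))"

lemma ev_closed:
  assumes fs: "fs \<in> words E' d" and xs: "xs \<in> words E d" shows "ev fs xs \<in> carrier K"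
  unfolding ev_def words_length[OF xs]
  using dual_closed[OF letter_closed[OF fs] letter_closed[OF xs]] by (intro K.finprod_closed) auto

lemma ev_multilinear: 
  assumes "fs \<in> words E' d" shows "multilinear K E d R (ev fs)"
proof (rule multilinear_cong[OF product_multilinear E.module_axioms])
  show "letter fs t \<in> module_hom K E R" if "t \<in> {1..d}" for t
    by (rule dual_hom[OF letter_closed[OF assms that]])
  show "ev fs xs = (\<Otimes>t\<in>{1..d}. letter fs t (letter xs t))" if "xs \<in> words E d" for xs
    by (simp add: ev_def words_length[OF that])
qed (rule E.module_axioms)

lemma ev_multilinear': 
  assumes "xs \<in> words E d" shows "multilinear K E' d R (\<lambda>fs. ev fs xs)"
proof (rule multilinear_cong[OF product_multilinear E'_module])
  show "(\<lambda>f. f (letter xs t)) \<in> module_hom K E' R" if "t \<in> {1..d}" for t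
    by (rule dual_eval_hom[OF letter_closed[OF assms that]])
qed (use E'_module in \<open>auto simp: ev_def words_length[OF assms]\<close>)

text \<open>Reordering both words alike only reorders the factors of a product in a commutative
  ring.\<close>

lemma ev_permw:
  assumes fs: "fs \<in> words E' d" and xs: "xs \<in> words E d" and s: "\<sigma> permutes {1..d}"
  shows "ev (permw \<sigma> fs) (permw \<sigma> xs) = ev fs xs"
proof -
  have c: "letter fs t (letter xs t) \<in> carrier K" if "t \<in> {1..d}" for t
    by (rule dual_closed[OF letter_closed[OF fs that] letter_closed[OF xs that]])
  have im: "\<sigma> t \<in> {1..d}" if "t \<in> {1..d}" for t using permutes_in_image[OF s] that by simp
  have "ev (permw \<sigma> fs) (permw \<sigma> xs) = (\<Otimes>t\<in>{1..d}. letter fs (\<sigma> t) (letter xs (\<sigma> t)))"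
    unfolding ev_def
    by (rule K.finprod_cong') (use c im words_length[OF xs] words_length[OF fs] in \<open>auto simp: letter_permw\<close>)
  also have "\<dots> = (\<Otimes>t\<in>{1..d}. letter fs t (letter xs t))"
    by (rule K.finprod_bij_betw[OF permutes_imp_bij[OF s], where f = "\<lambda>t. letter fs t (letter xs t)"]) (rule c)
  finally show ?thesis by (simp add: ev_def words_length[OF xs])
qed

lemma ev_append:
  assumes fs: "fs \<in> words E' p" and gs: "gs \<in> words E' h" and xs: "xs \<in> words E (p + h)"
  shows "ev (fs @ gs) xs = ev fs (take p xs) \<otimes> ev gs (drop p xs)"
proof -
  have len: "length xs = p + h" "length fs = p" "length gs = h" using assms words_length by auto
  have t: "take p xs \<in> words E p" and d: "drop p xs \<in> words E h"
    using take_words[OF xs, of p] drop_words[OF xs, of p] by auto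
  have c: "letter (fs @ gs) t (letter xs t) \<in> carrier K" if "t \<in> {1..p + h}" for t
    by (rule dual_closed[OF letter_closed[OF words_append[OF fs gs] that] letter_closed[OF xs that]])
  have S: "{1..p + h} = {1..p} \<union> (\<lambda>t. p + t) ` {1..h}"
  proof (intro equalityI subsetI)
    fix t assume "t \<in> {1..p + h}"
    then show "t \<in> {1..p} \<union> (\<lambda>t. p + t) ` {1..h}"
      by (cases "t \<le> p") (auto intro!: image_eqI[of _ _ "t - p"])
  qed auto
  have "ev (fs @ gs) xs = (\<Otimes>t\<in>{1..p}. letter (fs @ gs) t (letter xs t)) \<otimes>
      (\<Otimes>t\<in>(\<lambda>t. p + t) ` {1..h}. letter (fs @ gs) t (letter xs t))"
    unfolding ev_def len(1) S using c by (intro K.finprod_Un_disjoint) auto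
  also have "(\<Otimes>t\<in>(\<lambda>t. p + t) ` {1..h}. letter (fs @ gs) t (letter xs t))
      = (\<Otimes>t\<in>{1..h}. letter (fs @ gs) (p + t) (letter xs (p + t)))"
    using c by (intro K.finprod_reindex) auto
  also have "\<dots> = (\<Otimes>t\<in>{1..length (drop p xs)}. letter gs t (letter (drop p xs) t))"
  proof (rule K.finprod_cong')
    show "(\<lambda>t. letter gs t (letter (drop p xs) t)) \<in> {1..length (drop p xs)} \<rightarrow> carrier K"
      using dual_closed[OF letter_closed[OF gs] letter_closed[OF d]] len by auto
    show "letter (fs @ gs) (p + t) (letter xs (p + t)) = letter gs t (letter (drop p xs) t)"
      if "t \<in> {1..length (drop p xs)}" for t
      using that len by (auto simp: letter_def nth_append)
  qed (use len in simp)
  also have "(\<Otimes>t\<in>{1..p}. letter (fs @ gs) t (letter xs t))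
      = (\<Otimes>t\<in>{1..length (take p xs)}. letter fs t (letter (take p xs) t))"
  proof (rule K.finprod_cong')
    show "(\<lambda>t. letter fs t (letter (take p xs) t)) \<in> {1..length (take p xs)} \<rightarrow> carrier K"
      using dual_closed[OF letter_closed[OF fs] letter_closed[OF t]] len by auto
    show "letter (fs @ gs) t (letter xs t) = letter fs t (letter (take p xs) t)"
      if "t \<in> {1..length (take p xs)}" for t
      using that len by (auto simp: letter_def nth_append)
  qed (use len in simp)
  finally show ?thesis unfolding ev_def[symmetric] .
qed

definition word_pairing :: "'e list \<Rightarrow> ('e \<Rightarrow> 'k) list \<Rightarrow> 'k"
  where "word_pairing xs fs = twisted_sum R (length xs) (ev fs) xs"

lemma word_pairing_eq: "xs \<in> words E d \<Longrightarrow> word_pairing xs fs = twisted_sum R d (ev fs) xs"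
  by (simp add: word_pairing_def words_length)

text \<open>By \<open>ev_permw\<close> a permutation of the vectors can be traded for its inverse on
  the forms, and the character takes the same value on inverses. Thus the pairing is a twisted sum
  in either variable, which yields equivariance in both.\<close>

lemma word_pairing_eq':
  assumes xs: "xs \<in> words E d" and fs: "fs \<in> words E' d"
  shows "word_pairing xs fs = D.twisted_sum R d (\<lambda>gs. ev gs xs) fs"
proof -
  let ?f = "\<lambda>\<rho>. \<chi> d \<rho> \<odot>\<^bsub>R\<^esub> ev fs (permw \<rho> xs)"
  have "D.twisted_sum R d (\<lambda>gs. ev gs xs) fs = (\<Oplus>\<^bsub>R\<^esub>\<rho>\<in>W d. ?f (inv' \<rho>))"
    unfolding D.twisted_sum_def
  proof (rule R.finsum_cong'[OF refl])
    fix \<rho> assume r: "\<rho> \<in> W d"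
    note ri = W_inv[OF r]
    have "permw \<rho> (permw (inv' \<rho>) xs) = xs"
      using permw_comp_W[OF xs r] permutes_inv_o(2)[OF W_permutes[OF r]] by simp
    then have "ev (permw \<rho> fs) xs = ev fs (permw (inv' \<rho>) xs)"
      using ev_permw[OF fs permw_W[OF xs ri] W_permutes[OF r]] by simp
    then show "\<chi> d \<rho> \<odot>\<^bsub>R\<^esub> ev (permw \<rho> fs) xs = ?f (inv' \<rho>)" using chi_inv'[OF r] by simp
  qed (use ev_closed[OF fs permw_W[OF xs W_inv]] chi_closed W_inv in auto)
  also have "\<dots> = (\<Oplus>\<^bsub>R\<^esub>\<rho>\<in>W d. ?f \<rho>)"
    by (rule R.finsum_bij_betw[OF W_inv_bij, where f = ?f]) (use ev_closed[OF fs permw_W[OF xs]] chi_closed in auto)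
  finally show ?thesis by (simp add: word_pairing_eq[OF xs] twisted_sum_def)
qed

lemma word_pairing_form: "fs \<in> words E' d \<Longrightarrow> chi_form d R (\<lambda>xs. word_pairing xs fs)"
  by (rule chi_form_cong[OF twisted_sum_form[OF R_module ev_multilinear] word_pairing_eq])

lemma word_pairing_form':
  assumes "xs \<in> words E d" shows "D.chi_form d R (word_pairing xs)"
  by (rule D.chi_form_cong[OF D.twisted_sum_form[OF R_module ev_multilinear'[OF assms]] word_pairing_eq'[OF assms]])

abbreviation "pairing_formula \<equiv> \<lambda>d xs fs. \<Oplus>\<^bsub>K\<^esub>\<sigma>\<in>W d. \<chi> d \<sigma> \<otimes>\<^bsub>K\<^esub> (\<Otimes>\<^bsub>K\<^esub>t\<in>{1..d}. letter fs t (letter xs (inv' \<sigma> t)))"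

text \<open>The formula permutes the vectors by the inverse of \<open>\<sigma>\<close>, a twisted
  sum by the element itself. Inversion reindexes the sum and does not change the character.\<close>

lemma pairing_formula_eq:
  assumes xs: "xs \<in> words E d" and fs: "fs \<in> words E' d"
  shows "pairing_formula d xs fs = word_pairing xs fs"
proof -
  let ?f = "\<lambda>\<rho>. \<chi> d \<rho> \<odot>\<^bsub>R\<^esub> ev fs (permw \<rho> xs)"
  have fc: "?f \<rho> \<in> carrier R" if "\<rho> \<in> W d" for \<rho>
    using ev_closed[OF fs permw_W[OF xs that]] chi_closed[OF that] by simp
  have "pairing_formula d xs fs = (\<Oplus>\<^bsub>K\<^esub>\<rho>\<in>W d. ?f (inv' \<rho>))"
  proof (rule K.finsum_cong'[OF refl])
    fix \<sigma> assume s: "\<sigma> \<in> W d"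
    have "(\<Otimes>t\<in>{1..d}. letter fs t (letter xs (inv' \<sigma> t))) = ev fs (permw (inv' \<sigma>) xs)"
      unfolding ev_def length_permw words_length[OF xs]
    proof (rule K.finprod_cong'[OF refl])
      show "(\<lambda>t. letter fs t (letter (permw (inv' \<sigma>) xs) t)) \<in> {1..d} \<rightarrow> carrier K"
        using dual_closed[OF letter_closed[OF fs] letter_closed[OF permw_W[OF xs W_inv[OF s]]]] by auto
    qed (use words_length[OF xs] in \<open>auto simp: letter_permw\<close>)
    then show "\<chi> d \<sigma> \<otimes> (\<Otimes>t\<in>{1..d}. letter fs t (letter xs (inv' \<sigma> t))) = ?f (inv' \<sigma>)"
      using chi_inv'[OF s] by simp
  qed (use fc[OF W_inv] in auto)
  also have "\<dots> = (\<Oplus>\<^bsub>K\<^esub>\<rho>\<in>W d. ?f \<rho>)"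
    by (rule K.finsum_bij_betw[OF W_inv_bij, where f = ?f]) (use fc in auto)
  finally show ?thesis by (simp add: word_pairing_eq[OF xs] twisted_sum_def)
qed

definition word_form :: "nat \<Rightarrow> 'e list \<Rightarrow> (('e \<Rightarrow> 'k) list \<Rightarrow> 'k) set set \<Rightarrow> 'k"
  where "word_form d xs = chi_lift K R (pairing_formula d xs)"

lemma word_form:
  assumes xs: "xs \<in> words E d"
  shows word_form_hom: "word_form d xs \<in> module_hom K (D.A d) R"
    and word_form_cls: "fs \<in> words E' d \<Longrightarrow> word_form d xs (D.cls fs) = word_pairing xs fs"
proof -
  have f: "D.chi_form d R (pairing_formula d xs)"
    by (rule D.chi_form_cong[OF word_pairing_form'[OF xs] pairing_formula_eq[OF xs]])
  show "word_form d xs \<in> module_hom K (D.A d) R"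
    unfolding word_form_def by (rule D.chi_lift_hom[OF R_module f])
  show "word_form d xs (D.cls fs) = word_pairing xs fs" if "fs \<in> words E' d"
    unfolding word_form_def using D.chi_lift_cls[OF R_module f that] pairing_formula_eq[OF xs that] by simp
qed

abbreviation "pairing \<equiv> chi_pairing K W \<chi> E"

lemma pairing_hom: "u \<in> carrier D.C \<Longrightarrow> (\<lambda>z. pairing z u) \<in> module_hom K C R"
  and pairing_w: "\<lbrakk>u \<in> carrier D.C; xs \<in> words E d\<rbrakk> \<Longrightarrow> pairing (w xs) u = word_form d xs (u d)"
proof -
  have eq: "pairing z u = dsum_lift A R (\<lambda>d. chi_lift K R (\<lambda>xs. word_form d xs (u d))) z" for z u
    unfolding chi_pairing_def Let_def word_form_def ..
  have form: "chi_form d R (\<lambda>xs. word_form d xs (u d))" if u: "u \<in> carrier D.C" for u d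
  proof (rule chi_form_of_spans[where G = "word_form d" and u = "u d", OF R_module D.chi_comp_module D.spans_cls])
    fix s assume "s \<in> D.cls ` words E' d"
    then obtain fs where fs: "fs \<in> words E' d" "s = D.cls fs" by auto
    show "chi_form d R (\<lambda>xs. word_form d xs s)"
      by (rule chi_form_cong[OF word_pairing_form[OF fs(1)]]) (simp add: fs(2) word_form_cls[OF _ fs(1)])
  next
    show "u d \<in> carrier (D.A d)" using u by (simp add: D.C_eq dsum_simps)
  qed (rule word_form_hom)
  show "(\<lambda>z. pairing z u) \<in> module_hom K C R" if "u \<in> carrier D.C"
    unfolding eq by (rule chi_form_dsum_lift(2)[OF R_module form[OF that]])
  show "pairing (w xs) u = word_form d xs (u d)" if "u \<in> carrier D.C" "xs \<in> words E d"
    unfolding eq by (rule chi_form_dsum_lift(1)[OF R_module form[OF that(1)] that(2)])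
qed

lemma pairing_w_hom:
  assumes "xs \<in> words E d" shows "pairing (w xs) \<in> module_hom K D.C R"
proof (rule module_hom_cong[OF _ D.C_module pairing_w[OF _ assms]])
  show "(\<lambda>u. word_form d xs (u d)) \<in> module_hom K D.C R"
    using D.G.dsum_proj_hom[folded D.C_eq] word_form_hom[OF assms] by (rule module_hom_comp)
qed

lemma pairing_bilinear: "bilinear_map K C D.C R pairing"
  unfolding bilinear_map_def
proof (intro conjI ballI pairing_hom)
  fix z assume z: "z \<in> carrier C"
  show "pairing z \<in> module_hom K D.C R"
    by (rule spans_hom_second[OF C_module D.C_module R_module spans_w pairing_hom _ z]) (auto intro: pairing_w_hom)
qed

lemma pairing_w_w:
  assumes xs: "xs \<in> words E d" and fs: "fs \<in> words E' e"
  shows "pairing (w xs) (D.w fs) = (if d = e then word_pairing xs fs else \<zero>)"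
  using pairing_w[OF D.w_closed[OF fs] xs] word_form_cls[OF xs] fs
    module_hom_zero[OF word_form_hom[OF xs] D.chi_comp_module R_module]
  by (auto simp: D.w_eq[OF fs] dsum_in_def)

text \<open>Pairing with a word of length \<open>d\<close> was built from \<open>u d\<close> alone.
  This makes the map to the graded dual act degree by degree.\<close>

lemma pairing_component:
  assumes x: "x \<in> carrier (A d)" and u: "u \<in> carrier D.C"
  shows "pairing (dsum_in A d x) u = pairing (dsum_in A d x) (dsum_in D.A d (u d))"
proof -
  have ud: "u d \<in> carrier (D.A d)" using u by (simp add: D.C_eq dsum_simps)
  have c: "dsum_in D.A d (u d) \<in> carrier D.C" unfolding D.C_eq by (rule D.G.dsum_in_closed[OF ud])
  note din = G.dsum_in_hom[folded C_eq]
  show ?thesis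
  proof (rule chi_comp_hom_eq[OF R_module module_hom_comp[OF din pairing_hom[OF u]]
        module_hom_comp[OF din pairing_hom[OF c]] _ x])
    fix xs assume xs: "xs \<in> words E d"
    show "pairing (dsum_in A d (cls xs)) u = pairing (dsum_in A d (cls xs)) (dsum_in D.A d (u d))"
      unfolding w_eq[OF xs, symmetric] pairing_w[OF u xs] pairing_w[OF c xs] by (simp add: dsum_in_def)
  qed
qed

section \<open>The isomorphism with the graded dual\<close>

definition to_dual :: "nat \<Rightarrow> (('e \<Rightarrow> 'k) list \<Rightarrow> 'k) set set \<Rightarrow> ('e list \<Rightarrow> 'k) set set \<Rightarrow> 'k"
  where "to_dual d v = (\<lambda>x\<in>carrier (A d). pairing (dsum_in A d x) (dsum_in D.A d v))"

text \<open>
  Pairing with a word and expanding in the basis yields the twisted sum of the word, which is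
  \<open>N d\<close> times its class; hence the factor \<open>iN d\<close>.
\<close>

definition from_dual :: "nat \<Rightarrow> (('e list \<Rightarrow> 'k) set set \<Rightarrow> 'k) \<Rightarrow> (('e \<Rightarrow> 'k) list \<Rightarrow> 'k) set set"
  where "from_dual d \<phi> = iN d \<odot>\<^bsub>D.A d\<^esub>
    (\<Oplus>\<^bsub>D.A d\<^esub>ws\<in>index_words B d. \<phi> (cls ws) \<odot>\<^bsub>D.A d\<^esub> D.cls (map dual_vector ws))"

lemma gdual_module: "module K (gdual K A d)"
  unfolding gdual_def by (rule dual_module_module[OF chi_comp_module])

lemma to_dual_hom: "to_dual d \<in> module_hom K (D.A d) (gdual K A d)"
proof -
  note din = G.dsum_in_hom[folded C_eq] and din' = D.G.dsum_in_hom[folded D.C_eq]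
  have h2: "(\<lambda>v. pairing (dsum_in A d x) (dsum_in D.A d v)) \<in> module_hom K (D.A d) R" if "x \<in> carrier (A d)" for x
    by (rule module_hom_comp[OF din' bilinear_mapD(2)[OF pairing_bilinear module_homD(1)[OF din that]]])
  have h1: "(\<lambda>x. pairing (dsum_in A d x) (dsum_in D.A d v)) \<in> module_hom K (A d) R" if "v \<in> carrier (D.A d)" for v
    by (rule module_hom_comp[OF din pairing_hom[OF module_homD(1)[OF din' that]]])
  show ?thesis
    unfolding gdual_def
  proof (rule module_homI)
    show "to_dual d v \<in> carrier (dual_module K (A d))" if "v \<in> carrier (D.A d)" for v
      unfolding to_dual_def by (rule restrict_dual[OF chi_comp_module h1[OF that]])
  qed (use module_homD(2,3)[OF h2] in \<open>auto simp: to_dual_def dual_module_simps\<close>)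
qed

lemma to_dual_cls:
  assumes xs: "xs \<in> words E d" and v: "v \<in> carrier (D.A d)"
  shows "to_dual d v (cls xs) = word_form d xs v"
  using pairing_w[OF _ xs, of "dsum_in D.A d v"] D.G.dsum_in_closed[OF v] cls_closed[OF xs]
  by (simp add: to_dual_def w_eq[OF xs] D.C_eq) (simp add: dsum_in_def)

lemma B_words: "ws \<in> index_words B d \<Longrightarrow> ws \<in> words E d"
  using map_index_words[of "\<lambda>b. b" B E] B_subset by fastforce

lemma dual_words: "ws \<in> index_words B d \<Longrightarrow> map dual_vector ws \<in> words E' d"
  using dual_vector_closed by (intro map_index_words[of _ B]) auto

text \<open>The coefficient of a basis word is the product of the coordinates of the letters, that
  is, the corresponding word of dual vectors evaluated at \<open>xs\<close>. This lets the
  coefficients of the expansion be read as evaluations, hence as pairings after averaging.\<close>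

lemma expand_words:
  assumes P: "module K P" and g: "multilinear K E d P g" and xs: "xs \<in> words E d"
  shows "g xs = (\<Oplus>\<^bsub>P\<^esub>ws\<in>index_words B d. ev (map dual_vector ws) xs \<odot>\<^bsub>P\<^esub> g ws)"
proof -
  interpret P: module K P by fact
  have "g xs = (\<Oplus>\<^bsub>P\<^esub>ws\<in>index_words B d. (\<Otimes>\<^bsub>K\<^esub>t\<in>{1..d}. coord (letter xs t) (letter ws t)) \<odot>\<^bsub>P\<^esub> g (map (\<lambda>b. b) ws))"
    by (rule multilinear_expand[OF E.module_axioms P B_finite _ _ _ g xs, of "\<lambda>b. b" "\<lambda>b x. coord x b"])
       (use B_subset coord_closed coord(2) in auto)
  also have "\<dots> = (\<Oplus>\<^bsub>P\<^esub>ws\<in>index_words B d. ev (map dual_vector ws) xs \<odot>\<^bsub>P\<^esub> g ws)"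
  proof (rule P.finsum_cong'[OF refl])
    fix ws assume ws: "ws \<in> index_words B d"
    have "(\<Otimes>t\<in>{1..d}. coord (letter xs t) (letter ws t)) = ev (map dual_vector ws) xs"
      unfolding ev_def words_length[OF xs]
    proof (rule K.finprod_cong'[OF refl])
      show "(\<lambda>t. letter (map dual_vector ws) t (letter xs t)) \<in> {1..d} \<rightarrow> carrier K"
        using dual_closed[OF letter_closed[OF dual_words[OF ws]] letter_closed[OF xs]] by auto
      show "coord (letter xs t) (letter ws t) = letter (map dual_vector ws) t (letter xs t)"
        if t: "t \<in> {1..d}" for t
      proof -
        have "t - 1 < length ws" using t ws by (auto simp: index_words_def)
        then have "letter (map dual_vector ws) t = dual_vector (letter ws t)"
          unfolding letter_def by (rule nth_map)
        then show ?thesis using letter_closed[OF xs t] by (simp add: dual_vector_def)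
      qed
    qed
    then show "(\<Otimes>\<^bsub>K\<^esub>t\<in>{1..d}. coord (letter xs t) (letter ws t)) \<odot>\<^bsub>P\<^esub> g (map (\<lambda>b. b) ws)
        = ev (map dual_vector ws) xs \<odot>\<^bsub>P\<^esub> g ws" by simp
  qed (use ev_closed[OF dual_words xs] multilinear_closed[OF g B_words] in auto)
  finally show ?thesis .
qed

lemma expand_dual_words:
  assumes P: "module K P" and g: "multilinear K E' d P g" and fs: "fs \<in> words E' d"
  shows "g fs = (\<Oplus>\<^bsub>P\<^esub>ws\<in>index_words B d. ev fs ws \<odot>\<^bsub>P\<^esub> g (map dual_vector ws))"
proof -
  interpret P: module K P by fact
  have "g fs = (\<Oplus>\<^bsub>P\<^esub>ws\<in>index_words B d. (\<Otimes>\<^bsub>K\<^esub>t\<in>{1..d}. letter fs t (letter ws t)) \<odot>\<^bsub>P\<^esub> g (map dual_vector ws))"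
    by (rule multilinear_expand[OF E'_module P B_finite _ _ _ g fs, of dual_vector "\<lambda>b f. f b"])
       (use dual_vector_closed dual_closed[OF _ subsetD[OF B_subset]] dual_expand in auto)
  also have "\<dots> = (\<Oplus>\<^bsub>P\<^esub>ws\<in>index_words B d. ev fs ws \<odot>\<^bsub>P\<^esub> g (map dual_vector ws))"
    by (rule P.finsum_cong'[OF refl])
       (use ev_closed[OF fs B_words] multilinear_closed[OF g dual_words] in
         \<open>auto simp: ev_def words_length[OF B_words]\<close>)
  finally show ?thesis .
qed

lemma from_dual_closed:
  assumes "\<phi> \<in> carrier (gdual K A d)" shows "from_dual d \<phi> \<in> carrier (D.A d)"
proof -
  interpret AD: module K "D.A d" by (rule D.chi_comp_module)
  have "\<phi> (cls ws) \<in> carrier K" if "ws \<in> index_words B d" for ws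
    using dual_closed[OF assms[unfolded gdual_def] cls_closed[OF B_words[OF that]]] .
  then show ?thesis
    unfolding from_dual_def using D.cls_closed[OF dual_words]
    by (intro AD.smult_closed AD.finsum_closed) auto
qed

text \<open>At a word the left side is \<open>iN d\<close> times a sum over basis words of an
  averaged coefficient times a value of \<open>\<phi>\<close>. Undoing the basis expansion turns the
  sum into the twisted sum of \<open>\<phi>\<close> on classes of words. That function is already
  equivariant, so the twisted sum is \<open>N d\<close> times it.\<close>

lemma to_dual_from_dual:
  assumes phi: "\<phi> \<in> carrier (gdual K A d)"
  shows "to_dual d (from_dual d \<phi>) = \<phi>"
proof (rule dual_module_eqI)
  note phi' = phi[unfolded gdual_def]
  interpret AD: module K "D.A d" by (rule D.chi_comp_module)
  show fc: "to_dual d (from_dual d \<phi>) \<in> carrier (dual_module K (A d))"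
    using module_homD(1)[OF to_dual_hom from_dual_closed[OF phi]] by (simp add: gdual_def)
  show "\<phi> \<in> carrier (dual_module K (A d))" by (rule phi')
  fix x assume x: "x \<in> carrier (A d)"
  show "to_dual d (from_dual d \<phi>) x = \<phi> x"
  proof (rule chi_comp_hom_eq[OF R_module dual_hom[OF fc] dual_hom[OF phi'] _ x])
    fix xs assume xs: "xs \<in> words E d"
    have pc: "\<phi> (cls ys) \<in> carrier K" if "ys \<in> words E d" for ys
      using dual_closed[OF phi' cls_closed[OF that]] .
    have cc: "D.cls (map dual_vector ws) \<in> carrier (D.A d)" if "ws \<in> index_words B d" for ws
      by (rule D.cls_closed[OF dual_words[OF that]])
    have pfc: "word_pairing xs (map dual_vector ws) \<in> carrier K" if "ws \<in> index_words B d" for ws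
      using module_homD(1)[OF word_form_hom[OF xs] cc[OF that]] word_form_cls[OF xs dual_words[OF that]] by simp
    have phim: "multilinear K E d R (\<lambda>ys. \<phi> (cls ys))"
      by (rule multilinear_compose[OF cls_multilinear dual_hom[OF phi']])
    have "to_dual d (from_dual d \<phi>) (cls xs) = word_form d xs (from_dual d \<phi>)"
      by (rule to_dual_cls[OF xs from_dual_closed[OF phi]])
    also have "\<dots> = iN d \<odot>\<^bsub>R\<^esub> word_form d xs (\<Oplus>\<^bsub>D.A d\<^esub>ws\<in>index_words B d. \<phi> (cls ws) \<odot>\<^bsub>D.A d\<^esub> D.cls (map dual_vector ws))"
      unfolding from_dual_def using pc[OF B_words] cc
      by (intro module_homD(3)[OF word_form_hom[OF xs]] AD.finsum_closed) auto
    also have "word_form d xs (\<Oplus>\<^bsub>D.A d\<^esub>ws\<in>index_words B d. \<phi> (cls ws) \<odot>\<^bsub>D.A d\<^esub> D.cls (map dual_vector ws))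
        = (\<Oplus>\<^bsub>R\<^esub>ws\<in>index_words B d. word_form d xs (\<phi> (cls ws) \<odot>\<^bsub>D.A d\<^esub> D.cls (map dual_vector ws)))"
      using pc[OF B_words] cc by (intro module_hom_finsum[OF word_form_hom[OF xs] D.chi_comp_module R_module]) auto
    also have "\<dots> = (\<Oplus>\<^bsub>R\<^esub>ws\<in>index_words B d. twisted_sum R d (ev (map dual_vector ws)) xs \<odot>\<^bsub>R\<^esub> \<phi> (cls ws))"
    proof (rule R.finsum_cong'[OF refl])
      fix ws assume ws: "ws \<in> index_words B d"
      show "word_form d xs (\<phi> (cls ws) \<odot>\<^bsub>D.A d\<^esub> D.cls (map dual_vector ws))
          = twisted_sum R d (ev (map dual_vector ws)) xs \<odot>\<^bsub>R\<^esub> \<phi> (cls ws)"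
        using module_homD(3)[OF word_form_hom[OF xs] pc[OF B_words[OF ws]] cc[OF ws]]
          word_form_cls[OF xs dual_words[OF ws]] word_pairing_eq[OF xs] pfc[OF ws] pc[OF B_words[OF ws]]
        by (simp add: K.m_comm)
    qed (use pfc pc[OF B_words] in \<open>auto simp: word_pairing_eq[OF xs]\<close>)
    also have "\<dots> = twisted_sum R d (\<lambda>ys. \<phi> (cls ys)) xs"
      by (rule twisted_sum_expand[symmetric, OF R_module xs index_words_finite[OF B_finite] expand_words[OF R_module phim]])
         (use ev_closed[OF dual_words] pc[OF B_words] in auto)
    also have "\<dots> = N d \<odot>\<^bsub>R\<^esub> \<phi> (cls xs)"
    proof (rule twisted_sum_equivariant[OF R_module _ xs])
      show "chi_form d R (\<lambda>ys. \<phi> (cls ys))"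
        using phim module_homD(3)[OF dual_hom[OF phi'] chi_closed cls_closed]
        by (simp add: chi_form_def cls_permw)
    qed
    finally show "to_dual d (from_dual d \<phi>) (cls xs) = \<phi> (cls xs)"
      using pc[OF xs] by (simp add: K.m_assoc[symmetric] iN_N)
  qed
qed

text \<open>The same computation on the side of the forms: \<open>word_pairing_eq'\<close> moves the
  permutations from the basis words to \<open>fs\<close>, and the expansion runs over words of dual
  vectors.\<close>

lemma from_dual_to_dual:
  assumes v: "v \<in> carrier (D.A d)"
  shows "from_dual d (to_dual d v) = v"
proof -
  interpret AD: module K "D.A d" by (rule D.chi_comp_module)
  have cc: "D.cls (map dual_vector ws) \<in> carrier (D.A d)" if "ws \<in> index_words B d" for ws
    by (rule D.cls_closed[OF dual_words[OF that]])
  have kc: "(\<lambda>a. a \<odot>\<^bsub>D.A d\<^esub> D.cls (map dual_vector ws)) \<in> module_hom K R (D.A d)"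
    if "ws \<in> index_words B d" for ws
    using cc[OF that] by (intro module_homI) (auto simp: AD.smult_l_distr AD.smult_assoc1)
  let ?b = "\<lambda>v. iN d \<odot>\<^bsub>D.A d\<^esub> (\<Oplus>\<^bsub>D.A d\<^esub>ws\<in>index_words B d. word_form d ws v \<odot>\<^bsub>D.A d\<^esub> D.cls (map dual_vector ws))"
  have pc: "word_form d ws v \<in> carrier K" if "ws \<in> index_words B d" "v \<in> carrier (D.A d)" for ws v
    using module_homD(1)[OF word_form_hom[OF B_words[OF that(1)]] that(2)] by simp
  have eq: "from_dual d (to_dual d v) = ?b v"
    unfolding from_dual_def
    by (intro arg_cong[of _ _ "\<lambda>z. iN d \<odot>\<^bsub>D.A d\<^esub> z"] AD.finsum_cong')
       (use to_dual_cls[OF B_words v] pc[OF _ v] cc in auto)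
  have "?b v = v"
  proof (rule D.chi_comp_hom_eq[OF D.chi_comp_module _ module_hom_id _ v])
    show "?b \<in> module_hom K (D.A d) (D.A d)"
      by (intro module_hom_smult module_hom_sum D.chi_comp_module iN_closed)
         (rule module_hom_comp[OF word_form_hom[OF B_words] kc])
    fix fs assume fs: "fs \<in> words E' d"
    have "(\<Oplus>\<^bsub>D.A d\<^esub>ws\<in>index_words B d. word_form d ws (D.cls fs) \<odot>\<^bsub>D.A d\<^esub> D.cls (map dual_vector ws))
        = (\<Oplus>\<^bsub>D.A d\<^esub>ws\<in>index_words B d. D.twisted_sum R d (\<lambda>gs. ev gs ws) fs \<odot>\<^bsub>D.A d\<^esub> D.cls (map dual_vector ws))"
    proof (rule AD.finsum_cong'[OF refl])
      have e: "word_form d ws (D.cls fs) = D.twisted_sum R d (\<lambda>gs. ev gs ws) fs" if "ws \<in> index_words B d" for ws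
        using word_form_cls[OF B_words[OF that] fs] word_pairing_eq'[OF B_words[OF that] fs] by simp
      show "word_form d ws (D.cls fs) \<odot>\<^bsub>D.A d\<^esub> D.cls (map dual_vector ws)
          = D.twisted_sum R d (\<lambda>gs. ev gs ws) fs \<odot>\<^bsub>D.A d\<^esub> D.cls (map dual_vector ws)"
        if "ws \<in> index_words B d" for ws by (simp add: e[OF that])
      show "(\<lambda>ws. D.twisted_sum R d (\<lambda>gs. ev gs ws) fs \<odot>\<^bsub>D.A d\<^esub> D.cls (map dual_vector ws)) \<in> index_words B d \<rightarrow> carrier (D.A d)"
        using pc[OF _ D.cls_closed[OF fs]] cc by (auto simp: e[symmetric])
    qed
    also have "\<dots> = D.twisted_sum (D.A d) d D.cls fs"
      by (rule D.twisted_sum_expand[symmetric, OF D.chi_comp_module fs index_words_finite[OF B_finite]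
            expand_dual_words[OF D.chi_comp_module D.cls_multilinear]])
         (use ev_closed B_words cc in auto)
    also have "\<dots> = N d \<odot>\<^bsub>D.A d\<^esub> D.cls fs"
      by (rule D.twisted_sum_equivariant[OF D.chi_comp_module D.cls_form fs])
    finally show "?b (D.cls fs) = D.cls fs"
      using D.cls_closed[OF fs] by (simp add: AD.smult_assoc1[symmetric] iN_N)
  qed
  then show ?thesis using eq by simp
qed

abbreviation "to_gdual \<equiv> chi_to_gdual K W \<chi> E"

lemma to_gdual_eq: "u \<in> carrier D.C \<Longrightarrow> to_gdual u = (\<lambda>d. to_dual d (u d))"
  unfolding chi_to_gdual_def form_components_def to_dual_def
  by (intro ext restrict_ext pairing_component)

lemmas to_gdual_iso = graded_iso_dsum[OF D.chi_comp_module gdual_module K.is_cring to_dual_hom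
    conjI[OF from_dual_closed to_dual_from_dual] from_dual_to_dual to_gdual_eq[unfolded D.C_eq], folded D.C_eq]

section \<open>Compatibility with the products\<close>

lemma to_gdual_component: "u \<in> carrier D.C \<Longrightarrow> to_gdual u d \<in> carrier (dual_module K (A d))"
  using module_homD(1)[OF to_dual_hom[of d], of "u d"] by (simp add: to_gdual_eq gdual_def D.C_eq dsum_simps)

lemma to_gdual_apply:
  assumes "u \<in> carrier D.C" "x \<in> carrier (A d)" shows "to_gdual u d x = pairing (dsum_in A d x) u"
  using assms by (simp add: chi_to_gdual_def form_components_def)

lemma gform_hom:
  assumes u: "u \<in> carrier D.C" shows "gdual_form K A (to_gdual u) \<in> module_hom K C R"
  unfolding gdual_form_def C_eq by (rule G.dsum_lift_hom[OF R_module dual_hom[OF to_gdual_component[OF u]]])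

lemma gform_w:
  assumes u: "u \<in> carrier D.C" and xs: "xs \<in> words E d"
  shows "gdual_form K A (to_gdual u) (w xs) = pairing (w xs) u"
  unfolding gdual_form_def w_eq[OF xs]
  using G.dsum_lift_in[OF R_module dual_hom[OF to_gdual_component[OF u]] cls_closed[OF xs]]
    to_gdual_apply[OF u cls_closed[OF xs]] by simp

lemma gmult_hom:
  assumes u: "u \<in> carrier D.C" and v: "v \<in> carrier D.C"
  defines "f \<equiv> \<lambda>z. tensor_form K (gdual_form K A (to_gdual u)) (gdual_form K A (to_gdual v)) (c z)"
  shows "f \<in> module_hom K C R"
    and "xs \<in> words E n \<Longrightarrow> f (w xs) = (\<Oplus>\<^bsub>R\<^esub>p\<in>{..n}. (iN p \<otimes> iN (n - p)) \<odot>\<^bsub>R\<^esub>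
      twisted_sum R n (\<lambda>ys. pairing (w (take p ys)) u \<otimes> pairing (w (drop p ys)) v) xs)"
proof -
  let ?t = "tensor_form K (gdual_form K A (to_gdual u)) (gdual_form K A (to_gdual v))"
  have t: "?t \<in> module_hom K CC R"
    by (rule tensor_form_hom[OF C_module C_module gform_hom[OF u] gform_hom[OF v]])
  show "f \<in> module_hom K C R" unfolding f_def by (rule module_hom_comp[OF c_hom t])
  have tc: "?t (cut p ys) = pairing (w (take p ys)) u \<otimes> pairing (w (drop p ys)) v" if "ys \<in> words E n" "p \<le> n" for p ys n
    unfolding cut_def
    using tensor_form_pure[OF C_module C_module gform_hom[OF u] gform_hom[OF v]
        w_closed[OF take_words[OF that]] w_closed[OF drop_words[OF that(1)]]]
      gform_w[OF u take_words[OF that]] gform_w[OF v drop_words[OF that(1)]] by simp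
  show "f (w xs) = (\<Oplus>\<^bsub>R\<^esub>p\<in>{..n}. (iN p \<otimes> iN (n - p)) \<odot>\<^bsub>R\<^esub>
      twisted_sum R n (\<lambda>ys. pairing (w (take p ys)) u \<otimes> pairing (w (drop p ys)) v) xs)" if xs: "xs \<in> words E n"
    unfolding f_def c_w[OF xs] hom_comp_c[OF R_module t xs]
  proof (rule R.finsum_cong'[OF refl])
    fix p assume p: "p \<in> {..n}"
    have "twisted_sum R n (\<lambda>ys. ?t (cut p ys)) xs = twisted_sum R n (\<lambda>ys. pairing (w (take p ys)) u \<otimes> pairing (w (drop p ys)) v) xs"
    proof (rule twisted_sum_cong[OF R_module xs])
      fix ys assume ys: "ys \<in> words E n"
      have le: "p \<le> n" using p by simp
      show "?t (cut p ys) = pairing (w (take p ys)) u \<otimes> pairing (w (drop p ys)) v"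
        by (rule tc[OF ys le])
      show "pairing (w (take p ys)) u \<otimes> pairing (w (drop p ys)) v \<in> carrier R"
        using module_homD(1)[OF t cut_closed[OF ys le]] unfolding tc[OF ys le] .
    qed
    then show "(iN p \<otimes> iN (n - p)) \<odot>\<^bsub>R\<^esub> twisted_sum R n (\<lambda>ys. ?t (cut p ys)) xs
        = (iN p \<otimes> iN (n - p)) \<odot>\<^bsub>R\<^esub> twisted_sum R n (\<lambda>ys. pairing (w (take p ys)) u \<otimes> pairing (w (drop p ys)) v) xs" by simp
  next
    have "twisted_sum R n (\<lambda>ys. pairing (w (take p ys)) u \<otimes> pairing (w (drop p ys)) v) xs \<in> carrier R" if "p \<in> {..n}" for p
    proof (rule twisted_sum_closed[OF R_module xs])
      fix ys assume ys: "ys \<in> words E n"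
      have le: "p \<le> n" using that by simp
      show "pairing (w (take p ys)) u \<otimes> pairing (w (drop p ys)) v \<in> carrier R"
        using module_homD(1)[OF t cut_closed[OF ys le]] unfolding tc[OF ys le] .
    qed
    then show "(\<lambda>p. (iN p \<otimes> iN (n - p)) \<odot>\<^bsub>R\<^esub> twisted_sum R n (\<lambda>ys. pairing (w (take p ys)) u \<otimes> pairing (w (drop p ys)) v) xs)
        \<in> {..n} \<rightarrow> carrier R" by auto
  qed
qed

text \<open>Expanding both pairings gives sums over \<open>W p\<close> and over the shifted
  \<open>W h\<close> of evaluations of \<open>fs @ gs\<close>. The outer sum over the whole group
  absorbs each of them, and the two orders that appear cancel against \<open>iN p\<close> and
  \<open>iN h\<close>. What remains is the pairing with the concatenated word.\<close>

lemma word_pairing_append: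
  assumes xs: "xs \<in> words E (p + h)" and fs: "fs \<in> words E' p" and gs: "gs \<in> words E' h"
  shows "(iN p \<otimes> iN h) \<otimes> twisted_sum R (p + h) (\<lambda>ys. word_pairing (take p ys) fs \<otimes> word_pairing (drop p ys) gs) xs = word_pairing xs (fs @ gs)"
proof -
  let ?n = "p + h"
  let ?e = "ev (fs @ gs)"
  note fgs = words_append[OF fs gs]
  let ?B = "\<lambda>ys. \<Oplus>\<^bsub>R\<^esub>\<tau>\<in>W h. \<chi> h \<tau> \<odot>\<^bsub>R\<^esub> ?e (permw ((omega ^^ p) \<tau>) ys)"
  have emb: "(omega ^^ p) \<tau> \<in> W ?n" "\<chi> ?n ((omega ^^ p) \<tau>) = \<chi> h \<tau>" if "\<tau> \<in> W h" for \<tau>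
    using W_omega[OF that, of p] by (auto simp: add.commute)
  have emb': "\<sigma> \<in> W ?n" "\<chi> ?n \<sigma> = \<chi> p \<sigma>" if "\<sigma> \<in> W p" for \<sigma>
    using W_mono[OF that, of ?n] by auto
  have Bc: "?B ys \<in> carrier R" if "ys \<in> words E ?n" for ys
    using ev_closed[OF fgs permw_W[OF that emb(1)]] chi_closed by (intro R.finsum_closed) auto
  have key: "word_pairing (take p ys) fs \<otimes> word_pairing (drop p ys) gs = (\<Oplus>\<^bsub>R\<^esub>\<sigma>\<in>W p. \<chi> p \<sigma> \<odot>\<^bsub>R\<^esub> ?B (permw \<sigma> ys))"
    if ys: "ys \<in> words E ?n" for ys
  proof -
    have t: "take p ys \<in> words E p" and d: "drop p ys \<in> words E h"
      using take_words[OF ys, of p] drop_words[OF ys, of p] by auto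
    have ec: "ev fs (permw \<sigma> (take p ys)) \<in> carrier K" if "\<sigma> \<in> W p" for \<sigma>
      by (rule ev_closed[OF fs permw_W[OF t that]])
    have gc: "ev gs (permw \<tau> (drop p ys)) \<in> carrier K" if "\<tau> \<in> W h" for \<tau>
      by (rule ev_closed[OF gs permw_W[OF d that]])
    have gsum: "word_pairing (drop p ys) gs \<in> carrier K"
      unfolding word_pairing_eq[OF d] using twisted_sum_closed[OF R_module d] ev_closed[OF gs] by simp
    \<comment> \<open>A permutation of the head together with one of the tail is a single element of
      the Young subgroup acting on the whole word, where evaluation of \<open>fs @ gs\<close> is
      multiplicative.\<close>
    have split: "?e (permw ((omega ^^ p) \<tau>) (permw \<sigma> ys)) = ev fs (permw \<sigma> (take p ys)) \<otimes> ev gs (permw \<tau> (drop p ys))"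
      if s: "\<sigma> \<in> W p" and ta: "\<tau> \<in> W h" for \<sigma> \<tau>
    proof -
      have y: "permw ((omega ^^ p) \<tau>) (permw \<sigma> ys) = permw (\<sigma> \<circ> (omega ^^ p) \<tau>) ys"
        by (rule permw_comp_W[OF ys emb(1)[OF ta]])
      show ?thesis
        unfolding y ev_append[OF fs gs permw_W[OF ys young_mem(1)[OF s ta]]] take_drop_young[OF ys s ta] ..
    qed
    have "word_pairing (take p ys) fs \<otimes> word_pairing (drop p ys) gs
        = (\<Oplus>\<sigma>\<in>W p. (\<chi> p \<sigma> \<otimes> ev fs (permw \<sigma> (take p ys))) \<otimes> word_pairing (drop p ys) gs)"
      unfolding word_pairing_eq[OF t] twisted_sum_def finsum_regular_module regular_module_simps
      using ec chi_closed gsum W_finite by (intro K.finsum_ldistr) auto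
    also have "\<dots> = (\<Oplus>\<sigma>\<in>W p. \<chi> p \<sigma> \<otimes> ?B (permw \<sigma> ys))"
    proof (rule K.finsum_cong'[OF refl])
      fix \<sigma> assume s: "\<sigma> \<in> W p"
      have "ev fs (permw \<sigma> (take p ys)) \<otimes> word_pairing (drop p ys) gs
          = (\<Oplus>\<tau>\<in>W h. ev fs (permw \<sigma> (take p ys)) \<otimes> (\<chi> h \<tau> \<otimes> ev gs (permw \<tau> (drop p ys))))"
        unfolding word_pairing_eq[OF d] twisted_sum_def finsum_regular_module regular_module_simps
        using ec[OF s] gc chi_closed W_finite by (intro K.finsum_rdistr) auto
      also have "\<dots> = ?B (permw \<sigma> ys)"
        unfolding finsum_regular_module regular_module_simps
        using ec[OF s] gc chi_closed split[OF s]
        by (intro K.finsum_cong') (auto simp: K.m_lcomm)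
      finally show "(\<chi> p \<sigma> \<otimes> ev fs (permw \<sigma> (take p ys))) \<otimes> word_pairing (drop p ys) gs = \<chi> p \<sigma> \<otimes> ?B (permw \<sigma> ys)"
        using ec[OF s] gsum chi_closed[OF s] by (simp add: K.m_assoc)
    qed (use Bc[OF permw_W[OF ys emb'(1)]] chi_closed in auto)
    finally show ?thesis by simp
  qed
  have Ac: "twisted_sum R ?n ?e xs \<in> carrier K"
    using twisted_sum_closed[OF R_module xs, of ?e] ev_closed[OF fgs] by simp
  have Bc': "twisted_sum R ?n ?B xs \<in> carrier R" by (rule twisted_sum_closed[OF R_module xs Bc])
  have "twisted_sum R ?n (\<lambda>ys. word_pairing (take p ys) fs \<otimes> word_pairing (drop p ys) gs) xs
      = twisted_sum R ?n (\<lambda>ys. \<Oplus>\<^bsub>R\<^esub>\<sigma>\<in>W p. \<chi> p \<sigma> \<odot>\<^bsub>R\<^esub> ?B (permw \<sigma> ys)) xs"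
  proof (rule twisted_sum_cong[OF R_module xs _ key])
    fix ys assume ys: "ys \<in> words E ?n"
    have "\<chi> p \<sigma> \<odot>\<^bsub>R\<^esub> ?B (permw \<sigma> ys) \<in> carrier R" if "\<sigma> \<in> W p" for \<sigma>
      by (rule R.smult_closed[OF chi_closed[OF that] Bc[OF permw_W[OF ys emb'(1)[OF that]]]])
    then show "(\<Oplus>\<^bsub>R\<^esub>\<sigma>\<in>W p. \<chi> p \<sigma> \<odot>\<^bsub>R\<^esub> ?B (permw \<sigma> ys)) \<in> carrier R"
      by (intro R.finsum_closed) auto
  qed
  \<comment> \<open>The inclusion of \<open>W p\<close> is absorbed here, the shifted copy of
    \<open>W h\<close> in the next step.\<close>
  also have "\<dots> = N p \<odot>\<^bsub>R\<^esub> twisted_sum R ?n ?B xs"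
    by (rule twisted_sum_absorb[OF R_module xs Bc emb'])
  also have "twisted_sum R ?n ?B xs = N h \<odot>\<^bsub>R\<^esub> twisted_sum R ?n ?e xs"
    by (rule twisted_sum_absorb[OF R_module xs _ emb]) (use ev_closed[OF fgs] in simp)
  finally have "(iN p \<otimes> iN h) \<otimes> twisted_sum R ?n (\<lambda>ys. word_pairing (take p ys) fs \<otimes> word_pairing (drop p ys) gs) xs
      = (iN p \<otimes> iN h) \<otimes> (N p \<otimes> (N h \<otimes> twisted_sum R ?n ?e xs))" by simp
  also have "\<dots> = (iN p \<otimes> N p) \<otimes> ((iN h \<otimes> N h) \<otimes> twisted_sum R ?n ?e xs)"
    using Ac iN_closed N_closed by (simp add: K.m_ac)
  finally show ?thesis using Ac by (simp add: iN_N word_pairing_eq[OF xs])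
qed

lemma pairing_closed: "\<lbrakk>z \<in> carrier C; u \<in> carrier D.C\<rbrakk> \<Longrightarrow> pairing z u \<in> carrier K"
  using bilinear_mapD(3)[OF pairing_bilinear, of z u] by simp

text \<open>Words of different lengths pair to zero, so a cut contributes only if its pieces have
  the lengths of \<open>fs\<close> and \<open>gs\<close>. This happens for the cut at
  \<open>p'\<close> when \<open>n = p' + h'\<close>, and for no cut otherwise.\<close>

lemma pairing_mul_words:
  assumes xs: "xs \<in> words E n" and fs: "fs \<in> words E' p'" and gs: "gs \<in> words E' h'"
  shows "(\<Oplus>\<^bsub>R\<^esub>p\<in>{..n}. (iN p \<otimes> iN (n - p)) \<odot>\<^bsub>R\<^esub>
      twisted_sum R n (\<lambda>ys. pairing (w (take p ys)) (D.w fs) \<otimes> pairing (w (drop p ys)) (D.w gs)) xs)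
    = pairing (w xs) (D.mul (D.w fs) (D.w gs))" (is "(\<Oplus>\<^bsub>R\<^esub>p\<in>{..n}. ?S p) = _")
proof -
  have prod: "pairing (w (take p ys)) (D.w fs) \<otimes> pairing (w (drop p ys)) (D.w gs)
      = (if p = p' \<and> n - p = h' then word_pairing (take p ys) fs \<otimes> word_pairing (drop p ys) gs else \<zero>)"
    if "p \<le> n" "ys \<in> words E n" for p ys
  proof -
    note t = take_words[OF that(2,1)] and d = drop_words[OF that(2), of p]
    have "pairing (w (take p ys)) (D.w fs) \<in> carrier K" "pairing (w (drop p ys)) (D.w gs) \<in> carrier K"
      by (rule pairing_closed[OF w_closed[OF t] D.w_closed[OF fs]],
          rule pairing_closed[OF w_closed[OF d] D.w_closed[OF gs]])
    then show ?thesis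
      unfolding pairing_w_w[OF t fs] pairing_w_w[OF d gs] by (cases "p = p'"; cases "n - p = h'") simp_all
  qed
  have zero: "?S p = \<zero>\<^bsub>R\<^esub>" if "p \<le> n" "\<not> (p = p' \<and> n - p = h')" for p
  proof -
    have "twisted_sum R n (\<lambda>ys. pairing (w (take p ys)) (D.w fs) \<otimes> pairing (w (drop p ys)) (D.w gs)) xs = twisted_sum R n (\<lambda>ys. \<zero>\<^bsub>R\<^esub>) xs"
    proof (rule twisted_sum_cong[OF R_module xs])
      fix ys assume ys: "ys \<in> words E n"
      show "pairing (w (take p ys)) (D.w fs) \<otimes> pairing (w (drop p ys)) (D.w gs) = \<zero>\<^bsub>R\<^esub>"
        unfolding prod[OF that(1) ys] by (simp only: that(2) if_False regular_module_simps)
    qed simp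
    also have "\<dots> = \<zero>\<^bsub>R\<^esub>"
      unfolding twisted_sum_def by (rule R.add.finprod_one_eqI) (simp add: chi_closed)
    finally show ?thesis by simp
  qed
  have rhs: "pairing (w xs) (D.mul (D.w fs) (D.w gs)) = (if n = p' + h' then word_pairing xs (fs @ gs) else \<zero>)"
    unfolding D.mul_w[OF fs gs] by (rule pairing_w_w[OF xs words_append[OF fs gs]])
  show ?thesis
  proof (cases "n = p' + h'")
    case False
    have "(\<Oplus>\<^bsub>R\<^esub>p\<in>{..n}. ?S p) = \<zero>\<^bsub>R\<^esub>"
      by (rule R.add.finprod_one_eqI) (rule zero, use False in auto)
    then show ?thesis unfolding rhs using False by simp
  next
    case True
    note xs' = xs[unfolded True]
    have "?S p' = (iN p' \<otimes> iN h') \<otimes> twisted_sum R (p' + h') (\<lambda>ys. word_pairing (take p' ys) fs \<otimes> word_pairing (drop p' ys) gs) xs"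
    proof -
      have "twisted_sum R n (\<lambda>ys. pairing (w (take p' ys)) (D.w fs) \<otimes> pairing (w (drop p' ys)) (D.w gs)) xs
          = twisted_sum R n (\<lambda>ys. word_pairing (take p' ys) fs \<otimes> word_pairing (drop p' ys) gs) xs"
      proof (rule twisted_sum_cong[OF R_module xs])
        fix ys assume ys: "ys \<in> words E n"
        have p: "p' \<le> n" using True by simp
        show *: "pairing (w (take p' ys)) (D.w fs) \<otimes> pairing (w (drop p' ys)) (D.w gs)
            = word_pairing (take p' ys) fs \<otimes> word_pairing (drop p' ys) gs"
          unfolding prod[OF p ys] using True by simp
        show "word_pairing (take p' ys) fs \<otimes> word_pairing (drop p' ys) gs \<in> carrier R"
          unfolding *[symmetric]
          using pairing_closed[OF w_closed[OF take_words[OF ys p]] D.w_closed[OF fs]]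
            pairing_closed[OF w_closed[OF drop_words[OF ys, of p']] D.w_closed[OF gs]] by simp
      qed
      then show ?thesis using True by simp
    qed
    then have S: "?S p' = word_pairing xs (fs @ gs)" using word_pairing_append[OF xs' fs gs] by simp
    have "word_pairing xs (fs @ gs) \<in> carrier R"
      using pairing_closed[OF w_closed[OF xs] D.w_closed[OF words_append[OF fs gs]]]
        pairing_w_w[OF xs words_append[OF fs gs]] True by simp
    then have "(\<Oplus>\<^bsub>R\<^esub>p\<in>{..n}. ?S p) = ?S p'"
      unfolding S[symmetric] using True by (intro R.finsum_single zero) auto
    then show ?thesis unfolding rhs S using True by simp
  qed
qed

text \<open>Both sides are bilinear in \<open>u\<close> and \<open>v\<close>, hence determined by
  their values on words. This is the duality between the comultiplication on \<open>E\<close> and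
  the multiplication on its dual, tested against a word.\<close>

lemma pairing_mul:
  assumes xs: "xs \<in> words E n" and u: "u \<in> carrier D.C" and v: "v \<in> carrier D.C"
  shows "(\<Oplus>\<^bsub>R\<^esub>p\<in>{..n}. (iN p \<otimes> iN (n - p)) \<odot>\<^bsub>R\<^esub>
      twisted_sum R n (\<lambda>ys. pairing (w (take p ys)) u \<otimes> pairing (w (drop p ys)) v) xs)
    = pairing (w xs) (D.mul u v)" (is "?L u v = ?R u v")
proof -
  have wt: "w (take p (permw \<rho> xs)) \<in> carrier C" "w (drop p (permw \<rho> xs)) \<in> carrier C"
    if "p \<in> {..n}" "\<rho> \<in> W n" for p \<rho>
    using that w_closed[OF take_words[OF permw_W[OF xs that(2)], of p]]
      w_closed[OF drop_words[OF permw_W[OF xs that(2)], of p]] by auto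
  note prh = bilinear_mapD(2)[OF pairing_bilinear]
  have L1: "(\<lambda>u. ?L u v) \<in> module_hom K D.C R" if v: "v \<in> carrier D.C" for v
    unfolding twisted_sum_def
  proof (intro module_hom_sum module_hom_smult D.C_module R_module K.m_closed iN_closed chi_closed)
    fix p \<rho> assume a: "p \<in> {..n}" "\<rho> \<in> W n"
    let ?k = "pairing (w (drop p (permw \<rho> xs))) v"
    have k: "?k \<in> carrier K" by (rule pairing_closed[OF wt(2)[OF a] v])
    have "(\<lambda>u. ?k \<odot>\<^bsub>R\<^esub> pairing (w (take p (permw \<rho> xs))) u) \<in> module_hom K D.C R"
      by (rule module_hom_smult[OF D.C_module R_module prh[OF wt(1)[OF a]] k])
    then show "(\<lambda>u. pairing (w (take p (permw \<rho> xs))) u \<otimes> ?k) \<in> module_hom K D.C R"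
      by (rule module_hom_cong[OF _ D.C_module]) (simp add: K.m_comm pairing_closed[OF wt(1)[OF a]] k)
  qed
  have L2: "?L u \<in> module_hom K D.C R" if u: "u \<in> carrier D.C" for u
    unfolding twisted_sum_def
  proof (intro module_hom_sum module_hom_smult D.C_module R_module K.m_closed iN_closed chi_closed)
    fix p \<rho> assume a: "p \<in> {..n}" "\<rho> \<in> W n"
    have "(\<lambda>v. pairing (w (take p (permw \<rho> xs))) u \<odot>\<^bsub>R\<^esub> pairing (w (drop p (permw \<rho> xs))) v) \<in> module_hom K D.C R"
      by (rule module_hom_smult[OF D.C_module R_module prh[OF wt(2)[OF a]] pairing_closed[OF wt(1)[OF a] u]])
    then show "(\<lambda>v. pairing (w (take p (permw \<rho> xs))) u \<otimes> pairing (w (drop p (permw \<rho> xs))) v) \<in> module_hom K D.C R"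
      by simp
  qed
  have R1: "(\<lambda>u. ?R u v) \<in> module_hom K D.C R" if v: "v \<in> carrier D.C" for v
    by (rule module_hom_comp[OF bilinear_mapD(1)[OF D.mul_bilinear v] pairing_w_hom[OF xs]])
  have R2: "?R u \<in> module_hom K D.C R" if u: "u \<in> carrier D.C" for u
    by (rule module_hom_comp[OF bilinear_mapD(2)[OF D.mul_bilinear u] pairing_w_hom[OF xs]])
  have "?L (D.w fs) v = ?R (D.w fs) v" if fs: "fs \<in> words E' d" for fs d
    by (rule D.C_hom_eq[OF R_module L2[OF D.w_closed[OF fs]] R2[OF D.w_closed[OF fs]] _ v])
       (rule pairing_mul_words[OF xs fs])
  then show ?thesis
    by (rule D.C_hom_eq[OF R_module L1[OF v] R1[OF v] _ u])
qed

abbreviation "gmul \<equiv> gdual_mult K A c"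

lemma to_gdual_mult:
  assumes u: "u \<in> carrier D.C" and v: "v \<in> carrier D.C"
  shows "to_gdual (D.mul u v) = gmul (to_gdual u) (to_gdual v)"
proof
  fix n
  note uv = bilinear_mapD(3)[OF D.mul_bilinear u v]
  note f = gmult_hom[OF u v]
  note din = G.dsum_in_hom[folded C_eq]
  show "to_gdual (D.mul u v) n = gmul (to_gdual u) (to_gdual v) n"
  proof (rule dual_module_eqI[OF to_gdual_component[OF uv]])
    have "(\<lambda>x. tensor_form K (gdual_form K A (to_gdual u)) (gdual_form K A (to_gdual v)) (c (dsum_in A n x))) \<in> module_hom K (A n) R"
      by (rule module_hom_comp[OF din f(1)])
    from restrict_dual[OF chi_comp_module this]
    show gc: "gmul (to_gdual u) (to_gdual v) n \<in> carrier (dual_module K (A n))"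
      by (simp add: gdual_mult_def form_components_def)
    fix x assume x: "x \<in> carrier (A n)"
    show "to_gdual (D.mul u v) n x = gmul (to_gdual u) (to_gdual v) n x"
    proof (rule chi_comp_hom_eq[OF R_module dual_hom[OF to_gdual_component[OF uv]] dual_hom[OF gc] _ x])
      fix xs assume xs: "xs \<in> words E n"
      have "gmul (to_gdual u) (to_gdual v) n (cls xs) = tensor_form K (gdual_form K A (to_gdual u)) (gdual_form K A (to_gdual v)) (c (w xs))"
        using cls_closed[OF xs] by (simp add: gdual_mult_def form_components_def w_eq[OF xs])
      also have "\<dots> = pairing (w xs) (D.mul u v)"
        unfolding f(2)[OF xs] by (rule pairing_mul[OF xs u v])
      also have "\<dots> = to_gdual (D.mul u v) n (cls xs)"
        using to_gdual_apply[OF uv cls_closed[OF xs]] by (simp add: w_eq[OF xs])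
      finally show "to_gdual (D.mul u v) n (cls xs) = gmul (to_gdual u) (to_gdual v) n (cls xs)" ..
    qed
  qed
qed

lemma to_gdual_one: "to_gdual (D.w []) = form_components A eps"
proof
  fix n
  note oc = D.w_closed[OF D.Nil_words]
  note din = G.dsum_in_hom[folded C_eq]
  show "to_gdual (D.w []) n = form_components A eps n"
  proof (rule dual_module_eqI[OF to_gdual_component[OF oc]])
    show gc: "form_components A eps n \<in> carrier (dual_module K (A n))"
      unfolding form_components_def
      by (rule restrict_dual[OF chi_comp_module module_hom_comp[OF din eps_hom]])
    fix x assume x: "x \<in> carrier (A n)"
    show "to_gdual (D.w []) n x = form_components A eps n x"
    proof (rule chi_comp_hom_eq[OF R_module dual_hom[OF to_gdual_component[OF oc]] dual_hom[OF gc] _ x])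
      fix xs assume xs: "xs \<in> words E n"
      have "to_gdual (D.w []) n (cls xs) = pairing (w xs) (D.w [])"
        using to_gdual_apply[OF oc cls_closed[OF xs]] by (simp add: w_eq[OF xs])
      also have "\<dots> = (if n = 0 then \<one> else \<zero>)"
      proof -
        \<comment> \<open>The trivial group \<open>W 0\<close> leaves one summand, an empty product
          with character value one.\<close>
        have "word_pairing [] [] = \<one>" by (simp add: word_pairing_def twisted_sum_def W_0 chi_id ev_def)
        moreover have "xs = []" if "n = 0" using xs that by (simp add: words_def)
        ultimately show ?thesis unfolding pairing_w_w[OF xs D.Nil_words] by auto
      qed
      also have "\<dots> = form_components A eps n (cls xs)"
        using cls_closed[OF xs] eps_w[OF xs] by (simp add: form_components_def w_eq[OF xs])
      finally show "to_gdual (D.w []) n (cls xs) = form_components A eps n (cls xs)" .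
    qed
  qed
qed

theorem dual_algebra:
  "graded_algebra K (gdual K A) gmul (form_components A eps)"
  "to_gdual \<in> graded_alg_iso K D.A (graded_alg K D.A D.mul (D.w []))
     (gdual K A) (graded_alg K (gdual K A) gmul (form_components A eps))"
proof -
  note transport = graded_algebra_transport[OF D.chi_graded_algebra gdual_module K.is_cring,
      where h = to_gdual and m' = gmul and u' = "form_components A eps", folded D.C_eq,
      OF to_gdual_iso to_gdual_mult to_gdual_one]
  show "graded_algebra K (gdual K A) gmul (form_components A eps)"
    by (rule transport(1))
  show "to_gdual \<in> graded_alg_iso K D.A (graded_alg K D.A D.mul (D.w []))
     (gdual K A) (graded_alg K (gdual K A) gmul (form_components A eps))"
    by (rule transport(2))
qed

end

text \<open>By additivity the image of the rational number \<open>n\<close> is \<open>n\<close>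
  times the unit, and the image of \<open>1/n\<close> is its inverse.\<close>

lemma rational_units:
  assumes K: "cring K" and i: "\<iota> \<in> ring_hom (ring_of_type_algebra :: rat ring) K" and n: "(n::nat) > 0"
  shows "[n] \<cdot>\<^bsub>K\<^esub> \<one>\<^bsub>K\<^esub> \<in> Units K"
proof -
  interpret K: cring K by fact
  let ?Q = "ring_of_type_algebra :: rat ring"
  have Q: "carrier ?Q = UNIV" "add ?Q = (+)" "monoid.mult ?Q = (*)" "\<one>\<^bsub>?Q\<^esub> = 1"
    by (simp_all add: ring_of_type_algebra_def)
  have add: "\<iota> (x + y) = \<iota> x \<oplus>\<^bsub>K\<^esub> \<iota> y" and mult: "\<iota> (x * y) = \<iota> x \<otimes>\<^bsub>K\<^esub> \<iota> y"
    and one: "\<iota> 1 = \<one>\<^bsub>K\<^esub>" and closed: "\<iota> x \<in> carrier K" for x y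
    using ring_hom_add[OF i, of x y] ring_hom_mult[OF i, of x y] ring_hom_one[OF i] ring_hom_closed[OF i, of x]
    by (simp_all add: Q)
  have z: "\<iota> 0 = \<zero>\<^bsub>K\<^esub>"
    using add[of 0 0] closed[of 0] by (simp add: K.add.l_cancel_one')
  have nat: "\<iota> (of_nat m) = [m] \<cdot>\<^bsub>K\<^esub> \<one>\<^bsub>K\<^esub>" for m
    by (induction m) (simp_all add: z add one K.a_comm closed)
  have "\<iota> (of_nat n) \<otimes>\<^bsub>K\<^esub> \<iota> (1 / of_nat n) = \<one>\<^bsub>K\<^esub>"
    using n by (simp add: mult[symmetric] one)
  then show ?thesis using closed[of "of_nat n"] closed[of "1 / of_nat n"]
    unfolding nat[symmetric] by (auto simp: Units_def K.m_comm intro!: bexI[of _ "\<iota> (1 / of_nat n)"])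
qed

theorem corollary22:
  fixes K :: "('k,'r) ring_scheme" and E :: "('k,'e,'s) module_scheme"
    and W :: "nat \<Rightarrow> (nat \<Rightarrow> nat) set" and \<chi> :: "nat \<Rightarrow> (nat \<Rightarrow> nat) \<Rightarrow> 'k"
  assumes "domain K"
    and "\<exists>\<iota>. \<iota> \<in> ring_hom (ring_of_type_algebra :: rat ring) K \<and> inj \<iota>"
    and "omega_invariant K W \<chi>"
    and "module K E"
    and "\<exists>B. is_finite_basis K E B"
  shows "let M = chi_comp K W \<chi> E; C = chi_module K W \<chi> E; CC = tensor_module K C C;
             w = chi_word K W \<chi> E; c = chi_comult K W \<chi> E; \<epsilon> = chi_counit K W \<chi> E;
             E' = dual_module K E
         in
           (\<forall>n. \<forall>xs\<in>words E n.
              c (w xs) = (\<Oplus>\<^bsub>CC\<^esub>p\<in>{..n}. \<Oplus>\<^bsub>CC\<^esub>\<rho>\<in>min_reps W p (n - p).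
                \<chi> n \<rho> \<odot>\<^bsub>CC\<^esub> pure_tensor K C C
                  (w (map (\<lambda>t. letter xs (\<rho> t)) [1..<Suc p]))
                  (w (map (\<lambda>t. letter xs (\<rho> t)) [Suc p..<Suc n])))) \<and>
           (\<forall>a\<in>carrier K. \<epsilon> (a \<odot>\<^bsub>C\<^esub> w []) = a) \<and>
           (\<forall>z\<in>carrier C. z 0 = \<zero>\<^bsub>M 0\<^esub> \<longrightarrow> \<epsilon> z = \<zero>\<^bsub>K\<^esub>) \<and>
           graded_coalgebra K M c \<epsilon> \<and>
           graded_algebra K (gdual K M) (gdual_mult K M c) (form_components M \<epsilon>) \<and>
           chi_to_gdual K W \<chi> E \<in> graded_alg_iso K
             (chi_comp K W \<chi> E')
             (graded_alg K (chi_comp K W \<chi> E') (chi_mult K W \<chi> E') (chi_word K W \<chi> E' []))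
             (gdual K M)
             (graded_alg K (gdual K M) (gdual_mult K M c) (form_components M \<epsilon>))"
proof -
  have K: "cring K" using assms(1) by (rule domain.axioms(1))
  obtain B where B: "is_finite_basis K E B" using assms(5) by blast
  have dl: "dual_letters K W \<chi> E B"
    using K assms(2-4) B rational_units[OF K]
    unfolding dual_letters_def rational_letters_def rational_chars_def rational_chars_axioms_def
      chi_letters_def omega_chars_def omega_chars_axioms_def letters_def based_module_def based_module_axioms_def
    by blast
  then have rl: "rational_letters K W \<chi> E" by (rule dual_letters.axioms(1))
  show ?thesis
    unfolding Let_def
    by (intro conjI allI ballI impI rational_letters.comult_word[OF rl] rational_letters.counit_scalar[OF rl]
        rational_letters.counit_positive[OF rl] rational_letters.graded_coalgebra[OF rl]
        dual_letters.dual_algebra[OF dl])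
qed

end
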